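(* Let $\Lambda^{(1)},\dots,\Lambda^{(n)}$ be integral dominant $\mathfrak{gl}_N$-weights with $\Lambda^{(i)}_N\in\mathbb Z_{\ge 0}$ for $i=1,\dots,n$, let $M=M_{\Lambda^{(1)}}\otimes\dots\otimes M_{\Lambda^{(n)}}$, let $K$ be an $N\times N$ matrix with complex entries, and let $z_1,\dots,z_n$ be distinct complex numbers. Then the kernel of the universal differential operator $\mathcal D_{K,M}(u,\partial_u)$ associated with $M$, $K$ and $z_1,\dots,z_n$ is generated by $M$-valued quasi-exponentials. Possible exponents $\lambda$ appearing in the kernel are eigenvalues of the matrix $K$. In particular, if $K=0$, then the kernel is generated by $M$-valued polynomials.
   Context: $N,n\ge1$ are integers and $e_{ab}$, $a,b=1,\dots,N$, are the standard generators of the complex Lie algebra $\mathfrak{gl}_N$. An integral dominant weight is $\Lambda=(\Lambda_1,\dots,\Lambda_N)$ with $\Lambda_a-\Lambda_{a+1}\in\mathbb Z_{\ge0}$; $M_\Lambda$ is the irreducible finite-dimensional $\mathfrak{gl}_N$-module with highest weight $\Lambda$. On $M=M_{\Lambda^{(1)}}\otimes\dots\otimes M_{\Lambda^{(n)}}$, $e^{(j)}_{ab}$ denotes $e_{ab}$ acting on the $j$-th tensor factor. Put $\partial_u=d/du$ and, for $a,b=1,\dots,N$, $$X_{ab}(u,\partial_u)=\delta_{ab}\,\partial_u-K_{ab}-\sum_{j=1}^n\frac{e^{(j)}_{ba}}{u-z_j}.$$ The universal differential operator is $$\mathcal D_{K,M}(u,\partial_u)=\sum_{\sigma\in S_N}(-1)^\sigma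 X_{1\sigma_1}(u,\partial_u)X_{2\sigma_2}(u,\partial_u)\cdots X_{N\sigma_N}(u,\partial_u),$$ where $(-1)^\sigma$ is the sign of $\sigma$. It acts on $M$-valued functions of $u$ and is a linear differential operator of order $N$ with leading coefficient $1$. An $M$-valued quasi-exponential is a finite sum of functions $e^{\lambda u}p(u)$ with $\lambda\in\mathbb C$ and $p$ an $M$-valued polynomial; the numbers $\lambda$ occurring with $p\neq0$ (for distinct $\lambda$'s) are its exponents. The kernel is said to be generated by quasi-exponentials (polynomials) if there exist $N\dim M$ $\mathbb C$-linearly independent $M$-valued quasi-exponentials (polynomials) in the kernel; equivalently, every solution on a connected simply connected open set avoiding $z_1,\dots,z_n$ is a quasi-exponential (polynomial). The exponents appearing in the kernel are the exponents of the quasi-exponentials lying in it. *)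

theory Defs
  imports
    "HOL-Analysis.Analysis"
    "HOL-Combinatorics.Permutations"
    "Jordan_Normal_Form.Spectral_Radius"
begin

unbundle no vec_syntax
hide_const (open) Finite_Cartesian_Product.mat Finite_Cartesian_Product.vec
  Determinants.det Finite_Cartesian_Product.row Module.submodule
hide_type (open) Finite_Cartesian_Product.vec

text \<open>
  All index ranges are 0-based: matrix entries, the components of a weight and the tensor factors
  are numbered by \<open>0, ..., N - 1\<close> and \<open>0, ..., n - 1\<close>. Finite-dimensional complex vector
  spaces are coordinate spaces \<open>carrier_vec d\<close> over the complex numbers, so that
  endomorphisms are \<open>d\<close> by \<open>d\<close> matrices.
\<close>

section \<open>Modules over the Lie algebra \<open>gl\<^sub>N\<close>\<close>

definition lie_bracket :: "complex mat \<Rightarrow> complex mat \<Rightarrow> complex mat" where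
  "lie_bracket A B = A * B - B * A"

definition gl_gen :: "nat \<Rightarrow> nat \<Rightarrow> nat \<Rightarrow> complex mat" where
  "gl_gen N a b = mat N N (\<lambda>(i, k). if i = a \<and> k = b then 1 else 0)"

text \<open>
  \<open>gl_module N d \<rho>\<close>: the map \<open>\<rho>\<close> is a Lie algebra homomorphism from \<open>gl\<^sub>N\<close>
  (all \<open>N\<close> by \<open>N\<close> matrices) to the endomorphisms of \<open>carrier_vec d\<close>.
\<close>

definition gl_module :: "nat \<Rightarrow> nat \<Rightarrow> (complex mat \<Rightarrow> complex mat) \<Rightarrow> bool" where
  "gl_module N d \<rho> \<longleftrightarrow>
     (\<forall>A\<in>carrier_mat N N. \<rho> A \<in> carrier_mat d d) \<and>
     (\<forall>A\<in>carrier_mat N N. \<forall>B\<in>carrier_mat N N. \<rho> (A + B) = \<rho> A + \<rho> B) \<and>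
     (\<forall>c. \<forall>A\<in>carrier_mat N N. \<rho> (c \<cdot>\<^sub>m A) = c \<cdot>\<^sub>m \<rho> A) \<and>
     (\<forall>A\<in>carrier_mat N N. \<forall>B\<in>carrier_mat N N.
        \<rho> (lie_bracket A B) = lie_bracket (\<rho> A) (\<rho> B))"

definition irreducible_gl_module ::
    "nat \<Rightarrow> nat \<Rightarrow> (complex mat \<Rightarrow> complex mat) \<Rightarrow> bool" where
  "irreducible_gl_module N d \<rho> \<longleftrightarrow>
     gl_module N d \<rho> \<and> d > 0 \<and>
     (\<forall>W. LinearCombinations.submodule class_ring W (module_vec TYPE(complex) d) \<and>
          (\<forall>A\<in>carrier_mat N N. \<forall>w\<in>W. \<rho> A *\<^sub>v w \<in> W)
        \<longrightarrow> W = {0\<^sub>v d} \<or> W = carrier_vec d)"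

definition highest_weight_vector ::
    "nat \<Rightarrow> nat \<Rightarrow> (complex mat \<Rightarrow> complex mat) \<Rightarrow> (nat \<Rightarrow> complex) \<Rightarrow> complex vec \<Rightarrow> bool" where
  "highest_weight_vector N d \<rho> \<Lambda> v \<longleftrightarrow>
     v \<in> carrier_vec d \<and> v \<noteq> 0\<^sub>v d \<and>
     (\<forall>b<N. \<forall>a<b. \<rho> (gl_gen N a b) *\<^sub>v v = 0\<^sub>v d) \<and>
     (\<forall>a<N. \<rho> (gl_gen N a a) *\<^sub>v v = \<Lambda> a \<cdot>\<^sub>v v)"

definition integral_dominant :: "nat \<Rightarrow> (nat \<Rightarrow> complex) \<Rightarrow> bool" where
  "integral_dominant N \<Lambda> \<longleftrightarrow> (\<forall>a. Suc a < N \<longrightarrow> \<Lambda> a - \<Lambda> (Suc a) \<in> \<nat>)"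

text \<open>\<open>is_M_Lambda N \<Lambda> d \<rho>\<close>: \<open>(d, \<rho>)\<close> is a realisation of the module \<open>M\<^sub>\<Lambda>\<close> on \<open>carrier_vec d\<close>.\<close>

definition is_M_Lambda ::
    "nat \<Rightarrow> (nat \<Rightarrow> complex) \<Rightarrow> nat \<Rightarrow> (complex mat \<Rightarrow> complex mat) \<Rightarrow> bool" where
  "is_M_Lambda N \<Lambda> d \<rho> \<longleftrightarrow>
     irreducible_gl_module N d \<rho> \<and> (\<exists>v. highest_weight_vector N d \<rho> \<Lambda> v)"

section \<open>The tensor product\<close>

text \<open>
  The tensor product of \<open>carrier_vec (d 0), ..., carrier_vec (d (n - 1))\<close> is \<open>carrier_vec D\<close>
  with \<open>D = (\<Prod>j<n. d j)\<close>, its standard basis being the tensor products of the standard basis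
  vectors in lexicographic order; the tensor product of endomorphisms is then the
  Kronecker product of matrices.
\<close>

definition kronecker :: "complex mat \<Rightarrow> complex mat \<Rightarrow> complex mat" where
  "kronecker A B =
     mat (dim_row A * dim_row B) (dim_col A * dim_col B)
       (\<lambda>(i, k). A $$ (i div dim_row B, k div dim_col B) * B $$ (i mod dim_row B, k mod dim_col B))"

definition tensor_dim :: "nat \<Rightarrow> (nat \<Rightarrow> nat) \<Rightarrow> nat" where
  "tensor_dim n d = (\<Prod>j<n. d j)"

text \<open>
  \<open>slot_gen N n d \<rho> j a b\<close> is \<open>e\<^sub>a\<^sub>b\<close> acting on the \<open>j\<close>-th tensor factor, that is
  \<open>1 \<otimes> ... \<otimes> \<rho>\<^sub>j(e\<^sub>a\<^sub>b) \<otimes> ... \<otimes> 1\<close>.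
\<close>

definition slot_gen ::
    "nat \<Rightarrow> nat \<Rightarrow> (nat \<Rightarrow> nat) \<Rightarrow> (nat \<Rightarrow> complex mat \<Rightarrow> complex mat)
      \<Rightarrow> nat \<Rightarrow> nat \<Rightarrow> nat \<Rightarrow> complex mat" where
  "slot_gen N n d \<rho> j a b =
     foldr kronecker (map (\<lambda>i. if i = j then \<rho> j (gl_gen N a b) else 1\<^sub>m (d i)) [0..<n]) (1\<^sub>m 1)"

section \<open>The universal differential operator\<close>

definition vec_deriv :: "nat \<Rightarrow> (complex \<Rightarrow> complex vec) \<Rightarrow> complex \<Rightarrow> complex vec" where
  "vec_deriv D f u = vec D (\<lambda>i. deriv (\<lambda>w. f w $ i) u)"

definition X_op ::
    "nat \<Rightarrow> nat \<Rightarrow> (nat \<Rightarrow> nat) \<Rightarrow> (nat \<Rightarrow> complex mat \<Rightarrow> complex mat)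
      \<Rightarrow> complex mat \<Rightarrow> (nat \<Rightarrow> complex) \<Rightarrow> nat \<Rightarrow> nat
      \<Rightarrow> (complex \<Rightarrow> complex vec) \<Rightarrow> (complex \<Rightarrow> complex vec)" where
  "X_op N n d \<rho> K z a b f = (\<lambda>u.
     (if a = b then vec_deriv (tensor_dim n d) f u else 0\<^sub>v (tensor_dim n d))
     - K $$ (a, b) \<cdot>\<^sub>v f u
     - finsum_vec TYPE(complex) (tensor_dim n d)
         (\<lambda>j. (1 / (u - z j)) \<cdot>\<^sub>v (slot_gen N n d \<rho> j b a *\<^sub>v f u)) {..<n})"

text \<open>
  In the summand for \<open>\<sigma>\<close> the operators are composed in the order of the rows, the one of
  row \<open>N - 1\<close> being applied to \<open>f\<close> first.
\<close>

definition universal_diff_op ::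
    "nat \<Rightarrow> nat \<Rightarrow> (nat \<Rightarrow> nat) \<Rightarrow> (nat \<Rightarrow> complex mat \<Rightarrow> complex mat)
      \<Rightarrow> complex mat \<Rightarrow> (nat \<Rightarrow> complex)
      \<Rightarrow> (complex \<Rightarrow> complex vec) \<Rightarrow> (complex \<Rightarrow> complex vec)" where
  "universal_diff_op N n d \<rho> K z f = (\<lambda>u.
     finsum_vec TYPE(complex) (tensor_dim n d)
       (\<lambda>\<sigma>. of_int (sign \<sigma>) \<cdot>\<^sub>v foldr (\<lambda>a g. X_op N n d \<rho> K z a (\<sigma> a) g) [0..<N] f u)
       {\<sigma>. \<sigma> permutes {..<N}})"

text \<open>
  The coefficients have poles at the \<open>z j\<close>, so solutions are considered away from these
  points. Only single-valued solutions are recorded here; quasi-exponentials are entire.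
\<close>

definition univ_kernel ::
    "nat \<Rightarrow> nat \<Rightarrow> (nat \<Rightarrow> nat) \<Rightarrow> (nat \<Rightarrow> complex mat \<Rightarrow> complex mat)
      \<Rightarrow> complex mat \<Rightarrow> (nat \<Rightarrow> complex) \<Rightarrow> (complex \<Rightarrow> complex vec) set" where
  "univ_kernel N n d \<rho> K z =
     {f. (\<forall>u. f u \<in> carrier_vec (tensor_dim n d)) \<and>
         (\<forall>i<tensor_dim n d. (\<lambda>u. f u $ i) holomorphic_on - z ` {..<n}) \<and>
         (\<forall>u\<in>- z ` {..<n}. universal_diff_op N n d \<rho> K z f u = 0\<^sub>v (tensor_dim n d))}"

section \<open>Quasi-exponentials\<close>

text \<open>A polynomial with values in \<open>carrier_vec D\<close> is given by a vector of \<open>D\<close> polynomials.\<close>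

definition eval_vpoly :: "complex poly vec \<Rightarrow> complex \<Rightarrow> complex vec" where
  "eval_vpoly p u = map_vec (\<lambda>q. poly q u) p"

definition vec_polynomial :: "nat \<Rightarrow> (complex \<Rightarrow> complex vec) \<Rightarrow> bool" where
  "vec_polynomial D f \<longleftrightarrow> (\<exists>p\<in>carrier_vec D. f = eval_vpoly p)"

text \<open>
  \<open>quasi_exp_with_exponents D S f\<close>: \<open>f\<close> is a quasi-exponential with values in \<open>carrier_vec D\<close>
  whose set of exponents is \<open>S\<close>.
\<close>

definition quasi_exp_with_exponents ::
    "nat \<Rightarrow> complex set \<Rightarrow> (complex \<Rightarrow> complex vec) \<Rightarrow> bool" where
  "quasi_exp_with_exponents D S f \<longleftrightarrow>
     finite S \<and>
     (\<exists>p. (\<forall>\<mu>\<in>S. p \<mu> \<in> carrier_vec D \<and> p \<mu> \<noteq> 0\<^sub>v D) \<and>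
          f = (\<lambda>u. finsum_vec TYPE(complex) D (\<lambda>\<mu>. exp (\<mu> * u) \<cdot>\<^sub>v eval_vpoly (p \<mu>) u) S))"

definition quasi_exponential :: "nat \<Rightarrow> (complex \<Rightarrow> complex vec) \<Rightarrow> bool" where
  "quasi_exponential D f \<longleftrightarrow> (\<exists>S. quasi_exp_with_exponents D S f)"

definition lin_indep_functions ::
    "nat \<Rightarrow> nat \<Rightarrow> (nat \<Rightarrow> complex \<Rightarrow> complex vec) \<Rightarrow> bool" where
  "lin_indep_functions D m F \<longleftrightarrow>
     (\<forall>c :: nat \<Rightarrow> complex.
        (\<forall>u. finsum_vec TYPE(complex) D (\<lambda>k. c k \<cdot>\<^sub>v F k u) {..<m} = 0\<^sub>v D)
        \<longrightarrow> (\<forall>k<m. c k = 0))"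

definition kernel_generated_by ::
    "((complex \<Rightarrow> complex vec) \<Rightarrow> bool)
      \<Rightarrow> nat \<Rightarrow> nat \<Rightarrow> (nat \<Rightarrow> nat) \<Rightarrow> (nat \<Rightarrow> complex mat \<Rightarrow> complex mat)
      \<Rightarrow> complex mat \<Rightarrow> (nat \<Rightarrow> complex) \<Rightarrow> bool" where
  "kernel_generated_by P N n d \<rho> K z \<longleftrightarrow>
     (\<exists>F. (\<forall>k < N * tensor_dim n d. P (F k) \<and> F k \<in> univ_kernel N n d \<rho> K z) \<and>
          lin_indep_functions (tensor_dim n d) (N * tensor_dim n d) F)"

definition kernel_exponents ::
    "nat \<Rightarrow> nat \<Rightarrow> (nat \<Rightarrow> nat) \<Rightarrow> (nat \<Rightarrow> complex mat \<Rightarrow> complex mat)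
      \<Rightarrow> complex mat \<Rightarrow> (nat \<Rightarrow> complex) \<Rightarrow> complex set" where
  "kernel_exponents N n d \<rho> K z =
     \<Union> {S. \<exists>f \<in> univ_kernel N n d \<rho> K z. quasi_exp_with_exponents (tensor_dim n d) S f}"

end

theory Submission
  imports
    Defs
    "HOL-Complex_Analysis.Complex_Analysis"
    "HOL-Computational_Algebra.Computational_Algebra"
    "HOL-Combinatorics.Permutations"
    "HOL-Library.Function_Algebras"
    "HOL-Library.FuncSet"
    "Jordan_Normal_Form.Char_Poly"
begin

unbundle no vec_syntax
hide_const (open) Finite_Cartesian_Product.mat Finite_Cartesian_Product.vec
  Determinants.det Finite_Cartesian_Product.row Module.submodule module.smult
  Finite_Cartesian_Product.transpose List.transpose
hide_type (open) Finite_Cartesian_Product.vec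

text \<open>
  At a point \<open>u0\<close> different from the \<open>z\<^sub>j\<close> the operator acts on vectors of formal power series, and
  a solution is determined by its first \<open>N\<close> coefficients, which are arbitrary.

  Suppose first that \<open>M\<close> is a tensor power of the vector representation with one tensor factor for each
  of the distinct poles \<open>\<zeta>\<^sub>s\<close>. With anticommuting variables \<open>\<psi>\<^sub>a\<close> the operator becomes a product of
  the linear forms \<open>\<theta>\<^sub>b = \<Sum>\<^sub>a \<psi>\<^sub>a X\<^sub>a\<^sub>b\<close>, and expanding the product shows that a solution \<open>f\<close> satisfies
  \<open>\<chi>(\<partial>) f = \<Sum>\<^sub>s W\<^sub>s\<close>, where \<open>\<chi>\<close> is the characteristic polynomial of \<open>K\<close> and the \<open>W\<^sub>s\<close> solve a linear
  system \<open>W' = H W\<close> with constant coefficients: \<open>W'\<^sub>s = (K\<^sub>s + \<Sum>\<^sub>t P\<^sub>s\<^sub>t / (\<zeta>\<^sub>s - \<zeta>\<^sub>t)) W\<^sub>s - \<Sum>\<^sub>t W\<^sub>t / (\<zeta>\<^sub>s - \<zeta>\<^sub>t)\<close>.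
  Hence \<open>f\<close> is a quasi-exponential. Its leading terms show that all exponents are roots of \<open>\<chi>\<close>, so a power
  of \<open>\<chi>(\<partial>)\<close> that does not depend on the poles annihilates \<open>f\<close>. This is a closed condition on the
  coefficients of \<open>f\<close>, so it survives when poles come together.

  A module \<open>M\<^sub>\<Lambda>\<close> with \<open>\<Lambda>\<^sub>N \<ge> 0\<close> is a subquotient of a tensor power of the vector representation, so every
  solution for general \<open>M\<close> is a linear image of a solution for a tensor power.
\<close>

text \<open>The vector representation is singled out by the associative rule
  \<open>E_ab E_cd = \<delta>_bc E_ad\<close>. With \<open>g' = - g * g\<close> for
  \<open>g = 1/(u - \<zeta>)\<close> it makes repeated poles cancel: differentiating a pole and
  letting its slot act a second time give opposite terms. So the product of the linear forms is
  multilinear in the poles, partial fractions apply, and the residue terms close up into a system.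
  The coefficients of that system blow up when poles meet, and meeting cannot be avoided: all slots
  that model one factor \<open>M_\<Lambda>\<close> carry the same \<open>z_j\<close>. The system
  itself is therefore useless in the limit. What can be kept is the number of its unknowns,
  \<open>card S * card \<Omega>\<close>, which bounds the order of an equation for \<open>f\<close>
  and hence the power of \<chi>. The coefficients of \<open>f\<close> converge because the recursion
  for them divides by integers only, never by differences of poles. As for the subquotient,
  irreducibility turns the submodule generated by a pair of highest weight vectors into the graph of
  a surjective homomorphism.\<close>

section \<open>Sums over subsets and partial fractions in a commutative ring\<close>

text \<open>A subset with a marked element is the same as a subset with a marked element outside it:
  delete or insert the mark. Every exchange below between "a slot already used" and "a new slot"
  goes through this bijection.\<close>

lemma sum_Pow_insert:
  fixes F :: "'s set \<Rightarrow> 's \<Rightarrow> 'a::comm_monoid_add"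
  assumes "finite S"
  shows "(\<Sum>I\<in>Pow S. \<Sum>i\<in>I. F I i) = (\<Sum>J\<in>Pow S. \<Sum>j\<in>S - J. F (insert j J) j)"
proof -
  have fin: "\<And>I. I \<in> Pow S \<Longrightarrow> finite I" using assms finite_subset by blast
  have "(\<Sum>I\<in>Pow S. \<Sum>i\<in>I. F I i) = (\<Sum>(I, i)\<in>Sigma (Pow S) (\<lambda>I. I). F I i)"
    using assms fin by (subst sum.Sigma) auto
  also have "\<dots> = (\<Sum>(J, j)\<in>Sigma (Pow S) (\<lambda>J. S - J). F (insert j J) j)"
    by (rule sum.reindex_bij_witness[where i = "\<lambda>(J, j). (insert j J, j)"
          and j = "\<lambda>(I, i). (I - {i}, i)"]) (auto simp: insert_absorb)
  also have "\<dots> = (\<Sum>J\<in>Pow S. \<Sum>j\<in>S - J. F (insert j J) j)"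
    using assms by (subst sum.Sigma) auto
  finally show ?thesis .
qed

lemma sum_Pow_split:
  fixes F :: "'s set \<Rightarrow> 'a::comm_monoid_add"
  assumes "finite S" "i \<in> S"
  shows "(\<Sum>J\<in>Pow S. F J) = (\<Sum>I\<in>Pow (S - {i}). F I) + (\<Sum>I\<in>Pow (S - {i}). F (insert i I))"
proof -
  have "Pow S = Pow (S - {i}) \<union> insert i ` Pow (S - {i})"
    using assms Pow_insert[of i "S - {i}"] by (simp add: insert_absorb)
  moreover have "inj_on (insert i) (Pow (S - {i}))"
    by (auto simp: inj_on_def)
  moreover have "Pow (S - {i}) \<inter> insert i ` Pow (S - {i}) = {}" by auto
  ultimately show ?thesis using assms
    by (simp add: sum.union_disjoint sum.reindex)
qed

text \<open>The model is \<open>x i = 1/(u - z_i)\<close> and \<open>a i j = 1/(z_i - z_j)\<close>.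
  \<open>tri\<close> says that \<open>a t\<close>, the value of \<open>x\<close> at
  \<open>u = z_t\<close>, satisfies the hypothesis on \<open>x\<close> as well. As the induction is
  general in \<open>x\<close>, its hypothesis can also be evaluated at the new pole, which yields
  the coefficient there.\<close>

lemma prod_partial_fractions:
  fixes a :: "'s \<Rightarrow> 's \<Rightarrow> 'a::comm_ring_1"
  assumes "finite I" "I \<noteq> {}" "I \<subseteq> S"
    and anti: "\<And>i j. i \<in> S \<Longrightarrow> j \<in> S \<Longrightarrow> i \<noteq> j \<Longrightarrow> a i j = - a j i"
    and tri: "\<And>t i j. t \<in> S \<Longrightarrow> i \<in> S \<Longrightarrow> j \<in> S \<Longrightarrow> t \<noteq> i \<Longrightarrow> t \<noteq> j \<Longrightarrow> i \<noteq> j \<Longrightarrow>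
      a t i * a t j = a i j * (a t i - a t j)"
    and x: "\<And>i j. i \<in> I \<Longrightarrow> j \<in> I \<Longrightarrow> i \<noteq> j \<Longrightarrow> x i * x j = a i j * (x i - x j)"
  shows "(\<Prod>i\<in>I. x i) = (\<Sum>i\<in>I. (\<Prod>j\<in>I - {i}. a i j) * x i)"
  using assms(1-3) x
proof (induction I arbitrary: x rule: finite_ne_induct)
  case (singleton t)
  then show ?case by simp
next
  case (insert t I)
  have t: "t \<in> S" and IS: "I \<subseteq> S" using insert by auto
  have 1: "(\<Prod>i\<in>I. a t i) = (\<Sum>i\<in>I. (\<Prod>j\<in>I - {i}. a i j) * a t i)"
    using insert t by (intro insert.IH) (auto intro!: tri)
  have 2: "(\<Prod>i\<in>I. x i) = (\<Sum>i\<in>I. (\<Prod>j\<in>I - {i}. a i j) * x i)"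
    using insert by (intro insert.IH) auto
  have "(\<Prod>i\<in>insert t I. x i) = (\<Sum>i\<in>I. (\<Prod>j\<in>I - {i}. a i j) * (x i * x t))"
    using insert.hyps 2 by (simp add: sum_distrib_left mult_ac)
  also have "\<dots> = (\<Sum>i\<in>I. (\<Prod>j\<in>I - {i}. a i j) * (a i t * (x i - x t)))"
    using insert.hyps insert.prems by (intro sum.cong refl) (metis insertI1 insertI2)
  also have "\<dots> = (\<Sum>i\<in>I. (\<Prod>j\<in>I - {i}. a i j) * (a i t * x i))
      - (\<Sum>i\<in>I. (\<Prod>j\<in>I - {i}. a i j) * a i t) * x t"
    by (simp add: algebra_simps sum_subtractf sum_distrib_left)
  also have "(\<Sum>i\<in>I. (\<Prod>j\<in>I - {i}. a i j) * a i t) = (\<Sum>i\<in>I. - ((\<Prod>j\<in>I - {i}. a i j) * a t i))"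
    using insert.hyps t IS by (intro sum.cong refl) (subst anti, auto)
  also have "\<dots> = - (\<Prod>i\<in>I. a t i)" by (simp add: 1 sum_negf)
  also have "(\<Sum>i\<in>I. (\<Prod>j\<in>I - {i}. a i j) * (a i t * x i))
      = (\<Sum>i\<in>I. (\<Prod>j\<in>insert t I - {i}. a i j) * x i)"
  proof (intro sum.cong refl)
    fix i assume "i \<in> I"
    then have "insert t I - {i} = insert t (I - {i})" using insert.hyps by auto
    then show "(\<Prod>j\<in>I - {i}. a i j) * (a i t * x i) = (\<Prod>j\<in>insert t I - {i}. a i j) * x i"
      using insert.hyps by (simp add: mult_ac)
  qed
  finally show ?case using insert.hyps by simp
qed

text \<open>In the same model this is, up to sign, the derivative of the partial fraction expansion
  of \<open>\<Prod>j\<in>I. 1/(u - z_j)\<close> at \<open>u = z_i\<close>. The abstract ring has no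
  variable \<open>u\<close> to differentiate by, hence a separate induction.\<close>

lemma prod_partial_fractions_deriv:
  fixes a :: "'s \<Rightarrow> 's \<Rightarrow> 'a::comm_ring_1"
  assumes "finite I" "I \<subseteq> S" "i \<in> S" "i \<notin> I"
    and anti: "\<And>i j. i \<in> S \<Longrightarrow> j \<in> S \<Longrightarrow> i \<noteq> j \<Longrightarrow> a i j = - a j i"
    and tri: "\<And>t i j. t \<in> S \<Longrightarrow> i \<in> S \<Longrightarrow> j \<in> S \<Longrightarrow> t \<noteq> i \<Longrightarrow> t \<noteq> j \<Longrightarrow> i \<noteq> j \<Longrightarrow>
      a t i * a t j = a i j * (a t i - a t j)"
  shows "(\<Sum>k\<in>I. (\<Prod>j\<in>I - {k}. a k j) * (a i k * a i k)) = (\<Prod>j\<in>I. a i j) * (\<Sum>j\<in>I. a i j)"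
  using assms(1,2,4)
proof (induction I rule: finite_induct)
  case empty
  then show ?case by simp
next
  case (insert t I)
  show ?case
  proof (cases "I = {}")
    case True
    then show ?thesis by simp
  next
    case False
    have t: "t \<in> S" and IS: "I \<subseteq> S" and it: "i \<noteq> t" "i \<notin> I" using insert by auto
    have 1: "(\<Prod>k\<in>I. a t k) = (\<Sum>k\<in>I. (\<Prod>j\<in>I - {k}. a k j) * a t k)"
      using insert t False by (intro prod_partial_fractions[where S = S] anti tri) auto
    have 2: "(\<Prod>k\<in>I. a i k) = (\<Sum>k\<in>I. (\<Prod>j\<in>I - {k}. a k j) * a i k)"
      using insert assms(3) False it by (intro prod_partial_fractions[where S = S] anti tri) auto
    have 3: "(\<Sum>k\<in>I. (\<Prod>j\<in>I - {k}. a k j) * a k t) = - (\<Prod>k\<in>I. a t k)"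
    proof -
      have "(\<Sum>k\<in>I. (\<Prod>j\<in>I - {k}. a k j) * a k t) = (\<Sum>k\<in>I. - ((\<Prod>j\<in>I - {k}. a k j) * a t k))"
        using insert.hyps t IS by (intro sum.cong refl) (subst anti, auto)
      then show ?thesis by (simp add: 1 sum_negf)
    qed
    have "(\<Sum>k\<in>I. (\<Prod>j\<in>insert t I - {k}. a k j) * (a i k * a i k))
        = (\<Sum>k\<in>I. (\<Prod>j\<in>I - {k}. a k j) * (a i t * (a i k * a i k) + a i t * a i t * a i k + a i t * a i t * a k t))"
    proof (intro sum.cong refl)
      fix k assume k: "k \<in> I"
      then have "insert t I - {k} = insert t (I - {k})" using insert.hyps by auto
      then have P: "(\<Prod>j\<in>insert t I - {k}. a k j) = (\<Prod>j\<in>I - {k}. a k j) * a k t"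
        using insert.hyps by (simp add: mult_ac)
      \<comment> \<open>Applied twice, this rule leaves only terms that depend on \<open>k\<close>
        through the square of \<open>a i k\<close>, through \<open>a i k\<close>, or through
        \<open>a k t\<close>. They are summed by the induction hypothesis, by \<open>2\<close> and
        by \<open>3\<close>.\<close>
      have rel: "a k t * a i k = a i k * a i t + a k t * a i t"
      proof -
        have "a i k * a i t = a k t * (a i k - a i t)"
          using k t IS it insert.hyps assms(3) by (intro tri) auto
        then show ?thesis by (simp add: algebra_simps)
      qed
      have "a k t * (a i k * a i k) = a i t * (a i k * a i k) + a i t * (a k t * a i k)"
        using rel by (metis (no_types, lifting) distrib_right mult.assoc mult.commute)
      also have "\<dots> = a i t * (a i k * a i k) + a i t * a i t * a i k + a i t * a i t * a k t"
        unfolding rel by (simp add: algebra_simps)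
      finally have "a k t * (a i k * a i k) = \<dots>" .
      with P show "(\<Prod>j\<in>insert t I - {k}. a k j) * (a i k * a i k)
         = (\<Prod>j\<in>I - {k}. a k j) * (a i t * (a i k * a i k) + a i t * a i t * a i k + a i t * a i t * a k t)"
        by (metis mult.assoc)
    qed
    also have "\<dots> = a i t * (\<Sum>k\<in>I. (\<Prod>j\<in>I - {k}. a k j) * (a i k * a i k))
        + a i t * a i t * (\<Sum>k\<in>I. (\<Prod>j\<in>I - {k}. a k j) * a i k)
        + a i t * a i t * (\<Sum>k\<in>I. (\<Prod>j\<in>I - {k}. a k j) * a k t)"
      by (simp add: algebra_simps sum.distrib sum_distrib_left)
    finally have *: "(\<Sum>k\<in>I. (\<Prod>j\<in>insert t I - {k}. a k j) * (a i k * a i k)) =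
        a i t * ((\<Prod>j\<in>I. a i j) * (\<Sum>j\<in>I. a i j)) + a i t * a i t * (\<Prod>k\<in>I. a i k)
        - a i t * a i t * (\<Prod>k\<in>I. a t k)"
      using insert.IH IS it 2 3 by simp
    have "insert t I - {t} = I" using insert.hyps by auto
    then show ?thesis using insert.hyps * by (simp add: algebra_simps)
  qed
qed

section \<open>The ring of differential operators, matrix units and anticommuting variables\<close>

lemma mult_minus_one_power_left:
  fixes x y :: "'a::ring_1"
  shows "x * ((- 1) ^ p * y) = (- 1) ^ p * (x * y)"
  by (cases "even p") simp_all

lemma comm_mult:
  fixes x a b :: "'a::semigroup_mult"
  assumes "a * x = x * a" "b * x = x * b"
  shows "a * b * x = x * (a * b)"
  by (metis assms mult.assoc)

lemma comm_mult_right: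
  fixes x a b :: "'a::semigroup_mult"
  assumes "x * a = a * x" "x * b = b * x"
  shows "x * (a * b) = a * b * x"
  by (metis assms mult.assoc)

lemma comm_sum:
  fixes x :: "'a::semiring_0"
  assumes "\<And>i. i \<in> A \<Longrightarrow> f i * x = x * f i"
  shows "sum f A * x = x * sum f A"
  using assms by (simp add: sum_distrib_left sum_distrib_right)

lemma comm_sum_right:
  fixes x :: "'a::semiring_0"
  assumes "\<And>i. i \<in> A \<Longrightarrow> x * f i = f i * x"
  shows "x * sum f A = sum f A * x"
  using assms by (simp add: sum_distrib_left sum_distrib_right)

text \<open>\<open>d\<close> is the derivation, \<open>mu h\<close> multiplication by a power
  series, \<open>eps s a b\<close> the matrix unit \<open>E_ab\<close> in slot \<open>s\<close>, and
  the \<open>psi a\<close> are the anticommuting variables. \<open>eps_same\<close> is the product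
  of matrix units, a feature of the vector representation; a general module has only the commutator.
  \<open>no_two_torsion\<close> turns \<open>x = - x\<close> into \<open>x = 0\<close>.\<close>

locale gaudin_ring =
  fixes N :: nat and S :: "'s set" and d :: "'r::ring_1" and mu :: "complex fps \<Rightarrow> 'r"
    and eps :: "'s \<Rightarrow> nat \<Rightarrow> nat \<Rightarrow> 'r" and psi :: "nat \<Rightarrow> 'r"
    and K :: "nat \<Rightarrow> nat \<Rightarrow> complex"
  assumes no_two_torsion: "x + x = 0 \<Longrightarrow> x = (0::'r)"
    and finite_S: "finite S"
    and mu_1: "mu 1 = 1"
    and mu_add: "mu (h + k) = mu h + mu k"
    and mu_mult: "mu (h * k) = mu h * mu k"
    and mu_eps: "s \<in> S \<Longrightarrow> a < N \<Longrightarrow> b < N \<Longrightarrow> eps s a b * mu h = mu h * eps s a b"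
    and mu_psi: "psi a * mu h = mu h * psi a"
    and d_mu: "d * mu h = mu h * d + mu (fps_deriv h)"
    and d_eps: "s \<in> S \<Longrightarrow> a < N \<Longrightarrow> b < N \<Longrightarrow> eps s a b * d = d * eps s a b"
    and d_psi: "d * psi a = psi a * d"
    and eps_psi: "s \<in> S \<Longrightarrow> a < N \<Longrightarrow> b < N \<Longrightarrow> eps s a b * psi c = psi c * eps s a b"
    and psi_anti: "psi a * psi b = - (psi b * psi a)"
    and eps_same: "s \<in> S \<Longrightarrow> a < N \<Longrightarrow> b < N \<Longrightarrow> c < N \<Longrightarrow> e < N \<Longrightarrow>
      eps s a b * eps s c e = (if b = c then eps s a e else 0)"
    and eps_diff: "s \<in> S \<Longrightarrow> t \<in> S \<Longrightarrow> s \<noteq> t \<Longrightarrow> a < N \<Longrightarrow> b < N \<Longrightarrow> c < N \<Longrightarrow> e < N \<Longrightarrow>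
      eps s a b * eps t c e = eps t c e * eps s a b"
    and eps_sum: "s \<in> S \<Longrightarrow> (\<Sum>a<N. eps s a a) = 1"
begin

definition sc :: "complex \<Rightarrow> 'r" where "sc c = mu (fps_const c)"
text \<open>The indices are exchanged: \<open>yy a b\<close> is the pole-free part of the entry
  \<open>X_ba\<close>, so that summing \<open>psi a * yy a b\<close> over \<open>a\<close> runs
  along row \<open>b\<close>.\<close>

definition yy :: "nat \<Rightarrow> nat \<Rightarrow> 'r" where "yy a b = (if a = b then d else 0) - sc (K b a)"
definition y :: "nat \<Rightarrow> 'r" where "y b = (\<Sum>a<N. psi a * yy a b)"
definition eta :: "'s \<Rightarrow> nat \<Rightarrow> 'r" where "eta s b = (\<Sum>a<N. psi a * eps s a b)"
definition Perm :: "'s \<Rightarrow> 's \<Rightarrow> 'r" where "Perm i j = (\<Sum>a<N. \<Sum>b<N. eps i a b * eps j b a)"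
text \<open>This is \<open>d\<close> minus the action of \<open>K\<close> in slot \<open>i\<close>.
  Written as a contraction with matrix units it acts on \<open>eta i b\<close> just as
  \<open>Perm i j\<close> does, with \<open>y\<close> in place of \<open>eta j\<close>.\<close>

definition ell :: "'s \<Rightarrow> 'r" where "ell i = (\<Sum>e<N. \<Sum>c<N. eps i e c * yy c e)"

text \<open>The part of the product of the forms \<open>y b + (\<Sum>i. eta i b)\<close>, for
  \<open>b\<close> along \<open>bs\<close>, in which each slot of \<open>I\<close> supplies exactly
  one factor and all other factors are \<open>y\<close>.\<close>

primrec om :: "nat list \<Rightarrow> 's set \<Rightarrow> 'r" where
  "om [] I = (if I = {} then 1 else 0)"
| "om (b # bs) I = y b * om bs I + (\<Sum>i\<in>I. eta i b * om bs (I - {i}))"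

lemma mu_0: "mu 0 = 0" using mu_add[of 0 0] by simp
lemma mu_minus: "mu (- h) = - mu h" using mu_add[of h "- h"] by (simp add: mu_0 add_eq_0_iff)
lemma mu_diff: "mu (h - k) = mu h - mu k" using mu_add[of h "- k"] by (simp add: mu_minus)
lemma mu_sum: "mu (sum f A) = (\<Sum>x\<in>A. mu (f x))"
  by (induction A rule: infinite_finite_induct) (auto simp: mu_0 mu_add)
lemma mu_comm: "mu h * mu k = mu k * mu h" by (metis mu_mult mult.commute)

lemma sc_0: "sc 0 = 0" and sc_1: "sc 1 = 1" and sc_add: "sc (a + b) = sc a + sc b"
  and sc_minus: "sc (- a) = - sc a" and sc_mult: "sc (a * b) = sc a * sc b"
  unfolding sc_def by (simp_all add: mu_1 mu_0 flip: mu_add mu_minus mu_mult)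
lemma sc_sum: "sc (sum f A) = (\<Sum>x\<in>A. sc (f x))"
  by (induction A rule: infinite_finite_induct) (auto simp: sc_0 sc_add)

lemma sc_eps: "s \<in> S \<Longrightarrow> a < N \<Longrightarrow> b < N \<Longrightarrow> eps s a b * sc c = sc c * eps s a b"
  unfolding sc_def by (rule mu_eps)
lemma sc_psi: "psi a * sc c = sc c * psi a"
  unfolding sc_def by (rule mu_psi)
lemma sc_d: "d * sc c = sc c * d"
  unfolding sc_def by (simp add: d_mu mu_0)
lemma sc_sc: "sc a * sc b = sc b * sc a"
  unfolding sc_def by (rule mu_comm)

lemma yy_sc: "yy a b * sc c = sc c * yy a b"
  by (auto simp: yy_def left_diff_distrib right_diff_distrib sc_d sc_sc)
lemma yy_eps: "s \<in> S \<Longrightarrow> a < N \<Longrightarrow> b < N \<Longrightarrow> eps s a b * yy c e = yy c e * eps s a b"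
  by (auto simp: yy_def left_diff_distrib right_diff_distrib d_eps sc_eps)
lemma yy_psi: "yy a b * psi c = psi c * yy a b"
  by (auto simp: yy_def left_diff_distrib right_diff_distrib d_psi sc_psi)
lemma yy_yy: "yy a b * yy c e = yy c e * yy a b"
  by (auto simp: yy_def left_diff_distrib right_diff_distrib sc_d sc_sc)

text \<open>Source of all sign rules for \<open>y\<close>, \<open>psi\<close> and the
  \<open>eta\<close> of different slots: the coefficients commute, so only the sign of exchanging
  two \<open>psi\<close> is left.\<close>

lemma psi_psi_sum_anti:
  fixes u v :: "nat \<Rightarrow> 'r"
  assumes "\<And>a b. a < N \<Longrightarrow> b < N \<Longrightarrow> u a * v b = v b * u a"
    and "\<And>a b. a < N \<Longrightarrow> u a * psi b = psi b * u a"
    and "\<And>a b. a < N \<Longrightarrow> v a * psi b = psi b * v a"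
  shows "(\<Sum>a<N. psi a * u a) * (\<Sum>b<N. psi b * v b) = - ((\<Sum>b<N. psi b * v b) * (\<Sum>a<N. psi a * u a))"
proof -
  have 1: "psi a * u a * (psi b * v b) = - (psi b * v b * (psi a * u a))" if "a < N" "b < N" for a b
  proof -
    have "psi a * u a * (psi b * v b) = psi a * psi b * (u a * v b)"
      using assms(2)[OF that(1)] by (metis mult.assoc)
    also have "\<dots> = - (psi b * psi a * (v b * u a))"
      by (subst psi_anti) (simp add: assms(1) that)
    also have "psi b * psi a * (v b * u a) = psi b * v b * (psi a * u a)"
      using assms(3)[OF that(2)] by (metis mult.assoc)
    finally show ?thesis .
  qed
  have "(\<Sum>a<N. psi a * u a) * (\<Sum>b<N. psi b * v b) = (\<Sum>a<N. \<Sum>b<N. psi a * u a * (psi b * v b))"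
    by (simp add: sum_product)
  also have "\<dots> = (\<Sum>b<N. \<Sum>a<N. - (psi b * v b * (psi a * u a)))"
    by (subst sum.swap) (intro sum.cong refl, simp add: 1)
  also have "\<dots> = - ((\<Sum>b<N. psi b * v b) * (\<Sum>a<N. psi a * u a))"
    by (simp add: sum_product sum_negf)
  finally show ?thesis .
qed

lemma psi_as_sum: "b < N \<Longrightarrow> psi b = (\<Sum>a<N. psi a * (if a = b then 1 else 0))"
  by (simp add: if_distrib cong: if_cong)

lemma y_y: "y b * y c = - (y c * y b)"
  unfolding y_def by (rule psi_psi_sum_anti) (auto simp: yy_yy yy_psi)
lemma eta_y: "s \<in> S \<Longrightarrow> b < N \<Longrightarrow> eta s b * y c = - (y c * eta s b)"
  unfolding y_def eta_def by (rule psi_psi_sum_anti) (auto simp: yy_eps yy_psi eps_psi)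
lemma eta_eta: "s \<in> S \<Longrightarrow> t \<in> S \<Longrightarrow> s \<noteq> t \<Longrightarrow> b < N \<Longrightarrow> c < N \<Longrightarrow> eta s b * eta t c = - (eta t c * eta s b)"
  unfolding eta_def by (rule psi_psi_sum_anti) (auto simp: eps_diff eps_psi)
lemma psi_y:
  assumes "b < N"
  shows "psi b * y c = - (y c * psi b)"
proof -
  have "(\<Sum>a<N. psi a * (if a = b then 1 else 0)) * y c = - (y c * (\<Sum>a<N. psi a * (if a = b then 1 else 0)))"
    unfolding y_def by (rule psi_psi_sum_anti) (auto simp: yy_psi)
  then show ?thesis by (simp only: psi_as_sum[OF assms, symmetric])
qed
lemma psi_eta:
  assumes "b < N" "s \<in> S" "c < N"
  shows "psi b * eta s c = - (eta s c * psi b)"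
proof -
  have "(\<Sum>a<N. psi a * (if a = b then 1 else 0)) * eta s c = - (eta s c * (\<Sum>a<N. psi a * (if a = b then 1 else 0)))"
    unfolding eta_def using assms by (intro psi_psi_sum_anti) (auto simp: eps_psi)
  then show ?thesis by (simp only: psi_as_sum[OF assms(1), symmetric])
qed

text \<open>Within one slot the forms do not simply anticommute: the matrix units contract and leave
  a bare \<open>psi b\<close>. This is the term that will cancel the derivative of a pole.\<close>

lemma eta_same:
  assumes "s \<in> S" "b < N" "c < N"
  shows "eta s b * eta s c = - (psi b * eta s c)"
proof -
  have "eta s b * eta s c = (\<Sum>a<N. \<Sum>a'<N. psi a * eps s a b * (psi a' * eps s a' c))"
    by (simp add: eta_def sum_product)
  also have "\<dots> = (\<Sum>a<N. \<Sum>a'<N. if b = a' then psi a * psi b * eps s a c else 0)"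
  proof (intro sum.cong refl)
    fix a a' assume "a \<in> {..<N}" "a' \<in> {..<N}"
    then have aa: "a < N" "a' < N" by auto
    have "psi a * eps s a b * (psi a' * eps s a' c) = psi a * psi a' * (eps s a b * eps s a' c)"
      using eps_psi[OF assms(1) aa(1) assms(2), of a'] by (metis mult.assoc)
    then show "psi a * eps s a b * (psi a' * eps s a' c) = (if b = a' then psi a * psi b * eps s a c else 0)"
      using aa assms by (simp add: eps_same)
  qed
  also have "\<dots> = (\<Sum>a<N. psi a * psi b * eps s a c)"
    using assms by simp
  also have "\<dots> = (\<Sum>a<N. - (psi b * (psi a * eps s a c)))"
    by (intro sum.cong refl) (subst psi_anti, simp add: mult.assoc)
  also have "\<dots> = - (psi b * eta s c)"
    by (simp add: eta_def sum_distrib_left sum_negf)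
  finally show ?thesis .
qed

lemma y_mu: "b < N \<Longrightarrow> y b * mu h = mu h * y b + mu (fps_deriv h) * psi b"
proof -
  assume b: "b < N"
  have "yy a b * mu h = mu h * yy a b + mu (fps_deriv h) * (if a = b then 1 else 0)" for a
    by (auto simp: yy_def left_diff_distrib right_diff_distrib d_mu sc_def mu_comm)
  then have "psi a * yy a b * mu h = mu h * (psi a * yy a b) + mu (fps_deriv h) * (psi a * (if a = b then 1 else 0))" for a
    by (metis (no_types, lifting) distrib_left mu_psi mult.assoc)
  then have "y b * mu h = mu h * y b + mu (fps_deriv h) * (\<Sum>a<N. psi a * (if a = b then 1 else 0))"
    by (simp add: y_def sum_distrib_right sum_distrib_left sum.distrib)
  then show ?thesis by (simp only: psi_as_sum[OF b, symmetric])
qed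

lemma eta_mu: "s \<in> S \<Longrightarrow> b < N \<Longrightarrow> eta s b * mu h = mu h * eta s b"
  unfolding eta_def by (intro comm_sum comm_mult) (auto simp: mu_eps mu_psi)

lemma eps_y: "s \<in> S \<Longrightarrow> a < N \<Longrightarrow> b < N \<Longrightarrow> eps s a b * y c = y c * eps s a b"
  unfolding y_def by (intro comm_sum_right comm_mult_right) (auto simp: yy_eps eps_psi)

lemma eps_eta: "s \<in> S \<Longrightarrow> t \<in> S \<Longrightarrow> s \<noteq> t \<Longrightarrow> a < N \<Longrightarrow> b < N \<Longrightarrow> c < N \<Longrightarrow>
    eps s a b * eta t c = eta t c * eps s a b"
  unfolding eta_def by (intro comm_sum_right comm_mult_right) (auto simp: eps_diff eps_psi)

lemma Perm_y: "i \<in> S \<Longrightarrow> j \<in> S \<Longrightarrow> Perm i j * y c = y c * Perm i j"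
  unfolding Perm_def by (intro comm_sum comm_mult) (auto simp: eps_y)

lemma Perm_eta: "i \<in> S \<Longrightarrow> j \<in> S \<Longrightarrow> k \<in> S \<Longrightarrow> k \<noteq> i \<Longrightarrow> k \<noteq> j \<Longrightarrow> c < N \<Longrightarrow>
    Perm i j * eta k c = eta k c * Perm i j"
  unfolding Perm_def by (intro comm_sum comm_mult) (auto simp: eps_eta)

lemma Perm_mu: "i \<in> S \<Longrightarrow> j \<in> S \<Longrightarrow> Perm i j * mu c = mu c * Perm i j"
  unfolding Perm_def by (intro comm_sum comm_mult) (auto simp: mu_eps)

lemma Perm_sc: "i \<in> S \<Longrightarrow> j \<in> S \<Longrightarrow> Perm i j * sc c = sc c * Perm i j"
  unfolding sc_def by (rule Perm_mu)

lemma Perm_commute: "i \<in> S \<Longrightarrow> j \<in> S \<Longrightarrow> i \<noteq> j \<Longrightarrow> Perm i j = Perm j i"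
  unfolding Perm_def by (subst sum.swap) (intro sum.cong refl, simp add: eps_diff)

lemma eps_eta_same:
  assumes "i \<in> S" "c < N" "b < N" "e < N"
  shows "eps i e c * eta i b = psi c * eps i e b"
proof -
  have "eps i e c * eta i b = (\<Sum>a<N. psi a * (eps i e c * eps i a b))"
    unfolding eta_def sum_distrib_left
    by (intro sum.cong refl) (simp add: assms eps_psi flip: mult.assoc)
  also have "\<dots> = (\<Sum>a<N. if c = a then psi c * eps i e b else 0)"
    using assms by (intro sum.cong refl) (auto simp: eps_same)
  also have "\<dots> = psi c * eps i e b" using assms by simp
  finally show ?thesis .
qed

lemma Perm_eta_left:
  assumes "i \<in> S" "j \<in> S" "i \<noteq> j" "b < N"
  shows "Perm i j * eta i b = (\<Sum>e<N. eta j e * eps i e b)"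
proof -
  have "Perm i j * eta i b = (\<Sum>e<N. \<Sum>c<N. eps i e c * eps j c e * eta i b)"
    by (simp add: Perm_def sum_distrib_right)
  also have "\<dots> = (\<Sum>e<N. \<Sum>c<N. psi c * eps j c e * eps i e b)"
  proof (intro sum.cong refl)
    fix e c assume "e \<in> {..<N}" "c \<in> {..<N}"
    then have ec: "e < N" "c < N" by auto
    have "eps i e c * eps j c e * eta i b = eps j c e * (eps i e c * eta i b)"
      using assms ec by (simp add: eps_diff flip: mult.assoc)
    also have "\<dots> = eps j c e * psi c * eps i e b"
      using assms ec by (simp add: eps_eta_same mult.assoc)
    also have "\<dots> = psi c * eps j c e * eps i e b"
      using assms ec by (simp add: eps_psi)
    finally show "eps i e c * eps j c e * eta i b = psi c * eps j c e * eps i e b" .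
  qed
  also have "\<dots> = (\<Sum>e<N. eta j e * eps i e b)"
    by (simp add: eta_def sum_distrib_right)
  finally show ?thesis .
qed

lemma ell_eta:
  assumes "i \<in> S" "b < N"
  shows "ell i * eta i b = (\<Sum>e<N. y e * eps i e b)"
proof -
  have "ell i * eta i b = (\<Sum>e<N. \<Sum>c<N. eps i e c * yy c e * eta i b)"
    by (simp add: ell_def sum_distrib_right)
  also have "\<dots> = (\<Sum>e<N. \<Sum>c<N. psi c * yy c e * eps i e b)"
  proof (intro sum.cong refl)
    fix e c assume "e \<in> {..<N}" "c \<in> {..<N}"
    then have ec: "e < N" "c < N" by auto
    have "eps i e c * yy c e * eta i b = yy c e * (eps i e c * eta i b)"
      using assms ec by (simp add: yy_eps flip: mult.assoc)
    also have "\<dots> = yy c e * psi c * eps i e b"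
      using assms ec by (simp add: eps_eta_same mult.assoc)
    finally show "eps i e c * yy c e * eta i b = psi c * yy c e * eps i e b"
      by (simp add: yy_psi)
  qed
  also have "\<dots> = (\<Sum>e<N. y e * eps i e b)"
    by (simp add: y_def sum_distrib_right)
  finally show ?thesis .
qed

lemma Perm_eta_eta:
  assumes "i \<in> S" "j \<in> S" "i \<noteq> j" "b < N" "c < N"
  shows "Perm i j * (eta i b * eta j c) = - (eta i b * eta j c)"
proof -
  have "Perm i j * (eta i b * eta j c) = (\<Sum>e<N. eta j e * (eps i e b * eta j c))"
    using assms by (simp add: Perm_eta_left sum_distrib_right mult.assoc flip: mult.assoc[of "Perm i j"])
  also have "\<dots> = (\<Sum>e<N. - (psi e * eps i e b * eta j c))"
  proof (intro sum.cong refl)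
    fix e assume "e \<in> {..<N}"
    then have e: "e < N" by auto
    have "eta j e * (eps i e b * eta j c) = eta j e * eta j c * eps i e b"
      using assms e by (simp add: eps_eta mult.assoc)
    also have "\<dots> = - (psi e * eta j c * eps i e b)"
      using assms e by (simp add: eta_same)
    also have "psi e * eta j c * eps i e b = psi e * eps i e b * eta j c"
      using assms e by (simp add: eps_eta mult.assoc)
    finally show "eta j e * (eps i e b * eta j c) = - (psi e * eps i e b * eta j c)" .
  qed
  also have "\<dots> = - (eta i b * eta j c)"
    by (simp add: eta_def[of i] sum_distrib_right sum_negf)
  finally show ?thesis .
qed

end

context gaudin_ring
begin

text \<open>Some factor of \<open>om bs I\<close> is a form of slot \<open>j\<close>. Move
  \<open>eta j b\<close> up to it by anticommutation and collapse the two by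
  \<open>eta_same\<close>; the surviving \<open>psi b\<close> travels back with the same
  signs.\<close>

lemma eta_om:
  assumes "j \<in> I" "I \<subseteq> S" "b < N" "set bs \<subseteq> {..<N}"
  shows "eta j b * om bs I = - (psi b * om bs I)"
  using assms
proof (induction bs arbitrary: I)
  case Nil
  then show ?case by auto
next
  case (Cons c bs)
  then have j: "j \<in> S" and c: "c < N" by auto
  have IH: "eta j b * om bs J = - (psi b * om bs J)" if "j \<in> J" "J \<subseteq> S" for J
    using Cons that by auto
  have 1: "eta j b * (y c * om bs I) = - (psi b * (y c * om bs I))"
  proof -
    have "eta j b * (y c * om bs I) = - (y c * (eta j b * om bs I))"
      using eta_y[OF j Cons.prems(3)] by (simp flip: mult.assoc)
    also have "\<dots> = y c * psi b * om bs I"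
      using Cons.prems by (simp add: IH mult.assoc)
    also have "\<dots> = - (psi b * (y c * om bs I))"
      using psi_y[OF Cons.prems(3), of c] by (simp add: mult.assoc flip: mult.assoc[of "psi b"])
    finally show ?thesis .
  qed
  have 2: "eta j b * (eta i c * om bs (I - {i})) = - (psi b * (eta i c * om bs (I - {i})))"
    if i: "i \<in> I" for i
  proof (cases "i = j")
    case True
    then show ?thesis using eta_same[OF j Cons.prems(3) c] by (simp flip: mult.assoc)
  next
    case False
    have iS: "i \<in> S" using i Cons.prems by auto
    have "eta j b * (eta i c * om bs (I - {i})) = - (eta i c * (eta j b * om bs (I - {i})))"
      using eta_eta[OF j iS _ Cons.prems(3) c] False by (simp flip: mult.assoc)
    also have "\<dots> = eta i c * psi b * om bs (I - {i})"
      using Cons.prems False by (subst IH) (auto simp: mult.assoc)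
    also have "\<dots> = - (psi b * (eta i c * om bs (I - {i})))"
      using psi_eta[OF Cons.prems(3) iS c] by (simp add: mult.assoc flip: mult.assoc[of "psi b"])
    finally show ?thesis .
  qed
  show ?case
    by (simp add: distrib_left sum_distrib_left 1 2 sum_negf)
qed

text \<open>Slot \<open>i\<close> supplies the leading factor and \<open>j\<close> a later one. The
  \<open>y\<close> and the forms of other slots commute with \<open>Perm i j\<close> and are moved
  out in front, until the two forms are adjacent and \<open>Perm_eta_eta\<close> applies.\<close>

lemma Perm_eta_om:
  assumes "i \<in> S" "i \<notin> J" "j \<in> J" "J \<subseteq> S" "b < N" "set bs \<subseteq> {..<N}"
  shows "Perm i j * (eta i b * om bs J) = - (eta i b * om bs J)"
  using assms
proof (induction bs arbitrary: J)
  case Nil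
  then show ?case by auto
next
  case (Cons c bs)
  then have j: "j \<in> S" and ij: "i \<noteq> j" and c: "c < N" and i: "i \<in> S" and b: "b < N" by auto
  have IH: "Perm i j * (eta i b * om bs I) = - (eta i b * om bs I)" if "j \<in> I" "i \<notin> I" "I \<subseteq> S" for I
    using Cons that by auto
  have 1: "Perm i j * (eta i b * (y c * om bs J)) = - (eta i b * (y c * om bs J))"
  proof -
    have e: "eta i b * (y c * om bs J) = - (y c * (eta i b * om bs J))"
      using eta_y[OF i b] by (simp flip: mult.assoc)
    have "Perm i j * (y c * (eta i b * om bs J)) = y c * (Perm i j * (eta i b * om bs J))"
      using Perm_y[OF i j] by (simp flip: mult.assoc)
    also have "\<dots> = - (y c * (eta i b * om bs J))"
      using Cons.prems by (subst IH) auto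
    finally show ?thesis by (simp add: e)
  qed
  have 2: "Perm i j * (eta i b * (eta k c * om bs (J - {k}))) = - (eta i b * (eta k c * om bs (J - {k})))"
    if k: "k \<in> J" for k
  proof (cases "k = j")
    case True
    then show ?thesis using Perm_eta_eta[OF i j ij b c] by (simp flip: mult.assoc)
  next
    case False
    have kS: "k \<in> S" and ki: "k \<noteq> i" using k Cons.prems by auto
    have e: "eta i b * (eta k c * om bs (J - {k})) = - (eta k c * (eta i b * om bs (J - {k})))"
      using eta_eta[OF i kS _ b c] ki by (simp flip: mult.assoc)
    have "Perm i j * (eta k c * (eta i b * om bs (J - {k}))) = eta k c * (Perm i j * (eta i b * om bs (J - {k})))"
      using Perm_eta[OF i j kS ki False c] by (simp flip: mult.assoc)
    also have "\<dots> = - (eta k c * (eta i b * om bs (J - {k})))"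
      using Cons.prems False by (subst IH) auto
    finally show ?thesis by (simp add: e)
  qed
  show ?case
    by (simp add: distrib_left sum_distrib_left 1 2 sum_negf)
qed

lemma Perm_om:
  assumes "i \<in> I" "j \<in> I" "i \<noteq> j" "I \<subseteq> S" "set bs \<subseteq> {..<N}"
  shows "Perm i j * om bs I = - om bs I"
  using assms
proof (induction bs arbitrary: I)
  case Nil
  then show ?case by auto
next
  case (Cons c bs)
  then have j: "j \<in> S" and i: "i \<in> S" and c: "c < N" and ij: "i \<noteq> j" by auto
  have IH: "Perm i j * om bs J = - om bs J" if "j \<in> J" "i \<in> J" "J \<subseteq> S" for J
    using Cons that by auto
  have 1: "Perm i j * (y c * om bs I) = - (y c * om bs I)"
  proof -
    have "Perm i j * (y c * om bs I) = y c * (Perm i j * om bs I)"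
      using Perm_y[OF i j] by (simp flip: mult.assoc)
    then show ?thesis using Cons.prems by (simp add: IH)
  qed
  have 2: "Perm i j * (eta k c * om bs (I - {k})) = - (eta k c * om bs (I - {k}))"
    if k: "k \<in> I" for k
  proof -
    have kS: "k \<in> S" using k Cons.prems by auto
    consider "k = i" | "k = j" | "k \<noteq> i" "k \<noteq> j" by auto
    then show ?thesis
    proof cases
      case 1
      then show ?thesis using Cons.prems ij i c by (auto intro!: Perm_eta_om)
    next
      case 2
      have "Perm j i * (eta j c * om bs (I - {j})) = - (eta j c * om bs (I - {j}))"
        using Cons.prems ij j c by (intro Perm_eta_om) auto
      then show ?thesis using 2 Perm_commute[OF i j ij] by simp
    next
      case 3
      have "Perm i j * (eta k c * om bs (I - {k})) = eta k c * (Perm i j * om bs (I - {k}))"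
        using Perm_eta[OF i j kS 3 c] by (simp flip: mult.assoc)
      then show ?thesis using Cons.prems 3 by (subst (asm) IH) auto
    qed
  qed
  show ?case
    by (simp add: distrib_left sum_distrib_left 1 2 sum_negf)
qed

text \<open>Laplace expansion with respect to slot \<open>i\<close>: its only factor sits at some
  position \<open>p\<close> and is moved to the front past \<open>p\<close> anticommuting
  forms.\<close>

lemma om_insert:
  assumes "i \<in> S" "i \<notin> I" "I \<subseteq> S" "set bs \<subseteq> {..<N}"
  shows "om bs (insert i I) =
    (\<Sum>p<length bs. (- 1) ^ p * (eta i (bs ! p) * om (take p bs @ drop (Suc p) bs) I))"
  using assms
proof (induction bs arbitrary: I)
  case Nil
  then show ?case by auto
next
  case (Cons c bs)
  then have i: "i \<in> S" and c: "c < N" by auto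
  have finI: "finite I" using Cons.prems finite_S finite_subset by blast
  let ?rem = "\<lambda>p. take p bs @ drop (Suc p) bs"
  have nth: "bs ! p < N" if "p < length bs" for p
    using that Cons.prems by (auto simp: subset_iff)
  have IH: "om bs (insert i J) = (\<Sum>p<length bs. (- 1) ^ p * (eta i (bs ! p) * om (?rem p) J))"
    if "i \<notin> J" "J \<subseteq> S" for J
    using Cons that by auto
  have 1: "y c * om bs (insert i I) = (\<Sum>p<length bs. - ((- 1) ^ p * (eta i (bs ! p) * (y c * om (?rem p) I))))"
  proof -
    have "y c * (eta i (bs ! p) * X) = - (eta i (bs ! p) * (y c * X))" if "p < length bs" for p X
      using eta_y[OF i nth[OF that], of c] by (simp flip: mult.assoc)
    then show ?thesis using Cons.prems
      by (simp add: IH sum_distrib_left mult_minus_one_power_left)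
  qed
  have 2: "eta k c * om bs (insert i I - {k})
      = (\<Sum>p<length bs. - ((- 1) ^ p * (eta i (bs ! p) * (eta k c * om (?rem p) (I - {k})))))"
    if k: "k \<in> I" for k
  proof -
    have kS: "k \<in> S" and ki: "k \<noteq> i" using k Cons.prems by auto
    have "eta k c * (eta i (bs ! p) * X) = - (eta i (bs ! p) * (eta k c * X))" if "p < length bs" for p X
      using eta_eta[OF kS i ki c nth[OF that]] by (simp flip: mult.assoc)
    moreover have "insert i I - {k} = insert i (I - {k})" using ki by auto
    moreover have "om bs (insert i (I - {k})) = (\<Sum>p<length bs. (- 1) ^ p * (eta i (bs ! p) * om (?rem p) (I - {k})))"
      using Cons.prems by (intro IH) auto
    ultimately show ?thesis
      by (simp add: sum_distrib_left mult_minus_one_power_left)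
  qed
  have "om (c # bs) (insert i I) = y c * om bs (insert i I) + eta i c * om bs I
     + (\<Sum>k\<in>I. eta k c * om bs (insert i I - {k}))"
    using Cons.prems finI by simp
  also have "(\<Sum>k\<in>I. eta k c * om bs (insert i I - {k})) =
     (\<Sum>p<length bs. - ((- 1) ^ p * (eta i (bs ! p) * (\<Sum>k\<in>I. eta k c * om (?rem p) (I - {k})))))"
    by (simp add: 2 sum_negf sum_distrib_left) (rule sum.swap)
  also have "y c * om bs (insert i I) + eta i c * om bs I + \<dots> =
     eta i c * om bs I + (\<Sum>p<length bs. - ((- 1) ^ p * (eta i (bs ! p) * om (c # ?rem p) I)))"
    by (simp add: 1 distrib_left sum_negf sum.distrib sum_subtractf)
  also have "\<dots> = (\<Sum>p<length (c # bs). (- 1) ^ p * (eta i ((c # bs) ! p) *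
      om (take p (c # bs) @ drop (Suc p) (c # bs)) I))"
    by (simp del: sum.lessThan_Suc add: sum.lessThan_Suc_shift)
  finally show ?case .
qed

lemma om_Cons_scale:
  assumes "\<And>J. J \<subseteq> I \<Longrightarrow> om xs J = (- 1) ^ p * om ys J"
  shows "om (x # xs) I = (- 1) ^ p * om (x # ys) I"
proof -
  have "om xs I = (- 1) ^ p * om ys I" "\<And>i. om xs (I - {i}) = (- 1) ^ p * om ys (I - {i})"
    by (intro assms, blast)+
  then show ?thesis
    by (simp add: mult_minus_one_power_left distrib_left sum_distrib_left)
qed

lemma om_swap:
  assumes "I \<subseteq> S" "a < N" "b < N"
  shows "om (a # b # bs) I = - om (b # a # bs) I"
proof -
  have finI: "finite I" using assms finite_S finite_subset by blast
  \<comment> \<open>The value 0 on the diagonal lets both indices run over all of \<open>I\<close>,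
    so that \<open>sum.swap\<close> can exchange the two slots.\<close>
  define Q where "Q a b i k = (if i = k then 0 else eta i a * (eta k b * om bs (I - {i} - {k})))" for a b i k
  have E: "om (a # b # bs) I = y a * (y b * om bs I) + (\<Sum>i\<in>I. y a * (eta i b * om bs (I - {i})))
      + (\<Sum>i\<in>I. eta i a * (y b * om bs (I - {i}))) + (\<Sum>i\<in>I. \<Sum>k\<in>I. Q a b i k)" for a b
  proof -
    have "(\<Sum>k\<in>I - {i}. eta i a * (eta k b * om bs (I - {i} - {k}))) = (\<Sum>k\<in>I. Q a b i k)" for i
      using finI by (intro sum.mono_neutral_cong_left) (auto simp: Q_def)
    then show ?thesis
      by (simp add: distrib_left sum_distrib_left sum.distrib add.assoc)
  qed
  have 1: "y a * (y b * X) = - (y b * (y a * X))" for X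
    using y_y[of a b] by (simp flip: mult.assoc)
  have 2: "y a * (eta i b * X) = - (eta i b * (y a * X))" if "i \<in> I" "b < N" for i b a X
    using eta_y[of i b a] that assms by (auto simp flip: mult.assoc)
  have "Q a b i k = - Q b a k i" if "i \<in> I" "k \<in> I" for i k
  proof (cases "i = k")
    case False
    have "i \<in> S" "k \<in> S" using that assms by auto
    then have "eta i a * (eta k b * X) = - (eta k b * (eta i a * X))" for X
      using eta_eta[of i k a b] False assms by (simp flip: mult.assoc)
    moreover have "I - {i} - {k} = I - {k} - {i}" by auto
    ultimately show ?thesis using False by (simp add: Q_def)
  qed (simp add: Q_def)
  then have 3: "(\<Sum>i\<in>I. \<Sum>k\<in>I. Q a b i k) = - (\<Sum>i\<in>I. \<Sum>k\<in>I. Q b a i k)"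
    by (subst sum.swap) (simp add: sum_negf)
  have 4: "(\<Sum>i\<in>I. y a * (eta i b * om bs (I - {i}))) = - (\<Sum>i\<in>I. eta i b * (y a * om bs (I - {i})))"
    using assms by (simp add: 2 sum_negf)
  have 5: "(\<Sum>i\<in>I. y b * (eta i a * om bs (I - {i}))) = - (\<Sum>i\<in>I. eta i a * (y b * om bs (I - {i})))"
    using assms by (simp add: 2 sum_negf)
  show ?thesis by (simp only: E 3 4 5 1[of "om bs I"]) (simp add: algebra_simps)
qed

lemma om_move:
  assumes "I \<subseteq> S" "b < N" "set xs \<subseteq> {..<N}"
  shows "om (b # xs @ ys) I = (- 1) ^ length xs * om (xs @ b # ys) I"
  using assms(1,3)
proof (induction xs arbitrary: I)
  case Nil
  then show ?case by simp
next
  case (Cons x xs)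
  have "om (b # (x # xs) @ ys) I = - om (x # b # xs @ ys) I"
    using Cons.prems assms om_swap[of I b x "xs @ ys"] by (simp del: om.simps)
  also have "om (x # b # xs @ ys) I = (- 1) ^ length xs * om (x # xs @ b # ys) I"
    using Cons.prems by (intro om_Cons_scale Cons.IH) auto
  finally show ?case by (simp del: om.simps)
qed

lemma om_zero_append:
  assumes "\<And>J. J \<subseteq> I \<Longrightarrow> om ys J = 0"
  shows "om (xs @ ys) I = 0"
  using assms
proof (induction xs arbitrary: I)
  case (Cons x xs)
  have "om (xs @ ys) J = 0" if "J \<subseteq> I" for J
    using that Cons.prems by (intro Cons.IH) (meson order_trans)
  then show ?case by simp
qed simp

lemma om_repeat:
  assumes "I \<subseteq> S" "b < N" "set bs \<subseteq> {..<N}" "b \<in> set bs"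
  shows "om (b # bs) I = 0"
proof -
  obtain xs ys where bs: "bs = xs @ b # ys" using assms(4) by (auto simp: in_set_conv_decomp)
  have "om (b # bs) I = (- 1) ^ length xs * om (xs @ b # b # ys) I"
    unfolding bs using assms bs by (intro om_move) auto
  also have "om (xs @ b # b # ys) I = 0"
  proof (rule om_zero_append)
    fix J assume "J \<subseteq> I"
    then have "om (b # b # ys) J = - om (b # b # ys) J"
      using assms by (intro om_swap) auto
    then have "om (b # b # ys) J + om (b # b # ys) J = 0" by (simp only: eq_neg_iff_add_eq_0)
    then show "om (b # b # ys) J = 0" by (rule no_two_torsion)
  qed
  finally show ?thesis by (simp only: mult_zero_right)
qed

text \<open>The analogue of a matrix times its adjugate. Moving \<open>e\<close> from the front to
  position \<open>p\<close> absorbs the sign; the result is the full product if \<open>e = p\<close>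
  and has a repeated form otherwise.\<close>

lemma om_replace:
  assumes "I \<subseteq> S" "e < N" "p < N"
  shows "(- 1) ^ p * om (e # take p [0..<N] @ drop (Suc p) [0..<N]) I = (if e = p then om [0..<N] I else 0)"
proof (cases "e = p")
  case True
  have "om (e # take p [0..<N] @ drop (Suc p) [0..<N]) I
      = (- 1) ^ p * om (take p [0..<N] @ e # drop (Suc p) [0..<N]) I"
    using om_move[OF assms(1,2), of "take p [0..<N]" "drop (Suc p) [0..<N]"] set_take_subset[of p "[0..<N]"] True assms
    by (simp add: subset_iff del: om.simps)
  also have "take p [0..<N] @ e # drop (Suc p) [0..<N] = [0..<N]"
    using True assms id_take_nth_drop[of p "[0..<N]"] by simp
  finally show ?thesis using True by (cases "even p") (simp_all del: om.simps)
next
  case False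
  have "e \<in> set (take p [0..<N] @ drop (Suc p) [0..<N])"
    using False assms by (auto simp: take_upt drop_upt)
  moreover have "set (take p [0..<N] @ drop (Suc p) [0..<N]) \<subseteq> {..<N}"
    by (auto dest: in_set_takeD in_set_dropD)
  ultimately show ?thesis using False assms by (simp add: om_repeat del: om.simps)
qed

text \<open>Expand by \<open>om_insert\<close>. \<open>ell i\<close> turns the factor
  \<open>eta i p\<close> into \<open>\<Sum>e. eps i e p * y e\<close>, and \<open>Perm i j\<close>
  turns it into \<open>\<Sum>e. eps i e p * eta j e\<close>. By the recursion for \<open>om\<close>
  these together put the form \<open>e\<close> in front, and \<open>om_replace\<close> leaves the
  diagonal \<open>\<Sum>p. eps i p p = 1\<close>.\<close>

lemma ell_om:
  assumes i: "i \<in> S" "i \<notin> I" and IS: "I \<subseteq> S"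
  shows "ell i * om [0..<N] (insert i I) + (\<Sum>j\<in>I. Perm i j * om [0..<N] (insert i (I - {j}))) = om [0..<N] I"
proof -
  let ?rem = "\<lambda>p. take p [0..<N] @ drop (Suc p) [0..<N]"
  have sub: "set [0..<N] \<subseteq> {..<N}" by auto
  have ins: "om [0..<N] (insert i J) = (\<Sum>p<N. (- 1) ^ p * (eta i p * om (?rem p) J))" if "J \<subseteq> I" for J
    using om_insert[of i J "[0..<N]"] i IS that sub by auto
  have 1: "ell i * om [0..<N] (insert i I)
      = (\<Sum>p<N. \<Sum>e<N. (- 1) ^ p * (eps i e p * (y e * om (?rem p) I)))"
  proof -
    have "ell i * (eta i p * X) = (\<Sum>e<N. eps i e p * (y e * X))" if "p < N" for p X
    proof -
      have "ell i * (eta i p * X) = (\<Sum>e<N. y e * eps i e p) * X"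
        using ell_eta[OF i(1) that] by (simp flip: mult.assoc)
      also have "\<dots> = (\<Sum>e<N. eps i e p * (y e * X))"
        unfolding sum_distrib_right using i that
        by (intro sum.cong refl) (simp add: eps_y flip: mult.assoc)
      finally show ?thesis .
    qed
    then show ?thesis
      by (simp add: ins sum_distrib_left mult_minus_one_power_left)
  qed
  have 2: "Perm i j * om [0..<N] (insert i (I - {j}))
      = (\<Sum>p<N. \<Sum>e<N. (- 1) ^ p * (eps i e p * (eta j e * om (?rem p) (I - {j}))))" if j: "j \<in> I" for j
  proof -
    have jS: "j \<in> S" "i \<noteq> j" using j i IS by auto
    have "Perm i j * (eta i p * X) = (\<Sum>e<N. eps i e p * (eta j e * X))" if "p < N" for p X
    proof -
      have "Perm i j * (eta i p * X) = (\<Sum>e<N. eta j e * eps i e p) * X"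
        using Perm_eta_left[OF i(1) jS that] by (simp flip: mult.assoc)
      also have "\<dots> = (\<Sum>e<N. eps i e p * (eta j e * X))"
        unfolding sum_distrib_right using i that jS
        by (intro sum.cong refl) (simp add: eps_eta flip: mult.assoc)
      finally show ?thesis .
    qed
    then show ?thesis
      by (simp add: ins sum_distrib_left mult_minus_one_power_left)
  qed
  have "ell i * om [0..<N] (insert i I) + (\<Sum>j\<in>I. Perm i j * om [0..<N] (insert i (I - {j})))
      = (\<Sum>p<N. \<Sum>e<N. (- 1) ^ p * (eps i e p * (y e * om (?rem p) I)))
       + (\<Sum>p<N. \<Sum>e<N. \<Sum>j\<in>I. (- 1) ^ p * (eps i e p * (eta j e * om (?rem p) (I - {j}))))"
    by (simp add: 1 2 sum.swap[of _ _ I])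
  also have "\<dots> = (\<Sum>p<N. \<Sum>e<N. (- 1) ^ p * (eps i e p * om (e # ?rem p) I))"
    by (simp add: sum.distrib distrib_left sum_distrib_left)
  also have "\<dots> = (\<Sum>p<N. \<Sum>e<N. eps i e p * ((- 1) ^ p * om (e # ?rem p) I))"
    by (simp only: mult_minus_one_power_left)
  also have "\<dots> = (\<Sum>p<N. \<Sum>e<N. if e = p then eps i p p * om [0..<N] I else 0)"
    using IS by (intro sum.cong refl) (subst om_replace, auto)
  also have "\<dots> = om [0..<N] I"
    by (simp add: eps_sum i flip: sum_distrib_right)
  finally show ?thesis .
qed

end

section \<open>The product of the linear forms, its residues and the linear system for them\<close>

lemma fps_deriv_prod_riccati:
  fixes g :: "'s \<Rightarrow> complex fps"
  assumes "finite I" "\<And>i. i \<in> I \<Longrightarrow> fps_deriv (g i) = - (g i * g i)"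
  shows "fps_deriv (\<Prod>i\<in>I. g i) = - (\<Sum>j\<in>I. g j * (\<Prod>i\<in>I. g i))"
  using assms
  by (induction I rule: finite_induct) (simp_all add: algebra_simps sum_distrib_left)

lemma sum_Pow_swap:
  fixes F :: "'s set \<Rightarrow> 's \<Rightarrow> 'a::comm_monoid_add"
  assumes "finite S"
  shows "(\<Sum>J\<in>Pow S. \<Sum>i\<in>S - J. F J i) = (\<Sum>i\<in>S. \<Sum>J\<in>Pow (S - {i}). F J i)"
proof -
  have "(\<Sum>J\<in>Pow S. \<Sum>i\<in>S - J. F J i) = (\<Sum>(J, i)\<in>Sigma (Pow S) (\<lambda>J. S - J). F J i)"
    using assms by (subst sum.Sigma) auto
  also have "\<dots> = (\<Sum>(i, J)\<in>Sigma S (\<lambda>i. Pow (S - {i})). F J i)"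
    by (rule sum.reindex_bij_witness[where i = prod.swap and j = prod.swap]) auto
  also have "\<dots> = (\<Sum>i\<in>S. \<Sum>J\<in>Pow (S - {i}). F J i)"
    using assms by (subst sum.Sigma) auto
  finally show ?thesis .
qed

locale gaudin_ring_poles = gaudin_ring N S d mu eps psi K
  for N :: nat and S :: "'s set" and d :: "'r::ring_1" and mu eps psi K +
  fixes g :: "'s \<Rightarrow> complex fps"
  assumes g_deriv: "s \<in> S \<Longrightarrow> fps_deriv (g s) = - (g s * g s)"
begin

definition theta :: "nat \<Rightarrow> 'r" where "theta b = y b - (\<Sum>s\<in>S. mu (g s) * eta s b)"

definition gprod :: "'s set \<Rightarrow> complex fps" where "gprod I = (\<Prod>i\<in>I. g i)"

lemma gprod_insert: "finite I \<Longrightarrow> j \<notin> I \<Longrightarrow> gprod (insert j I) = g j * gprod I"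
  by (simp add: gprod_def)

text \<open>No square of a pole survives. Moving \<open>y b\<close> past \<open>gprod I\<close>
  differentiates it and gives \<open>- g j * gprod I * psi b\<close> for each \<open>j\<close> in
  \<open>I\<close>. By \<open>eta_om\<close> the term \<open>- g j * eta j b\<close> of
  \<open>theta b\<close> contributes the opposite. There remain the slots outside \<open>I\<close>,
  as in the recursion for \<open>om\<close>.\<close>

lemma theta_prod:
  assumes "set bs \<subseteq> {..<N}"
  shows "prod_list (map theta bs) = (\<Sum>I\<in>Pow S. sc ((- 1) ^ card I) * (mu (gprod I) * om bs I))"
  using assms
proof (induction bs)
  case Nil
  have "(\<Sum>I\<in>Pow S. sc ((- 1) ^ card I) * (mu (gprod I) * om [] I))
     = (\<Sum>I\<in>Pow S. if I = {} then sc 1 * mu 1 else 0)"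
    by (intro sum.cong refl) (auto simp: gprod_def)
  then show ?case using finite_S by (simp add: mu_1 sc_1)
next
  case (Cons b bs)
  then have b: "b < N" and sub: "set bs \<subseteq> {..<N}" by auto
  have fin: "finite I" if "I \<in> Pow S" for I using that finite_S finite_subset by blast
  define c where "c I = sc ((- 1) ^ card I)" for I :: "'s set"
  have c_y: "y b * (c I * X) = c I * (y b * X)" for I X
    using y_mu[OF b, of "fps_const ((- 1) ^ card I)"]
    by (simp add: c_def sc_def mu_0 flip: mult.assoc)
  have c_eta: "eta s b * (c I * X) = c I * (eta s b * X)" if "s \<in> S" for I X s
    using eta_mu[OF that b, of "fps_const ((- 1) ^ card I)"]
    by (simp add: c_def sc_def flip: mult.assoc)
  have c_mu: "mu h * (c I * X) = c I * (mu h * X)" for I X h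
    by (simp add: c_def sc_def mu_comm[of h] flip: mult.assoc)
  have 1: "y b * (mu (gprod I) * om bs I) = mu (gprod I) * (y b * om bs I)
      - (\<Sum>j\<in>I. mu (g j * gprod I) * (psi b * om bs I))" if I: "I \<in> Pow S" for I
  proof -
    have "fps_deriv (gprod I) = - (\<Sum>j\<in>I. g j * gprod I)"
      unfolding gprod_def using fin[OF I] I g_deriv by (intro fps_deriv_prod_riccati) auto
    then show ?thesis
      by (simp add: y_mu[OF b] mu_minus mu_sum algebra_simps sum_distrib_left sum_distrib_right sum_negf
          flip: mult.assoc[of "y b"])
  qed
  have 2: "mu (g s) * eta s b * (mu (gprod I) * om bs I) = mu (g s * gprod I) * (eta s b * om bs I)"
    if "s \<in> S" for s I
    using eta_mu[OF that b, of "gprod I"] by (simp add: mu_mult mult.assoc flip: mult.assoc[of "eta s b"])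
  have 3: "mu (g s * gprod I) * (eta s b * om bs I) = - (mu (g s * gprod I) * (psi b * om bs I))"
    if "s \<in> I" "I \<in> Pow S" for s I
    using eta_om[OF that(1) _ b sub] that by simp
  have split: "(\<Sum>s\<in>S. f s) = (\<Sum>s\<in>I. f s) + (\<Sum>s\<in>S - I. f s)" if "I \<in> Pow S" for I and f :: "'s \<Rightarrow> 'r"
    using that finite_S by (simp add: sum.subset_diff add.commute)
  have "theta b * (c I * (mu (gprod I) * om bs I))
      = c I * (mu (gprod I) * (y b * om bs I)) - (\<Sum>s\<in>S - I. c I * (mu (g s * gprod I) * (eta s b * om bs I)))"
    if I: "I \<in> Pow S" for I
  proof -
    have "theta b * (c I * (mu (gprod I) * om bs I)) = c I * (y b * (mu (gprod I) * om bs I))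
        - (\<Sum>s\<in>S. c I * (mu (g s * gprod I) * (eta s b * om bs I)))"
      by (simp add: theta_def left_diff_distrib c_y sum_distrib_right mult.assoc c_eta c_mu 2[unfolded mult.assoc] cong: sum.cong)
    also have "\<dots> = c I * (mu (gprod I) * (y b * om bs I)) - (\<Sum>s\<in>S - I. c I * (mu (g s * gprod I) * (eta s b * om bs I)))"
      using I by (simp add: 1 split 3 right_diff_distrib sum_distrib_left sum_negf cong: sum.cong)
    finally show ?thesis .
  qed
  note theta_step = this
  have "prod_list (map theta (b # bs)) = (\<Sum>I\<in>Pow S. theta b * (c I * (mu (gprod I) * om bs I)))"
    using Cons.IH[OF sub] by (simp add: sum_distrib_left c_def)
  also have "\<dots> = (\<Sum>I\<in>Pow S. c I * (mu (gprod I) * (y b * om bs I))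
      - (\<Sum>s\<in>S - I. c I * (mu (g s * gprod I) * (eta s b * om bs I))))"
    by (intro sum.cong refl theta_step)
  also have "\<dots> = (\<Sum>I\<in>Pow S. c I * (mu (gprod I) * (y b * om bs I)))
      + (\<Sum>I\<in>Pow S. \<Sum>s\<in>S - I. c (insert s I) * (mu (gprod (insert s I)) * (eta s b * om bs (insert s I - {s}))))"
  proof -
    have cc: "c (insert s I) * (mu (gprod (insert s I)) * (eta s b * om bs (insert s I - {s})))
       = - (c I * (mu (g s * gprod I) * (eta s b * om bs I)))"
      if "I \<in> Pow S" "s \<in> S - I" for I s
      using that fin[OF that(1)] by (simp add: c_def sc_minus gprod_insert)
    have "(\<Sum>I\<in>Pow S. \<Sum>s\<in>S - I. c (insert s I) * (mu (gprod (insert s I)) * (eta s b * om bs (insert s I - {s}))))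
       = (\<Sum>I\<in>Pow S. \<Sum>s\<in>S - I. - (c I * (mu (g s * gprod I) * (eta s b * om bs I))))"
      by (intro sum.cong refl cc)
    then show ?thesis
      by (simp add: sum_subtractf sum_negf)
  qed
  also have "(\<Sum>I\<in>Pow S. \<Sum>s\<in>S - I. c (insert s I) * (mu (gprod (insert s I)) * (eta s b * om bs (insert s I - {s}))))
      = (\<Sum>I\<in>Pow S. \<Sum>s\<in>I. c I * (mu (gprod I) * (eta s b * om bs (I - {s}))))"
    by (rule sum_Pow_insert[OF finite_S, symmetric])
  also have "(\<Sum>I\<in>Pow S. c I * (mu (gprod I) * (y b * om bs I))) + \<dots>
     = (\<Sum>I\<in>Pow S. c I * (mu (gprod I) * om (b # bs) I))"
    by (simp add: distrib_left sum.distrib sum_distrib_left)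
  finally show ?case by (simp add: c_def)
qed

end

text \<open>\<open>\<alpha> i j\<close> stands for \<open>1/(\<zeta>_i - \<zeta>_j)\<close>, so the
  poles are pairwise distinct here. The rules for \<alpha> are assumed along with
  \<open>g_prod\<close> because partial fractions are needed both for the poles and for their values
  at one another.\<close>

locale gaudin_ring_simple_poles = gaudin_ring_poles N S d mu eps psi K g
  for N :: nat and S :: "'s set" and d :: "'r::ring_1" and mu eps psi K g +
  fixes \<alpha> :: "'s \<Rightarrow> 's \<Rightarrow> complex"
  assumes g_prod: "i \<in> S \<Longrightarrow> j \<in> S \<Longrightarrow> i \<noteq> j \<Longrightarrow> g i * g j = fps_const (\<alpha> i j) * (g i - g j)"
    and \<alpha>_anti: "i \<in> S \<Longrightarrow> j \<in> S \<Longrightarrow> i \<noteq> j \<Longrightarrow> \<alpha> i j = - \<alpha> j i"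
    and \<alpha>_tri: "t \<in> S \<Longrightarrow> i \<in> S \<Longrightarrow> j \<in> S \<Longrightarrow> t \<noteq> i \<Longrightarrow> t \<noteq> j \<Longrightarrow> i \<noteq> j \<Longrightarrow>
      \<alpha> t i * \<alpha> t j = \<alpha> i j * (\<alpha> t i - \<alpha> t j)"
begin

definition aprod :: "'s \<Rightarrow> 's set \<Rightarrow> complex" where "aprod i I = (\<Prod>j\<in>I. \<alpha> i j)"
definition sg :: "'s set \<Rightarrow> complex" where "sg I = (- 1) ^ card I"
definition omN :: "'s set \<Rightarrow> 'r" where "omN I = om [0..<N] I"
text \<open>\<open>- res i\<close> is the coefficient of \<open>g i\<close> in the partial fraction
  expansion of \<open>Theta\<close>.\<close>

definition res :: "'s \<Rightarrow> 'r" where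
  "res i = (\<Sum>I\<in>Pow (S - {i}). sc (sg I * aprod i I) * omN (insert i I))"
definition Theta :: 'r where "Theta = prod_list (map theta [0..<N])"

lemma gprod_partial_fractions:
  assumes "I \<subseteq> S" "I \<noteq> {}"
  shows "gprod I = (\<Sum>i\<in>I. fps_const (aprod i (I - {i})) * g i)"
proof -
  have fin: "finite I" using assms finite_S finite_subset by blast
  have c: "(\<Prod>j\<in>J. fps_const (f j)) = fps_const (\<Prod>j\<in>J. f j)" for f :: "'s \<Rightarrow> complex" and J
    by (induction J rule: infinite_finite_induct) auto
  have "gprod I = (\<Sum>i\<in>I. (\<Prod>j\<in>I - {i}. fps_const (\<alpha> i j)) * g i)"
    unfolding gprod_def using fin assms
  proof (intro prod_partial_fractions[where S = S])
    fix i j assume "i \<in> S" "j \<in> S" "i \<noteq> j"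
    then show "fps_const (\<alpha> i j) = - fps_const (\<alpha> j i)" using \<alpha>_anti[of i j] by simp
  next
    fix t i j assume "t \<in> S" "i \<in> S" "j \<in> S" "t \<noteq> i" "t \<noteq> j" "i \<noteq> j"
    then show "fps_const (\<alpha> t i) * fps_const (\<alpha> t j) = fps_const (\<alpha> i j) * (fps_const (\<alpha> t i) - fps_const (\<alpha> t j))"
      using \<alpha>_tri[of t i j] by simp
  qed (use g_prod assms in auto)
  then show ?thesis by (simp add: c aprod_def)
qed

text \<open>\<open>omN {}\<close> is the product of the \<open>y b\<close> and contains no pole; it
  will become the characteristic polynomial. On a solution \<open>Theta\<close> vanishes, and what
  is left is an expression for it by the residue terms alone.\<close>

lemma Theta_expand: "omN {} = Theta + (\<Sum>i\<in>S. mu (g i) * res i)"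
proof -
  have sub: "set [0..<N] \<subseteq> {..<N}" by auto
  have fin: "finite I" if "I \<in> Pow S" for I using that finite_S finite_subset by blast
  have sc_mu: "sc c * mu h = mu (fps_const c * h)" for c h by (simp add: sc_def mu_mult)
  have "Theta = (\<Sum>I\<in>Pow S. sc (sg I) * (mu (gprod I) * omN I))"
    using theta_prod[OF sub] by (simp add: Theta_def sg_def omN_def)
  also have "\<dots> = omN {} + (\<Sum>I\<in>Pow S - {{}}. sc (sg I) * (mu (gprod I) * omN I))"
    using finite_S by (subst sum.remove[of _ "{}"]) (auto simp: sg_def gprod_def sc_1 mu_1)
  also have "(\<Sum>I\<in>Pow S - {{}}. sc (sg I) * (mu (gprod I) * omN I))
      = (\<Sum>I\<in>Pow S. \<Sum>i\<in>I. mu (g i) * (sc (sg I * aprod i (I - {i})) * omN I))"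
  proof -
    have "sc (sg I) * (mu (gprod I) * omN I) = (\<Sum>i\<in>I. mu (g i) * (sc (sg I * aprod i (I - {i})) * omN I))"
      if "I \<in> Pow S - {{}}" for I
    proof -
      have "sc (sg I) * (mu (gprod I) * omN I) = mu (fps_const (sg I) * gprod I) * omN I"
        by (simp add: sc_mu flip: mult.assoc)
      also have "fps_const (sg I) * gprod I = (\<Sum>i\<in>I. g i * fps_const (sg I * aprod i (I - {i})))"
        using that by (subst gprod_partial_fractions)
          (auto simp: sum_distrib_left mult_ac simp flip: fps_const_mult)
      also have "mu \<dots> * omN I = (\<Sum>i\<in>I. mu (g i) * (sc (sg I * aprod i (I - {i})) * omN I))"
        by (simp add: mu_sum sum_distrib_right mu_mult sc_def mult.assoc)
      finally show ?thesis .
    qed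
    then have "(\<Sum>I\<in>Pow S - {{}}. sc (sg I) * (mu (gprod I) * omN I))
      = (\<Sum>I\<in>Pow S - {{}}. \<Sum>i\<in>I. mu (g i) * (sc (sg I * aprod i (I - {i})) * omN I))"
      by (rule sum.cong[OF refl])
    also have "\<dots> = (\<Sum>I\<in>Pow S. \<Sum>i\<in>I. mu (g i) * (sc (sg I * aprod i (I - {i})) * omN I))"
      using finite_S by (intro sum.mono_neutral_left) auto
    finally show ?thesis .
  qed
  also have "\<dots> = (\<Sum>J\<in>Pow S. \<Sum>i\<in>S - J. mu (g i) * (sc (sg (insert i J) * aprod i (insert i J - {i})) * omN (insert i J)))"
    by (rule sum_Pow_insert[OF finite_S])
  also have "\<dots> = (\<Sum>J\<in>Pow S. \<Sum>i\<in>S - J. - (mu (g i) * (sc (sg J * aprod i J) * omN (insert i J))))"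
    using fin by (intro sum.cong refl) (auto simp: sg_def sc_minus)
  also have "\<dots> = (\<Sum>i\<in>S. \<Sum>J\<in>Pow (S - {i}). - (mu (g i) * (sc (sg J * aprod i J) * omN (insert i J))))"
    using finite_S by (rule sum_Pow_swap)
  also have "\<dots> = - (\<Sum>i\<in>S. mu (g i) * res i)"
    by (simp add: res_def sum_distrib_left sum_negf)
  finally show ?thesis by simp
qed

lemma ell_sc: "i \<in> S \<Longrightarrow> ell i * sc c = sc c * ell i"
  unfolding ell_def by (intro comm_sum comm_mult) (auto simp: yy_sc sc_eps)

text \<open>\<open>ell_res\<close>, \<open>Perm_res\<close> and \<open>sum_res\<close> are matched
  so that their sums cancel in \<open>res_equation\<close>. The sum with
  \<open>Perm i j * omN (insert i (I - {j}))\<close> is common to the first two, that with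
  \<open>omN I\<close> to the first and the third, and that with
  \<open>\<Sum>j\<in>I. \<alpha> i j\<close> to the last two.\<close>

lemma ell_res:
  assumes i: "i \<in> S"
  shows "ell i * res i = (\<Sum>I\<in>Pow (S - {i}). sc (sg I * aprod i I) * omN I)
    - (\<Sum>I\<in>Pow (S - {i}). \<Sum>j\<in>I. sc (sg I * aprod i I) * (Perm i j * omN (insert i (I - {j}))))"
proof -
  have e: "ell i * omN (insert i I) = omN I - (\<Sum>j\<in>I. Perm i j * omN (insert i (I - {j})))"
    if "I \<in> Pow (S - {i})" for I
    using ell_om[OF i, of I] that by (auto simp: omN_def algebra_simps)
  have "ell i * res i = (\<Sum>I\<in>Pow (S - {i}). sc (sg I * aprod i I) * (ell i * omN (insert i I)))"
    by (simp add: res_def sum_distrib_left ell_sc[OF i] flip: mult.assoc)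
  also have "\<dots> = (\<Sum>I\<in>Pow (S - {i}). sc (sg I * aprod i I) * omN I
      - (\<Sum>j\<in>I. sc (sg I * aprod i I) * (Perm i j * omN (insert i (I - {j})))))"
    by (intro sum.cong refl) (simp add: e right_diff_distrib sum_distrib_left)
  finally show ?thesis by (simp add: sum_subtractf)
qed

text \<open>For \<open>j\<close> in \<open>I\<close> antisymmetry replaces \<open>Perm i j\<close>
  by \<open>- 1\<close>. For \<open>j\<close> outside \<open>I\<close> the factor
  \<open>\<alpha> i j\<close> completes \<open>aprod i I\<close> to
  \<open>aprod i (insert j I)\<close>.\<close>

lemma Perm_res:
  assumes i: "i \<in> S"
  shows "(\<Sum>j\<in>S - {i}. sc (\<alpha> i j) * (Perm i j * res i)) =
    - (\<Sum>I\<in>Pow (S - {i}). sc (sg I * aprod i I * (\<Sum>j\<in>I. \<alpha> i j)) * omN (insert i I))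
    - (\<Sum>I\<in>Pow (S - {i}). \<Sum>j\<in>I. sc (sg I * aprod i I) * (Perm i j * omN (insert i (I - {j}))))"
proof -
  let ?T = "S - {i}"
  have finT: "finite ?T" using finite_S by simp
  have fin: "finite I" if "I \<in> Pow ?T" for I using that finT finite_subset by blast
  define F where "F J j = - (sc (sg J * aprod i J) * (Perm i j * omN (insert i (J - {j}))))" for J j
  define G where "G I j = sc (sg I * aprod i I * \<alpha> i j) * (Perm i j * omN (insert i I))" for I j
  have "(\<Sum>j\<in>?T. sc (\<alpha> i j) * (Perm i j * res i)) = (\<Sum>j\<in>?T. \<Sum>I\<in>Pow ?T. G I j)"
  proof (intro sum.cong refl)
    fix j assume j: "j \<in> ?T"
    have "sc (\<alpha> i j) * (Perm i j * (sc c * X)) = sc (c * \<alpha> i j) * (Perm i j * X)" for c X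
    proof -
      have "Perm i j * (sc c * X) = sc c * (Perm i j * X)"
        using Perm_sc[OF i, of j c] j by (simp flip: mult.assoc)
      then show ?thesis by (simp add: sc_mult sc_sc[of c] flip: mult.assoc)
    qed
    then show "sc (\<alpha> i j) * (Perm i j * res i) = (\<Sum>I\<in>Pow ?T. G I j)"
      by (simp add: res_def sum_distrib_left G_def)
  qed
  also have "\<dots> = (\<Sum>I\<in>Pow ?T. \<Sum>j\<in>?T. G I j)" by (rule sum.swap)
  also have "\<dots> = (\<Sum>I\<in>Pow ?T. (\<Sum>j\<in>I. G I j) + (\<Sum>j\<in>?T - I. G I j))"
    using finT by (intro sum.cong refl) (simp add: sum.subset_diff add.commute)
  also have "\<dots> = (\<Sum>I\<in>Pow ?T. (\<Sum>j\<in>I. G I j)) + (\<Sum>I\<in>Pow ?T. \<Sum>j\<in>?T - I. F (insert j I) j)"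
  proof -
    have "G I j = F (insert j I) j" if "I \<in> Pow ?T" "j \<in> ?T - I" for I j
      using that fin[OF that(1)] by (simp add: G_def F_def sg_def aprod_def sc_minus mult_ac)
    then show ?thesis by (simp add: sum.distrib)
  qed
  also have "(\<Sum>I\<in>Pow ?T. \<Sum>j\<in>?T - I. F (insert j I) j) = (\<Sum>I\<in>Pow ?T. \<Sum>j\<in>I. F I j)"
    by (rule sum_Pow_insert[OF finT, symmetric])
  also have "(\<Sum>I\<in>Pow ?T. (\<Sum>j\<in>I. G I j)) = (\<Sum>I\<in>Pow ?T. - (sc (sg I * aprod i I * (\<Sum>j\<in>I. \<alpha> i j)) * omN (insert i I)))"
  proof (intro sum.cong refl)
    fix I assume I: "I \<in> Pow ?T"
    have "Perm i j * omN (insert i I) = - omN (insert i I)" if "j \<in> I" for j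
      unfolding omN_def using that I i by (intro Perm_om) auto
    then show "(\<Sum>j\<in>I. G I j) = - (sc (sg I * aprod i I * (\<Sum>j\<in>I. \<alpha> i j)) * omN (insert i I))"
      by (simp add: G_def sum_negf sum_distrib_left sc_sum flip: sum_distrib_right)
  qed
  finally show ?thesis by (simp add: F_def sum_negf)
qed

text \<open>Collect the coefficient of each \<open>omN J\<close>. If \<open>i\<close> is not in
  \<open>J\<close>, it is a partial fraction expansion evaluated at the point \<open>i\<close>. If
  \<open>i\<close> is in \<open>J\<close>, the factor \<open>\<alpha> k i\<close> makes a square
  with \<open>\<alpha> i k\<close>, and the differentiated identity is needed.\<close>

lemma sum_res:
  assumes i: "i \<in> S"
  shows "(\<Sum>k\<in>S - {i}. sc (\<alpha> i k) * res k) =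
    omN {} - (\<Sum>I\<in>Pow (S - {i}). sc (sg I * aprod i I) * omN I)
    - (\<Sum>I\<in>Pow (S - {i}). sc (sg I * aprod i I * (\<Sum>j\<in>I. \<alpha> i j)) * omN (insert i I))"
proof -
  let ?T = "S - {i}"
  have finT: "finite ?T" using finite_S by simp
  have fin: "finite I" if "I \<in> Pow S" for I using that finite_S finite_subset by blast
  \<comment> \<open>The value 0 at \<open>k = i\<close> extends the sum from \<open>S - {i}\<close>
    to \<open>S\<close>, where the order of summation can be exchanged.\<close>
  define H where "H J k = (if k = i then 0 else - (sc (sg J * (aprod k (J - {k}) * \<alpha> i k)) * omN J))" for J k
  have "(\<Sum>k\<in>?T. sc (\<alpha> i k) * res k) = (\<Sum>k\<in>?T. \<Sum>I\<in>Pow (S - {k}). H (insert k I) k)"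
  proof (intro sum.cong refl)
    fix k assume k: "k \<in> ?T"
    have "sc (\<alpha> i k) * (sc (sg I * aprod k I) * omN (insert k I)) = H (insert k I) k" if "I \<in> Pow (S - {k})" for I
    proof -
      have fI: "finite I" and kI: "k \<notin> I" and ki: "k \<noteq> i" using that k fin by auto
      have "sc (\<alpha> i k) * (sc (sg I * aprod k I) * omN (insert k I))
          = sc (sg I * (aprod k I * \<alpha> i k)) * omN (insert k I)"
      proof -
        have "\<alpha> i k * (sg I * aprod k I) = sg I * (aprod k I * \<alpha> i k)" by (simp add: mult_ac)
        then show ?thesis by (metis sc_mult mult.assoc)
      qed
      then show ?thesis using fI kI ki by (simp add: H_def sg_def sc_minus)
    qed
    then show "sc (\<alpha> i k) * res k = (\<Sum>I\<in>Pow (S - {k}). H (insert k I) k)"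
      by (simp add: res_def sum_distrib_left)
  qed
  also have "\<dots> = (\<Sum>k\<in>S. \<Sum>I\<in>Pow (S - {k}). H (insert k I) k)"
    using finite_S i by (intro sum.mono_neutral_left) (auto simp: H_def)
  also have "\<dots> = (\<Sum>I\<in>Pow S. \<Sum>k\<in>S - I. H (insert k I) k)"
    by (rule sum_Pow_swap[OF finite_S, symmetric])
  also have "\<dots> = (\<Sum>J\<in>Pow S. \<Sum>k\<in>J. H J k)"
    by (rule sum_Pow_insert[OF finite_S, symmetric])
  also have "\<dots> = (\<Sum>J\<in>Pow ?T. \<Sum>k\<in>J. H J k) + (\<Sum>I\<in>Pow ?T. \<Sum>k\<in>insert i I. H (insert i I) k)"
    by (rule sum_Pow_split[OF finite_S i])
  also have "(\<Sum>J\<in>Pow ?T. \<Sum>k\<in>J. H J k) = omN {} - (\<Sum>I\<in>Pow ?T. sc (sg I * aprod i I) * omN I)"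
  proof -
    have "(\<Sum>k\<in>J. H J k) = (if J = {} then omN {} else 0) - sc (sg J * aprod i J) * omN J" if J: "J \<in> Pow ?T" for J
    proof (cases "J = {}")
      case True
      then show ?thesis by (simp add: sg_def aprod_def sc_1)
    next
      case False
      have "aprod i J = (\<Sum>k\<in>J. aprod k (J - {k}) * \<alpha> i k)"
        unfolding aprod_def using J fin False i
        by (intro prod_partial_fractions[where S = S] \<alpha>_anti \<alpha>_tri) auto
      moreover have "(\<Sum>k\<in>J. H J k) = - (\<Sum>k\<in>J. sc (sg J * (aprod k (J - {k}) * \<alpha> i k)) * omN J)"
        using J by (auto simp: H_def sum_negf[symmetric] intro!: sum.cong)
      ultimately show ?thesis using False
        by (simp add: sum_distrib_left sc_sum flip: sum_distrib_right)
    qed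
    then have "(\<Sum>J\<in>Pow ?T. \<Sum>k\<in>J. H J k)
      = (\<Sum>J\<in>Pow ?T. (if J = {} then omN {} else 0) - sc (sg J * aprod i J) * omN J)"
      by (intro sum.cong refl)
    then show ?thesis using finT by (simp add: sum_subtractf)
  qed
  also have "(\<Sum>I\<in>Pow ?T. \<Sum>k\<in>insert i I. H (insert i I) k) =
     (\<Sum>I\<in>Pow ?T. - (sc (sg I * aprod i I * (\<Sum>j\<in>I. \<alpha> i j)) * omN (insert i I)))"
  proof (intro sum.cong refl)
    fix I assume I: "I \<in> Pow ?T"
    then have finI: "finite I" and iI: "i \<notin> I" using fin by auto
    have D: "(\<Sum>k\<in>I. aprod k (I - {k}) * (\<alpha> i k * \<alpha> i k)) = aprod i I * (\<Sum>j\<in>I. \<alpha> i j)"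
      unfolding aprod_def using I i finI
      by (intro prod_partial_fractions_deriv[where S = S] \<alpha>_anti \<alpha>_tri) auto
    have "H (insert i I) k = - (sc (sg I * (aprod k (I - {k}) * (\<alpha> i k * \<alpha> i k))) * omN (insert i I))"
      if k: "k \<in> I" for k
    proof -
      have "insert i I - {k} = insert i (I - {k})" using k iI by auto
      then have "aprod k (insert i I - {k}) = - \<alpha> i k * aprod k (I - {k})"
      proof -
        have "\<alpha> k i = - \<alpha> i k" using I k iI i by (intro \<alpha>_anti) auto
        then show ?thesis using \<open>insert i I - {k} = insert i (I - {k})\<close> k iI finI by (simp add: aprod_def)
      qed
      then show ?thesis using k iI finI by (auto simp: H_def sg_def sc_minus mult_ac)
    qed
    then have "(\<Sum>k\<in>I. H (insert i I) k)
       = (\<Sum>k\<in>I. - (sc (sg I * (aprod k (I - {k}) * (\<alpha> i k * \<alpha> i k))) * omN (insert i I)))"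
      by (intro sum.cong refl)
    also have "\<dots> = - (sc (sg I * (aprod i I * (\<Sum>j\<in>I. \<alpha> i j))) * omN (insert i I))"
    proof -
      have "sg I * (aprod i I * (\<Sum>j\<in>I. \<alpha> i j)) = (\<Sum>k\<in>I. sg I * (aprod k (I - {k}) * (\<alpha> i k * \<alpha> i k)))"
        by (simp only: sum_distrib_left[symmetric] D)
      then show ?thesis by (simp only: sc_sum sum_distrib_right sum_negf)
    qed
    finally show "(\<Sum>k\<in>insert i I. H (insert i I) k) = - (sc (sg I * aprod i I * (\<Sum>j\<in>I. \<alpha> i j)) * omN (insert i I))"
      using finI iI by (simp add: H_def mult.assoc)
  qed
  finally show ?thesis by (simp add: sum_negf)
qed

lemma res_equation:
  assumes "i \<in> S"
  shows "ell i * res i = (\<Sum>j\<in>S - {i}. sc (\<alpha> i j) * (Perm i j * res i)) - (\<Sum>k\<in>S - {i}. sc (\<alpha> i k) * res k) + omN {}"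
  by (simp only: ell_res[OF assms] Perm_res[OF assms] sum_res[OF assms]) (simp add: algebra_simps)

definition Kop :: "'s \<Rightarrow> 'r" where "Kop i = (\<Sum>e<N. \<Sum>c<N. sc (K e c) * eps i e c)"

lemma ell_eq: "i \<in> S \<Longrightarrow> ell i = d - Kop i"
proof -
  assume i: "i \<in> S"
  have "ell i = (\<Sum>e<N. \<Sum>c<N. (if c = e then d * eps i e e else 0) - sc (K e c) * eps i e c)"
    unfolding ell_def yy_def using i
    by (intro sum.cong refl) (auto simp: right_diff_distrib d_eps sc_eps)
  also have "\<dots> = d * (\<Sum>e<N. eps i e e) - Kop i"
    by (simp add: sum_subtractf Kop_def sum_distrib_left)
  finally show ?thesis using i by (simp add: eps_sum)
qed

definition Wop :: "'s \<Rightarrow> 'r" where "Wop i = mu (g i) * res i"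

lemma Kop_mu: "i \<in> S \<Longrightarrow> Kop i * mu h = mu h * Kop i"
  unfolding Kop_def by (intro comm_sum comm_mult) (auto simp: mu_eps sc_def mu_comm)

text \<open>Up to the right multiple of \<open>Theta\<close> this is a linear system with constant coefficients.\<close>

lemma Wop_system:
  assumes i: "i \<in> S"
  shows "d * Wop i = Kop i * Wop i + (\<Sum>j\<in>S - {i}. sc (\<alpha> i j) * (Perm i j * Wop i))
    - (\<Sum>k\<in>S - {i}. sc (\<alpha> i k) * Wop k) + mu (g i) * Theta"
proof -
  \<comment> \<open>The derivative of \<open>g i\<close> gives \<open>- mu (g i) * Wop i\<close>,
    which cancels against the summand \<open>Wop i\<close> of \<open>omN {}\<close>. The products of
    \<open>g i\<close> and \<open>g k\<close> are split by \<open>g_prod\<close>; the half with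
    \<open>g i\<close> cancels the \<open>res k\<close> from \<open>res_equation\<close>. So no
    power series is left as a coefficient, except in front of \<open>Theta\<close>.\<close>
  have "d * Wop i = mu (g i) * (d * res i) - mu (g i) * Wop i"
    using i by (simp add: Wop_def d_mu g_deriv mu_minus mu_mult algebra_simps flip: mult.assoc[of d])
  also have "d * res i = ell i * res i + Kop i * res i"
    using i by (simp add: ell_eq algebra_simps)
  also have "ell i * res i = (\<Sum>j\<in>S - {i}. sc (\<alpha> i j) * (Perm i j * res i))
     - (\<Sum>k\<in>S - {i}. sc (\<alpha> i k) * res k) + (Theta + Wop i + (\<Sum>k\<in>S - {i}. Wop k))"
    using i finite_S by (simp add: res_equation Theta_expand Wop_def sum.remove[of S i])
  finally have "d * Wop i = mu (g i) * (Kop i * res i) + (\<Sum>j\<in>S - {i}. mu (g i) * (sc (\<alpha> i j) * (Perm i j * res i)))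
     + (\<Sum>k\<in>S - {i}. mu (g i) * Wop k - mu (g i) * (sc (\<alpha> i k) * res k)) + mu (g i) * Theta"
    by (simp add: algebra_simps sum_distrib_left sum_subtractf)
  also have "mu (g i) * (Kop i * res i) = Kop i * Wop i"
    using i by (simp add: Wop_def Kop_mu flip: mult.assoc)
  also have "(\<Sum>j\<in>S - {i}. mu (g i) * (sc (\<alpha> i j) * (Perm i j * res i)))
      = (\<Sum>j\<in>S - {i}. sc (\<alpha> i j) * (Perm i j * Wop i))"
    using i by (intro sum.cong refl)
      (simp add: Wop_def Perm_mu sc_def mu_comm[of "g i"] flip: mult.assoc)
  also have "(\<Sum>k\<in>S - {i}. mu (g i) * Wop k - mu (g i) * (sc (\<alpha> i k) * res k))
      = (\<Sum>k\<in>S - {i}. - (sc (\<alpha> i k) * Wop k))"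
  proof (intro sum.cong refl)
    fix k assume k: "k \<in> S - {i}"
    have "mu (g i) * Wop k = mu (fps_const (\<alpha> i k) * (g i - g k)) * res k"
      using g_prod[of i k] i k by (auto simp: Wop_def simp flip: mult.assoc mu_mult)
    also have "\<dots> = sc (\<alpha> i k) * (mu (g i) * res k) - sc (\<alpha> i k) * Wop k"
      by (simp only: Wop_def sc_def mu_mult mu_diff left_diff_distrib right_diff_distrib mult.assoc)
    also have "sc (\<alpha> i k) * (mu (g i) * res k) = mu (g i) * (sc (\<alpha> i k) * res k)"
      by (simp add: sc_def mu_comm[of "g i" "fps_const (\<alpha> i k)"] flip: mult.assoc)
    finally show "mu (g i) * Wop k - mu (g i) * (sc (\<alpha> i k) * res k) = - (sc (\<alpha> i k) * Wop k)"
      by simp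
  qed
  finally show ?thesis by (simp add: sum_negf)
qed

end

section \<open>Column determinants through anticommuting variables\<close>

lemma prod_list_sum_PiE:
  fixes T :: "nat \<Rightarrow> nat \<Rightarrow> 'a::semiring_1"
  shows "prod_list (map (\<lambda>b. \<Sum>a<N. T a b) [0..<n])
    = (\<Sum>g\<in>PiE {..<n} (\<lambda>_. {..<N}). prod_list (map (\<lambda>b. T (g b) b) [0..<n]))"
proof (induction n)
  case 0
  then show ?case by simp
next
  case (Suc n)
  have "(\<Sum>g\<in>PiE {..<Suc n} (\<lambda>_. {..<N}). prod_list (map (\<lambda>b. T (g b) b) [0..<Suc n]))
    = (\<Sum>(g, a)\<in>PiE {..<n} (\<lambda>_. {..<N}) \<times> {..<N}. prod_list (map (\<lambda>b. T (g b) b) [0..<n]) * T a n)"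
  proof (rule sum.reindex_bij_witness[where i = "\<lambda>(g, a). g(n := a)" and j = "\<lambda>g. (restrict g {..<n}, g n)"])
    fix g assume g: "g \<in> PiE {..<Suc n} (\<lambda>_. {..<N})"
    then show "(case (restrict g {..<n}, g n) of (g, a) \<Rightarrow> g(n := a)) = g"
      by (auto simp: PiE_iff extensional_def restrict_def fun_eq_iff)
    show "(restrict g {..<n}, g n) \<in> PiE {..<n} (\<lambda>_. {..<N}) \<times> {..<N}"
      using g by (auto simp: PiE_iff)
    have e: "map (\<lambda>b. T (restrict g {..<n} b) b) [0..<n] = map (\<lambda>b. T (g b) b) [0..<n]" by simp
    show "(case (restrict g {..<n}, g n) of (g, a) \<Rightarrow> prod_list (map (\<lambda>b. T (g b) b) [0..<n]) * T a n)
       = prod_list (map (\<lambda>b. T (g b) b) [0..<Suc n])"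
      unfolding prod.case e by simp
  next
    fix p assume "p \<in> PiE {..<n} (\<lambda>_. {..<N}) \<times> {..<N}"
    then obtain g a where p: "p = (g, a)" and g: "g \<in> PiE {..<n} (\<lambda>_. {..<N})" and a: "a < N" by auto
    show "(restrict (case p of (g, a) \<Rightarrow> g(n := a)) {..<n}, (case p of (g, a) \<Rightarrow> g(n := a)) n) = p"
      using g by (auto simp: p PiE_iff extensional_def restrict_def fun_eq_iff)
    show "(case p of (g, a) \<Rightarrow> g(n := a)) \<in> PiE {..<Suc n} (\<lambda>_. {..<N})"
      using g a by (auto simp: p PiE_iff extensional_def)
  qed
  then show ?case
    by (simp add: Suc sum_product sum.cartesian_product)
qed

locale anticommuting =
  fixes psi :: "nat \<Rightarrow> 'r::ring_1"
  assumes anti: "psi a * psi b = - (psi b * psi a)"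
    and square: "psi a * psi a = 0"
begin

definition pl :: "nat list \<Rightarrow> 'r" where "pl as = prod_list (map psi as)"

lemma psi_pl: "psi a * pl as = (- 1) ^ length as * (pl as * psi a)"
proof (induction as)
  case (Cons b as)
  have "psi a * pl (b # as) = - (psi b * (psi a * pl as))"
    using anti[of a b] by (simp add: pl_def flip: mult.assoc)
  then show ?case
    by (simp add: Cons mult_minus_one_power_left) (simp add: pl_def mult.assoc)
qed (simp add: pl_def)

lemma pl_append: "pl (as @ bs) = pl as * pl bs"
  by (simp add: pl_def)

lemma pl_Cons: "pl (a # as) = psi a * pl as"
  by (simp add: pl_def)

lemma pl_repeat:
  assumes "\<not> distinct as"
  shows "pl as = 0"
proof -
  obtain xs ys zs a where as: "as = xs @ [a] @ ys @ [a] @ zs"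
    using assms not_distinct_decomp by blast
  have "psi a * (pl ys * (psi a * pl zs)) = (- 1) ^ length ys * (pl ys * ((psi a * psi a) * pl zs))"
    by (simp add: psi_pl[of a ys] flip: mult.assoc)
  then show ?thesis by (simp add: as pl_append pl_Cons square)
qed

lemma pl_swap: "pl (xs @ [a] @ ys @ [b] @ zs) = - pl (xs @ [b] @ ys @ [a] @ zs)"
proof -
  have "psi a * (pl ys * (psi b * Z)) = - (psi b * (pl ys * (psi a * Z)))" for Z
  proof -
    have "psi a * (pl ys * (psi b * Z)) = (- 1) ^ length ys * (pl ys * (psi a * psi b * Z))"
      by (simp add: psi_pl[of a ys] flip: mult.assoc)
    also have "psi a * psi b = - (psi b * psi a)" by (rule anti)
    also have "(- 1) ^ length ys * (pl ys * (- (psi b * psi a) * Z)) = - ((- 1) ^ length ys * (pl ys * (psi b * (psi a * Z))))"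
      by (simp add: mult.assoc)
    also have "(- 1) ^ length ys * (pl ys * (psi b * (psi a * Z))) = psi b * (pl ys * (psi a * Z))"
      by (simp add: psi_pl[of b ys] flip: mult.assoc)
    finally show ?thesis .
  qed
  then show ?thesis by (simp add: pl_append pl_Cons)
qed

lemma pl_transpose:
  assumes "a < n" "b < n" "a \<noteq> b"
  shows "pl (map (transpose a b) [0..<n]) = - pl [0..<n]"
  using assms
proof (induction a b rule: linorder_wlog)
  case (le a b)
  then have ab: "a < b" by auto
  have "[0..<n] = [0..<a] @ [a..<n]" using le(2) by (metis upt_add_eq_append[of 0 a "n - a"] le_add_diff_inverse less_imp_le le0)
  also have "[a..<n] = [a] @ [Suc a..<n]" using le by (simp add: upt_conv_Cons)
  also have "[Suc a..<n] = [Suc a..<b] @ [b..<n]"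
    using le ab upt_add_eq_append[of "Suc a" b "n - b"] by simp
  also have "[b..<n] = [b] @ [Suc b..<n]" using le by (simp add: upt_conv_Cons)
  finally have e: "[0..<n] = [0..<a] @ [a] @ [Suc a..<b] @ [b] @ [Suc b..<n]" .
  have t: "map (transpose a b) [0..<a] = [0..<a]" "map (transpose a b) [Suc a..<b] = [Suc a..<b]"
    "map (transpose a b) [Suc b..<n] = [Suc b..<n]"
    using ab by (auto intro!: map_idI simp: transpose_def)
  have "map (transpose a b) [0..<n] = [0..<a] @ [b] @ [Suc a..<b] @ [a] @ [Suc b..<n]"
    by (subst e) (simp add: t del: append_Cons append_assoc flip: append_assoc)
  then have "pl (map (transpose a b) [0..<n]) = - pl ([0..<a] @ [a] @ [Suc a..<b] @ [b] @ [Suc b..<n])"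
    by (simp only: pl_swap[of "[0..<a]" b "[Suc a..<b]" a "[Suc b..<n]"])
  then show ?case by (simp only: e[symmetric])
next
  case (sym a b)
  then show ?case using transpose_commute[of a b] by simp
qed

end

text \<open>Stated for a variable family \<psi>, since the induction changes it: composing with a
  transposition of the indices gives another anticommuting family.\<close>

lemma anticommuting_permutes:
  fixes \<psi> :: "nat \<Rightarrow> 'r::ring_1"
  assumes "\<sigma> permutes {..<n}" "anticommuting \<psi>"
  shows "prod_list (map (\<lambda>b. \<psi> (\<sigma> b)) [0..<n]) = of_int (sign \<sigma>) * prod_list (map \<psi> [0..<n])"
proof -
  have "\<forall>\<psi>. anticommuting (\<psi> :: nat \<Rightarrow> 'r) \<longrightarrow>
    prod_list (map (\<lambda>b. \<psi> (\<sigma> b)) [0..<n]) = of_int (sign \<sigma>) * prod_list (map \<psi> [0..<n])"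
    using assms(1) finite_lessThan
  proof (induction rule: permutes_induct)
    case id
    then show ?case by (simp add: sign_id)
  next
    case (swap a b p)
    show ?case
    proof (intro allI impI)
      fix \<psi> :: "nat \<Rightarrow> 'r" assume \<psi>: "anticommuting \<psi>"
      show "prod_list (map (\<lambda>b'. \<psi> ((transpose a b \<circ> p) b')) [0..<n])
          = of_int (sign (transpose a b \<circ> p)) * prod_list (map \<psi> [0..<n])"
      proof (cases "a = b")
        case True
        then show ?thesis using swap \<psi> by simp
      next
        case False
        have \<psi>': "anticommuting (\<lambda>x. \<psi> (transpose a b x))"
          by (rule anticommuting.intro; rule anticommuting.anti[OF \<psi>] anticommuting.square[OF \<psi>])
        have p: "permutation p" using swap.hyps by (auto intro: permutes_imp_permutation[OF finite_lessThan])
        have "prod_list (map (\<lambda>b'. \<psi> ((transpose a b \<circ> p) b')) [0..<n])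
           = of_int (sign p) * prod_list (map (\<lambda>x. \<psi> (transpose a b x)) [0..<n])"
          using swap(5)[rule_format, OF \<psi>'] by (simp add: comp_def)
        also have "prod_list (map (\<lambda>x. \<psi> (transpose a b x)) [0..<n]) = - prod_list (map \<psi> [0..<n])"
          using anticommuting.pl_transpose[OF \<psi>, of a n b] swap False
          by (simp add: anticommuting.pl_def[OF \<psi>] comp_def)
        also have "of_int (sign p) * - prod_list (map \<psi> [0..<n]) = of_int (sign (transpose a b \<circ> p)) * prod_list (map \<psi> [0..<n])"
          using False p by (simp add: sign_compose permutation_swap_id sign_swap_id)
        finally show ?thesis .
      qed
    qed
  qed
  then show ?thesis using assms(2) by blast
qed

context anticommuting
begin

lemma pl_permutes:
  assumes "\<sigma> permutes {..<n}"
  shows "prod_list (map (\<lambda>b. psi (\<sigma> b)) [0..<n]) = of_int (sign \<sigma>) * prod_list (map psi [0..<n])"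
  by (rule anticommuting_permutes[OF assms anticommuting_axioms])

lemma prod_list_mult_commuting:
  fixes X :: "nat \<Rightarrow> 'r"
  assumes "\<And>a b. X b * psi a = psi a * X b"
  shows "prod_list (map (\<lambda>b. psi (g b) * X b) bs) = prod_list (map (\<lambda>b. psi (g b)) bs) * prod_list (map X bs)"
proof (induction bs)
  case (Cons b bs)
  have "X b * prod_list (map (\<lambda>b. psi (g b)) cs) = prod_list (map (\<lambda>b. psi (g b)) cs) * X b" for cs
  proof (induction cs)
    case (Cons c cs)
    show ?case using comm_mult_right[OF assms[of b "g c"] Cons] by simp
  qed simp
  then have "psi (g b) * (X b * (prod_list (map (\<lambda>b. psi (g b)) bs) * Q))
      = psi (g b) * (prod_list (map (\<lambda>b. psi (g b)) bs) * (X b * Q))" for Q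
    by (metis mult.assoc)
  then show ?case by (simp add: Cons mult.assoc)
qed simp

text \<open>Expand over all maps of indices. Maps that are not injective repeat a \<open>psi\<close>
  and drop out, the others are permutations and produce their sign. The entries move past the
  \<open>psi\<close> only, so their order along the product is preserved.\<close>

lemma cdet_expand:
  fixes X :: "nat \<Rightarrow> nat \<Rightarrow> 'r"
  assumes comm: "\<And>a b c. X a b * psi c = psi c * X a b"
  shows "prod_list (map (\<lambda>b. \<Sum>a<N. psi a * X a b) [0..<N]) =
    prod_list (map psi [0..<N]) *
      (\<Sum>\<sigma>|\<sigma> permutes {..<N}. of_int (sign \<sigma>) * prod_list (map (\<lambda>b. X (\<sigma> b) b) [0..<N]))"
proof -
  define P where "P g = prod_list (map (\<lambda>b. psi (g b) * X (g b) b) [0..<N])" for g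
  have "prod_list (map (\<lambda>b. \<Sum>a<N. psi a * X a b) [0..<N]) = (\<Sum>g\<in>PiE {..<N} (\<lambda>_. {..<N}). P g)"
    by (simp add: prod_list_sum_PiE P_def)
  also have "\<dots> = (\<Sum>g\<in>{g \<in> PiE {..<N} (\<lambda>_. {..<N}). inj_on g {..<N}}. P g)"
  proof (rule sum.mono_neutral_right)
    show "\<forall>g\<in>PiE {..<N} (\<lambda>_. {..<N}) - {g \<in> PiE {..<N} (\<lambda>_. {..<N}). inj_on g {..<N}}. P g = 0"
    proof
      fix g assume "g \<in> PiE {..<N} (\<lambda>_. {..<N}) - {g \<in> PiE {..<N} (\<lambda>_. {..<N}). inj_on g {..<N}}"
      then have "\<not> distinct (map g [0..<N])" by (auto simp: distinct_map atLeast0LessThan)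
      then have "prod_list (map (\<lambda>b. psi (g b)) [0..<N]) = 0"
        using pl_repeat[of "map g [0..<N]"] by (simp add: pl_def comp_def)
      then show "P g = 0" using comm by (simp add: P_def prod_list_mult_commuting)
    qed
  qed (auto intro: finite_PiE)
  also have "\<dots> = (\<Sum>\<sigma>|\<sigma> permutes {..<N}. P \<sigma>)"
  proof (rule sum.reindex_bij_witness[where i = "\<lambda>\<sigma>. restrict \<sigma> {..<N}" and j = "\<lambda>g x. if x < N then g x else x"])
    fix g assume g: "g \<in> {g \<in> PiE {..<N} (\<lambda>_. {..<N}). inj_on g {..<N}}"
    then show "restrict (\<lambda>x. if x < N then g x else x) {..<N} = g"
      by (auto simp: PiE_iff extensional_def restrict_def fun_eq_iff)
    have "bij_betw g {..<N} {..<N}"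
      using g endo_inj_surj[of "{..<N}" g] by (auto simp: bij_betw_def PiE_iff image_subset_iff)
    then have "bij_betw (\<lambda>x. if x < N then g x else x) {..<N} {..<N}"
      by (rule bij_betw_cong[THEN iffD1, rotated]) auto
    then show "(\<lambda>x. if x < N then g x else x) \<in> {\<sigma>. \<sigma> permutes {..<N}}"
      by (auto intro!: bij_imp_permutes split: if_splits)
    have "map (\<lambda>b. psi (if b < N then g b else b) * X (if b < N then g b else b) b) [0..<N]
      = map (\<lambda>b. psi (g b) * X (g b) b) [0..<N]" by simp
    then show "P (\<lambda>x. if x < N then g x else x) = P g" by (simp only: P_def)
  next
    fix \<sigma> assume \<sigma>: "\<sigma> \<in> {\<sigma>. \<sigma> permutes {..<N}}"
    then show "(\<lambda>x. if x < N then restrict \<sigma> {..<N} x else x) = \<sigma>"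
      by (auto simp: fun_eq_iff permutes_not_in)
    have "inj_on \<sigma> {..<N}" "\<sigma> ` {..<N} = {..<N}"
      using \<sigma> permutes_inj_on permutes_image by blast+
    then show "restrict \<sigma> {..<N} \<in> {g \<in> PiE {..<N} (\<lambda>_. {..<N}). inj_on g {..<N}}"
      by (auto simp: PiE_iff inj_on_restrict_eq)
  qed
  also have "\<dots> = (\<Sum>\<sigma>|\<sigma> permutes {..<N}. prod_list (map psi [0..<N]) * (of_int (sign \<sigma>) * prod_list (map (\<lambda>b. X (\<sigma> b) b) [0..<N])))"
  proof (intro sum.cong refl)
    fix \<sigma> assume "\<sigma> \<in> {\<sigma>. \<sigma> permutes {..<N}}"
    then have "P \<sigma> = of_int (sign \<sigma>) * prod_list (map psi [0..<N]) * prod_list (map (\<lambda>b. X (\<sigma> b) b) [0..<N])"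
      using comm by (simp add: P_def prod_list_mult_commuting pl_permutes)
    then show "P \<sigma> = prod_list (map psi [0..<N]) * (of_int (sign \<sigma>) * prod_list (map (\<lambda>b. X (\<sigma> b) b) [0..<N]))"
      by (cases \<sigma> rule: sign_cases) (simp_all add: mult.assoc)
  qed
  finally show ?thesis by (simp add: sum_distrib_left)
qed

end

section \<open>Differential operators on vectors of formal power series\<close>

text \<open>\<open>T\<close> applied to each coefficient. Vectors are functions on an arbitrary
  index type, so that coordinate spaces and word functions are treated alike.\<close>

definition cl :: "(('a \<Rightarrow> complex) \<Rightarrow> ('b \<Rightarrow> complex)) \<Rightarrow> ('a \<Rightarrow> complex fps) \<Rightarrow> 'b \<Rightarrow> complex fps" where
  "cl T f = (\<lambda>w. Abs_fps (\<lambda>m. T (\<lambda>x. fps_nth (f x) m) w))"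

definition Xf :: "(nat \<Rightarrow> nat \<Rightarrow> complex) \<Rightarrow> 's set \<Rightarrow> ('s \<Rightarrow> complex fps)
    \<Rightarrow> ('s \<Rightarrow> nat \<Rightarrow> nat \<Rightarrow> ('w \<Rightarrow> complex) \<Rightarrow> 'w \<Rightarrow> complex) \<Rightarrow> nat \<Rightarrow> nat
    \<Rightarrow> ('w \<Rightarrow> complex fps) \<Rightarrow> 'w \<Rightarrow> complex fps" where
  "Xf K S g e a b f = (\<lambda>w. (if a = b then fps_deriv (f w) else 0) - fps_const (K a b) * f w
     - (\<Sum>s\<in>S. g s * cl (e s b a) f w))"

text \<open>The formal counterpart of \<open>universal_diff_op\<close>, for any family of poles
  \<open>g\<close> and any action \<open>e\<close>. Several \<open>s\<close> may share a pole, which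
  is how a sum of slots at one point is represented.\<close>

definition Df :: "nat \<Rightarrow> (nat \<Rightarrow> nat \<Rightarrow> complex) \<Rightarrow> 's set \<Rightarrow> ('s \<Rightarrow> complex fps)
    \<Rightarrow> ('s \<Rightarrow> nat \<Rightarrow> nat \<Rightarrow> ('w \<Rightarrow> complex) \<Rightarrow> 'w \<Rightarrow> complex)
    \<Rightarrow> ('w \<Rightarrow> complex fps) \<Rightarrow> 'w \<Rightarrow> complex fps" where
  "Df N K S g e f = (\<lambda>w. \<Sum>\<sigma>|\<sigma> permutes {..<N}.
     of_int (sign \<sigma>) * foldr (\<lambda>a h. Xf K S g e a (\<sigma> a) h) [0..<N] f w)"

text \<open>\<open>pd p f\<close> is the constant coefficient operator \<open>p(\<partial>)\<close> applied to \<open>f\<close>.\<close>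

definition pd :: "complex poly \<Rightarrow> complex fps \<Rightarrow> complex fps" where
  "pd p f = fold_coeffs (\<lambda>c h. fps_const c * f + fps_deriv h) p 0"

definition yP :: "(nat \<Rightarrow> nat \<Rightarrow> complex) \<Rightarrow> nat \<Rightarrow> nat \<Rightarrow> complex poly" where
  "yP K a b = (if a = b then [:0, 1:] else 0) - [:K a b:]"

definition chiP :: "nat \<Rightarrow> (nat \<Rightarrow> nat \<Rightarrow> complex) \<Rightarrow> complex poly" where
  "chiP N K = (\<Sum>\<sigma>|\<sigma> permutes {..<N}. of_int (sign \<sigma>) * (\<Prod>a<N. yP K a (\<sigma> a)))"

lemma pd_0 [simp]: "pd 0 f = 0"
  by (simp add: pd_def)

lemma pd_pCons: "pd (pCons c p) f = fps_const c * f + fps_deriv (pd p f)"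
proof (cases "c = 0 \<and> p = 0")
  case True
  then show ?thesis by (simp add: pd_def)
next
  case False
  then show ?thesis by (auto simp: pd_def fold_coeffs_pCons_not_0_0_eq fold_coeffs_pCons_coeff_not_0_eq)
qed

lemma pd_add_right: "pd p (f + h) = pd p f + pd p h"
  by (induction p) (simp_all add: pd_pCons algebra_simps)

lemma pd_0_right [simp]: "pd p 0 = 0"
  by (induction p) (simp_all add: pd_pCons)

lemma pd_const_mult: "pd p (fps_const c * f) = fps_const c * pd p f"
  by (induction p) (simp_all add: pd_pCons algebra_simps)

lemma pd_add: "pd (p + q) f = pd p f + pd q f"
  by (induction p q rule: poly_induct2) (simp_all add: pd_pCons algebra_simps flip: fps_const_add)

lemma pd_smult: "pd (smult c p) f = fps_const c * pd p f"
  by (induction p) (simp_all add: pd_pCons algebra_simps flip: fps_const_mult)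

lemma pd_mult: "pd (p * q) f = pd p (pd q f)"
  by (induction p) (simp_all add: pd_pCons pd_add pd_smult)

lemma pd_mult_commute: "pd p (pd q f) = pd q (pd p f)"
  by (metis pd_mult mult.commute)

lemma pd_1 [simp]: "pd 1 f = f"
  by (simp add: one_pCons pd_pCons)

lemma pd_sum: "pd (sum p A) f = (\<Sum>x\<in>A. pd (p x) f)"
  by (induction A rule: infinite_finite_induct) (simp_all add: pd_add)

lemma pd_sum_right: "pd p (sum f A) = (\<Sum>x\<in>A. pd p (f x))"
  by (induction A rule: infinite_finite_induct) (simp_all add: pd_add_right)

lemma pd_minus: "pd (- p) f = - pd p f"
  using pd_add[of p "- p" f] by (simp add: add_eq_0_iff)

lemma pd_diff: "pd (p - q) f = pd p f - pd q f"
  using pd_add[of p "- q" f] by (simp add: pd_minus)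

lemma pd_of_int: "pd (of_int c * p) f = of_int c * pd p f"
  by (simp add: of_int_poly pd_smult  flip: fps_of_int)

lemma pd_yP: "pd (yP K a b) f = (if a = b then fps_deriv f else 0) - fps_const (K a b) * f"
  by (simp add: yP_def pd_diff pd_pCons)

section \<open>A realisation of the ring of operators\<close>

text \<open>Multiplication has to be composition, which is not the pointwise product on a function
  type; hence a type of its own. The sort of the argument type provides two different elements, so
  that \<open>0 \<noteq> 1\<close> among the maps.\<close>

typedef (overloaded) 'a endo = "{f :: 'a::{ab_group_add, zero_neq_one} \<Rightarrow> 'a. \<forall>x y. f (x + y) = f x + f y}"
  morphisms app Endo
  by (rule exI[of _ id]) simp

setup_lifting type_definition_endo

lemma app_add: "app f (x + y) = app f x + app f y"
  using app[of f] by simp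
lemma app_0: "app f 0 = 0"
  using app_add[of f 0 0] by simp
instantiation endo :: ("{ab_group_add, zero_neq_one}") ring_1
begin

lift_definition zero_endo :: "'a endo" is "\<lambda>_. 0" by simp
lift_definition one_endo :: "'a endo" is "\<lambda>x. x" by simp
lift_definition plus_endo :: "'a endo \<Rightarrow> 'a endo \<Rightarrow> 'a endo" is "\<lambda>f g x. f x + g x"
  by (simp add: algebra_simps)
lift_definition minus_endo :: "'a endo \<Rightarrow> 'a endo \<Rightarrow> 'a endo" is "\<lambda>f g x. f x - g x"
  by (simp add: algebra_simps)
lift_definition uminus_endo :: "'a endo \<Rightarrow> 'a endo" is "\<lambda>f x. - f x"
  by simp
lift_definition times_endo :: "'a endo \<Rightarrow> 'a endo \<Rightarrow> 'a endo" is "\<lambda>f g x. f (g x)"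
  by simp

instance
proof
  fix a b c :: "'a endo"
  show "a + b + c = a + (b + c)" "a + b = b + a" "0 + a = a" "- a + a = 0" "a - b = a + - b"
    "a * b * c = a * (b * c)" "1 * a = a" "a * 1 = a" "(a + b) * c = a * c + b * c"
    by (transfer; simp add: algebra_simps)+
  show "a * (b + c) = a * b + a * c"
    by transfer (auto simp: fun_eq_iff)
  show "(0 :: 'a endo) \<noteq> 1"
    by transfer (metis zero_neq_one)
qed

end

lemma app_plus: "app (f + g) x = app f x + app g x" by transfer simp
lemma app_diff: "app (f - g) x = app f x - app g x" by transfer simp
lemma app_uminus: "app (- f) x = - app f x" by transfer simp
lemma app_times: "app (f * g) x = app f (app g x)" by transfer simp
lemma app_one: "app 1 x = x" by transfer simp
lemma app_zero: "app 0 x = 0" by transfer simp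
lemma app_sum_left: "app (sum f A) x = (\<Sum>i\<in>A. app (f i) x)"
  by (induction A rule: infinite_finite_induct) (simp_all add: app_zero app_plus)
lemma endo_eqI: "(\<And>x. app f x = app g x) \<Longrightarrow> f = g"
  by (metis app_inject ext)
lemma app_Endo: "(\<And>x y. f (x + y) = f x + f y) \<Longrightarrow> app (Endo f) = f"
  by (simp add: Endo_inverse)

lemmas app_simps = app_plus app_diff app_uminus app_times app_one app_zero app_sum_left

text \<open>Vectors of power series with coefficients in the exterior algebra; the set stands for
  the monomial of its variables in increasing order.\<close>

type_synonym 'w grass = "nat set \<Rightarrow> 'w \<Rightarrow> complex fps"

definition gd :: "'w grass endo" where "gd = Endo (\<lambda>\<phi> I w. fps_deriv (\<phi> I w))"
definition gmu :: "complex fps \<Rightarrow> 'w grass endo" where "gmu h = Endo (\<lambda>\<phi> I w. h * \<phi> I w)"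
text \<open>Left multiplication by the variable \<open>a\<close>; the sign brings it past the
  smaller variables to its place.\<close>

definition gpsi :: "nat \<Rightarrow> 'w grass endo" where
  "gpsi a = Endo (\<lambda>\<phi> I w. if a \<in> I then (- 1) ^ card {b\<in>I. b < a} * \<phi> (I - {a}) w else 0)"

definition letter :: "nat \<Rightarrow> 's \<Rightarrow> ('s \<Rightarrow> nat) \<Rightarrow> nat" where
  "letter N s w = w s mod N"
text \<open>Adding a multiple of \<open>N\<close> to a letter changes nothing; this makes the unit of the matrix
  algebra act as the identity on functions of all words.\<close>
definition put :: "nat \<Rightarrow> 's \<Rightarrow> nat \<Rightarrow> ('s \<Rightarrow> nat) \<Rightarrow> ('s \<Rightarrow> nat)" where
  "put N s b w = w(s := w s div N * N + b)"

text \<open>The operator acts on coefficient functions: \<open>E_ab\<close> sends the letter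
  \<open>b\<close> to \<open>a\<close>, so the new value at a word with letter \<open>a\<close> is
  the old value with \<open>b\<close> written there.\<close>

definition epsV :: "nat \<Rightarrow> 's \<Rightarrow> nat \<Rightarrow> nat \<Rightarrow> (('s \<Rightarrow> nat) \<Rightarrow> 'c::zero) \<Rightarrow> ('s \<Rightarrow> nat) \<Rightarrow> 'c" where
  "epsV N s a b f = (\<lambda>w. if letter N s w = a then f (put N s b w) else 0)"

definition geps :: "nat \<Rightarrow> 's \<Rightarrow> nat \<Rightarrow> nat \<Rightarrow> ('s \<Rightarrow> nat) grass endo" where
  "geps N s a b = Endo (\<lambda>\<phi> I. epsV N s a b (\<phi> I))"

lemma app_gd: "app gd \<phi> = (\<lambda>I w. fps_deriv (\<phi> I w))"
  unfolding gd_def by (subst app_Endo) (auto simp: fun_eq_iff plus_fun_def)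
lemma app_gmu: "app (gmu h) \<phi> = (\<lambda>I w. h * \<phi> I w)"
  unfolding gmu_def by (subst app_Endo) (auto simp: fun_eq_iff plus_fun_def algebra_simps)
lemma app_gpsi: "app (gpsi a) \<phi> = (\<lambda>I w. if a \<in> I then (- 1) ^ card {b\<in>I. b < a} * \<phi> (I - {a}) w else 0)"
  unfolding gpsi_def by (subst app_Endo) (auto simp: fun_eq_iff plus_fun_def algebra_simps)
lemma app_geps: "app (geps N s a b) \<phi> = (\<lambda>I. epsV N s a b (\<phi> I))"
  unfolding geps_def by (subst app_Endo) (auto simp: fun_eq_iff plus_fun_def epsV_def)

lemmas app_gen = app_gd app_gmu app_gpsi app_geps

lemma letter_put_same: "b < N \<Longrightarrow> letter N s (put N s b w) = b"
  by (simp add: letter_def put_def)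
lemma letter_put_diff: "s \<noteq> t \<Longrightarrow> letter N t (put N s b w) = letter N t w"
  by (simp add: letter_def put_def)
lemma put_put_same: "b < N \<Longrightarrow> put N s c (put N s b w) = put N s c w"
  by (simp add: put_def)
lemma put_put_diff: "s \<noteq> t \<Longrightarrow> put N s b (put N t c w) = put N t c (put N s b w)"
  by (simp add: put_def fun_upd_twist)
lemma put_letter: "put N s (letter N s w) w = w"
  by (simp add: put_def letter_def)
lemma letter_less: "N > 0 \<Longrightarrow> letter N s w < N"
  by (simp add: letter_def)

lemma gpsi_anti: "gpsi a * gpsi b = - (gpsi b * gpsi a :: 'w grass endo)"
proof (rule endo_eqI)
  fix \<phi> :: "'w grass"
  have swap: "app (gpsi a * gpsi b) \<phi> I w = - app (gpsi b * gpsi a) \<phi> I w" if "a < b" for a b I w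
  proof (cases "a \<in> I \<and> b \<in> I")
    case True
    have fin: "finite {x \<in> I. x < b}" by (rule finite_subset[of _ "{..<b}"]) auto
    have k: "card {x \<in> I. x < b} = Suc (card ({x \<in> I. x < b} - {a}))"
      by (rule card.remove[OF fin]) (use True that in auto)
    have 1: "{x \<in> I - {a}. x < b} = {x \<in> I. x < b} - {a}" and 2: "{x \<in> I - {b}. x < a} = {x \<in> I. x < a}"
      using that by auto
    have L: "app (gpsi a * gpsi b) \<phi> I w
       = (- 1) ^ card {x \<in> I. x < a} * ((- 1) ^ card {x \<in> I - {a}. x < b} * \<phi> (I - {a} - {b}) w)"
      unfolding app_times app_gpsi using True that by auto
    have R: "app (gpsi b * gpsi a) \<phi> I w
       = (- 1) ^ card {x \<in> I. x < b} * ((- 1) ^ card {x \<in> I - {b}. x < a} * \<phi> (I - {b} - {a}) w)"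
      unfolding app_times app_gpsi using True that by auto
    have 3: "I - {b} - {a} = I - {a} - {b}" by auto
    show ?thesis unfolding L R 1 2 3 k by (simp add: mult_ac)
  qed (auto simp: app_simps app_gpsi)
  consider "a < b" | "b < a" | "a = b" by linarith
  then show "app (gpsi a * gpsi b) \<phi> = app (- (gpsi b * gpsi a)) \<phi>"
  proof cases
    case 1
    then show ?thesis by (intro ext) (simp add: app_uminus swap[OF 1])
  next
    case 2
    then show ?thesis by (intro ext) (simp add: app_uminus swap[OF 2])
  next
    case 3
    then show ?thesis by (intro ext) (simp add: app_simps app_gpsi)
  qed
qed

lemma sum_fun_comp: "sum f A x = (\<Sum>i\<in>A. f i x)" for f :: "'i \<Rightarrow> 'x \<Rightarrow> 'y::comm_monoid_add"
  by (induction A rule: infinite_finite_induct) auto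

lemma grass_no_two_torsion: "x + x = 0 \<Longrightarrow> x = (0 :: 'w grass endo)"
proof (rule endo_eqI, intro ext, rule fps_ext)
  fix \<phi> :: "'w grass" and I w n assume "x + x = 0"
  then have "app (x + x) \<phi> I w = 0" by (simp add: app_zero)
  then have "fps_nth (app x \<phi> I w) n + fps_nth (app x \<phi> I w) n = 0"
    unfolding app_plus plus_fun_apply by (simp only: fps_add_nth[symmetric] fps_zero_nth)
  then show "fps_nth (app x \<phi> I w) n = fps_nth (app 0 \<phi> I w) n"
    by (simp add: complex_eq_iff app_zero)
qed

lemma gaudin_ring_grass:
  assumes "N > 0" "finite S"
  shows "gaudin_ring N S (gd :: ('s \<Rightarrow> nat) grass endo) gmu (geps N) gpsi"
proof
  show "\<And>x. x + x = 0 \<Longrightarrow> x = (0 :: ('s \<Rightarrow> nat) grass endo)" by (rule grass_no_two_torsion)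
  show "finite S" by fact
  show "gmu 1 = (1 :: ('s \<Rightarrow> nat) grass endo)"
    by (rule endo_eqI) (simp add: app_gen app_simps)
  fix h k show "gmu (h + k) = gmu h + (gmu k :: ('s \<Rightarrow> nat) grass endo)"
    by (rule endo_eqI) (auto simp: app_gen app_simps algebra_simps fun_eq_iff)
  show "gmu (h * k) = gmu h * (gmu k :: ('s \<Rightarrow> nat) grass endo)"
    by (rule endo_eqI) (auto simp: app_gen app_simps algebra_simps fun_eq_iff)
  show "gd * gmu h = gmu h * gd + (gmu (fps_deriv h) :: ('s \<Rightarrow> nat) grass endo)"
    by (rule endo_eqI) (auto simp: app_gen app_simps algebra_simps fun_eq_iff)
  fix a b
  show "gpsi a * gmu h = gmu h * (gpsi a :: ('s \<Rightarrow> nat) grass endo)"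
    by (rule endo_eqI) (auto simp: app_gen app_simps algebra_simps fun_eq_iff)
  have d: "fps_deriv ((- 1) ^ k * f) = (- 1) ^ k * fps_deriv f" for k and f :: "complex fps"
    by (cases "even k") auto
  show "gd * gpsi a = gpsi a * (gd :: ('s \<Rightarrow> nat) grass endo)"
    by (rule endo_eqI) (auto simp: app_gen app_simps fun_eq_iff d simp del: fps_deriv_mult)
  show "gpsi a * gpsi b = - (gpsi b * (gpsi a :: ('s \<Rightarrow> nat) grass endo))" by (rule gpsi_anti)
  fix s assume "s \<in> S"
  show "geps N s a b * gmu h = gmu h * geps N s a b"
    by (rule endo_eqI) (auto simp: app_gen app_simps fun_eq_iff epsV_def)
  show "geps N s a b * gd = gd * geps N s a b"
    by (rule endo_eqI) (auto simp: app_gen app_simps fun_eq_iff epsV_def)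
  fix c
  show "geps N s a b * gpsi c = gpsi c * geps N s a b"
    by (rule endo_eqI) (auto simp: app_gen app_simps fun_eq_iff epsV_def)
  assume "a < N" "b < N" "c < N"
  fix e assume "e < N"
  show "geps N s a b * geps N s c e = (if b = c then geps N s a e else 0)"
    using \<open>b < N\<close> by (intro endo_eqI) (auto simp: app_gen app_simps fun_eq_iff epsV_def letter_put_same put_put_same)
  fix t assume "s \<noteq> t"
  show "geps N s a b * geps N t c e = geps N t c e * geps N s a b"
    using \<open>s \<noteq> t\<close> by (intro endo_eqI)
      (auto simp: app_gen app_simps fun_eq_iff epsV_def letter_put_diff put_put_diff)
next
  fix s assume "s \<in> S"
  show "(\<Sum>a<N. geps N s a a) = (1 :: ('s \<Rightarrow> nat) grass endo)"
  proof (rule endo_eqI, intro ext)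
    fix \<phi> :: "('s \<Rightarrow> nat) grass" and I w
    have "app (\<Sum>a<N. geps N s a a) \<phi> I w = (\<Sum>a<N. app (geps N s a a) \<phi> I w)"
      by (simp add: app_sum_left sum_fun_comp)
    also have "\<dots> = (\<Sum>a<N. if a = letter N s w then \<phi> I w else 0)"
      by (intro sum.cong refl) (auto simp: app_geps epsV_def put_letter)
    also have "\<dots> = \<phi> I w" using letter_less[OF assms(1), of s w] by simp
    finally show "app (\<Sum>a<N. geps N s a a) \<phi> I w = app 1 \<phi> I w" by (simp add: app_one)
  qed
qed

section \<open>Word functions with distinct poles: an equation with constant coefficients\<close>

interpretation fpsV: vector_space "\<lambda>c f. fps_const c * f :: complex fps"
  by standard (simp_all add: algebra_simps flip: fps_const_add fps_const_mult)

lemma pd_monom: "pd (monom c k) f = fps_const c * (fps_deriv ^^ k) f"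
  by (induction k) (simp_all add: monom_0 monom_Suc pd_pCons)

text \<open>The derivatives of \<open>x\<close> of orders 0 to \<open>card B\<close> are one more
  than the dimension allows, so they are linearly related. Two equal derivatives are already a
  relation; they are treated apart because dependence is a notion for sets, in which they would
  collapse.\<close>

lemma span_deriv_closed:
  assumes "finite B" and closed: "\<And>x. x \<in> B \<Longrightarrow> fps_deriv x \<in> fpsV.span B" and x: "x \<in> fpsV.span B"
  shows "\<exists>p. p \<noteq> 0 \<and> degree p \<le> card B \<and> pd p x = 0"
proof -
  have der: "fps_deriv y \<in> fpsV.span B" if "y \<in> fpsV.span B" for y
    using that
  proof (induction rule: fpsV.span_induct_alt)
    case base
    then show ?case by (simp add: fpsV.span_zero)
  next
    case (step c x y)
    then show ?case by (simp add: fpsV.span_add fpsV.span_scale closed)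
  qed
  define v where "v k = (fps_deriv ^^ k) x" for k
  have v: "v k \<in> fpsV.span B" for k
    by (induction k) (simp_all add: v_def x der)
  define n where "n = card B"
  have "\<exists>c. (\<exists>k\<le>n. c k \<noteq> 0) \<and> (\<Sum>k\<le>n. fps_const (c k) * v k) = 0"
  proof (cases "inj_on v {..n}")
    case True
    have "fpsV.dependent (v ` {..n})"
    proof (rule ccontr)
      assume "fpsV.independent (v ` {..n})"
      then have "card (v ` {..n}) \<le> card B"
        using fpsV.independent_span_bound[of B "v ` {..n}"] assms(1) v by auto
      then show False using True by (simp add: card_image n_def)
    qed
    then obtain u where u: "\<exists>y\<in>v ` {..n}. u y \<noteq> 0" "(\<Sum>y\<in>v ` {..n}. fps_const (u y) * y) = 0"
      using fpsV.dependent_finite[of "v ` {..n}"] by auto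
    then show ?thesis using True by (intro exI[of _ "u \<circ> v"]) (auto simp: sum.reindex)
  next
    case False
    then obtain i j where ij: "i \<le> n" "j \<le> n" "i \<noteq> j" "v i = v j" by (auto simp: inj_on_def)
    define c where "c k = (if k = i then 1 else if k = j then - 1 else 0 :: complex)" for k
    have "(\<Sum>k\<le>n. fps_const (c k) * v k) = (\<Sum>k\<in>{i, j}. fps_const (c k) * v k)"
      using ij by (intro sum.mono_neutral_right) (auto simp: c_def)
    also have "\<dots> = 0" using ij by (simp add: c_def flip: fps_const_neg)
    finally show ?thesis using ij by (intro exI[of _ c]) (auto simp: c_def)
  qed
  then obtain c where c: "\<exists>k\<le>n. c k \<noteq> 0" "(\<Sum>k\<le>n. fps_const (c k) * v k) = 0" by blast
  define p where "p = (\<Sum>k\<le>n. monom (c k) k)"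
  have co: "coeff p k = (if k \<le> n then c k else 0)" for k
    by (simp add: p_def coeff_sum)
  have "p \<noteq> 0" using c(1) co by (metis coeff_0)
  moreover have "degree p \<le> n" by (rule degree_le) (simp add: co)
  moreover have "pd p x = 0" using c(2) by (simp add: p_def pd_sum pd_monom v_def)
  ultimately show ?thesis by (auto simp: n_def)
qed

text \<open>The expansion of \<open>1/(u - z)\<close> in powers of \<open>u - u0\<close>.\<close>

definition pole :: "complex \<Rightarrow> complex \<Rightarrow> complex fps" where
  "pole u0 z = inverse (fps_X + fps_const (u0 - z))"

lemma pole_mult: "u0 \<noteq> z \<Longrightarrow> pole u0 z * (fps_X + fps_const (u0 - z)) = 1"
  unfolding pole_def by (rule inverse_mult_eq_1) simp

lemma pole_deriv: "u0 \<noteq> z \<Longrightarrow> fps_deriv (pole u0 z) = - (pole u0 z * pole u0 z)"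
  unfolding pole_def by (subst fps_inverse_deriv) (simp_all add: power2_eq_square)

lemma pole_prod:
  assumes "u0 \<noteq> z" "u0 \<noteq> z'" "z \<noteq> z'"
  shows "pole u0 z * pole u0 z' = fps_const (1 / (z - z')) * (pole u0 z - pole u0 z')"
proof -
  let ?p = "pole u0 z" and ?q = "pole u0 z'" and ?l = "fps_X + fps_const (u0 - z)" and ?l' = "fps_X + fps_const (u0 - z')"
  have "?p - ?q = ?p * (?q * ?l') - ?q * (?p * ?l)"
    using pole_mult[OF assms(1)] pole_mult[OF assms(2)] by simp
  also have "\<dots> = ?p * ?q * (?l' - ?l)" by (simp only: right_diff_distrib mult_ac)
  also have "?l' - ?l = fps_const (z - z')" by simp
  finally have "fps_const (1 / (z - z')) * (?p - ?q) = ?p * ?q * (fps_const (z - z') * fps_const (1 / (z - z')))"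
    by (simp only: mult_ac)
  also have "fps_const (z - z') * fps_const (1 / (z - z')) = 1" using assms by (simp add: fps_const_mult)
  finally show ?thesis by simp
qed

definition vac :: "('w \<Rightarrow> complex fps) \<Rightarrow> 'w grass" where
  "vac f = (\<lambda>I. if I = {} then f else (\<lambda>_. 0))"

lemma vac_0: "vac (\<lambda>_. 0) = 0"
  by (auto simp: vac_def fun_eq_iff)

text \<open>The variables are multiplied on from the last to the first, each one smaller than those
  already there, so no sign arises.\<close>

lemma psi_top:
  assumes "k \<le> N"
  shows "app (prod_list (map gpsi [k..<N])) (vac f) = (\<lambda>I. if I = {k..<N} then f else (\<lambda>_. 0))"
  using assms
proof (induction rule: inc_induct)
  case base
  then show ?case by (simp add: app_one vac_def)
next
  case (step k)
  have "app (prod_list (map gpsi [k..<N])) (vac f) = app (gpsi k) (app (prod_list (map gpsi [Suc k..<N])) (vac f))"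
    using step by (simp add: upt_conv_Cons app_times)
  also have "\<dots> = (\<lambda>I. if I = {k..<N} then f else (\<lambda>_. 0))"
  proof (intro ext)
    fix I w
    have "insert k {Suc k..<N} = {k..<N}" using step.hyps by auto
    then have 1: "k \<in> I \<and> I - {k} = {Suc k..<N} \<longleftrightarrow> I = {k..<N}"
    proof (intro iffI conjI; (elim conjE)?)
      assume k: "k \<in> I" and "I - {k} = {Suc k..<N}"
      then have "I = insert k {Suc k..<N}" using insert_Diff[OF k] by simp
      then show "I = {k..<N}" using \<open>insert k {Suc k..<N} = {k..<N}\<close> by simp
    qed (use step.hyps in auto)
    have 2: "{b. k \<le> b \<and> b < N \<and> b < k} = {}" by auto
    show "app (gpsi k) (app (prod_list (map gpsi [Suc k..<N])) (vac f)) I w = (if I = {k..<N} then f else (\<lambda>_. 0)) w"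
    proof (cases "I = {k..<N}")
      case True
      have "{k..<N} - {k} = {Suc k..<N}" by auto
      then show ?thesis using step.hyps by (simp add: True step.IH app_gpsi 2)
    next
      case False
      then have "k \<in> I \<Longrightarrow> I - {k} \<noteq> {Suc k..<N}" using 1 by blast
      then show ?thesis using False by (simp add: step.IH app_gpsi)
    qed
  qed
  finally show ?case .
qed

lemma cl_epsV: "cl (epsV N s a b) f = epsV N s a b f"
  by (auto simp: cl_def epsV_def fun_eq_iff intro!: fps_ext)

lemma app_sign: "app (of_int (sign \<sigma>) * x) \<phi> = (\<lambda>I w. of_int (sign \<sigma>) * app x \<phi> I w)"
  for \<phi> :: "'w grass"
  by (cases \<sigma> rule: sign_cases) (auto simp: app_uminus fun_eq_iff)

text \<open>As \<Omega> is closed under changing letters, \<open>Wop_system\<close> expresses the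
  derivatives of the \<open>W s w\<close> with \<open>w\<close> in \<Omega> by these same finitely
  many series. The series \<open>pd (chiP N K) (f w)\<close> is a sum of some of them, so it
  satisfies an equation whose order is at most their number. This bound does not see the position of
  the poles.\<close>

lemma vec_solution_words:
  fixes S :: "'s set" and K :: "nat \<Rightarrow> nat \<Rightarrow> complex" and zz :: "'s \<Rightarrow> complex"
    and f :: "('s \<Rightarrow> nat) \<Rightarrow> complex fps"
  assumes N: "N > 0" and fin: "finite S" and inj: "inj_on zz S" and u0: "\<And>s. s \<in> S \<Longrightarrow> u0 \<noteq> zz s"
    and sol: "Df N K S (\<lambda>s. pole u0 (zz s)) (\<lambda>s a b. epsV N s a b) f = (\<lambda>_. 0)"
    and \<Omega>: "finite \<Omega>" "\<And>w s b. w \<in> \<Omega> \<Longrightarrow> s \<in> S \<Longrightarrow> b < N \<Longrightarrow> put N s b w \<in> \<Omega>" and w: "w \<in> \<Omega>"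
  shows "\<exists>p. p \<noteq> 0 \<and> degree p \<le> card S * card \<Omega> \<and> pd p (pd (chiP N K) (f w)) = 0"
proof -
  define g where "g s = pole u0 (zz s)" for s
  define \<alpha> where "\<alpha> i j = 1 / (zz i - zz j)" for i j
  interpret gaudin_ring N S "gd :: ('s \<Rightarrow> nat) grass endo" gmu "geps N" gpsi K
    by (rule gaudin_ring_grass[OF N fin])
  interpret gaudin_ring_simple_poles N S "gd :: ('s \<Rightarrow> nat) grass endo" gmu "geps N" gpsi K g \<alpha>
  proof
    show "fps_deriv (g s) = - (g s * g s)" if "s \<in> S" for s
      unfolding g_def using that u0 by (intro pole_deriv) auto
    fix i j assume ij: "i \<in> S" "j \<in> S" "i \<noteq> j"
    then have z: "zz i \<noteq> zz j" using inj by (auto simp: inj_on_def)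
    show "g i * g j = fps_const (\<alpha> i j) * (g i - g j)"
      unfolding g_def \<alpha>_def using ij u0 z by (intro pole_prod) auto
    show "\<alpha> i j = - \<alpha> j i" using z by (simp add: \<alpha>_def divide_simps)
    fix t assume t: "t \<in> S" "t \<noteq> i" "t \<noteq> j"
    then have "zz t \<noteq> zz i" "zz t \<noteq> zz j" using inj ij by (auto simp: inj_on_def)
    then show "\<alpha> t i * \<alpha> t j = \<alpha> i j * (\<alpha> t i - \<alpha> t j)" using z
      by (simp add: \<alpha>_def divide_simps)
  qed
  interpret anti: anticommuting "gpsi :: nat \<Rightarrow> ('s \<Rightarrow> nat) grass endo"
  proof
    show 1: "gpsi a * gpsi b = - (gpsi b * (gpsi a :: ('s \<Rightarrow> nat) grass endo))" for a b by (rule psi_anti)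
    have "gpsi a * gpsi a + gpsi a * (gpsi a :: ('s \<Rightarrow> nat) grass endo) = 0" for a :: nat
      using 1[of a a] by (simp only: eq_neg_iff_add_eq_0)
    then show "gpsi a * (gpsi a :: ('s \<Rightarrow> nat) grass endo) = 0" for a by (rule no_two_torsion)
  qed
  \<comment> \<open>The entry \<open>X_ba\<close>, with the exchanged indices of
    \<open>yy\<close>.\<close>
  define XX where "XX a b = yy a b - (\<Sum>s\<in>S. gmu (g s) * geps N s a b)" for a b
  define Psi :: "('s \<Rightarrow> nat) grass endo" where "Psi = prod_list (map gpsi [0..<N])"
  define A where "A = (\<Sum>\<sigma>|\<sigma> permutes {..<N}. of_int (sign \<sigma>) * prod_list (map (\<lambda>b. XX (\<sigma> b) b) [0..<N]))"
  define C where "C = (\<Sum>\<sigma>|\<sigma> permutes {..<N}. of_int (sign \<sigma>) * prod_list (map (\<lambda>b. yy (\<sigma> b) b) [0..<N]))"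
  have psi_sum: "gpsi a * (\<Sum>s\<in>S. gmu (g s) * geps N s a' b) = (\<Sum>s\<in>S. gmu (g s) * (gpsi a * geps N s a' b))" for a a' b
    by (simp add: sum_distrib_left mu_psi flip: mult.assoc)
  have geps_psi: "geps N s a b * gpsi c = gpsi c * geps N s a b" for s :: 's and a b c
    by (rule endo_eqI) (auto simp: app_gen app_simps fun_eq_iff epsV_def)
  have XX_psi: "XX a b * gpsi c = gpsi c * XX a b" for a b c
    unfolding XX_def left_diff_distrib right_diff_distrib yy_psi
    by (intro arg_cong2[where f = minus] refl comm_sum comm_mult) (simp_all add: mu_psi geps_psi)
  have theta_XX: "theta b = (\<Sum>a<N. gpsi a * XX a b)" for b
  proof -
    have "(\<Sum>s\<in>S. gmu (g s) * eta s b) = (\<Sum>a<N. gpsi a * (\<Sum>s\<in>S. gmu (g s) * geps N s a b))"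
    proof -
      have "(\<Sum>s\<in>S. gmu (g s) * eta s b) = (\<Sum>s\<in>S. \<Sum>a<N. gmu (g s) * (gpsi a * geps N s a b))"
        by (simp add: eta_def sum_distrib_left)
      also have "\<dots> = (\<Sum>a<N. \<Sum>s\<in>S. gmu (g s) * (gpsi a * geps N s a b))"
        by (rule sum.swap)
      finally show ?thesis by (simp only: psi_sum)
    qed
    then show ?thesis by (simp add: theta_def y_def XX_def right_diff_distrib sum_subtractf)
  qed
  have Theta: "Theta = Psi * A"
    unfolding Theta_def theta_XX[abs_def] Psi_def A_def by (rule anti.cdet_expand) (rule XX_psi)
  have om_empty: "om bs {} = prod_list (map y bs)" for bs by (induction bs) simp_all
  have om0: "omN {} = Psi * C"
    unfolding omN_def om_empty y_def[abs_def] Psi_def C_def by (rule anti.cdet_expand) (rule yy_psi)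
  have app_yy: "app (yy a b) (vac h) = vac (\<lambda>w. pd (yP K b a) (h w))" for a b and h :: "('s \<Rightarrow> nat) \<Rightarrow> complex fps"
    by (auto simp: yy_def vac_def app_simps app_gen sc_def pd_yP fun_eq_iff)
  have app_XX: "app (XX a b) (vac h) = vac (Xf K S g (\<lambda>s a b. epsV N s a b) b a h)" for a b and h :: "('s \<Rightarrow> nat) \<Rightarrow> complex fps"
    unfolding XX_def app_diff app_yy
    by (auto simp: vac_def app_simps app_gen pd_yP fun_eq_iff Xf_def cl_epsV sum_fun_comp epsV_def intro!: sum.neutral)
  have app_XXs: "app (prod_list (map (\<lambda>b. XX (\<sigma> b) b) bs)) (vac h)
      = vac (foldr (\<lambda>a h. Xf K S g (\<lambda>s a b. epsV N s a b) a (\<sigma> a) h) bs h)" for \<sigma> bs and h :: "('s \<Rightarrow> nat) \<Rightarrow> complex fps"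
    by (induction bs) (simp_all add: app_one app_times app_XX)
  have app_yys: "app (prod_list (map (\<lambda>b. yy (\<sigma> b) b) bs)) (vac h)
      = vac (\<lambda>w. pd (prod_list (map (\<lambda>b. yP K b (\<sigma> b)) bs)) (h w))" for \<sigma> bs and h :: "('s \<Rightarrow> nat) \<Rightarrow> complex fps"
    by (induction bs) (simp_all add: app_one app_times app_yy pd_mult)
  have appA: "app A (vac f) = vac (Df N K S g (\<lambda>s a b. epsV N s a b) f)"
  proof (intro ext)
    fix I w
    have "app A (vac f) I w = (\<Sum>\<sigma>|\<sigma> permutes {..<N}. of_int (sign \<sigma>)
       * app (prod_list (map (\<lambda>b. XX (\<sigma> b) b) [0..<N])) (vac f) I w)"
      by (simp add: A_def app_sum_left app_sign sum_fun_comp)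
    also have "\<dots> = vac (Df N K S g (\<lambda>s a b. epsV N s a b) f) I w"
      unfolding app_XXs by (simp add: vac_def Df_def)
    finally show "app A (vac f) I w = vac (Df N K S g (\<lambda>s a b. epsV N s a b) f) I w" .
  qed
  have appC: "app C (vac f) = vac (\<lambda>w. pd (chiP N K) (f w))"
  proof -
    have "(\<Prod>a<N. yP K a (\<sigma> a)) = prod_list (map (\<lambda>b. yP K b (\<sigma> b)) [0..<N])" for \<sigma>
      using prod.distinct_set_conv_list[of "[0..<N]" "\<lambda>b. yP K b (\<sigma> b)"] by (simp add: atLeast0LessThan)
    note prod = this
    show ?thesis
    proof (intro ext)
      fix I w
      have "app C (vac f) I w = (\<Sum>\<sigma>|\<sigma> permutes {..<N}. of_int (sign \<sigma>)
         * app (prod_list (map (\<lambda>b. yy (\<sigma> b) b) [0..<N])) (vac f) I w)"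
        by (simp add: C_def app_sum_left app_sign sum_fun_comp)
      also have "\<dots> = vac (\<lambda>w. pd (chiP N K) (f w)) I w"
        unfolding app_yys by (simp add: vac_def chiP_def pd_sum pd_of_int prod)
      finally show "app C (vac f) I w = vac (\<lambda>w. pd (chiP N K) (f w)) I w" .
    qed
  qed
  have Theta0: "app Theta (vac f) = 0"
    using sol by (simp add: Theta app_times appA g_def[symmetric] vac_0 app_0)
  \<comment> \<open>Only the component at the top monomial is kept: that is where \<open>Psi\<close>
    puts its result.\<close>
  define W where "W s = app (Wop s) (vac f) {..<N}" for s
  have F: "pd (chiP N K) (f w) = (\<Sum>s\<in>S. W s w)" for w
  proof -
    have "app (omN {}) (vac f) = (\<Sum>s\<in>S. app (Wop s) (vac f))"
      using Theta_expand by (simp add: app_plus Theta0 app_sum_left Wop_def)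
    moreover have "app (omN {}) (vac f) {..<N} w = pd (chiP N K) (f w)"
      by (simp add: om0 app_times appC Psi_def psi_top[of 0, simplified] atLeast0LessThan)
    ultimately show ?thesis by (simp add: W_def sum_fun_comp)
  qed
  define B where "B = (\<lambda>(s, w). W s w) ` (S \<times> \<Omega>)"
  have WB: "W s w \<in> fpsV.span B" if "s \<in> S" "w \<in> \<Omega>" for s w
    using that by (intro fpsV.span_base) (auto simp: B_def)
  have deps: "epsV N s a b h w \<in> fpsV.span B" if "s \<in> S" "w \<in> \<Omega>" "b < N" "\<And>w. w \<in> \<Omega> \<Longrightarrow> h w \<in> fpsV.span B"
    for s a b h w using that \<Omega>(2) by (auto simp: epsV_def fpsV.span_zero)
  have der: "fps_deriv (W s w) \<in> fpsV.span B" if s: "s \<in> S" and w: "w \<in> \<Omega>" for s w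
  proof -
    have "fps_deriv (W s w) = app (gd * Wop s) (vac f) {..<N} w"
      by (simp add: app_times app_gd W_def)
    also have "\<dots> = (\<Sum>e<N. \<Sum>c<N. fps_const (K e c) * epsV N s e c (W s) w)
       + (\<Sum>j\<in>S - {s}. fps_const (\<alpha> s j) * (\<Sum>a<N. \<Sum>b<N. epsV N s a b (epsV N j b a (W s)) w))
       - (\<Sum>k\<in>S - {s}. fps_const (\<alpha> s k) * W k w)"
      unfolding Wop_system[OF s]
      by (simp add: app_simps app_sum_left sum_fun_comp Theta0 app_0 Kop_def Perm_def sc_def app_gen W_def
          sum_distrib_left)
    also have "\<dots> \<in> fpsV.span B"
      using s w by (intro fpsV.span_add fpsV.span_diff fpsV.span_sum fpsV.span_scale deps WB) auto
    finally show ?thesis .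
  qed
  have "finite B" using fin \<Omega>(1) by (simp add: B_def)
  moreover have "fps_deriv x \<in> fpsV.span B" if "x \<in> B" for x using that der by (auto simp: B_def)
  moreover have "pd (chiP N K) (f w) \<in> fpsV.span B"
    unfolding F using w by (intro fpsV.span_sum WB) auto
  ultimately obtain p where "p \<noteq> 0" "degree p \<le> card B" "pd p (pd (chiP N K) (f w)) = 0"
    using span_deriv_closed[of B] by blast
  moreover have "card B \<le> card S * card \<Omega>"
    unfolding B_def using card_image_le[of "S \<times> \<Omega>" "\<lambda>(s, w). W s w"] fin \<Omega>(1) by (simp add: card_cartesian_product)
  ultimately show ?thesis by (intro exI[of _ p]) auto
qed

section \<open>Linear maps between index types and operators that they intertwine\<close>

definition lin :: "(('a \<Rightarrow> complex) \<Rightarrow> 'b \<Rightarrow> complex) \<Rightarrow> bool" where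
  "lin T \<longleftrightarrow> (\<forall>x y. T (\<lambda>w. x w + y w) = (\<lambda>w. T x w + T y w)) \<and> (\<forall>c x. T (\<lambda>w. c * x w) = (\<lambda>w. c * T x w))"

lemma lin_add: "lin T \<Longrightarrow> T (\<lambda>w. x w + y w) = (\<lambda>w. T x w + T y w)"
  and lin_scale: "lin T \<Longrightarrow> T (\<lambda>w. c * x w) = (\<lambda>w. c * T x w)"
  by (simp_all add: lin_def)

lemma lin_0: "lin T \<Longrightarrow> T (\<lambda>w. 0) = (\<lambda>w. 0)"
  using lin_scale[of T 0] by simp

lemma lin_sum:
  assumes "lin T"
  shows "T (\<lambda>w. \<Sum>i\<in>A. x i w) = (\<lambda>w. \<Sum>i\<in>A. T (x i) w)"
  by (induction A rule: infinite_finite_induct) (simp_all add: lin_0[OF assms] lin_add[OF assms])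

lemma lin_id: "lin (\<lambda>x. x)"
  by (simp add: lin_def)

lemma lin_comp: "lin T \<Longrightarrow> lin U \<Longrightarrow> lin (\<lambda>x. T (U x))"
  by (simp add: lin_def)

lemma lin_mult: "lin T \<Longrightarrow> lin (\<lambda>x w. c * T x w)"
  by (auto simp: lin_def fun_eq_iff algebra_simps)

lemma cl_nth: "fps_nth (cl T f w) m = T (\<lambda>x. fps_nth (f x) m) w"
  by (simp add: cl_def)

lemma cl_add:
  assumes "lin T"
  shows "cl T (\<lambda>w. f w + h w) = (\<lambda>w. cl T f w + cl T h w)"
  by (auto simp: fun_eq_iff cl_nth lin_add[OF assms] intro!: fps_ext)

lemma cl_0:
  assumes "lin T"
  shows "cl T (\<lambda>w. 0) = (\<lambda>w. 0)"
  by (auto simp: fun_eq_iff cl_nth lin_0[OF assms] intro!: fps_ext)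

lemma cl_mult:
  assumes "lin T"
  shows "cl T (\<lambda>w. h * f w) = (\<lambda>w. h * cl T f w)"
  by (auto simp: fun_eq_iff cl_nth fps_mult_nth lin_sum[OF assms] lin_scale[OF assms] intro!: fps_ext)

lemma cl_sum: "lin T \<Longrightarrow> cl T (\<lambda>w. \<Sum>i\<in>A. f i w) = (\<lambda>w. \<Sum>i\<in>A. cl T (f i) w)"
  by (induction A rule: infinite_finite_induct) (simp_all add: cl_0 cl_add)

lemma cl_uminus: "lin T \<Longrightarrow> cl T (\<lambda>w. - f w) = (\<lambda>w. - cl T f w)"
  using cl_mult[of T "- 1" f] by simp

lemma cl_diff: "lin T \<Longrightarrow> cl T (\<lambda>w. f w - h w) = (\<lambda>w. cl T f w - cl T h w)"
  using cl_add[of T f "\<lambda>w. - h w"] by (simp add: cl_uminus)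

lemma cl_deriv:
  assumes "lin T"
  shows "cl T (\<lambda>w. fps_deriv (f w)) = (\<lambda>w. fps_deriv (cl T f w))"
  by (auto simp: fun_eq_iff cl_nth lin_scale[OF assms] fps_deriv_nth intro!: fps_ext)

lemma cl_comp: "cl T (cl U f) = cl (\<lambda>x. T (U x)) f"
  by (auto simp: fun_eq_iff cl_nth intro!: fps_ext)

lemma cl_pd: "lin T \<Longrightarrow> cl T (\<lambda>w. pd p (f w)) = (\<lambda>w. pd p (cl T f w))"
  by (induction p) (simp_all add: pd_pCons cl_0 cl_add cl_mult cl_deriv)

lemma Xf_natural:
  assumes \<phi>: "lin \<phi>" and e: "\<And>s x. s \<in> S \<Longrightarrow> e' s b a (\<phi> x) = \<phi> (e s b a x)"
  shows "Xf K S g e' a b (cl \<phi> f) = cl \<phi> (Xf K S g e a b f)"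
proof -
  have "cl (e' s b a) (cl \<phi> f) = cl \<phi> (cl (e s b a) f)" if "s \<in> S" for s
    by (simp add: cl_comp e[OF that])
  then have 1: "(\<Sum>s\<in>S. g s * cl (e' s b a) (cl \<phi> f) w) = cl \<phi> (\<lambda>w. \<Sum>s\<in>S. g s * cl (e s b a) f w) w" for w
    using \<phi> by (simp add: cl_sum cl_mult)
  show ?thesis unfolding Xf_def 1 using \<phi>
    by (cases "a = b") (simp_all add: cl_diff cl_mult cl_deriv cl_uminus)
qed

lemma Df_natural:
  assumes \<phi>: "lin \<phi>" and e: "\<And>s a b x. s \<in> S \<Longrightarrow> a < N \<Longrightarrow> b < N \<Longrightarrow> e' s a b (\<phi> x) = \<phi> (e s a b x)"
  shows "Df N K S g e' (cl \<phi> f) = cl \<phi> (Df N K S g e f)"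
proof -
  have "foldr (\<lambda>a h. Xf K S g e' a (\<sigma> a) h) as (cl \<phi> f) = cl \<phi> (foldr (\<lambda>a h. Xf K S g e a (\<sigma> a) h) as f)"
    if "\<sigma> permutes {..<N}" "set as \<subseteq> {..<N}" for \<sigma> as
    using that(2)
  proof (induction as)
    case (Cons a as)
    then show ?case using that(1) permutes_in_image[of \<sigma> "{..<N}" a]
      by (simp add: Xf_natural[OF \<phi>] e)
  qed simp
  then have 1: "of_int (sign \<sigma>) * foldr (\<lambda>a h. Xf K S g e' a (\<sigma> a) h) [0..<N] (cl \<phi> f) w
      = cl \<phi> (\<lambda>w. of_int (sign \<sigma>) * foldr (\<lambda>a h. Xf K S g e a (\<sigma> a) h) [0..<N] f w) w"
    if "\<sigma> permutes {..<N}" for \<sigma> w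
    using that \<phi> by (simp add: cl_mult subset_iff)
  show ?thesis unfolding Df_def cl_sum[OF \<phi>] by (intro ext sum.cong refl) (simp add: 1)
qed

section \<open>Splitting off the pole-free part, uniformly in the poles\<close>

text \<open>Scaled monomials in the generators; sums are left to \<open>TS\<close>.\<close>

inductive_set alg :: "(('w \<Rightarrow> complex) \<Rightarrow> 'w \<Rightarrow> complex) set \<Rightarrow> (('w \<Rightarrow> complex) \<Rightarrow> 'w \<Rightarrow> complex) set"
  for E where
  alg_id: "(\<lambda>x. x) \<in> alg E"
| alg_comp: "T \<in> E \<Longrightarrow> U \<in> alg E \<Longrightarrow> (\<lambda>x. T (U x)) \<in> alg E"
| alg_scale: "U \<in> alg E \<Longrightarrow> (\<lambda>x w. c * U x w) \<in> alg E"

lemma alg_lin: "T \<in> alg E \<Longrightarrow> (\<And>T. T \<in> E \<Longrightarrow> lin T) \<Longrightarrow> lin T"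
  by (induction rule: alg.induct) (simp_all add: lin_id lin_comp lin_mult)

definition gens :: "nat \<Rightarrow> 's set \<Rightarrow> ('s \<Rightarrow> nat \<Rightarrow> nat \<Rightarrow> ('w \<Rightarrow> complex) \<Rightarrow> 'w \<Rightarrow> complex)
   \<Rightarrow> (('w \<Rightarrow> complex) \<Rightarrow> 'w \<Rightarrow> complex) set" where
  "gens N S e = {e s a b | s a b. s \<in> S \<and> a < N \<and> b < N}"

text \<open>The lower order part of the operator is a sum of terms \<open>g\<^sub>j\<^sub>1 \<cdots> g\<^sub>j\<^sub>r T \<partial>\<^sup>k\<close>, \<open>r > 0\<close>,
  where neither the words nor the operators \<open>T\<close> depend on the position of the poles.\<close>

inductive_set TS :: "'s set \<Rightarrow> (('w \<Rightarrow> complex) \<Rightarrow> 'w \<Rightarrow> complex) set \<Rightarrow> nat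
    \<Rightarrow> (('s \<Rightarrow> complex fps) \<Rightarrow> ('w \<Rightarrow> complex fps) \<Rightarrow> 'w \<Rightarrow> complex fps) set"
  for S E m where
  TS_zero: "(\<lambda>g f w. 0) \<in> TS S E m"
| TS_add: "P \<in> TS S E m \<Longrightarrow> Q \<in> TS S E m \<Longrightarrow> (\<lambda>g f w. P g f w + Q g f w) \<in> TS S E m"
| TS_base: "js \<noteq> [] \<Longrightarrow> set js \<subseteq> S \<Longrightarrow> T \<in> alg E \<Longrightarrow> k < m \<Longrightarrow>
    (\<lambda>g f w. prod_list (map g js) * cl T (\<lambda>w. (fps_deriv ^^ k) (f w)) w) \<in> TS S E m"

lemma TS_sum: "finite A \<Longrightarrow> (\<And>i. i \<in> A \<Longrightarrow> P i \<in> TS S E m) \<Longrightarrow> (\<lambda>g f w. \<Sum>i\<in>A. P i g f w) \<in> TS S E m"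
  by (induction A rule: finite_induct) (simp_all add: TS_zero TS_add)

lemma TS_sum_list: "(\<And>i. i \<in> set xs \<Longrightarrow> P i \<in> TS S E m) \<Longrightarrow> (\<lambda>g f w. \<Sum>i\<leftarrow>xs. P i g f w) \<in> TS S E m"
  by (induction xs) (simp_all add: TS_zero TS_add)

lemma fps_const_cl: "fps_const c * (p * cl T h w) = p * cl (\<lambda>x w. c * T x w) h w"
proof -
  have "fps_const c * cl T h w = cl (\<lambda>x w. c * T x w) h w"
    by (auto simp: cl_nth intro!: fps_ext)
  then show ?thesis by (metis mult.left_commute)
qed

lemma TS_base_scale:
  assumes "js \<noteq> []" "set js \<subseteq> S" "T \<in> alg E" "k < m"
  shows "(\<lambda>g f w. fps_const c * (prod_list (map g js) * cl T (\<lambda>w. (fps_deriv ^^ k) (f w)) w)) \<in> TS S E m"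
  unfolding fps_const_cl using assms by (intro TS_base alg_scale)

lemma TS_scale: "P \<in> TS S E m \<Longrightarrow> (\<lambda>g f w. fps_const c * P g f w) \<in> TS S E m"
proof (induction rule: TS.induct)
  case (TS_add P Q)
  from TS.TS_add[OF TS_add.IH] show ?case by (simp add: algebra_simps)
qed (use TS_base_scale TS.TS_zero in auto)

lemma TS_mono: "P \<in> TS S E m \<Longrightarrow> m \<le> n \<Longrightarrow> P \<in> TS S E n"
  by (induction rule: TS.induct) (auto intro: TS.intros)

lemma prod_list_deriv:
  assumes "\<And>s. s \<in> S \<Longrightarrow> fps_deriv (g s) = - (g s * g s :: complex fps)" "set js \<subseteq> S"
  shows "fps_deriv (prod_list (map g js)) = (\<Sum>j\<leftarrow>js. fps_const (- 1) * prod_list (map g (j # js)))"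
proof -
  have "fps_deriv (prod_list (map g js)) = - (\<Sum>j\<leftarrow>js. prod_list (map g (j # js)))"
    using assms(2)
  proof (induction js)
    case (Cons i js)
    have 1: "(\<Sum>j\<leftarrow>js. g j * (g i * prod_list (map g js))) = g i * (\<Sum>j\<leftarrow>js. g j * prod_list (map g js))"
      by (simp add: sum_list_const_mult[symmetric] mult_ac)
    show ?case using Cons assms(1)[of i] by (simp add: 1 algebra_simps)
  qed simp
  also have "\<dots> = fps_const (- 1) * (\<Sum>j\<leftarrow>js. prod_list (map g (j # js)))" by simp
  also have "\<dots> = (\<Sum>j\<leftarrow>js. fps_const (- 1) * prod_list (map g (j # js)))"
    by (simp only: sum_list_const_mult)
  finally show ?thesis .
qed

text \<open>Differentiating a pole gives a product of poles again, so a single \<open>Q\<close>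
  serves for all families \<open>g\<close> with \<open>g' = - g * g\<close>. The quantifiers are in
  this order because the poles will be moved later.\<close>

lemma TS_deriv:
  assumes "P \<in> TS S E m" and E: "\<And>T. T \<in> E \<Longrightarrow> lin T"
  shows "\<exists>Q\<in>TS S E (Suc m). \<forall>g f w. (\<forall>s\<in>S. fps_deriv (g s) = - (g s * g s)) \<longrightarrow> fps_deriv (P g f w) = Q g f w"
  using assms(1)
proof (induction rule: TS.induct)
  case TS_zero
  show ?case by (intro bexI[OF _ TS.TS_zero]) simp
next
  case (TS_add P Q)
  then obtain P' Q' where P': "P' \<in> TS S E (Suc m)" "\<forall>g f w. (\<forall>s\<in>S. fps_deriv (g s) = - (g s * g s)) \<longrightarrow> fps_deriv (P g f w) = P' g f w"
    and Q': "Q' \<in> TS S E (Suc m)" "\<forall>g f w. (\<forall>s\<in>S. fps_deriv (g s) = - (g s * g s)) \<longrightarrow> fps_deriv (Q g f w) = Q' g f w"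
    by blast
  show ?case by (intro bexI[OF _ TS.TS_add[OF P'(1) Q'(1)]]) (simp add: P'(2) Q'(2))
next
  case (TS_base js T k)
  let ?Q = "\<lambda>g f w. (\<Sum>j\<leftarrow>js. fps_const (- 1) * (prod_list (map g (j # js)) * cl T (\<lambda>w. (fps_deriv ^^ k) (f w)) w))
     + prod_list (map g js) * cl T (\<lambda>w. (fps_deriv ^^ Suc k) (f w)) w"
  have lin: "lin T" using TS_base E alg_lin by blast
  show ?case
  proof (rule bexI[of _ ?Q], intro allI impI)
    fix g f w assume g: "\<forall>s\<in>S. fps_deriv (g s) = - (g s * g s :: complex fps)"
    have e: "cl T (\<lambda>w. (fps_deriv ^^ Suc k) (f w)) w = fps_deriv (cl T (\<lambda>w. (fps_deriv ^^ k) (f w)) w)"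
      using cl_deriv[OF lin, of "\<lambda>w. (fps_deriv ^^ k) (f w)"] by simp
    have d: "fps_deriv (prod_list (map g js)) = (\<Sum>j\<leftarrow>js. fps_const (- 1) * prod_list (map g (j # js)))"
      using g TS_base by (intro prod_list_deriv[where S = S]) auto
    show "fps_deriv (prod_list (map g js) * cl T (\<lambda>w. (fps_deriv ^^ k) (f w)) w) = ?Q g f w"
      unfolding fps_deriv_mult d e by (simp only: sum_list_mult_const[symmetric] mult.assoc add.commute)
  next
    show "?Q \<in> TS S E (Suc m)"
      using TS_base by (intro TS.TS_add TS_sum_list TS_base_scale TS.TS_base) auto
  qed
qed

lemma TS_comp:
  assumes "P \<in> TS S E m" and E: "\<And>T. T \<in> E \<Longrightarrow> lin T" and T: "T \<in> E" and s: "s \<in> S"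
  shows "(\<lambda>g f w. g s * cl T (P g f) w) \<in> TS S E m"
  using assms(1)
proof (induction rule: TS.induct)
  case TS_zero
  then show ?case using cl_0[OF E[OF T]] by (simp add: TS.TS_zero)
next
  case (TS_add P Q)
  from TS.TS_add[OF TS_add.IH] show ?case by (simp add: cl_add[OF E[OF T]] algebra_simps)
next
  case (TS_base js U k)
  have "(\<lambda>g f w. prod_list (map g (s # js)) * cl (\<lambda>x. T (U x)) (\<lambda>w. (fps_deriv ^^ k) (f w)) w) \<in> TS S E m"
    using TS_base s by (intro TS.TS_base[OF _ _ alg_comp[OF T TS_base(3)]]) auto
  then show ?case by (simp add: cl_mult[OF E[OF T]] cl_comp mult.assoc)
qed

lemma pd_altdef:
  assumes "degree q \<le> m"
  shows "pd q f = (\<Sum>k<Suc m. fps_const (coeff q k) * (fps_deriv ^^ k) f)"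
proof -
  have "q = (\<Sum>k\<le>m. monom (coeff q k) k)"
    using assms by (intro poly_eqI) (simp add: coeff_sum coeff_eq_0)
  then have "pd q f = pd (\<Sum>k\<le>m. monom (coeff q k) k) f" by simp
  also have "\<dots> = (\<Sum>k<Suc m. fps_const (coeff q k) * (fps_deriv ^^ k) f)"
    by (simp add: pd_sum pd_monom lessThan_Suc_atMost)
  finally show ?thesis .
qed

lemma degree_yP: "degree (yP K a b) \<le> 1"
  unfolding yP_def by (rule degree_diff_le) auto

text \<open>A further factor multiplies the pole-free part by \<open>yP\<close> or hits it with a
  pole. In the second case it does not differentiate, so every term with a pole has fewer
  derivatives than there are factors, and this gap survives later derivatives.\<close>

lemma Xf_product_expand:
  fixes e :: "'s \<Rightarrow> nat \<Rightarrow> nat \<Rightarrow> ('w \<Rightarrow> complex) \<Rightarrow> 'w \<Rightarrow> complex"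
  assumes fin: "finite S" and lin: "\<And>T. T \<in> gens N S e \<Longrightarrow> lin T" and \<sigma>: "\<sigma> permutes {..<N}"
    and as: "set as \<subseteq> {..<N}"
  shows "\<exists>P\<in>TS S (gens N S e) (length as). \<forall>g f w. (\<forall>s\<in>S. fps_deriv (g s) = - (g s * g s)) \<longrightarrow>
    foldr (\<lambda>a h. Xf K S g e a (\<sigma> a) h) as f w = pd (prod_list (map (\<lambda>a. yP K a (\<sigma> a)) as)) (f w) + P g f w"
  using as
proof (induction as)
  case Nil
  show ?case by (intro bexI[OF _ TS.TS_zero]) simp
next
  case (Cons a as)
  let ?E = "gens N S e" and ?m = "length as"
  define q where "q = prod_list (map (\<lambda>a. yP K a (\<sigma> a)) as)"
  have q: "degree q \<le> ?m"
    unfolding q_def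
  proof (induction as)
    case (Cons a as)
    then show ?case using degree_mult_le[of "yP K a (\<sigma> a)" "prod_list (map (\<lambda>a. yP K a (\<sigma> a)) as)"] degree_yP[of K a "\<sigma> a"] by simp
  qed simp
  obtain P where P: "P \<in> TS S ?E ?m" and Pe: "\<And>g f w. (\<forall>s\<in>S. fps_deriv (g s) = - (g s * g s)) \<Longrightarrow>
    foldr (\<lambda>a h. Xf K S g e a (\<sigma> a) h) as f w = pd q (f w) + P g f w"
    using Cons unfolding q_def by auto
  obtain P' where P': "P' \<in> TS S ?E (Suc ?m)" and Pe': "\<And>g f w. (\<forall>s\<in>S. fps_deriv (g s) = - (g s * g s)) \<Longrightarrow>
    fps_deriv (P g f w) = P' g f w" using TS_deriv[OF P lin] by blast
  have aN: "a < N" "\<sigma> a < N" using Cons.prems permutes_in_image[OF \<sigma>, of a] by auto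
  have eE: "e s (\<sigma> a) a \<in> ?E" if "s \<in> S" for s using that aN by (auto simp: gens_def)
  let ?R = "\<lambda>g f w. ((fps_const (if a = \<sigma> a then 1 else 0) * P' g f w + fps_const (- K a (\<sigma> a)) * P g f w)
     + (\<Sum>s\<in>S. fps_const (- 1) * (g s * cl (e s (\<sigma> a) a) (P g f) w)))
     + (\<Sum>s\<in>S. \<Sum>k<Suc ?m. fps_const (- coeff q k) * (prod_list (map g [s]) * cl (\<lambda>x. e s (\<sigma> a) a x) (\<lambda>w. (fps_deriv ^^ k) (f w)) w))"
  show ?case
  proof (rule bexI[of _ ?R], intro allI impI)
    fix g f w assume g: "\<forall>s\<in>S. fps_deriv (g s) = - (g s * g s :: complex fps)"
    let ?h = "foldr (\<lambda>a h. Xf K S g e a (\<sigma> a) h) as f"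
    have h: "?h = (\<lambda>w. pd q (f w) + P g f w)" using Pe[OF g] by auto
    have c: "cl (e s (\<sigma> a) a) ?h w = (\<Sum>k<Suc ?m. fps_const (coeff q k) * cl (e s (\<sigma> a) a) (\<lambda>w. (fps_deriv ^^ k) (f w)) w)
        + cl (e s (\<sigma> a) a) (P g f) w" if "s \<in> S" for s
      unfolding h pd_altdef[OF q] using lin[OF eE[OF that]] by (simp only: cl_add cl_sum cl_mult)
    have "Xf K S g e a (\<sigma> a) ?h w = (if a = \<sigma> a then fps_deriv (?h w) else 0) - fps_const (K a (\<sigma> a)) * ?h w
       - (\<Sum>s\<in>S. g s * cl (e s (\<sigma> a) a) ?h w)" by (subst Xf_def) (rule refl)
    also have "(if a = \<sigma> a then fps_deriv (?h w) else 0) - fps_const (K a (\<sigma> a)) * ?h w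
       = pd (yP K a (\<sigma> a) * q) (f w) + fps_const (if a = \<sigma> a then 1 else 0) * P' g f w - fps_const (K a (\<sigma> a)) * P g f w"
      unfolding h pd_mult pd_yP by (simp add: Pe'[OF g] algebra_simps)
    also have "(\<Sum>s\<in>S. g s * cl (e s (\<sigma> a) a) ?h w) = (\<Sum>s\<in>S. g s * cl (e s (\<sigma> a) a) (P g f) w)
       + (\<Sum>s\<in>S. \<Sum>k<Suc ?m. fps_const (coeff q k) * (g s * cl (e s (\<sigma> a) a) (\<lambda>w. (fps_deriv ^^ k) (f w)) w))"
      by (simp add: c distrib_left sum.distrib sum_distrib_left mult.left_commute add.commute del: sum.lessThan_Suc cong: sum.cong)
    finally show "foldr (\<lambda>a h. Xf K S g e a (\<sigma> a) h) (a # as) f w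
       = pd (prod_list (map (\<lambda>a. yP K a (\<sigma> a)) (a # as))) (f w) + ?R g f w"
      by (simp add: q_def sum_negf del: sum.lessThan_Suc flip: fps_const_neg)
  next
    have "?R \<in> TS S ?E (Suc ?m)"
    proof (rule TS.TS_add[OF TS.TS_add[OF TS.TS_add]])
      have Pm: "P \<in> TS S ?E (Suc ?m)" by (rule TS_mono[OF P]) simp
      show "(\<lambda>g f w. fps_const (if a = \<sigma> a then 1 else 0) * P' g f w) \<in> TS S ?E (Suc ?m)"
        by (rule TS_scale[OF P'])
      show "(\<lambda>g f w. fps_const (- K a (\<sigma> a)) * P g f w) \<in> TS S ?E (Suc ?m)"
        by (rule TS_scale[OF Pm])
      show "(\<lambda>g f w. \<Sum>s\<in>S. fps_const (- 1) * (g s * cl (e s (\<sigma> a) a) (P g f) w)) \<in> TS S ?E (Suc ?m)"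
        by (rule TS_sum[OF fin], rule TS_scale, rule TS_comp[OF Pm lin eE])
      show "(\<lambda>g f w. \<Sum>s\<in>S. \<Sum>k<Suc ?m. fps_const (- coeff q k) *
          (prod_list (map g [s]) * cl (\<lambda>x. e s (\<sigma> a) a x) (\<lambda>w. (fps_deriv ^^ k) (f w)) w)) \<in> TS S ?E (Suc ?m)"
        by (rule TS_sum[OF fin], rule TS_sum, simp, rule TS_base_scale)
          (use alg_comp[OF eE alg_id] in auto)
    qed
    then show "?R \<in> TS S ?E (length (a # as))" by simp
  qed
qed

lemma Df_expand:
  fixes e :: "'s \<Rightarrow> nat \<Rightarrow> nat \<Rightarrow> ('w \<Rightarrow> complex) \<Rightarrow> 'w \<Rightarrow> complex"
  assumes fin: "finite S" and lin: "\<And>T. T \<in> gens N S e \<Longrightarrow> lin T"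
  shows "\<exists>P\<in>TS S (gens N S e) N. \<forall>g f w. (\<forall>s\<in>S. fps_deriv (g s) = - (g s * g s)) \<longrightarrow>
    Df N K S g e f w = pd (chiP N K) (f w) + P g f w"
proof -
  have sub: "set [0..<N] \<subseteq> {..<N}" by auto
  have "\<forall>\<sigma>\<in>{\<sigma>. \<sigma> permutes {..<N}}. \<exists>P\<in>TS S (gens N S e) N. \<forall>g f w. (\<forall>s\<in>S. fps_deriv (g s) = - (g s * g s)) \<longrightarrow>
    foldr (\<lambda>a h. Xf K S g e a (\<sigma> a) h) [0..<N] f w = pd (prod_list (map (\<lambda>a. yP K a (\<sigma> a)) [0..<N])) (f w) + P g f w"
  proof
    fix \<sigma> assume "\<sigma> \<in> {\<sigma>. \<sigma> permutes {..<N}}"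
    then have "\<sigma> permutes {..<N}" by simp
    from Xf_product_expand[where N = N and e = e and as = "[0..<N]" and K = K, OF fin lin this sub]
    show "\<exists>P\<in>TS S (gens N S e) N. \<forall>g f w. (\<forall>s\<in>S. fps_deriv (g s) = - (g s * g s)) \<longrightarrow>
      foldr (\<lambda>a h. Xf K S g e a (\<sigma> a) h) [0..<N] f w = pd (prod_list (map (\<lambda>a. yP K a (\<sigma> a)) [0..<N])) (f w) + P g f w"
      by (simp only: length_upt diff_zero)
  qed
  from bchoice[OF this[unfolded Bex_def]]
  obtain P where P: "\<And>\<sigma>. \<sigma> permutes {..<N} \<Longrightarrow> P \<sigma> \<in> TS S (gens N S e) N"
    "\<And>\<sigma> g f w. \<sigma> permutes {..<N} \<Longrightarrow> (\<forall>s\<in>S. fps_deriv (g s) = - (g s * g s)) \<Longrightarrow>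
      foldr (\<lambda>a h. Xf K S g e a (\<sigma> a) h) [0..<N] f w = pd (prod_list (map (\<lambda>a. yP K a (\<sigma> a)) [0..<N])) (f w) + P \<sigma> g f w"
    by blast
  have prod: "(\<Prod>a<N. yP K a (\<sigma> a)) = prod_list (map (\<lambda>b. yP K b (\<sigma> b)) [0..<N])" for \<sigma>
    using prod.distinct_set_conv_list[of "[0..<N]" "\<lambda>b. yP K b (\<sigma> b)"] by (simp add: atLeast0LessThan)
  show ?thesis
  proof (rule bexI[of _ "\<lambda>g f w. \<Sum>\<sigma>|\<sigma> permutes {..<N}. fps_const (of_int (sign \<sigma>)) * P \<sigma> g f w"], intro allI impI)
    fix g f w assume g: "\<forall>s\<in>S. fps_deriv (g s) = - (g s * g s :: complex fps)"
    show "Df N K S g e f w = pd (chiP N K) (f w) + (\<Sum>\<sigma>|\<sigma> permutes {..<N}. fps_const (of_int (sign \<sigma>)) * P \<sigma> g f w)"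
      using g by (simp add: Df_def P(2) chiP_def pd_sum pd_of_int prod distrib_left sum.distrib fps_of_int)
  next
    show "(\<lambda>g f w. \<Sum>\<sigma>|\<sigma> permutes {..<N}. fps_const (of_int (sign \<sigma>)) * P \<sigma> g f w) \<in> TS S (gens N S e) N"
      by (rule TS_sum, simp add: finite_permutations, rule TS_scale, rule P(1), simp)
  qed
qed

lemma chiP_char_poly: "chiP N K = char_poly (mat N N (\<lambda>(i, j). K i j))"
proof -
  have "char_poly (mat N N (\<lambda>(i, j). K i j)) =
     (\<Sum>\<sigma>|\<sigma> permutes {..<N}. of_int (sign \<sigma>) * (\<Prod>a<N. yP K a (\<sigma> a)))"
    unfolding char_poly_def det_def' [OF char_poly_matrix_closed[OF mat_carrier]]
  proof (simp add: atLeast0LessThan, intro sum.cong refl arg_cong2[where f = times] prod.cong)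
    fix \<sigma> a assume "\<sigma> \<in> {\<sigma>. \<sigma> permutes {..<N}}" "a \<in> {..<N}"
    then have "a < N" "\<sigma> a < N" using permutes_in_image[of \<sigma> "{..<N}" a] by auto
    then show "char_poly_matrix (mat N N (\<lambda>(i, j). K i j)) $$ (a, \<sigma> a) = yP K a (\<sigma> a)"
      by (auto simp: char_poly_matrix_def yP_def)
  qed
  then show ?thesis by (simp add: chiP_def)
qed

lemma chiP_monic: "coeff (chiP N K) N = 1" "degree (chiP N K) = N"
  using degree_monic_char_poly[of "mat N N (\<lambda>(i, j). K i j)" N] by (simp_all add: chiP_char_poly)

section \<open>Formal solutions\<close>

definition slice :: "('w \<Rightarrow> complex fps) \<Rightarrow> nat \<Rightarrow> 'w \<Rightarrow> complex" where
  "slice f m = (\<lambda>w. fps_nth (f w) m)"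

definition lsub :: "('w \<Rightarrow> complex) set \<Rightarrow> bool" where
  "lsub Q \<longleftrightarrow> (\<lambda>_. 0) \<in> Q \<and> (\<forall>x\<in>Q. \<forall>y\<in>Q. (\<lambda>w. x w + y w) \<in> Q) \<and> (\<forall>c. \<forall>x\<in>Q. (\<lambda>w. c * x w) \<in> Q)"

text \<open>Sequential continuity for pointwise convergence. A linear map on functions of infinitely
  many words may lack it, so it is a condition on the generators.\<close>

definition pcont :: "(('w \<Rightarrow> complex) \<Rightarrow> 'v \<Rightarrow> complex) \<Rightarrow> bool" where
  "pcont T \<longleftrightarrow> (\<forall>X x. (\<forall>w. (\<lambda>t. X t w) \<longlonglongrightarrow> x w) \<longrightarrow> (\<forall>w. (\<lambda>t::nat. T (X t) w) \<longlonglongrightarrow> T x w))"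

lemma pcontD: "pcont T \<Longrightarrow> (\<And>w. (\<lambda>t. X t w) \<longlonglongrightarrow> x w) \<Longrightarrow> (\<lambda>t::nat. T (X t) w) \<longlonglongrightarrow> T x w"
  by (simp add: pcont_def)

lemma lsub_add: "lsub Q \<Longrightarrow> x \<in> Q \<Longrightarrow> y \<in> Q \<Longrightarrow> (\<lambda>w. x w + y w) \<in> Q"
  and lsub_scale: "lsub Q \<Longrightarrow> x \<in> Q \<Longrightarrow> (\<lambda>w. c * x w) \<in> Q"
  and lsub_0: "lsub Q \<Longrightarrow> (\<lambda>w. 0) \<in> Q"
  by (auto simp: lsub_def)

lemma lsub_sum:
  assumes "lsub Q" "\<And>i. i \<in> A \<Longrightarrow> x i \<in> Q"
  shows "(\<lambda>w. \<Sum>i\<in>A. x i w) \<in> Q"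
  using assms(2)
  by (induction A rule: infinite_finite_induct) (simp_all add: lsub_0[OF assms(1)] lsub_add[OF assms(1)])

text \<open>\<open>dc k i = (i + 1) * ... * (i + k)\<close>, the factor that \<open>k\<close>
  derivatives put on coefficient \<open>i\<close>.\<close>

primrec dc :: "nat \<Rightarrow> nat \<Rightarrow> complex" where
  "dc 0 i = 1"
| "dc (Suc k) i = of_nat (Suc i) * dc k (Suc i)"

lemma dc_nonzero: "dc k i \<noteq> 0"
  by (induction k arbitrary: i) (simp_all del: of_nat_Suc)

lemma nth_deriv_funpow: "fps_nth ((fps_deriv ^^ k) f) i = dc k i * fps_nth f (i + k)"
  by (induction k arbitrary: i) (simp_all add: mult.assoc)

lemma alg_invariant:
  assumes "T \<in> alg E" "lsub Q" "\<And>T x. T \<in> E \<Longrightarrow> x \<in> Q \<Longrightarrow> T x \<in> Q" "x \<in> Q"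
  shows "T x \<in> Q"
  using assms(1) by (induction rule: alg.induct) (simp_all add: assms lsub_scale)

lemma alg_pcont:
  assumes "T \<in> alg E" "\<And>T. T \<in> E \<Longrightarrow> pcont T"
  shows "pcont T"
  using assms(1)
proof (induction rule: alg.induct)
  case (alg_comp T U)
  then show ?case using assms(2)[of T] by (auto simp: pcont_def)
next
  case (alg_scale U c)
  then show ?case unfolding pcont_def by (auto intro!: tendsto_mult tendsto_const)
qed (simp add: pcont_def)

lemma TS_nth_base:
  "fps_nth (p * cl T (\<lambda>w. (fps_deriv ^^ k) (f w)) w) m
    = (\<Sum>i=0..m. fps_nth p i * T (\<lambda>x. dc k (m - i) * fps_nth (f x) (m - i + k)) w)"
  by (simp add: fps_mult_nth cl_nth nth_deriv_funpow)

text \<open>With fewer than \<open>N\<close> derivatives, coefficient \<open>m\<close> of the result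
  sees coefficients of \<open>f\<close> below \<open>m + N\<close> only. The leading derivative of
  order \<open>N\<close> brings in coefficient \<open>m + N\<close>. This is the recursion behind
  existence, uniqueness and continuity of formal solutions.\<close>

lemma TS_causal:
  assumes "P \<in> TS S E N" and f: "\<And>w i. i < m + N \<Longrightarrow> fps_nth (f w) i = fps_nth (f' w) i"
  shows "fps_nth (P g f w) m = fps_nth (P g f' w) m"
  using assms(1)
proof (induction rule: TS.induct)
  case (TS_base js T k)
  have "(\<lambda>x. dc k (m - i) * fps_nth (f x) (m - i + k)) = (\<lambda>x. dc k (m - i) * fps_nth (f' x) (m - i + k))"
    if "i \<in> {0..m}" for i using TS_base that f by simp
  then show ?case unfolding TS_nth_base by (intro sum.cong refl) simp
qed simp_all

lemma TS_slice:
  assumes "P \<in> TS S E N" and Q: "lsub Q" "\<And>T x. T \<in> E \<Longrightarrow> x \<in> Q \<Longrightarrow> T x \<in> Q" and f: "\<And>i. slice f i \<in> Q"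
  shows "slice (P g f) m \<in> Q"
  using assms(1)
proof (induction rule: TS.induct)
  case TS_zero
  then show ?case using Q by (simp add: slice_def lsub_0)
next
  case (TS_add P R)
  then show ?case using lsub_add[OF Q(1)] by (simp add: slice_def)
next
  case (TS_base js T k)
  have "(\<lambda>x. dc k j * fps_nth (f x) (j + k)) \<in> Q" for j
    using lsub_scale[OF Q(1) f] by (simp add: slice_def)
  then have "T (\<lambda>x. dc k j * fps_nth (f x) (j + k)) \<in> Q" for j
    by - (rule alg_invariant[OF TS_base(3) Q(1)], rule Q(2), assumption, assumption, assumption)
  then show ?case unfolding slice_def TS_nth_base
    by (intro lsub_sum[OF Q(1)] lsub_scale[OF Q(1)])
qed

lemma prod_list_tendsto:
  fixes G :: "nat \<Rightarrow> 's \<Rightarrow> complex fps"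
  assumes "\<And>s i. s \<in> set js \<Longrightarrow> (\<lambda>t. fps_nth (G t s) i) \<longlonglongrightarrow> fps_nth (g s) i"
  shows "(\<lambda>t. fps_nth (prod_list (map (G t) js)) i) \<longlonglongrightarrow> fps_nth (prod_list (map g js)) i"
  using assms
proof (induction js arbitrary: i)
  case (Cons j js)
  then show ?case by (auto simp: fps_mult_nth intro!: tendsto_sum tendsto_mult)
qed simp

lemma TS_tendsto:
  assumes "P \<in> TS S E N" and E: "\<And>T. T \<in> E \<Longrightarrow> pcont T"
    and f: "\<And>w i. i < m + N \<Longrightarrow> (\<lambda>t::nat. fps_nth (F t w) i) \<longlonglongrightarrow> fps_nth (f w) i"
    and g: "\<And>s i. s \<in> S \<Longrightarrow> (\<lambda>t. fps_nth (G t s) i) \<longlonglongrightarrow> fps_nth (g s) i"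
  shows "(\<lambda>t. fps_nth (P (G t) (F t) w) m) \<longlonglongrightarrow> fps_nth (P g f w) m"
  using assms(1)
proof (induction rule: TS.induct)
  case (TS_base js T k)
  have T: "pcont T" using alg_pcont[OF TS_base(3) E] by simp
  have "(\<lambda>t. T (\<lambda>x. dc k j * fps_nth (F t x) (j + k)) w) \<longlonglongrightarrow> T (\<lambda>x. dc k j * fps_nth (f x) (j + k)) w"
    if "j \<le> m" for j
    using that TS_base by (intro pcontD[OF T] tendsto_mult tendsto_const f) auto
  note * = this
  show ?case unfolding TS_nth_base
  proof (intro tendsto_sum tendsto_mult)
    fix i
    show "(\<lambda>t. fps_nth (prod_list (map (G t) js)) i) \<longlonglongrightarrow> fps_nth (prod_list (map g js)) i"
      using TS_base g by (intro prod_list_tendsto) auto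
    show "(\<lambda>t. T (\<lambda>x. dc k (m - i) * fps_nth (F t x) (m - i + k)) w) \<longlonglongrightarrow> T (\<lambda>x. dc k (m - i) * fps_nth (f x) (m - i + k)) w"
      by (rule *) simp
  qed
qed (auto intro!: tendsto_add)

text \<open>The remainder after splitting off the leading term \<open>\<partial>\<^sup>N\<close>.\<close>

locale remainder_op =
  fixes N :: nat and K :: "nat \<Rightarrow> nat \<Rightarrow> complex" and S :: "'s set"
    and e :: "'s \<Rightarrow> nat \<Rightarrow> nat \<Rightarrow> ('w \<Rightarrow> complex) \<Rightarrow> 'w \<Rightarrow> complex"
    and R :: "('s \<Rightarrow> complex fps) \<Rightarrow> ('w \<Rightarrow> complex fps) \<Rightarrow> 'w \<Rightarrow> complex fps"
  assumes eq: "(\<And>s. s \<in> S \<Longrightarrow> fps_deriv (g s) = - (g s * g s)) \<Longrightarrow>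
      Df N K S g e f w = (fps_deriv ^^ N) (f w) + R g f w"
    and causal: "(\<And>w i. i < m + N \<Longrightarrow> fps_nth (f w) i = fps_nth (f' w) i) \<Longrightarrow>
      fps_nth (R g f w) m = fps_nth (R g f' w) m"
    and slice_in: "lsub Q \<Longrightarrow> (\<And>T x. T \<in> gens N S e \<Longrightarrow> x \<in> Q \<Longrightarrow> T x \<in> Q) \<Longrightarrow>
      (\<And>i. slice f i \<in> Q) \<Longrightarrow> slice (R g f) m \<in> Q"
    and tendsto: "(\<And>T. T \<in> gens N S e \<Longrightarrow> pcont T) \<Longrightarrow>
      (\<And>w i. i < m + N \<Longrightarrow> (\<lambda>t::nat. fps_nth (F t w) i) \<longlonglongrightarrow> fps_nth (f w) i) \<Longrightarrow>
      (\<And>s i. s \<in> S \<Longrightarrow> (\<lambda>t. fps_nth (G t s) i) \<longlonglongrightarrow> fps_nth (g s) i) \<Longrightarrow>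
      (\<lambda>t. fps_nth (R (G t) (F t) w) m) \<longlonglongrightarrow> fps_nth (R g f w) m"

lemma remainder_op_exists:
  fixes e :: "'s \<Rightarrow> nat \<Rightarrow> nat \<Rightarrow> ('w \<Rightarrow> complex) \<Rightarrow> 'w \<Rightarrow> complex"
  assumes fin: "finite S" and lin: "\<And>T. T \<in> gens N S e \<Longrightarrow> lin T"
  shows "\<exists>R. remainder_op N K S e R"
proof -
  obtain P where P: "P \<in> TS S (gens N S e) N" and Pe: "\<And>g f w. (\<And>s. s \<in> S \<Longrightarrow> fps_deriv (g s) = - (g s * g s)) \<Longrightarrow>
    Df N K S g e f w = pd (chiP N K) (f w) + P g f w"
    using Df_expand[where N = N and e = e and K = K, OF fin lin] by blast
  define C where "C f = (\<Sum>k<N. fps_const (coeff (chiP N K) k) * (fps_deriv ^^ k) f)" for f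
  define R where "R g f w = C (f w) + P g f w" for g f w
  have chi: "pd (chiP N K) h = (fps_deriv ^^ N) h + C h" for h
    using pd_altdef[of "chiP N K" N h] chiP_monic[of N K] by (simp add: C_def)
  have Cn: "fps_nth (C h) m = (\<Sum>k<N. coeff (chiP N K) k * (dc k m * fps_nth h (m + k)))" for h m
    by (simp add: C_def fps_sum_nth nth_deriv_funpow)
  have p1: "Df N K S g e f w = (fps_deriv ^^ N) (f w) + R g f w"
    if "\<And>s. s \<in> S \<Longrightarrow> fps_deriv (g s) = - (g s * g s)" for g f w
    using Pe[OF that] by (simp add: R_def chi)
  have p2: "fps_nth (R g f w) m = fps_nth (R g f' w) m"
    if "\<And>w i. i < m + N \<Longrightarrow> fps_nth (f w) i = fps_nth (f' w) i" for g f f' m w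
    using TS_causal[OF P that] that by (simp add: R_def Cn)
  have p3: "slice (R g f) m \<in> Q"
    if "lsub Q" "\<And>T x. T \<in> gens N S e \<Longrightarrow> x \<in> Q \<Longrightarrow> T x \<in> Q" "\<And>i. slice f i \<in> Q" for Q g f m
  proof -
    have "(\<lambda>w. \<Sum>k<N. coeff (chiP N K) k * (dc k m * slice f (m + k) w)) \<in> Q"
      by (intro lsub_sum lsub_scale that(1,3))
    then have "slice (\<lambda>w. C (f w)) m \<in> Q" by (simp add: slice_def Cn)
    moreover have "slice (P g f) m \<in> Q"
      by (rule TS_slice[OF P that(1)], rule that(2), assumption, assumption, rule that(3))
    ultimately show ?thesis using lsub_add[OF that(1)] by (simp add: slice_def R_def)
  qed
  have p4: "(\<lambda>t. fps_nth (R (G t) (F t) w) m) \<longlonglongrightarrow> fps_nth (R g f w) m"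
    if "\<And>T. T \<in> gens N S e \<Longrightarrow> pcont T"
      "\<And>w i. i < m + N \<Longrightarrow> (\<lambda>t::nat. fps_nth (F t w) i) \<longlonglongrightarrow> fps_nth (f w) i"
      "\<And>s i. s \<in> S \<Longrightarrow> (\<lambda>t. fps_nth (G t s) i) \<longlonglongrightarrow> fps_nth (g s) i"
    for F f G g m w
    using TS_tendsto[OF P that] that(2) unfolding R_def fps_add_nth Cn
    by (intro tendsto_add tendsto_sum tendsto_mult tendsto_const) auto
  have "remainder_op N K S e R"
    by (rule remainder_op.intro) (fact p1, fact p2, fact p3, fact p4)
  then show ?thesis by blast
qed

text \<open>Course-of-values recursion for an \<open>F\<close> that takes a whole sequence: the
  values from \<open>m\<close> on are masked by the default \<open>z\<close>, which makes the
  equation well founded.\<close>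

lemma strong_recursion: "\<exists>y. \<forall>m::nat. y m = F m (\<lambda>i. if i < m then y i else z)"
proof -
  define y where "y = wfrec less_than (\<lambda>h m. F m (\<lambda>i. if i < m then h i else z))"
  have "y m = F m (\<lambda>i. if i < m then y i else z)" for m
  proof -
    have "y m = F m (\<lambda>i. if i < m then cut y less_than m i else z)"
      unfolding y_def by (subst wfrec[OF wf_less_than]) simp
    also have "(\<lambda>i. if i < m then cut y less_than m i else z) = (\<lambda>i. if i < m then y i else z)"
      by (auto simp: cut_def)
    finally show ?thesis .
  qed
  then show ?thesis by blast
qed

text \<open>The subspace \<open>Q\<close> is carried along because a solution in a tensor power will
  have to stay in the submodule that is mapped to the given module.\<close>

lemma Df_solution_exists:
  fixes e :: "'s \<Rightarrow> nat \<Rightarrow> nat \<Rightarrow> ('w \<Rightarrow> complex) \<Rightarrow> 'w \<Rightarrow> complex"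
  assumes fin: "finite S" and lin: "\<And>T. T \<in> gens N S e \<Longrightarrow> lin T"
    and g: "\<And>s. s \<in> S \<Longrightarrow> fps_deriv (g s) = - (g s * g s)"
    and Q: "lsub Q" "\<And>T x. T \<in> gens N S e \<Longrightarrow> x \<in> Q \<Longrightarrow> T x \<in> Q"
    and v: "\<And>k. k < N \<Longrightarrow> v k \<in> Q"
  shows "\<exists>f. Df N K S g e f = (\<lambda>_. 0) \<and> (\<forall>k<N. slice f k = v k) \<and> (\<forall>i. slice f i \<in> Q)"
proof -
  obtain R where R: "remainder_op N K S e R"
    using remainder_op_exists[where N = N and e = e and K = K, OF fin lin] by blast
  note R1 = remainder_op.eq[OF R g]
  \<comment> \<open>From \<open>N\<close> on, coefficient \<open>m\<close> is solved for in the
    equation at coefficient \<open>m - N\<close>. Coefficients not yet known are filled with 0, to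
    which \<open>R\<close> is blind by causality.\<close>
  define F where "F m h = (if m < N then v m else
     (\<lambda>w. - (1 / dc N (m - N)) * slice (R g (\<lambda>w. Abs_fps (\<lambda>i. h i w))) (m - N) w))" for m and h :: "nat \<Rightarrow> 'w \<Rightarrow> complex"
  obtain y where y: "\<And>m. y m = F m (\<lambda>i. if i < m then y i else (\<lambda>_. 0))"
    using strong_recursion[of F "\<lambda>_. 0"] by blast
  define f where "f w = Abs_fps (\<lambda>i. y i w)" for w
  have yQ: "y m \<in> Q" for m
  proof (induction m rule: less_induct)
    case (less m)
    show ?case
    proof (cases "m < N")
      case True
      then show ?thesis using v by (subst y) (simp add: F_def)
    next
      case False
      have "slice (\<lambda>w. Abs_fps (\<lambda>i. (if i < m then y i else (\<lambda>_. 0)) w)) i \<in> Q" for i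
        using less Q lsub_0 by (auto simp: slice_def)
      then have "slice (R g (\<lambda>w. Abs_fps (\<lambda>i. (if i < m then y i else (\<lambda>_. 0)) w))) (m - N) \<in> Q"
        by - (rule remainder_op.slice_in[OF R Q(1)], rule Q(2), assumption, assumption, assumption)
      then have "(\<lambda>w. - (1 / dc N (m - N)) * slice (R g (\<lambda>w. Abs_fps (\<lambda>i. (if i < m then y i else (\<lambda>_. 0)) w))) (m - N) w) \<in> Q"
        by (rule lsub_scale[OF Q(1)])
      then show ?thesis using False by (subst y) (simp add: F_def)
    qed
  qed
  have "Df N K S g e f w = 0" for w
  proof (rule fps_ext)
    fix m
    have "fps_nth (R g (\<lambda>w. Abs_fps (\<lambda>i. (if i < m + N then y i else (\<lambda>_. 0)) w)) w) m = fps_nth (R g f w) m"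
      by (rule remainder_op.causal[OF R]) (simp add: f_def)
    moreover have "y (m + N) w = - (1 / dc N m) * fps_nth (R g (\<lambda>w. Abs_fps (\<lambda>i. (if i < m + N then y i else (\<lambda>_. 0)) w)) w) m"
      by (subst y) (simp add: F_def slice_def)
    ultimately have "dc N m * y (m + N) w = - fps_nth (R g f w) m"
      using dc_nonzero[of N m] by simp
    then show "fps_nth (Df N K S g e f w) m = fps_nth 0 m"
      by (simp add: R1 nth_deriv_funpow) (simp add: f_def)
  qed
  moreover have "slice f k = y k" for k by (auto simp: slice_def f_def)
  moreover have "y k = v k" if "k < N" for k using that by (subst y) (simp add: F_def)
  ultimately show ?thesis using yQ by (intro exI[of _ f]) auto
qed

lemma Df_solution_coeff:
  assumes "(fps_deriv ^^ N) h + r = 0"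
  shows "fps_nth h (m + N) = - (1 / dc N m) * fps_nth r m"
proof -
  have "dc N m * fps_nth h (m + N) + fps_nth r m = 0"
    using arg_cong[OF assms, of "\<lambda>x. fps_nth x m"] by (simp add: nth_deriv_funpow)
  then show ?thesis using dc_nonzero[of N m] by (simp add: field_simps eq_neg_iff_add_eq_0)
qed

lemma Df_solution_unique:
  fixes e :: "'s \<Rightarrow> nat \<Rightarrow> nat \<Rightarrow> ('w \<Rightarrow> complex) \<Rightarrow> 'w \<Rightarrow> complex"
  assumes fin: "finite S" and lin: "\<And>T. T \<in> gens N S e \<Longrightarrow> lin T"
    and g: "\<And>s. s \<in> S \<Longrightarrow> fps_deriv (g s) = - (g s * g s)"
    and f: "Df N K S g e f = (\<lambda>_. 0)" and f': "Df N K S g e f' = (\<lambda>_. 0)"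
    and init: "\<And>k. k < N \<Longrightarrow> slice f k = slice f' k"
  shows "f = f'"
proof -
  obtain R where R: "remainder_op N K S e R"
    using remainder_op_exists[where N = N and e = e and K = K, OF fin lin] by blast
  note R1 = remainder_op.eq[OF R g]
  have "slice f k = slice f' k" for k
  proof (induction k rule: less_induct)
    case (less k)
    show ?case
    proof (cases "k < N")
      case False
      define m where "m = k - N"
      have k: "k = m + N" using False by (simp add: m_def)
      have "fps_nth (R g f w) m = fps_nth (R g f' w) m" for w
        using less k by (intro remainder_op.causal[OF R]) (auto simp: slice_def fun_eq_iff)
      moreover have "(fps_deriv ^^ N) (f w) + R g f w = 0" "(fps_deriv ^^ N) (f' w) + R g f' w = 0" for w
        using fun_cong[OF f, of w] fun_cong[OF f', of w] by (simp_all only: R1)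
      ultimately have "fps_nth (f w) (m + N) = fps_nth (f' w) (m + N)" for w
        using Df_solution_coeff by metis
      then show ?thesis by (simp add: slice_def k)
    qed (use init in auto)
  qed
  then show ?thesis by (auto simp: slice_def fun_eq_iff intro!: fps_ext)
qed

text \<open>The recursion divides by \<open>dc N m\<close> only. So the coefficients depend
  continuously on the poles, even where poles of the limit coincide.\<close>

lemma Df_solution_tendsto:
  fixes e :: "'s \<Rightarrow> nat \<Rightarrow> nat \<Rightarrow> ('w \<Rightarrow> complex) \<Rightarrow> 'w \<Rightarrow> complex"
  assumes fin: "finite S" and lin: "\<And>T. T \<in> gens N S e \<Longrightarrow> lin T" and pc: "\<And>T. T \<in> gens N S e \<Longrightarrow> pcont T"
    and g: "\<And>s. s \<in> S \<Longrightarrow> fps_deriv (g s) = - (g s * g s)"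
    and G: "\<And>t s. s \<in> S \<Longrightarrow> fps_deriv (G t s) = - (G t s * G t s)"
    and lim: "\<And>s i. s \<in> S \<Longrightarrow> (\<lambda>t::nat. fps_nth (G t s) i) \<longlonglongrightarrow> fps_nth (g s) i"
    and f: "Df N K S g e f = (\<lambda>_. 0)" and F: "\<And>t. Df N K S (G t) e (F t) = (\<lambda>_. 0)"
    and init: "\<And>t k. k < N \<Longrightarrow> slice (F t) k = slice f k"
  shows "(\<lambda>t. fps_nth (F t w) k) \<longlonglongrightarrow> fps_nth (f w) k"
proof -
  obtain R where R: "remainder_op N K S e R"
    using remainder_op_exists[where N = N and e = e and K = K, OF fin lin] by blast
  show ?thesis
  proof (induction k arbitrary: w rule: less_induct)
    case (less k)
    show ?case
    proof (cases "k < N")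
      case True
      then have "fps_nth (F t w) k = fps_nth (f w) k" for t
        using init[of k t] by (auto simp: slice_def fun_eq_iff)
      then show ?thesis by simp
    next
      case False
      define m where "m = k - N"
      have k: "k = m + N" using False by (simp add: m_def)
      have "(\<lambda>t. fps_nth (R (G t) (F t) w) m) \<longlonglongrightarrow> fps_nth (R g f w) m"
        using less k lim by (intro remainder_op.tendsto[OF R] pc) auto
      then have "(\<lambda>t. - (1 / dc N m) * fps_nth (R (G t) (F t) w) m) \<longlonglongrightarrow> - (1 / dc N m) * fps_nth (R g f w) m"
        by (intro tendsto_mult tendsto_const)
      moreover have 1: "(fps_deriv ^^ N) (f w) + R g f w = 0"
        using fun_cong[OF f, of w] by (simp only: remainder_op.eq[OF R g])
      moreover have 2: "(fps_deriv ^^ N) (F t w) + R (G t) (F t) w = 0" for t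
        using fun_cong[OF F, of t w] by (simp only: remainder_op.eq[OF R G])
      ultimately show ?thesis by (simp only: k Df_solution_coeff[OF 1] Df_solution_coeff[OF 2])
    qed
  qed
qed

section \<open>Quasi-exponentials as formal power series\<close>

definition ep :: "complex \<Rightarrow> complex poly \<Rightarrow> complex fps" where
  "ep \<mu> q = fps_exp \<mu> * fps_of_poly q"

text \<open>Degree below \<open>m\<close>; unlike a condition on \<open>degree\<close>, it includes
  the zero polynomial at \<open>m = 0\<close>.\<close>

definition bd :: "nat \<Rightarrow> complex poly \<Rightarrow> bool" where
  "bd m q \<longleftrightarrow> (\<forall>k\<ge>m. coeff q k = 0)"

definition dop :: "complex \<Rightarrow> complex poly \<Rightarrow> complex poly" where
  "dop a q = pderiv q + smult a q"

lemma ep_0 [simp]: "ep \<mu> 0 = 0" by (simp add: ep_def)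
lemma ep_add: "ep \<mu> (p + q) = ep \<mu> p + ep \<mu> q" by (simp add: ep_def fps_of_poly_add algebra_simps)
lemma ep_smult: "ep \<mu> (smult c p) = fps_const c * ep \<mu> p"
  by (simp add: ep_def fps_of_poly_smult mult_ac)
lemma ep_uminus: "ep \<mu> (- p) = - ep \<mu> p" by (simp add: ep_def fps_of_poly_uminus)
lemma ep_eq_0: "ep \<mu> q = 0 \<longleftrightarrow> q = 0"
  using fps_of_poly_eq_iff[of q 0] by (simp add: ep_def)
lemma ep_mult: "fps_of_poly r * ep \<mu> q = ep \<mu> (r * q)"
  by (simp add: ep_def fps_of_poly_mult mult_ac)

lemma ep_deriv: "fps_deriv (ep \<mu> q) = ep \<mu> (dop \<mu> q)"
  by (simp add: ep_def dop_def fps_of_poly_add fps_of_poly_smult fps_of_poly_pderiv algebra_simps)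

lemma ep_deriv_funpow: "(fps_deriv ^^ k) (ep \<mu> q) = ep \<mu> ((dop \<mu> ^^ k) q)"
  by (induction k) (simp_all add: ep_deriv)

lemma pd_linear_ep: "pd [:- a, 1:] (ep \<mu> q) = ep \<mu> (dop (\<mu> - a) q)"
proof -
  have "dop \<mu> q + smult (- a) q = dop (\<mu> - a) q"
    by (simp add: dop_def smult_diff_left)
  moreover have "pd [:- a, 1:] (ep \<mu> q) = ep \<mu> (dop \<mu> q) + ep \<mu> (smult (- a) q)"
    by (simp add: pd_pCons ep_deriv ep_smult ep_uminus)
  ultimately show ?thesis by (metis ep_add)
qed

lemma pd_linear_funpow_ep: "pd ([:- a, 1:] ^ n) (ep \<mu> q) = ep \<mu> ((dop (\<mu> - a) ^^ n) q)"
proof (induction n)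
  case (Suc n)
  show ?case by (simp only: power_Suc pd_mult Suc pd_linear_ep funpow.simps comp_def)
qed simp

lemma bd_mono: "bd m q \<Longrightarrow> m \<le> n \<Longrightarrow> bd n q" by (auto simp: bd_def)
lemma bd_add: "bd m p \<Longrightarrow> bd m q \<Longrightarrow> bd m (p + q)" by (simp add: bd_def)
lemma bd_0_iff: "bd 0 q \<longleftrightarrow> q = 0" by (auto simp: bd_def poly_eq_iff)
lemma bd_zero: "bd m 0" by (simp add: bd_def)
lemma bd_exists: "\<exists>m. bd m q" unfolding bd_def by (metis coeff_eq_0 Suc_le_lessD)

lemma bd_dop: "bd m q \<Longrightarrow> bd m (dop a q)"
  by (simp add: bd_def dop_def coeff_pderiv)

lemma bd_dop_funpow: "bd m q \<Longrightarrow> bd m ((dop a ^^ k) q)"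
  by (induction k) (simp_all add: bd_dop)

lemma bd_pderiv: "bd (Suc m) q \<Longrightarrow> bd m (pderiv q)"
  by (simp add: bd_def coeff_pderiv)

lemma dop_0: "dop 0 = pderiv" by (auto simp: dop_def)

lemma pderiv_funpow_bd: "bd m q \<Longrightarrow> m \<le> n \<Longrightarrow> (pderiv ^^ n) q = 0"
proof (induction n arbitrary: m q)
  case 0
  then show ?case by (simp add: bd_0_iff)
next
  case (Suc n)
  then have "bd n (pderiv q)" using bd_mono[of m q "Suc n"] bd_pderiv by blast
  then show ?case using Suc.IH[of n "pderiv q"] by (simp add: funpow_swap1)
qed

lemma dop_inj: "a \<noteq> 0 \<Longrightarrow> dop a q = 0 \<Longrightarrow> q = 0"
proof (rule ccontr)
  assume a: "a \<noteq> 0" "dop a q = 0" "q \<noteq> 0"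
  have "coeff (dop a q) (degree q) = a * coeff q (degree q)"
    by (simp add: dop_def coeff_pderiv coeff_eq_0)
  then show False using a by simp
qed

lemma dop_funpow_inj: "a \<noteq> 0 \<Longrightarrow> (dop a ^^ n) q = 0 \<Longrightarrow> q = 0"
  by (induction n) (auto dest: dop_inj)

text \<open>For \<open>a = 0\<close> integrate, which raises the degree by one. For
  \<open>a \<noteq> 0\<close> cancel the leading coefficient and descend, which does not. The bound
  \<open>Suc m\<close> covers both cases.\<close>

lemma dop_solve: "bd m q \<Longrightarrow> \<exists>r. dop a r = q \<and> bd (Suc m) r"
proof (cases "a = 0")
  case True
  assume m: "bd m q"
  define r where "r = (\<Sum>k<m. monom (coeff q k / of_nat (Suc k)) (Suc k))"
  have co: "coeff r j = (\<Sum>k<m. if Suc k = j then coeff q k / of_nat (Suc k) else 0)" for j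
    by (simp add: r_def coeff_sum del: of_nat_Suc)
  have "pderiv r = q"
  proof (rule poly_eqI)
    fix n
    have "coeff (pderiv r) n = of_nat (Suc n) * (if n < m then coeff q n / of_nat (Suc n) else 0)"
      by (simp add: coeff_pderiv co del: of_nat_Suc)
    also have "\<dots> = coeff q n" using m by (simp add: bd_def del: of_nat_Suc)
    finally show "coeff (pderiv r) n = coeff q n" .
  qed
  moreover have "bd (Suc m) r" unfolding bd_def co by (auto intro!: sum.neutral)
  ultimately show ?thesis using True by (auto simp: dop_0)
next
  case a: False
  assume "bd m q"
  then have "\<exists>r. dop a r = q \<and> bd m r"
  proof (induction m arbitrary: q)
    case 0
    then show ?case by (intro exI[of _ 0]) (simp add: bd_0_iff dop_def)
  next
    case (Suc m)
    define r0 where "r0 = monom (coeff q m / a) m"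
    have b: "bd (Suc m) r0" by (simp add: bd_def r0_def)
    have "bd m (q - dop a r0)"
      unfolding bd_def
    proof (intro allI impI)
      fix k assume "k \<ge> m"
      then consider "k = m" | "k \<ge> Suc m" by linarith
      then show "coeff (q - dop a r0) k = 0"
      proof cases
        case 1
        then show ?thesis using a by (simp add: dop_def r0_def coeff_pderiv)
      next
        case 2
        then show ?thesis using Suc.prems bd_dop[OF b, of a] by (simp add: bd_def)
      qed
    qed
    then obtain r1 where r1: "dop a r1 = q - dop a r0" "bd m r1" using Suc.IH by blast
    have "dop a (r0 + r1) = q" using r1(1) by (simp add: dop_def pderiv_add smult_add_right algebra_simps)
    moreover have "bd (Suc m) (r0 + r1)" using b bd_mono[OF r1(2), of "Suc m"] by (simp add: bd_add)
    ultimately show ?case by blast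
  qed
  then show ?thesis using bd_mono[of m _ "Suc m"] by auto
qed

text \<open>Split off a root \<open>a\<close> of \<open>p\<close>. By induction
  \<open>(\<partial> - a) h\<close> is a quasi-exponential, \<open>dop_solve\<close> provides a
  quasi-exponential \<open>G\<close> with the same image, and \<open>h - G\<close> is a multiple of
  \<open>exp (a x)\<close>. Each root raises the degree bound by at most one.\<close>

lemma ode_quasi_exponential:
  assumes "p \<noteq> 0" "pd p h = 0"
  shows "\<exists>q. h = (\<Sum>\<mu>\<in>{\<mu>. poly p \<mu> = 0}. ep \<mu> (q \<mu>)) \<and> (\<forall>\<mu>. bd (degree p) (q \<mu>))"
  using assms
proof (induction "degree p" arbitrary: p h)
  case 0
  then obtain c where c: "p = [:c:]" "c \<noteq> 0" by (metis degree_eq_zeroE pCons_0_0)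
  then have "h = 0" using 0 by (simp add: pd_pCons)
  then show ?case using c by (intro exI[of _ "\<lambda>_. 0"]) (simp add: bd_zero)
next
  case (Suc n)
  then have "\<not> constant (poly p)" by (simp add: constant_degree)
  then obtain a where a: "poly p a = 0" using Fundamental_Theorem_Algebra.fundamental_theorem_of_algebra by blast
  then obtain p' where p': "p = [:- a, 1:] * p'" by (auto simp: poly_eq_0_iff_dvd elim: dvdE)
  have p'0: "p' \<noteq> 0" using p' Suc.prems by auto
  have deg: "degree p' = n" using Suc.hyps(2) p' p'0 degree_mult_eq[of "[:- a, 1:]" p'] by simp
  have "pd p' (pd [:- a, 1:] h) = 0" using Suc.prems(2) unfolding p' by (simp only: pd_mult pd_mult_commute[of p'])
  from Suc.hyps(1)[OF deg[symmetric] p'0 this] obtain q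
    where "pd [:- a, 1:] h = (\<Sum>\<mu>\<in>{\<mu>. poly p' \<mu> = 0}. ep \<mu> (q \<mu>)) \<and> (\<forall>\<mu>. bd (degree p') (q \<mu>))" ..
  then have q: "pd [:- a, 1:] h = (\<Sum>\<mu>\<in>{\<mu>. poly p' \<mu> = 0}. ep \<mu> (q \<mu>))" "\<And>\<mu>. bd n (q \<mu>)"
    unfolding deg by simp_all
  have "\<exists>r. dop (\<mu> - a) r = q \<mu> \<and> bd (Suc n) r" for \<mu> using dop_solve[OF q(2)] by simp
  from choice[OF allI, OF this] obtain r where "\<forall>\<mu>. dop (\<mu> - a) (r \<mu>) = q \<mu> \<and> bd (Suc n) (r \<mu>)" ..
  then have r: "\<And>\<mu>. dop (\<mu> - a) (r \<mu>) = q \<mu>" "\<And>\<mu>. bd (Suc n) (r \<mu>)" by simp_all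
  define G where "G = (\<Sum>\<mu>\<in>{\<mu>. poly p' \<mu> = 0}. ep \<mu> (r \<mu>))"
  have G: "pd [:- a, 1:] G = (\<Sum>\<mu>\<in>{\<mu>. poly p' \<mu> = 0}. ep \<mu> (q \<mu>))"
    unfolding G_def pd_sum_right pd_linear_ep r(1) ..
  have neg: "fps_const (- b) * X = - (fps_const b * X)" for b :: complex and X
    by (rule fps_ext) simp
  define k where "k = h + fps_const (- 1) * G"
  have k: "h = G + k" unfolding k_def neg by simp
  have "- (fps_const a * k) + fps_deriv k = pd [:- a, 1:] k"
    unfolding pd_pCons pd_0 neg by simp
  also have "pd [:- a, 1:] k = 0"
    unfolding k_def pd_add_right pd_const_mult q(1) G unfolding neg by simp
  finally have "- (fps_const a * k) + fps_deriv k = 0" .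
  then have "fps_deriv k = fps_const a * k" unfolding add_eq_0_iff minus_minus .
  then have kc: "k = fps_const (fps_nth k 0) * fps_exp a" by (rule fps_exp_unique_ODE[THEN iffD1])
  define c where "c = fps_nth k 0"
  have e: "ep a [:c:] = fps_const c * fps_exp a"
    unfolding ep_def fps_of_poly_const by (rule mult.commute)
  have ke: "k = ep a [:c:]" unfolding e unfolding c_def by (rule kc)
  have h: "h = G + ep a [:c:]" unfolding ke[symmetric] by (rule k)
  define q' where "q' \<mu> = (if poly p' \<mu> = 0 then r \<mu> else 0) + (if \<mu> = a then [:c:] else 0)" for \<mu>
  have fin: "finite {\<mu>. poly p \<mu> = 0}" using Suc.prems by (simp add: poly_roots_finite)
  have roots: "{\<mu>. poly p \<mu> = 0} = insert a {\<mu>. poly p' \<mu> = 0}" by (auto simp: p')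
  have "(\<Sum>\<mu>\<in>{\<mu>. poly p \<mu> = 0}. ep \<mu> (q' \<mu>))
     = (\<Sum>\<mu>\<in>{\<mu>. poly p \<mu> = 0}. if poly p' \<mu> = 0 then ep \<mu> (r \<mu>) else 0) + (\<Sum>\<mu>\<in>{\<mu>. poly p \<mu> = 0}. if \<mu> = a then ep a [:c:] else 0)"
    unfolding sum.distrib[symmetric] by (intro sum.cong refl) (auto simp: q'_def ep_add)
  also have "\<dots> = G + ep a [:c:]"
  proof -
    have "(\<Sum>\<mu>\<in>{\<mu>. poly p \<mu> = 0}. if poly p' \<mu> = 0 then ep \<mu> (r \<mu>) else 0) = G"
      unfolding G_def using fin roots by (intro sum.mono_neutral_cong_right) auto
    then show ?thesis using fin a by simp
  qed
  finally have "h = (\<Sum>\<mu>\<in>{\<mu>. poly p \<mu> = 0}. ep \<mu> (q' \<mu>))" by (simp add: h)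
  moreover have "bd (degree p) (q' \<mu>)" for \<mu>
    unfolding q'_def Suc.hyps(2)[symmetric] using r(2)[of \<mu>] by (intro bd_add) (auto simp: bd_def coeff_pCons split: nat.splits)
  ultimately show ?case by (intro exI[of _ q'] conjI allI)
qed

text \<open>A high power of \<open>\<partial> - a\<close> removes the term with exponent
  \<open>a\<close> and acts injectively on the polynomials of the other terms.\<close>

lemma ep_independent:
  assumes "finite A" "(\<Sum>\<mu>\<in>A. ep \<mu> (q \<mu>)) = 0" "\<mu> \<in> A"
  shows "q \<mu> = 0"
  using assms
proof (induction A arbitrary: q \<mu> rule: finite_induct)
  case (insert a A)
  obtain n where n: "bd n (q a)" using bd_exists by blast
  have "pd ([:- a, 1:] ^ n) (\<Sum>\<mu>\<in>insert a A. ep \<mu> (q \<mu>)) = 0" using insert.prems by simp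
  then have "ep a ((pderiv ^^ n) (q a)) + (\<Sum>\<mu>\<in>A. ep \<mu> ((dop (\<mu> - a) ^^ n) (q \<mu>))) = 0"
    using insert.hyps by (simp add: pd_add_right pd_sum_right pd_linear_funpow_ep dop_0)
  then have "(\<Sum>\<mu>\<in>A. ep \<mu> ((dop (\<mu> - a) ^^ n) (q \<mu>))) = 0"
    using pderiv_funpow_bd[OF n] by simp
  then have "(dop (\<mu> - a) ^^ n) (q \<mu>) = 0" if "\<mu> \<in> A" for \<mu>
    using insert.IH[of "\<lambda>\<mu>. (dop (\<mu> - a) ^^ n) (q \<mu>)" \<mu>] that by simp
  then have A: "q \<mu> = 0" if "\<mu> \<in> A" for \<mu>
    using dop_funpow_inj[of "\<mu> - a" n "q \<mu>"] that insert.hyps by auto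
  then have "ep a (q a) = 0" using insert.prems(1) insert.hyps by simp
  then show ?case using A insert.prems(2) by (auto simp: ep_eq_0)
qed simp

section \<open>The exponents of a quasi-exponential solution\<close>

definition den :: "complex \<Rightarrow> 's set \<Rightarrow> ('s \<Rightarrow> complex) \<Rightarrow> complex poly" where
  "den u0 S z = (\<Prod>s\<in>S. [:u0 - z s, 1:])"

lemma den_monic:
  assumes "finite S"
  shows "degree (den u0 S z) = card S" "coeff (den u0 S z) (card S) = 1"
proof -
  have m: "lead_coeff (den u0 S z) = 1"
    unfolding den_def by (simp add: lead_coeff_prod)
  show d: "degree (den u0 S z) = card S"
    unfolding den_def using assms by (subst degree_prod_eq_sum_degree) auto
  show "coeff (den u0 S z) (card S) = 1" using m d by simp
qed

lemma den_pow_monic: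
  assumes "finite S"
  shows "degree (den u0 S z ^ n) = n * card S" "coeff (den u0 S z ^ n) (n * card S) = 1"
proof -
  have l: "lead_coeff (den u0 S z) = 1" using den_monic[OF assms, of u0 z] by simp
  have d: "degree (den u0 S z ^ n) = n * card S" using l den_monic[OF assms, of u0 z] by (subst degree_power_eq) auto
  show "degree (den u0 S z ^ n) = n * card S" by (fact d)
  have "lead_coeff (den u0 S z ^ n) = 1" using l by (simp add: lead_coeff_power)
  then show "coeff (den u0 S z ^ n) (n * card S) = 1" by (simp add: d)
qed

text \<open>Each pole cancels a linear factor of \<open>den\<close>, so a product of poles lowers
  the degree \<open>n * card S\<close> by its length. Terms with a pole thus cannot reach the top
  degree.\<close>

lemma den_poles:
  assumes "finite S" "\<And>s. s \<in> S \<Longrightarrow> u0 \<noteq> z s" "set js \<subseteq> S" "length js \<le> n"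
  shows "\<exists>d. fps_of_poly (den u0 S z ^ n) * prod_list (map (\<lambda>s. pole u0 (z s)) js) = fps_of_poly d
     \<and> degree d + length js \<le> n * card S"
  using assms(3,4)
proof (induction js arbitrary: n)
  case Nil
  then show ?case using den_pow_monic(1)[OF assms(1), of u0 z n] by (intro exI[of _ "den u0 S z ^ n"]) simp
next
  case (Cons j js)
  then obtain n' where n': "n = Suc n'" by (cases n) auto
  obtain d where d: "fps_of_poly (den u0 S z ^ n') * prod_list (map (\<lambda>s. pole u0 (z s)) js) = fps_of_poly d"
     "degree d + length js \<le> n' * card S" using Cons n' by auto
  have j: "j \<in> S" using Cons.prems by auto
  define r where "r = den u0 (S - {j}) z"
  have den: "den u0 S z = [:u0 - z j, 1:] * r"
    unfolding den_def r_def using assms(1) j by (subst prod.remove[of S j]) auto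
  have "fps_of_poly [:u0 - z j, 1:] * pole u0 (z j) = 1"
    using pole_mult[OF assms(2)[OF j]] by (simp only: fps_of_poly_linear mult.commute)
  then have "fps_of_poly (den u0 S z) * pole u0 (z j) = fps_of_poly r"
    unfolding den fps_of_poly_mult by (metis mult.assoc mult.commute mult_1)
  then have "fps_of_poly (den u0 S z ^ n) * prod_list (map (\<lambda>s. pole u0 (z s)) (j # js)) = fps_of_poly r * fps_of_poly d"
    unfolding d(1)[symmetric] n' by (simp add: fps_of_poly_mult mult_ac)
  moreover have "degree (r * d) + length (j # js) \<le> n * card S"
  proof -
    have "degree r = card (S - {j})" unfolding r_def using assms(1) by (intro den_monic) auto
    moreover have "card S = Suc (card (S - {j}))" using assms(1) j by (rule card.remove)
    ultimately show ?thesis using d(2) degree_mult_le[of r d] by (simp add: n')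
  qed
  ultimately show ?case by (metis fps_of_poly_mult)
qed

lemma cl_ep:
  assumes T: "lin T" and q: "\<And>w. bd m (q w)"
  shows "\<exists>r. (\<forall>w. bd m (r w)) \<and> cl T (\<lambda>w. ep \<mu> (q w)) = (\<lambda>w. ep \<mu> (r w))"
proof -
  define r where "r w = (\<Sum>k<m. monom (T (\<lambda>x. coeff (q x) k) w) k)" for w
  have co: "coeff (r w) k = T (\<lambda>x. coeff (q x) k) w" for w k
  proof (cases "k < m")
    case False
    then have "(\<lambda>x. coeff (q x) k) = (\<lambda>x. 0)" using q by (auto simp: bd_def)
    then show ?thesis using False by (simp add: r_def coeff_sum lin_0[OF T])
  qed (simp add: r_def coeff_sum)
  have "bd m (r w)" for w by (simp add: r_def bd_def coeff_sum)
  moreover have "cl T (\<lambda>w. fps_of_poly (q w)) = (\<lambda>w. fps_of_poly (r w))"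
    by (auto simp: fun_eq_iff cl_nth co intro!: fps_ext)
  ultimately show ?thesis unfolding ep_def cl_mult[OF T] by auto
qed

lemma bd_mult: "bd (Suc m) p \<Longrightarrow> bd n q \<Longrightarrow> bd (m + n) (p * q)"
  unfolding bd_def coeff_mult
proof (intro allI impI sum.neutral ballI)
  fix k i assume p: "\<forall>k\<ge>Suc m. coeff p k = 0" and q: "\<forall>k\<ge>n. coeff q k = 0" and k: "m + n \<le> k" and i: "i \<in> {..k}"
  show "coeff p i * coeff q (k - i) = 0"
  proof (cases "i \<ge> Suc m")
    case False
    then have "k - i \<ge> n" using k by auto
    then show ?thesis using q by simp
  qed (use p in simp)
qed

text \<open>For \<open>q\<close> of degree at most \<open>m\<close> the product of
  \<open>den ^ n\<close> and \<open>q\<close> may reach the degree \<open>n * card S + m\<close>;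
  the remainder stays strictly below it, as \<open>js\<close> is nonempty in every term. The power
  \<open>n\<close> must be at least the number of poles in each term, hence the threshold
  \<open>n0\<close>.\<close>

lemma TS_ep:
  fixes E :: "(('w \<Rightarrow> complex) \<Rightarrow> 'w \<Rightarrow> complex) set"
  assumes "P \<in> TS S E N" and fin: "finite S" and u0: "\<And>s. s \<in> S \<Longrightarrow> u0 \<noteq> z s" and E: "\<And>T. T \<in> E \<Longrightarrow> lin T"
  shows "\<exists>n0. \<forall>n\<ge>n0. \<forall>\<mu> (q :: 'w \<Rightarrow> complex poly) m. (\<forall>w. bd (Suc m) (q w)) \<longrightarrow> (\<exists>h. (\<forall>w. bd (n * card S + m) (h w)) \<and>
    (\<forall>w. fps_of_poly (den u0 S z ^ n) * P (\<lambda>s. pole u0 (z s)) (\<lambda>w. ep \<mu> (q w)) w = ep \<mu> (h w)))"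
  using assms(1)
proof (induction rule: TS.induct)
  case TS_zero
  show ?case by (intro exI[of _ 0] allI impI exI[of _ "\<lambda>_. 0"]) (simp add: bd_zero)
next
  case (TS_add P Q)
  obtain n1 where
    1: "\<And>n \<mu> (q :: 'w \<Rightarrow> complex poly) m. n \<ge> n1 \<Longrightarrow> \<forall>w. bd (Suc m) (q w) \<Longrightarrow> \<exists>h. (\<forall>w. bd (n * card S + m) (h w)) \<and>
    (\<forall>w. fps_of_poly (den u0 S z ^ n) * P (\<lambda>s. pole u0 (z s)) (\<lambda>w. ep \<mu> (q w)) w = ep \<mu> (h w))"
    using TS_add.IH(1) by blast
  obtain n2 where
    2: "\<And>n \<mu> (q :: 'w \<Rightarrow> complex poly) m. n \<ge> n2 \<Longrightarrow> \<forall>w. bd (Suc m) (q w) \<Longrightarrow> \<exists>h. (\<forall>w. bd (n * card S + m) (h w)) \<and>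
    (\<forall>w. fps_of_poly (den u0 S z ^ n) * Q (\<lambda>s. pole u0 (z s)) (\<lambda>w. ep \<mu> (q w)) w = ep \<mu> (h w))"
    using TS_add.IH(2) by blast
  show ?case
  proof (intro exI[of _ "max n1 n2"] allI impI)
    fix n \<mu> and q :: "'w \<Rightarrow> complex poly" and m assume n: "n \<ge> max n1 n2" and q: "\<forall>w. bd (Suc m) (q w)"
    obtain h1 where h1: "\<forall>w. bd (n * card S + m) (h1 w)"
      "\<forall>w. fps_of_poly (den u0 S z ^ n) * P (\<lambda>s. pole u0 (z s)) (\<lambda>w. ep \<mu> (q w)) w = ep \<mu> (h1 w)"
      using 1[of n m q \<mu>] n q by auto
    obtain h2 where h2: "\<forall>w. bd (n * card S + m) (h2 w)"
      "\<forall>w. fps_of_poly (den u0 S z ^ n) * Q (\<lambda>s. pole u0 (z s)) (\<lambda>w. ep \<mu> (q w)) w = ep \<mu> (h2 w)"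
      using 2[of n m q \<mu>] n q by auto
    show "\<exists>h. (\<forall>w. bd (n * card S + m) (h w)) \<and>
      (\<forall>w. fps_of_poly (den u0 S z ^ n) * (P (\<lambda>s. pole u0 (z s)) (\<lambda>w. ep \<mu> (q w)) w + Q (\<lambda>s. pole u0 (z s)) (\<lambda>w. ep \<mu> (q w)) w) = ep \<mu> (h w))"
      using h1 h2 by (intro exI[of _ "\<lambda>w. h1 w + h2 w"]) (simp add: bd_add ep_add distrib_left)
  qed
next
  case (TS_base js T k)
  have T: "lin T" using alg_lin[OF TS_base(3) E] by simp
  show ?case
  proof (intro exI[of _ "length js"] allI impI)
    fix n \<mu> and q :: "'w \<Rightarrow> complex poly" and m assume n: "n \<ge> length js" and q: "\<forall>w. bd (Suc m) (q w)"
    obtain d where d: "fps_of_poly (den u0 S z ^ n) * prod_list (map (\<lambda>s. pole u0 (z s)) js) = fps_of_poly d"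
      "degree d + length js \<le> n * card S" using den_poles[where z = z, OF fin u0 TS_base(2) n] by blast
    have nS: "n * card S > degree d" using d(2) TS_base(1) by (cases js) auto
    then obtain l where l: "n * card S = Suc l" by (cases "n * card S") auto
    have bdd: "bd (n * card S) d" unfolding bd_def using nS by (auto intro: coeff_eq_0)
    have "\<And>w. bd (Suc m) ((dop \<mu> ^^ k) (q w))" using q bd_dop_funpow by blast
    from cl_ep[where q = "\<lambda>w. (dop \<mu> ^^ k) (q w)", OF T this, of \<mu>] obtain r where r: "\<forall>w. bd (Suc m) (r w)"
      "cl T (\<lambda>w. ep \<mu> ((dop \<mu> ^^ k) (q w))) = (\<lambda>w. ep \<mu> (r w))" by (elim exE conjE)
    have "fps_of_poly (den u0 S z ^ n) * (prod_list (map (\<lambda>s. pole u0 (z s)) js) * cl T (\<lambda>w. (fps_deriv ^^ k) (ep \<mu> (q w))) w) = ep \<mu> (d * r w)" for w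
      unfolding ep_deriv_funpow r(2) mult.assoc[symmetric] d(1) by (simp add: ep_mult)
    moreover have "bd (n * card S + m) (d * r w)" for w
      using bd_mult[of l d "Suc m" "r w"] bdd r(1) l by simp
    ultimately show "\<exists>h. (\<forall>w. bd (n * card S + m) (h w)) \<and>
      (\<forall>w. fps_of_poly (den u0 S z ^ n) * (prod_list (map (\<lambda>s. pole u0 (z s)) js) * cl T (\<lambda>w. (fps_deriv ^^ k) (ep \<mu> (q w))) w) = ep \<mu> (h w))"
      by (intro exI[of _ "\<lambda>w. d * r w"]) simp
  qed
qed

lemma TS_additive:
  assumes "P \<in> TS S E N" and E: "\<And>T. T \<in> E \<Longrightarrow> lin T"
  shows "P g (\<lambda>w. \<Sum>\<mu>\<in>A. F \<mu> w) w = (\<Sum>\<mu>\<in>A. P g (F \<mu>) w)"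
  using assms(1)
proof (induction arbitrary: w rule: TS.induct)
  case (TS_base js T k)
  have T: "lin T" using alg_lin[OF TS_base(3) E] by simp
  have "(fps_deriv ^^ k) (\<Sum>\<mu>\<in>A. F \<mu> w) = (\<Sum>\<mu>\<in>A. (fps_deriv ^^ k) (F \<mu> w))" for w
    using pd_sum_right[of "monom 1 k" "\<lambda>\<mu>. F \<mu> w" A] by (simp add: pd_monom)
  then show ?case by (simp add: cl_sum[OF T] sum_distrib_left)
qed (simp_all add: sum.distrib)

text \<open>The polynomial part of \<open>p(\<partial>)\<close> applied to
  \<open>exp (\<mu> x) q\<close>.\<close>

definition spd :: "complex poly \<Rightarrow> complex \<Rightarrow> complex poly \<Rightarrow> complex poly" where
  "spd p \<mu> q = fold_coeffs (\<lambda>c r. smult c q + dop \<mu> r) p 0"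

lemma spd_0: "spd 0 \<mu> q = 0" by (simp add: spd_def)

lemma spd_pCons: "spd (pCons c p) \<mu> q = smult c q + dop \<mu> (spd p \<mu> q)"
proof (cases "c = 0 \<and> p = 0")
  case True
  then show ?thesis by (simp add: spd_def dop_def)
next
  case False
  then show ?thesis by (auto simp: spd_def fold_coeffs_pCons_not_0_0_eq fold_coeffs_pCons_coeff_not_0_eq)
qed

lemma pd_ep: "pd p (ep \<mu> q) = ep \<mu> (spd p \<mu> q)"
  by (induction p) (simp_all add: pd_pCons spd_pCons spd_0 ep_add ep_smult ep_deriv)

text \<open>Differentiating the polynomial lowers its degree, so on the top coefficient \<partial>
  is multiplication by \<mu>.\<close>

lemma spd_top: "bd (Suc m) q \<Longrightarrow> bd (Suc m) (spd p \<mu> q) \<and> coeff (spd p \<mu> q) m = poly p \<mu> * coeff q m"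
proof (induction p)
  case 0
  then show ?case by (simp add: spd_0 bd_zero)
next
  case (pCons c p)
  then have b: "bd (Suc m) (spd p \<mu> q)" and t: "coeff (spd p \<mu> q) m = poly p \<mu> * coeff q m" by auto
  have "coeff (dop \<mu> (spd p \<mu> q)) m = \<mu> * (poly p \<mu> * coeff q m)"
    using b t by (simp add: dop_def coeff_pderiv bd_def)
  moreover have "bd (Suc m) (smult c q + dop \<mu> (spd p \<mu> q))"
    using pCons.prems by (intro bd_add bd_dop b) (simp add: bd_def)
  ultimately show ?case by (simp add: spd_pCons algebra_simps)
qed

text \<open>Clear denominators with \<open>den ^ n\<close> and separate the exponents by
  independence. In the top degree only the pole-free part of the operator contributes, with
  \<open>poly (chiP N K) \<mu>\<close> times the top coefficient of \<open>q\<close>. If that value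
  is not 0, the degree bound drops by one, and finally to 0.\<close>

lemma Df_exponents:
  fixes e :: "'s \<Rightarrow> nat \<Rightarrow> nat \<Rightarrow> ('w \<Rightarrow> complex) \<Rightarrow> 'w \<Rightarrow> complex"
  assumes fin: "finite S" and lin: "\<And>T. T \<in> gens N S e \<Longrightarrow> lin T" and u0: "\<And>s. s \<in> S \<Longrightarrow> u0 \<noteq> z s"
    and A: "finite A" and q: "\<And>w \<mu>. bd m (q w \<mu>)"
    and sol: "Df N K S (\<lambda>s. pole u0 (z s)) e (\<lambda>w. \<Sum>\<mu>\<in>A. ep \<mu> (q w \<mu>)) = (\<lambda>_. 0)"
    and \<mu>: "\<mu> \<in> A" "poly (chiP N K) \<mu> \<noteq> 0"
  shows "q w \<mu> = 0"
proof -
  define g where "g s = pole u0 (z s)" for s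
  have g: "fps_deriv (g s) = - (g s * g s)" if "s \<in> S" for s using that u0 by (simp add: g_def pole_deriv)
  obtain P where P: "P \<in> TS S (gens N S e) N" and Pe: "\<And>f w. Df N K S g e f w = pd (chiP N K) (f w) + P g f w"
    using Df_expand[where N = N and e = e and K = K, OF fin lin] g by blast
  obtain n where n: "\<And>\<mu> (q :: 'w \<Rightarrow> complex poly) m. (\<forall>w. bd (Suc m) (q w)) \<Longrightarrow> (\<exists>h. (\<forall>w. bd (n * card S + m) (h w)) \<and>
    (\<forall>w. fps_of_poly (den u0 S z ^ n) * P g (\<lambda>w. ep \<mu> (q w)) w = ep \<mu> (h w)))"
    using TS_ep[where z = z, OF P fin u0 lin] unfolding g_def by blast
  let ?D = "den u0 S z ^ n"
  have main: "fps_of_poly ?D * Df N K S g e (\<lambda>w. ep \<mu> (q w \<mu>)) w = 0" if "\<mu> \<in> A" for \<mu> w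
  proof -
    have "\<exists>h. \<forall>w. fps_of_poly ?D * P g (\<lambda>w. ep \<mu> (q w \<mu>)) w = ep \<mu> (h w)" for \<mu>
      using n[of m "\<lambda>w. q w \<mu>" \<mu>] q bd_mono[of m _ "Suc m"] by fastforce
    then obtain h where h: "\<And>\<mu> w. fps_of_poly ?D * P g (\<lambda>w. ep \<mu> (q w \<mu>)) w = ep \<mu> (h \<mu> w)" by metis
    have s: "fps_of_poly ?D * Df N K S g e (\<lambda>w. ep \<mu> (q w \<mu>)) w = ep \<mu> (?D * spd (chiP N K) \<mu> (q w \<mu>) + h \<mu> w)" for \<mu> w
      by (simp add: Pe distrib_left h pd_ep ep_mult ep_add)
    have "0 = fps_of_poly ?D * Df N K S g e (\<lambda>w. \<Sum>\<mu>\<in>A. ep \<mu> (q w \<mu>)) w"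
      using fun_cong[OF sol, of w] by (simp add: g_def[abs_def])
    also have "\<dots> = (\<Sum>\<mu>\<in>A. fps_of_poly ?D * Df N K S g e (\<lambda>w. ep \<mu> (q w \<mu>)) w)"
    proof -
      have "P g (\<lambda>w. \<Sum>\<mu>\<in>A. ep \<mu> (q w \<mu>)) w = (\<Sum>\<mu>\<in>A. P g (\<lambda>w. ep \<mu> (q w \<mu>)) w)"
        by (rule TS_additive[OF P lin])
      then show ?thesis
        by (simp only: Pe pd_sum_right sum.distrib[symmetric] sum_distrib_left)
    qed
    finally have "(\<Sum>\<mu>\<in>A. ep \<mu> (?D * spd (chiP N K) \<mu> (q w \<mu>) + h \<mu> w)) = 0" by (simp add: s)
    from ep_independent[OF A this that] show ?thesis by (simp add: s)
  qed
  \<comment> \<open>The degree bound is assumed for all components together, because the remainder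
    mixes them.\<close>
  have top: "coeff (q w \<mu>) k = 0" if b: "\<And>w. bd (Suc k) (q w \<mu>)" for k w
  proof -
    obtain h where h: "\<forall>w. bd (n * card S + k) (h w)"
      "\<forall>w. fps_of_poly ?D * P g (\<lambda>w. ep \<mu> (q w \<mu>)) w = ep \<mu> (h w)"
      using n[of k "\<lambda>w. q w \<mu>" \<mu>] b by blast
    have "ep \<mu> (?D * spd (chiP N K) \<mu> (q w \<mu>) + h w) = 0"
      using main[OF \<mu>(1), of w] by (simp add: Pe distrib_left h(2) pd_ep ep_mult ep_add)
    then have "coeff (?D * spd (chiP N K) \<mu> (q w \<mu>) + h w) (n * card S + k) = 0"
      by (simp only: ep_eq_0 coeff_0)
    moreover have "coeff (h w) (n * card S + k) = 0" using h(1) by (simp add: bd_def)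
    moreover have "coeff (?D * spd (chiP N K) \<mu> (q w \<mu>)) (n * card S + k)
        = coeff ?D (n * card S) * coeff (spd (chiP N K) \<mu> (q w \<mu>)) k"
    proof -
      have "coeff ?D i * coeff (spd (chiP N K) \<mu> (q w \<mu>)) (n * card S + k - i) = 0"
        if "i \<le> n * card S + k" "i \<noteq> n * card S" for i
      proof (cases "i < n * card S")
        case True
        then show ?thesis using spd_top[OF b, of "chiP N K" \<mu> w] by (simp add: bd_def)
      next
        case False
        then have "coeff ?D i = 0" using that den_pow_monic(1)[OF fin, of u0 z n] by (intro coeff_eq_0) auto
        then show ?thesis by simp
      qed
      then have "coeff (?D * spd (chiP N K) \<mu> (q w \<mu>)) (n * card S + k)
        = (\<Sum>i\<in>{n * card S}. coeff ?D i * coeff (spd (chiP N K) \<mu> (q w \<mu>)) (n * card S + k - i))"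
        unfolding coeff_mult by (intro sum.mono_neutral_right) auto
      then show ?thesis by simp
    qed
    ultimately have "poly (chiP N K) \<mu> * coeff (q w \<mu>) k = 0"
      using spd_top[OF b, of "chiP N K" \<mu> w] den_pow_monic(2)[OF fin, of u0 z n] by simp
    then show ?thesis using \<mu>(2) by simp
  qed
  have "\<forall>w. bd k (q w \<mu>)" if "k \<le> m" for k
    using that
  proof (induction rule: inc_induct)
    case (step k)
    then have c: "coeff (q w \<mu>) k = 0" for w by (intro top) blast
    show ?case unfolding bd_def
    proof (intro allI impI)
      fix w j assume "k \<le> j"
      then show "coeff (q w \<mu>) j = 0" using c step.IH by (cases "j = k") (auto simp: bd_def)
    qed
  qed (use q in blast)
  from this[of 0] show ?thesis by (simp add: bd_0_iff)
qed

lemma pd_power_ep: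
  assumes "poly \<chi> \<mu> = 0" "bd m q" "m \<le> n"
  shows "pd (\<chi> ^ n) (ep \<mu> q) = 0"
proof -
  have "[:- \<mu>, 1:] dvd \<chi>" using assms(1) by (simp add: poly_eq_0_iff_dvd)
  then have "[:- \<mu>, 1:] ^ n dvd \<chi> ^ n" by (rule dvd_power_same)
  then obtain r where r: "\<chi> ^ n = [:- \<mu>, 1:] ^ n * r" by (elim dvdE)
  have "pd ([:- \<mu>, 1:] ^ n) (ep \<mu> q) = 0"
    using pderiv_funpow_bd[OF assms(2,3)] by (simp only: pd_linear_funpow_ep diff_self dop_0 ep_0)
  then show ?thesis unfolding r pd_mult pd_mult_commute[of _ r] by simp
qed

section \<open>Word functions with arbitrary poles\<close>

lemma lin_epsV: "lin (epsV N s a b)"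
  by (auto simp: lin_def epsV_def fun_eq_iff)

lemma pcont_epsV: "pcont (epsV N s a b)"
  by (auto simp: pcont_def epsV_def)

text \<open>Makes a solution vanish outside the finite set \<Omega>, so that one finite set of
  exponents and one degree bound serve for all words.\<close>

definition cut_off :: "'w set \<Rightarrow> ('w \<Rightarrow> complex) \<Rightarrow> 'w \<Rightarrow> complex" where
  "cut_off \<Omega> x = (\<lambda>w. if w \<in> \<Omega> then x w else 0)"

lemma lin_cut_off: "lin (cut_off \<Omega>)"
  by (auto simp: lin_def cut_off_def fun_eq_iff)

lemma put_closed_iff:
  assumes "N > 0" "\<And>w s b. w \<in> \<Omega> \<Longrightarrow> s \<in> S \<Longrightarrow> b < N \<Longrightarrow> put N s b w \<in> \<Omega>" "s \<in> S" "b < N"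
  shows "put N s b w \<in> \<Omega> \<longleftrightarrow> w \<in> \<Omega>"
proof
  assume "put N s b w \<in> \<Omega>"
  then have "put N s (letter N s w) (put N s b w) \<in> \<Omega>"
    by (rule assms(2)[OF _ assms(3) letter_less[OF assms(1)]])
  then show "w \<in> \<Omega>" using assms by (simp add: put_put_same put_letter)
qed (rule assms(2)[OF _ assms(3,4)])

text \<open>\<open>vec_solution_words\<close> gives each word an equation of bounded order, but with
  exponents that could vary with the poles. \<open>Df_exponents\<close> confines them to the roots
  of \<open>chiP N K\<close>, and \<open>pd_power_ep\<close> then replaces all these equations by a
  single one that is free of the poles.\<close>

lemma words_quasi_exponential_distinct:
  fixes S :: "'s set" and K :: "nat \<Rightarrow> nat \<Rightarrow> complex" and zz :: "'s \<Rightarrow> complex"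
    and f :: "('s \<Rightarrow> nat) \<Rightarrow> complex fps"
  assumes N: "N > 0" and fin: "finite S" and inj: "inj_on zz S" and u0: "\<And>s. s \<in> S \<Longrightarrow> u0 \<noteq> zz s"
    and sol: "Df N K S (\<lambda>s. pole u0 (zz s)) (\<lambda>s a b. epsV N s a b) f = (\<lambda>_. 0)"
    and \<Omega>: "finite \<Omega>" "\<And>w s b. w \<in> \<Omega> \<Longrightarrow> s \<in> S \<Longrightarrow> b < N \<Longrightarrow> put N s b w \<in> \<Omega>" and w: "w \<in> \<Omega>"
  shows "pd (chiP N K ^ (N + card S * card \<Omega>)) (f w) = 0"
proof -
  \<comment> \<open>Bounds the degree of \<open>p * chiP N K\<close>: \<open>N\<close> for the
    characteristic polynomial, the rest for the linear system.\<close>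
  define M where "M = N + card S * card \<Omega>"
  define f' where "f' = cl (cut_off \<Omega>) f"
  have f': "f' w = (if w \<in> \<Omega> then f w else 0)" for w
    by (auto simp: f'_def cl_nth cut_off_def intro!: fps_ext)
  have sol': "Df N K S (\<lambda>s. pole u0 (zz s)) (\<lambda>s a b. epsV N s a b) f' = (\<lambda>_. 0)"
  proof -
    have "Df N K S (\<lambda>s. pole u0 (zz s)) (\<lambda>s a b. epsV N s a b) f'
        = cl (cut_off \<Omega>) (Df N K S (\<lambda>s. pole u0 (zz s)) (\<lambda>s a b. epsV N s a b) f)"
      unfolding f'_def
    proof (rule Df_natural[OF lin_cut_off])
      fix s a b x assume "s \<in> S" "a < N" "b < N"
      then show "epsV N s a b (cut_off \<Omega> x) = cut_off \<Omega> (epsV N s a b x)"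
        using put_closed_iff[where S = S, OF N \<Omega>(2)] by (auto simp: epsV_def cut_off_def fun_eq_iff)
    qed
    then show ?thesis by (simp add: sol cl_0[OF lin_cut_off])
  qed
  have "\<exists>p. p \<noteq> 0 \<and> degree p \<le> M \<and> pd p (f' w) = 0" for w
  proof (cases "w \<in> \<Omega>")
    case True
    then obtain p where p: "p \<noteq> 0" "degree p \<le> card S * card \<Omega>" "pd p (pd (chiP N K) (f w)) = 0"
      using vec_solution_words[where S = S and \<Omega> = \<Omega>, OF N fin inj u0 sol \<Omega> True] by blast
    moreover have "chiP N K \<noteq> 0" using chiP_monic(1)[of N K] by auto
    ultimately show ?thesis using True degree_mult_le[of p "chiP N K"] chiP_monic(2)[of N K]
      by (intro exI[of _ "p * chiP N K"]) (simp add: f' pd_mult M_def)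
  qed (auto simp: f' intro!: exI[of _ 1])
  then obtain p where p: "\<And>w. p w \<noteq> 0" "\<And>w. degree (p w) \<le> M" "\<And>w. pd (p w) (f' w) = 0" by metis
  have "\<forall>w. \<exists>q. f' w = (\<Sum>\<mu>\<in>{\<mu>. poly (p w) \<mu> = 0}. ep \<mu> (q \<mu>)) \<and> (\<forall>\<mu>. bd M (q \<mu>))"
    using ode_quasi_exponential[OF p(1,3)] bd_mono[OF _ p(2)] by blast
  then obtain q where q: "\<And>w. f' w = (\<Sum>\<mu>\<in>{\<mu>. poly (p w) \<mu> = 0}. ep \<mu> (q w \<mu>))" "\<And>w \<mu>. bd M (q w \<mu>)" by metis
  define A where "A = (\<Union>w\<in>\<Omega>. {\<mu>. poly (p w) \<mu> = 0})"
  define q' where "q' w \<mu> = (if w \<in> \<Omega> \<and> poly (p w) \<mu> = 0 then q w \<mu> else 0)" for w \<mu>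
  have finA: "finite A" using \<Omega>(1) p(1) by (auto simp: A_def poly_roots_finite)
  have q'bd: "bd M (q' w \<mu>)" for w \<mu> using q(2) by (simp add: q'_def bd_zero)
  have f'q: "f' w = (\<Sum>\<mu>\<in>A. ep \<mu> (q' w \<mu>))" for w
  proof (cases "w \<in> \<Omega>")
    case True
    have "f' w = (\<Sum>\<mu>\<in>{\<mu>. poly (p w) \<mu> = 0}. ep \<mu> (q w \<mu>))" by (rule q(1))
    also have "\<dots> = (\<Sum>\<mu>\<in>A. ep \<mu> (q' w \<mu>))"
      using finA True by (intro sum.mono_neutral_cong_left) (auto simp: A_def q'_def)
    finally show ?thesis .
  qed (simp add: f' q'_def)
  have "q' w \<mu> = 0" if "\<mu> \<in> A" "poly (chiP N K) \<mu> \<noteq> 0" for w \<mu>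
  proof (rule Df_exponents[where q = q' and \<mu> = \<mu> and w = w and z = zz and K = K and A = A and m = M and S = S])
    show "Df N K S (\<lambda>s. pole u0 (zz s)) (\<lambda>s a b. epsV N s a b) (\<lambda>w. \<Sum>\<mu>\<in>A. ep \<mu> (q' w \<mu>)) = (\<lambda>_. 0)"
    proof -
      have "(\<lambda>w. \<Sum>\<mu>\<in>A. ep \<mu> (q' w \<mu>)) = f'" by (rule ext) (rule f'q[symmetric])
      with sol' show ?thesis by (simp only:)
    qed
  qed (use fin u0 finA q'bd that lin_epsV in \<open>auto simp: gens_def\<close>)
  then have "pd (chiP N K ^ M) (ep \<mu> (q' w \<mu>)) = 0" if "\<mu> \<in> A" for w \<mu>
    using pd_power_ep[OF _ q'bd, of "chiP N K" \<mu> M] that by (cases "poly (chiP N K) \<mu> = 0") auto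
  then have "pd (chiP N K ^ M) (f' w) = 0" by (simp add: f'q pd_sum_right)
  then show ?thesis using w by (simp add: f' M_def)
qed

lemma pole_nth_0: "u0 \<noteq> z \<Longrightarrow> fps_nth (pole u0 z) 0 = 1 / (u0 - z)"
  by (simp add: pole_def divide_inverse)

lemma pole_nth_Suc:
  assumes "u0 \<noteq> z"
  shows "fps_nth (pole u0 z) (Suc i) = - fps_nth (pole u0 z) i / (u0 - z)"
proof -
  have "fps_nth (pole u0 z * fps_X + pole u0 z * fps_const (u0 - z)) (Suc i) = fps_nth 1 (Suc i)"
    unfolding distrib_left[symmetric] pole_mult[OF assms] ..
  then have "fps_nth (pole u0 z) i + fps_nth (pole u0 z) (Suc i) * (u0 - z) = 0"
    unfolding fps_add_nth fps_X_mult_right_nth fps_mult_right_const_nth by simp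
  then show ?thesis using assms by (simp add: field_simps eq_neg_iff_add_eq_0)
qed

lemma pole_tendsto:
  assumes "(\<lambda>t. Z t) \<longlonglongrightarrow> z" "u0 \<noteq> z" "\<And>t. u0 \<noteq> Z t"
  shows "(\<lambda>t. fps_nth (pole u0 (Z t)) i) \<longlonglongrightarrow> fps_nth (pole u0 z) i"
proof (induction i)
  case 0
  then show ?case using assms by (simp add: pole_nth_0) (intro tendsto_intros, auto)
next
  case (Suc i)
  have "(\<lambda>t. - fps_nth (pole u0 (Z t)) i / (u0 - Z t)) \<longlonglongrightarrow> - fps_nth (pole u0 z) i / (u0 - z)"
    using Suc assms by (intro tendsto_intros) auto
  then show ?case using assms by (simp add: pole_nth_Suc)
qed

text \<open>Shift \<open>zz s\<close> by \<open>\<kappa> s / (t + 1)\<close> with distinct numbers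
  \<open>\<kappa> s\<close>. Equal poles separate at once; distinct poles stay distinct for large
  \<open>t\<close>, and so do the poles and \<open>u0\<close>. Starting the sequence late discards
  the bad \<open>t\<close>.\<close>

lemma perturbation_exists:
  fixes zz :: "'s \<Rightarrow> complex"
  assumes fin: "finite S" and u0: "\<And>s. s \<in> S \<Longrightarrow> u0 \<noteq> zz s"
  shows "\<exists>Z. (\<forall>t::nat. inj_on (Z t) S \<and> (\<forall>s\<in>S. u0 \<noteq> Z t s)) \<and> (\<forall>s\<in>S. (\<lambda>t. Z t s) \<longlonglongrightarrow> zz s)"
proof -
  obtain \<kappa> :: "'s \<Rightarrow> nat" where \<kappa>: "inj_on \<kappa> S" using finite_imp_inj_to_nat_seg[OF fin] by blast
  define Z where "Z t s = zz s + of_nat (\<kappa> s) * (1 / of_nat (Suc t))" for t s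
  have lim: "(\<lambda>t. Z t s) \<longlonglongrightarrow> zz s" for s
  proof -
    have "(\<lambda>t. 1 / of_nat (Suc t) :: complex) \<longlonglongrightarrow> 0"
      by (rule LIMSEQ_Suc[OF lim_1_over_n])
    then have "(\<lambda>t. zz s + of_nat (\<kappa> s) * (1 / of_nat (Suc t))) \<longlonglongrightarrow> zz s + of_nat (\<kappa> s) * 0"
      by (intro tendsto_intros)
    then show ?thesis by (simp add: Z_def)
  qed
  have "eventually (\<lambda>t. Z t s \<noteq> Z t s') sequentially" if "s \<in> S" "s' \<in> S" "s \<noteq> s'" for s s'
  proof (cases "zz s = zz s'")
    case True
    have "\<kappa> s \<noteq> \<kappa> s'" using \<kappa> that by (auto simp: inj_on_def)
    then show ?thesis using True by (simp add: Z_def del: of_nat_Suc)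
  next
    case False
    have "(\<lambda>t. Z t s - Z t s') \<longlonglongrightarrow> zz s - zz s'" by (intro tendsto_diff lim)
    then have "eventually (\<lambda>t. Z t s - Z t s' \<noteq> 0) sequentially"
      using False by (intro tendsto_imp_eventually_ne) auto
    then show ?thesis by (rule eventually_mono) auto
  qed
  then have "eventually (\<lambda>t. \<forall>p\<in>{p \<in> S \<times> S. fst p \<noteq> snd p}. Z t (fst p) \<noteq> Z t (snd p)) sequentially"
    using fin by (intro eventually_ball_finite) auto
  moreover have "eventually (\<lambda>t. \<forall>s\<in>S. Z t s \<noteq> u0) sequentially"
    using fin u0 by (intro eventually_ball_finite ballI tendsto_imp_eventually_ne[OF lim]) auto
  ultimately have "eventually (\<lambda>t. (\<forall>p\<in>{p \<in> S \<times> S. fst p \<noteq> snd p}. Z t (fst p) \<noteq> Z t (snd p)) \<and> (\<forall>s\<in>S. Z t s \<noteq> u0)) sequentially"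
    by (rule eventually_conj)
  then obtain T where T: "\<And>t. t \<ge> T \<Longrightarrow> (\<forall>p\<in>{p \<in> S \<times> S. fst p \<noteq> snd p}. Z t (fst p) \<noteq> Z t (snd p)) \<and> (\<forall>s\<in>S. Z t s \<noteq> u0)"
    by (auto simp: eventually_sequentially)
  show ?thesis
  proof (intro exI[of _ "\<lambda>t. Z (t + T)"] conjI allI ballI)
    fix t
    show "inj_on (Z (t + T)) S"
    proof (rule inj_onI, rule ccontr)
      fix x y assume "x \<in> S" "y \<in> S" "Z (t + T) x = Z (t + T) y" "x \<noteq> y"
      then show False using T[of "t + T"] by force
    qed
    show "u0 \<noteq> Z (t + T) s" if "s \<in> S" for s using T[of "t + T"] that by force
  next
    show "(\<lambda>t. Z (t + T) s) \<longlonglongrightarrow> zz s" if "s \<in> S" for s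
      by (rule LIMSEQ_ignore_initial_segment[OF lim])
  qed
qed

text \<open>Solve with separated poles and the initial coefficients of \<open>f\<close>. All these
  solutions satisfy the same equation, each coefficient of which involves finitely many coefficients
  of the solution, so it passes to the limit.\<close>

lemma words_quasi_exponential:
  fixes S :: "'s set" and K :: "nat \<Rightarrow> nat \<Rightarrow> complex" and zz :: "'s \<Rightarrow> complex"
    and f :: "('s \<Rightarrow> nat) \<Rightarrow> complex fps"
  assumes N: "N > 0" and fin: "finite S" and u0: "\<And>s. s \<in> S \<Longrightarrow> u0 \<noteq> zz s"
    and sol: "Df N K S (\<lambda>s. pole u0 (zz s)) (\<lambda>s a b. epsV N s a b) f = (\<lambda>_. 0)"
    and \<Omega>: "finite \<Omega>" "\<And>w s b. w \<in> \<Omega> \<Longrightarrow> s \<in> S \<Longrightarrow> b < N \<Longrightarrow> put N s b w \<in> \<Omega>" and w: "w \<in> \<Omega>"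
  shows "pd (chiP N K ^ (N + card S * card \<Omega>)) (f w) = 0"
proof -
  let ?e = "\<lambda>s a b. epsV N s a b :: (('s \<Rightarrow> nat) \<Rightarrow> complex) \<Rightarrow> ('s \<Rightarrow> nat) \<Rightarrow> complex"
  let ?p = "chiP N K ^ (N + card S * card \<Omega>)"
  obtain Z where Z: "\<And>t. inj_on (Z t) S" "\<And>t s. s \<in> S \<Longrightarrow> u0 \<noteq> Z t s" "\<And>s. s \<in> S \<Longrightarrow> (\<lambda>t::nat. Z t s) \<longlonglongrightarrow> zz s"
    using perturbation_exists[where zz = zz, OF fin u0] by blast
  have lin: "lin T" if "T \<in> gens N S ?e" for T using that by (auto simp: gens_def lin_epsV)
  have pc: "pcont T" if "T \<in> gens N S ?e" for T using that by (auto simp: gens_def pcont_epsV)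
  have "\<exists>F. Df N K S (\<lambda>s. pole u0 (Z t s)) ?e F = (\<lambda>_. 0) \<and> (\<forall>k<N. slice F k = slice f k)" for t
  proof -
    have "\<exists>F. Df N K S (\<lambda>s. pole u0 (Z t s)) ?e F = (\<lambda>_. 0) \<and> (\<forall>k<N. slice F k = slice f k) \<and> (\<forall>i. slice F i \<in> UNIV)"
      by (rule Df_solution_exists[OF fin lin]) (auto simp: lsub_def intro!: pole_deriv Z)
    then show ?thesis by blast
  qed
  then obtain F where F: "\<And>t. Df N K S (\<lambda>s. pole u0 (Z t s)) ?e (F t) = (\<lambda>_. 0)" "\<And>t k. k < N \<Longrightarrow> slice (F t) k = slice f k"
    by metis
  have "pd ?p (F t w) = 0" for t
    by (rule words_quasi_exponential_distinct[OF N fin Z(1,2) F(1) \<Omega> w])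
  moreover have lim: "(\<lambda>t. fps_nth (F t w) k) \<longlonglongrightarrow> fps_nth (f w) k" for k
    by (rule Df_solution_tendsto[OF fin lin pc, where g = "\<lambda>s. pole u0 (zz s)" and G = "\<lambda>t s. pole u0 (Z t s)" and K = K and N = N])
      (auto intro!: pole_deriv pole_tendsto Z u0 sol F)
  have "(\<lambda>t. fps_nth (pd ?p (F t w)) m) \<longlonglongrightarrow> fps_nth (pd ?p (f w)) m" for m
    unfolding pd_altdef[OF order_refl] fps_sum_nth fps_mult_left_const_nth nth_deriv_funpow
    by (intro tendsto_intros lim)
  ultimately have "(\<lambda>t::nat. 0) \<longlonglongrightarrow> fps_nth (pd ?p (f w)) m" for m by simp
  then have "fps_nth (pd ?p (f w)) m = 0" for m
    using LIMSEQ_unique[OF _ tendsto_const] by metis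
  then show ?thesis by (intro fps_ext) simp
qed

section \<open>Cyclic modules generated by a highest weight vector\<close>

text \<open>\<open>'q\<close> will be the disjoint sum of the index types of two modules, and
  \<open>p0\<close> a pair of highest weight vectors of equal weight.\<close>

locale highest_weight_functions =
  fixes N :: nat and E :: "nat \<Rightarrow> nat \<Rightarrow> ('q \<Rightarrow> complex) \<Rightarrow> 'q \<Rightarrow> complex"
    and p0 :: "'q \<Rightarrow> complex" and \<Lambda> :: "nat \<Rightarrow> complex"
  assumes lin: "a < N \<Longrightarrow> b < N \<Longrightarrow> lin (E a b)"
    and bracket: "a < N \<Longrightarrow> b < N \<Longrightarrow> c < N \<Longrightarrow> d < N \<Longrightarrow>
      E a b (E c d p) w = E c d (E a b p) w + (if b = c then E a d p w else 0) - (if d = a then E c b p w else 0)"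
    and raising: "a < b \<Longrightarrow> b < N \<Longrightarrow> E a b p0 = (\<lambda>_. 0)"
    and weight: "a < N \<Longrightarrow> E a a p0 = (\<lambda>w. \<Lambda> a * p0 w)"
begin

text \<open>Generated by lowering operators only, so that the weights that occur can be read off the
  construction; that this is the whole submodule is the content of
  \<open>cyc_invariant\<close>.\<close>

inductive_set cyc :: "('q \<Rightarrow> complex) set" where
  zero: "(\<lambda>_. 0) \<in> cyc"
| add: "p \<in> cyc \<Longrightarrow> q \<in> cyc \<Longrightarrow> (\<lambda>w. p w + q w) \<in> cyc"
| scale: "p \<in> cyc \<Longrightarrow> (\<lambda>w. c * p w) \<in> cyc"
| base: "p0 \<in> cyc"
| lowering: "p \<in> cyc \<Longrightarrow> b < a \<Longrightarrow> a < N \<Longrightarrow> E a b p \<in> cyc"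

lemma lsub_cyc: "lsub cyc"
  by (auto simp: lsub_def intro: zero add scale)

lemma cyc_invariant:
  assumes "p \<in> cyc" "c < N" "d < N"
  shows "E c d p \<in> cyc"
  using assms
proof (induction arbitrary: c d rule: cyc.induct)
  case zero
  then show ?case using lin_0[OF lin] cyc.zero by simp
next
  case (add p q)
  then show ?case using lin_add[OF lin[of c d], of p q] cyc.add[of "E c d p" "E c d q"] by simp
next
  case (scale p k)
  then show ?case using lin_scale[OF lin[of c d], of k p] cyc.scale[of "E c d p" k] by simp
next
  case base
  consider "c < d" | "c = d" | "d < c" by linarith
  then show ?case
  proof cases
    case 1
    then show ?thesis using raising base cyc.zero by simp
  next
    case 2
    then show ?thesis using weight base cyc.scale[OF cyc.base] by simp
  next
    case 3
    then show ?thesis using base cyc.lowering[OF cyc.base] by simp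
  qed
next
  case (lowering p b a)
  have 1: "E a b (E c d p) \<in> cyc"
    by (rule cyc.lowering) (use lowering in auto)
  have 2: "(\<lambda>w. if d = a then E c b p w else 0) \<in> cyc"
    using lowering.IH[of c b] lowering.prems lowering.hyps cyc.zero by (cases "d = a") simp_all
  have 3: "(\<lambda>w. if b = c then E a d p w else 0) \<in> cyc"
    using lowering.IH[of a d] lowering.prems lowering.hyps cyc.zero by (cases "b = c") simp_all
  have "E c d (E a b p) = (\<lambda>w. E a b (E c d p) w + (if d = a then E c b p w else 0)
      + (- 1) * (if b = c then E a d p w else 0))"
    using lowering.prems lowering.hyps by (intro ext, subst bracket) auto
  then show ?case
    using cyc.add[OF cyc.add[OF 1 2] cyc.scale[OF 3, of "- 1"]] by simp
qed

text \<open>This combination of the diagonal generators grades the submodule: \<open>E a b\<close>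
  with \<open>b < a\<close> raises its eigenvalue by \<open>a - b > 0\<close>. So a single operator
  suffices to recognise the multiples of \<open>p0\<close>, as the eigenvectors for
  \<open>h0\<close>.\<close>

definition h :: "('q \<Rightarrow> complex) \<Rightarrow> 'q \<Rightarrow> complex" where
  "h p = (\<lambda>w. \<Sum>c<N. of_nat c * E c c p w)"

definition h0 :: complex where
  "h0 = (\<Sum>c<N. of_nat c * \<Lambda> c)"

lemma lin_h: "lin h"
  unfolding lin_def h_def
  using lin by (auto simp: fun_eq_iff lin_add lin_scale sum_distrib_left sum.distrib algebra_simps)

lemma h_p0: "h p0 = (\<lambda>w. h0 * p0 w)"
  by (auto simp: h_def h0_def weight sum_distrib_right mult.assoc)

lemma h_lowering:
  assumes "b < a" "a < N" "h p = (\<lambda>w. x * p w)"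
  shows "h (E a b p) = (\<lambda>w. (x + of_nat (a - b)) * E a b p w)"
proof
  fix w
  have "h (E a b p) w = (\<Sum>c<N. of_nat c * (E a b (E c c p) w
      + (if c = a then E c b p w else 0) - (if b = c then E a c p w else 0)))"
    unfolding h_def
  proof (rule sum.cong[OF refl])
    fix c assume "c \<in> {..<N}"
    then show "of_nat c * E c c (E a b p) w = of_nat c * (E a b (E c c p) w
      + (if c = a then E c b p w else 0) - (if b = c then E a c p w else 0))"
      using assms by (subst bracket) auto
  qed
  also have "\<dots> = (\<Sum>c<N. of_nat c * E a b (E c c p) w)
      + (\<Sum>c<N. if c = a then of_nat a * E a b p w else 0) - (\<Sum>c<N. if c = b then of_nat b * E a b p w else 0)"
    unfolding sum.distrib[symmetric] sum_subtractf[symmetric]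
    by (rule sum.cong) (auto simp: algebra_simps)
  also have "\<dots> = E a b (h p) w + of_nat (a - b) * E a b p w"
    unfolding h_def lin_sum[OF lin[OF assms(2) less_trans[OF assms(1,2)]]]
      lin_scale[OF lin[OF assms(2) less_trans[OF assms(1,2)]]]
    using assms by (simp add: of_nat_diff algebra_simps)
  also have "\<dots> = (x + of_nat (a - b)) * E a b p w"
    using assms by (simp add: lin_scale[OF lin] algebra_simps)
  finally show "h (E a b p) w = (x + of_nat (a - b)) * E a b p w" .
qed

text \<open>To get rid of \<open>t\<close>, apply \<open>h - (h0 + t)\<close>: it multiplies
  \<open>g r\<close> by \<open>r - t\<close> and \<open>y\<close> by \<open>s - t\<close>, which is
  not 0.\<close>

lemma eigenvectors_independent:
  assumes "finite T" "s \<notin> T" "\<And>t. t \<in> T \<Longrightarrow> h (g t) = (\<lambda>w. (h0 + of_nat t) * g t w)"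
    "h y = (\<lambda>w. (h0 + of_nat s) * y w)" "y = (\<lambda>w. \<Sum>t\<in>T. g t w)"
  shows "y = (\<lambda>_. 0)"
  using assms
proof (induction T arbitrary: g y rule: finite_induct)
  case (insert t T)
  define g' where "g' = (\<lambda>r w. (of_nat r - of_nat t) * g r w :: complex)"
  define y' where "y' = (\<lambda>w. (of_nat s - of_nat t) * y w :: complex)"
  have "y' = (\<lambda>_. 0)"
  proof (rule insert.IH)
    show "h (g' r) = (\<lambda>w. (h0 + of_nat r) * g' r w)" if "r \<in> T" for r
      unfolding g'_def lin_scale[OF lin_h] using insert.prems(2)[of r] that by (simp add: mult_ac)
    show "h y' = (\<lambda>w. (h0 + of_nat s) * y' w)"
      unfolding y'_def lin_scale[OF lin_h] using insert.prems(3) by (simp add: mult_ac)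
    show "y' = (\<lambda>w. \<Sum>r\<in>T. g' r w)"
    proof
      fix w
      have "(h0 + of_nat s) * y w = h y w" using insert.prems(3) by simp
      also have "h y w = (\<Sum>r\<in>insert t T. h (g r) w)"
        by (simp add: insert.prems(4) lin_sum[OF lin_h])
      also have "\<dots> = (\<Sum>r\<in>insert t T. (h0 + of_nat r) * g r w)"
        by (rule sum.cong[OF refl]) (simp add: insert.prems(2))
      finally have "(h0 + of_nat s) * y w - (h0 + of_nat t) * y w
        = (\<Sum>r\<in>insert t T. (h0 + of_nat r) * g r w) - (\<Sum>r\<in>insert t T. (h0 + of_nat t) * g r w)"
        by (simp add: insert.prems(4) sum_distrib_left)
      also have "\<dots> = (\<Sum>r\<in>insert t T. g' r w)"
        unfolding sum_subtractf[symmetric] by (rule sum.cong) (auto simp: g'_def algebra_simps)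
      also have "\<dots> = (\<Sum>r\<in>T. g' r w)"
        using insert.hyps by (simp add: g'_def)
      finally show "y' w = (\<Sum>r\<in>T. g' r w)" by (simp add: y'_def algebra_simps)
    qed
  qed (use insert.prems in auto)
  then show ?case using insert.prems(1) by (auto simp: y'_def fun_eq_iff)
qed simp

text \<open>Lowering shifts the components up by \<open>a - b\<close>, so nothing new ever arrives
  at index 0, where only multiples of \<open>p0\<close> live.\<close>

lemma cyc_decomposition:
  assumes "p \<in> cyc"
  shows "\<exists>n g c. (\<forall>t. h (g t) = (\<lambda>w. (h0 + of_nat t) * g t w)) \<and> g 0 = (\<lambda>w. c * p0 w)
    \<and> (\<forall>t>n. g t = (\<lambda>_. 0)) \<and> p = (\<lambda>w. \<Sum>t\<le>n. g t w)"
  using assms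
proof (induction rule: cyc.induct)
  case zero
  show ?case
    by (rule exI[of _ 0], rule exI[of _ "\<lambda>_ _. 0"], rule exI[of _ 0]) (simp add: lin_0[OF lin_h])
next
  case (add p q)
  then obtain n g c n' g' c' where
    p: "\<And>t. h (g t) = (\<lambda>w. (h0 + of_nat t) * g t w)" "g 0 = (\<lambda>w. c * p0 w)"
      "\<And>t. t > n \<Longrightarrow> g t = (\<lambda>_. 0)" "p = (\<lambda>w. \<Sum>t\<le>n. g t w)" and
    q: "\<And>t. h (g' t) = (\<lambda>w. (h0 + of_nat t) * g' t w)" "g' 0 = (\<lambda>w. c' * p0 w)"
      "\<And>t. t > n' \<Longrightarrow> g' t = (\<lambda>_. 0)" "q = (\<lambda>w. \<Sum>t\<le>n'. g' t w)" by blast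
  have "p = (\<lambda>w. \<Sum>t\<le>max n n'. g t w)" "q = (\<lambda>w. \<Sum>t\<le>max n n'. g' t w)"
    by (subst p(4), rule ext, rule sum.mono_neutral_left, auto simp: p(3))
      (subst q(4), rule ext, rule sum.mono_neutral_left, auto simp: q(3))
  then show ?case
    by (intro exI[of _ "max n n'"] exI[of _ "\<lambda>t w. g t w + g' t w"] exI[of _ "c + c'"])
      (auto simp: lin_add[OF lin_h] p(1-3) q(1-3) sum.distrib algebra_simps)
next
  case (scale p k)
  then obtain n g c where
    p: "\<And>t. h (g t) = (\<lambda>w. (h0 + of_nat t) * g t w)" "g 0 = (\<lambda>w. c * p0 w)"
      "\<And>t. t > n \<Longrightarrow> g t = (\<lambda>_. 0)" "p = (\<lambda>w. \<Sum>t\<le>n. g t w)" by blast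
  then show ?case
    by (intro exI[of _ n] exI[of _ "\<lambda>t w. k * g t w"] exI[of _ "k * c"])
      (auto simp: lin_scale[OF lin_h] p(1-3) sum_distrib_left mult_ac)
next
  case base
  define g :: "nat \<Rightarrow> 'q \<Rightarrow> complex" where "g t = (if t = 0 then p0 else (\<lambda>_. 0))" for t
  have "h (g t) = (\<lambda>w. (h0 + of_nat t) * g t w)" for t
    by (cases "t = 0") (simp_all add: g_def lin_0[OF lin_h] h_p0)
  then show ?case
    by (intro exI[of _ 0] exI[of _ g] exI[of _ 1]) (simp add: g_def)
next
  case (lowering p b a)
  then obtain n g c where
    p: "\<And>t. h (g t) = (\<lambda>w. (h0 + of_nat t) * g t w)" "g 0 = (\<lambda>w. c * p0 w)"
      "\<And>t. t > n \<Longrightarrow> g t = (\<lambda>_. 0)" "p = (\<lambda>w. \<Sum>t\<le>n. g t w)" by blast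
  have bN: "b < N" using lowering.hyps by simp
  define s where "s = a - b"
  define g' where "g' t = (if t < s then (\<lambda>_. 0) else E a b (g (t - s)))" for t
  have s: "s > 0" using lowering.hyps by (simp add: s_def)
  have "h (g' t) = (\<lambda>w. (h0 + of_nat t) * g' t w)" for t
  proof (cases "t < s")
    case False
    then show ?thesis
      using h_lowering[OF lowering.hyps(2,3) p(1)[of "t - s"]]
      by (simp add: g'_def add.assoc flip: s_def of_nat_add)
  qed (simp add: g'_def lin_0[OF lin_h])
  moreover have "g' t = (\<lambda>_. 0)" if "t > n + s" for t
    using that by (simp add: g'_def p(3) lin_0[OF lin[OF lowering.hyps(3) bN]])
  moreover have "E a b p = (\<lambda>w. \<Sum>t\<le>n + s. g' t w)"
  proof
    fix w
    have "(\<Sum>t\<le>n + s. g' t w) = (\<Sum>t\<in>(\<lambda>t. t + s) ` {..n}. g' t w)"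
    proof (rule sum.mono_neutral_right)
      show "\<forall>t\<in>{..n + s} - (\<lambda>t. t + s) ` {..n}. g' t w = 0"
      proof
        fix t assume t: "t \<in> {..n + s} - (\<lambda>t. t + s) ` {..n}"
        have "t < s"
        proof (rule ccontr)
          assume "\<not> t < s"
          then have "t = (t - s) + s" "t - s \<in> {..n}" using t by auto
          then show False using t by blast
        qed
        then show "g' t w = 0" by (simp add: g'_def)
      qed
    qed auto
    also have "\<dots> = (\<Sum>t\<le>n. E a b (g t) w)"
      by (subst sum.reindex) (auto simp: g'_def inj_on_def)
    finally show "E a b p w = (\<Sum>t\<le>n + s. g' t w)"
      by (simp add: p(4) lin_sum[OF lin[OF lowering.hyps(3) bN]])
  qed
  ultimately show ?case
    by (intro exI[of _ "n + s"] exI[of _ g'] exI[of _ 0]) (use s in \<open>auto simp: g'_def\<close>)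
qed

lemma cyc_top_weight:
  assumes "p \<in> cyc" "h p = (\<lambda>w. h0 * p w)"
  shows "\<exists>c. p = (\<lambda>w. c * p0 w)"
proof -
  obtain n g c where
    p: "\<And>t. h (g t) = (\<lambda>w. (h0 + of_nat t) * g t w)" "g 0 = (\<lambda>w. c * p0 w)" "p = (\<lambda>w. \<Sum>t\<le>n. g t w)"
    using cyc_decomposition[OF assms(1)] by blast
  have split: "(\<Sum>t\<le>n. g t w) = g 0 w + (\<Sum>t\<in>{1..n}. g t w)" for w
    by (simp add: sum.atMost_shift sum.atLeast1_atMost_eq lessThan_Suc_atMost)
  define y where "y = (\<lambda>w. p w + (- 1) * (c * p0 w))"
  have "y = (\<lambda>_. 0)"
  proof (rule eigenvectors_independent)
    show "finite {1..n}" "0 \<notin> {1..n}" by auto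
    show "h y = (\<lambda>w. (h0 + of_nat 0) * y w)"
      unfolding y_def lin_add[OF lin_h] lin_scale[OF lin_h] assms(2) h_p0
      by (simp add: algebra_simps)
    show "y = (\<lambda>w. \<Sum>t\<in>{1..n}. g t w)"
      unfolding y_def p(3) split p(2) by simp
  qed (simp add: p)
  then show ?thesis by (intro exI[of _ c]) (simp add: y_def fun_eq_iff)
qed

end

section \<open>Highest weight vectors in tensor powers of the vector representation\<close>

definition vrep :: "nat \<Rightarrow> 's set \<Rightarrow> nat \<Rightarrow> nat \<Rightarrow> (('s \<Rightarrow> nat) \<Rightarrow> complex) \<Rightarrow> ('s \<Rightarrow> nat) \<Rightarrow> complex" where
  "vrep N S a b y = (\<lambda>w. \<Sum>s\<in>S. epsV N s a b y w)"

text \<open>Fixing the value 0 outside \<open>S\<close> makes the set finite, although words are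
  total functions.\<close>

definition words :: "nat \<Rightarrow> 's set \<Rightarrow> ('s \<Rightarrow> nat) set" where
  "words N S = {w. (\<forall>s\<in>S. w s < N) \<and> (\<forall>s. s \<notin> S \<longrightarrow> w s = 0)}"

lemma lin_vrep: "lin (vrep N S a b)"
  unfolding lin_def vrep_def lin_add[OF lin_epsV] lin_scale[OF lin_epsV] sum.distrib sum_distrib_left
  by simp

lemma finite_words: "finite S \<Longrightarrow> finite (words N S)"
  using finite_set_of_finite_funs[of S "{..<N}" 0] unfolding words_def
  by (rule rev_finite_subset) auto

lemma put_words_iff: "s \<in> S \<Longrightarrow> b < N \<Longrightarrow> put N s b w \<in> words N S \<longleftrightarrow> w \<in> words N S"
proof -
  assume s: "s \<in> S" "b < N"
  have "w s div N * N + b < N \<longleftrightarrow> w s < N"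
  proof (cases "w s < N")
    case False
    then have "w s div N > 0" using s by (simp add: div_greater_zero_iff)
    then have "N \<le> w s div N * N" by simp
    then show ?thesis using False by linarith
  qed (use s in simp)
  then show ?thesis using s by (auto simp: words_def put_def split: if_splits)
qed

lemma epsV_words: "w \<in> words N S \<Longrightarrow> s \<in> S \<Longrightarrow> epsV N s a b y w = (if w s = a then y (w(s := b)) else 0)"
  by (auto simp: epsV_def letter_def put_def words_def)

lemma epsV_same: "b < N \<Longrightarrow> epsV N s a b (epsV N s c d f) w = (if b = c then epsV N s a d f w else 0)"
  by (simp add: epsV_def letter_put_same put_put_same)

lemma epsV_diff: "s \<noteq> t \<Longrightarrow> epsV N s a b (epsV N t c d f) w = epsV N t c d (epsV N s a b f) w"
  using put_put_diff[of s t] by (simp add: epsV_def letter_put_diff)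

lemma sum_commutator:
  fixes A B :: "'s \<Rightarrow> 's \<Rightarrow> complex"
  assumes "\<And>s t. s \<noteq> t \<Longrightarrow> A s t = B t s"
  shows "(\<Sum>s\<in>S. \<Sum>t\<in>S. A s t) - (\<Sum>s\<in>S. \<Sum>t\<in>S. B s t) = (\<Sum>s\<in>S. A s s - B s s)"
proof (cases "finite S")
  case True
  have "(\<Sum>s\<in>S. \<Sum>t\<in>S. A s t) - (\<Sum>s\<in>S. \<Sum>t\<in>S. B s t) = (\<Sum>s\<in>S. \<Sum>t\<in>S. A s t - B t s)"
    by (subst sum.swap[of "\<lambda>s t. B s t"]) (simp add: sum_subtractf)
  also have "\<dots> = (\<Sum>s\<in>S. \<Sum>t\<in>S. if t = s then A s s - B s s else 0)"
    using assms by (intro sum.cong) auto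
  finally show ?thesis using True by simp
qed simp

lemma vrep_bracket:
  assumes "a < N" "b < N" "c < N" "d < N"
  shows "vrep N S a b (vrep N S c d y) w = vrep N S c d (vrep N S a b y) w
    + (if b = c then vrep N S a d y w else 0) - (if d = a then vrep N S c b y w else 0)"
proof -
  have *: "vrep N S a b (vrep N S c d y) w = (\<Sum>s\<in>S. \<Sum>t\<in>S. epsV N s a b (epsV N t c d y) w)" for a b c d
    unfolding vrep_def by (intro sum.cong refl) (simp add: lin_sum[OF lin_epsV])
  have "vrep N S a b (vrep N S c d y) w - vrep N S c d (vrep N S a b y) w
      = (\<Sum>s\<in>S. epsV N s a b (epsV N s c d y) w - epsV N s c d (epsV N s a b y) w)"
    unfolding * by (rule sum_commutator) (rule epsV_diff)
  also have "\<dots> = (\<Sum>s\<in>S. (if b = c then epsV N s a d y w else 0) - (if d = a then epsV N s c b y w else 0))"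
    using assms by (simp add: epsV_same)
  also have "\<dots> = (if b = c then vrep N S a d y w else 0) - (if d = a then vrep N S c b y w else 0)"
    by (simp add: sum_subtractf vrep_def)
  finally show ?thesis by (simp add: algebra_simps)
qed

lemma vrep_support:
  assumes "\<And>w. w \<notin> words N S \<Longrightarrow> y w = 0" "w \<notin> words N S" "b < N"
  shows "vrep N S a b y w = 0"
  unfolding vrep_def by (intro sum.neutral) (auto simp: epsV_def assms put_words_iff)

text \<open>Its determinant is the coefficient of the word \<open>x 0, ..., x (m - 1)\<close> in the
  wedge product of the first \<open>m\<close> basis vectors; a letter from \<open>m\<close> on gives
  a zero row.\<close>

definition letters_mat :: "nat \<Rightarrow> (nat \<Rightarrow> nat) \<Rightarrow> complex mat" where
  "letters_mat m x = mat m m (\<lambda>(r, s). if x r = s then 1 else 0)"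

lemma letters_mat_carrier [simp]: "letters_mat m x \<in> carrier_mat m m"
  and letters_mat_index: "r < m \<Longrightarrow> s < m \<Longrightarrow> letters_mat m x $$ (r, s) = (if x r = s then 1 else 0)"
  by (simp_all add: letters_mat_def)

lemma letters_mat_replace_row:
  assumes "r < m"
  shows "det (letters_mat m (x(r := b))) = (if b < m then cofactor (letters_mat m x) r b else 0)"
proof -
  have "cofactor (letters_mat m (x(r := b))) r s = cofactor (letters_mat m x) r s" for s
    unfolding cofactor_def mat_delete_def
    by (auto intro!: arg_cong2[where f = "(*)"] arg_cong[where f = det] cong_mat simp: letters_mat_def mat_delete_def)
  then have "det (letters_mat m (x(r := b))) = (\<Sum>s<m. letters_mat m (x(r := b)) $$ (r, s) * cofactor (letters_mat m x) r s)"
    using laplace_expansion_row[OF letters_mat_carrier assms] by simp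
  also have "\<dots> = (\<Sum>s<m. if s = b then cofactor (letters_mat m x) r b else 0)"
    using assms by (intro sum.cong) (auto simp: letters_mat_index)
  finally show ?thesis by simp
qed

text \<open>The left side is \<open>E_ab\<close> acting on that wedge product. Expanding along
  column \<open>b\<close> identifies it with the determinant in which column \<open>b\<close> is
  replaced by column \<open>a\<close>: two equal columns if \<open>a < b\<close>, the matrix itself
  if \<open>a = b\<close>.\<close>

lemma letters_mat_shift:
  assumes "a \<le> b"
  shows "(\<Sum>r<m. if x r = a then det (letters_mat m (x(r := b))) else 0)
    = (if a = b \<and> b < m then det (letters_mat m x) else 0)"
proof (cases "b < m")
  case False
  then have "(\<Sum>r<m. if x r = a then det (letters_mat m (x(r := b))) else 0) = 0"
    by (intro sum.neutral) (auto simp: letters_mat_replace_row)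
  then show ?thesis using False by simp
next
  case True
  define B where "B = mat m m (\<lambda>(r, s). letters_mat m x $$ (r, if s = b then a else s))"
  have B: "B \<in> carrier_mat m m" by (simp add: B_def)
  have "cofactor B r b = cofactor (letters_mat m x) r b" if "r < m" for r
    unfolding cofactor_def mat_delete_def using that
    by (auto intro!: arg_cong2[where f = "(*)"] arg_cong[where f = det] cong_mat simp: B_def letters_mat_def)
  then have "det B = (\<Sum>r<m. letters_mat m x $$ (r, a) * cofactor (letters_mat m x) r b)"
    using laplace_expansion_column[OF B True] True by (simp add: B_def)
  also have "\<dots> = (\<Sum>r<m. if x r = a then det (letters_mat m (x(r := b))) else 0)"
    using assms True by (intro sum.cong) (auto simp: letters_mat_index letters_mat_replace_row)
  finally have 1: "(\<Sum>r<m. if x r = a then det (letters_mat m (x(r := b))) else 0) = det B" ..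
  show ?thesis
  proof (cases "a = b")
    case True
    then have "B = letters_mat m x"
      by (auto simp: B_def letters_mat_def intro!: eq_matI)
    then show ?thesis using 1 True \<open>b < m\<close> by simp
  next
    case False
    then have "det B = 0"
      using assms True by (intro det_identical_columns[OF B, of a b]) (auto simp: B_def intro!: eq_vecI)
    then show ?thesis using 1 False by simp
  qed
qed

text \<open>The slots form the Young diagram of the weight \<open>l\<close>; the word function \<open>young_vec\<close> is antisymmetric
  along each of its columns.\<close>

definition young :: "nat \<Rightarrow> (nat \<Rightarrow> nat) \<Rightarrow> (nat \<times> nat) set" where
  "young N l = {(c, r). r < N \<and> c < l r}"

definition col_len :: "nat \<Rightarrow> (nat \<Rightarrow> nat) \<Rightarrow> nat \<Rightarrow> nat" where
  "col_len N l c = card {r. r < N \<and> c < l r}"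

definition young_vec :: "nat \<Rightarrow> (nat \<Rightarrow> nat) \<Rightarrow> (nat \<times> nat \<Rightarrow> nat) \<Rightarrow> complex" where
  "young_vec N l w = (if w \<in> words N (young N l)
     then \<Prod>c<l 0. det (letters_mat (col_len N l c) (\<lambda>r. w (c, r))) else 0)"

context
  fixes N :: nat and l :: "nat \<Rightarrow> nat"
  assumes decreasing: "\<And>a b. a \<le> b \<Longrightarrow> b < N \<Longrightarrow> l b \<le> l a"
begin

lemma col_len_less: "r < N \<Longrightarrow> c < l r \<longleftrightarrow> r < col_len N l c"
  and col_len_le: "col_len N l c \<le> N"
proof -
  have "\<exists>m\<le>N. {r. r < N \<and> c < l r} = {..<m}"
  proof (cases "\<exists>r<N. \<not> c < l r")
    case True
    define m where "m = (LEAST r. r < N \<and> \<not> c < l r)"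
    have m: "m < N" "\<not> c < l m"
      using LeastI_ex[of "\<lambda>r. r < N \<and> \<not> c < l r"] True unfolding m_def by blast+
    have "c < l r" if "r < m" for r
      using not_less_Least[of r "\<lambda>r. r < N \<and> \<not> c < l r"] that m(1) unfolding m_def by auto
    moreover have "\<not> c < l r" if "m \<le> r" "r < N" for r
      using decreasing[OF that] m(2) by simp
    ultimately have "{r. r < N \<and> c < l r} = {..<m}" using m by (auto simp: not_less) (meson not_le)
    then show ?thesis using m(1) less_imp_le by blast
  next
    case False
    then show ?thesis by (intro exI[of _ N]) auto
  qed
  then obtain m where m: "m \<le> N" "{r. r < N \<and> c < l r} = {..<m}" by blast
  then have "col_len N l c = m" by (simp add: col_len_def)
  then show "r < N \<Longrightarrow> c < l r \<longleftrightarrow> r < col_len N l c" "col_len N l c \<le> N" using m by blast+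
qed

lemma young_Sigma: "young N l = Sigma {..<l 0} (\<lambda>c. {..<col_len N l c})"
proof -
  have "c < l 0" if "r < N" "c < l r" for c r using decreasing[of 0 r] that by simp
  then show ?thesis using col_len_less col_len_le unfolding young_def
    by (auto simp: set_eq_iff) (meson col_len_le less_le_trans)+
qed

lemma finite_young: "finite (young N l)"
  by (simp add: young_Sigma)

text \<open>The action is a derivation over the columns, each of which is governed by
  \<open>letters_mat_shift\<close>. For \<open>a = b\<close> every column longer than
  \<open>a\<close> contributes one, and there are \<open>l a\<close> of them.\<close>

lemma young_vec_vrep:
  assumes "a \<le> b" "b < N"
  shows "vrep N (young N l) a b (young_vec N l) = (\<lambda>w. if a = b then of_nat (l a) * young_vec N l w else 0)"
proof
  fix w
  let ?h = "col_len N l"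
  define X where "X c = det (letters_mat (?h c) (\<lambda>r. w (c, r)))" for c
  show "vrep N (young N l) a b (young_vec N l) w = (if a = b then of_nat (l a) * young_vec N l w else 0)"
  proof (cases "w \<in> words N (young N l)")
    case False
    then show ?thesis by (auto intro!: vrep_support simp: young_vec_def assms)
  next
    case True
    have slot_term: "epsV N (c, r) a b (young_vec N l) w
        = (\<Prod>c'\<in>{..<l 0} - {c}. X c') *
          (if w (c, r) = a then det (letters_mat (?h c) ((\<lambda>r. w (c, r))(r := b))) else 0)"
      if "c < l 0" "r < ?h c" for c r
    proof -
      have s: "(c, r) \<in> young N l" using that by (auto simp: young_Sigma)
      have w': "w((c, r) := b) \<in> words N (young N l)"
        using True s assms by (auto simp: words_def)
      have "(\<Prod>c'<l 0. det (letters_mat (?h c') (\<lambda>r'. (w((c, r) := b)) (c', r'))))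
        = det (letters_mat (?h c) ((\<lambda>r. w (c, r))(r := b))) * (\<Prod>c'\<in>{..<l 0} - {c}. X c')"
        using that by (subst prod.remove[of _ c])
          (auto simp: X_def fun_upd_def intro!: arg_cong2[where f = "(*)"] prod.cong arg_cong[where f = det] arg_cong[where f = "letters_mat _"])
      then show ?thesis
        using w' by (simp add: epsV_words[OF True s] young_vec_def mult.commute)
    qed
    have "vrep N (young N l) a b (young_vec N l) w
        = (\<Sum>c<l 0. \<Sum>r<?h c. epsV N (c, r) a b (young_vec N l) w)"
      unfolding vrep_def young_Sigma by (subst sum.Sigma) auto
    also have "\<dots> = (\<Sum>c<l 0. (\<Prod>c'\<in>{..<l 0} - {c}. X c') * (if a = b \<and> b < ?h c then X c else 0))"
    proof (rule sum.cong[OF refl])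
      fix c assume c: "c \<in> {..<l 0}"
      have "(\<Sum>r<?h c. epsV N (c, r) a b (young_vec N l) w) = (\<Prod>c'\<in>{..<l 0} - {c}. X c') *
          (\<Sum>r<?h c. if w (c, r) = a then det (letters_mat (?h c) ((\<lambda>r. w (c, r))(r := b))) else 0)"
        unfolding sum_distrib_left using c by (intro sum.cong[OF refl] slot_term) auto
      then show "(\<Sum>r<?h c. epsV N (c, r) a b (young_vec N l) w)
          = (\<Prod>c'\<in>{..<l 0} - {c}. X c') * (if a = b \<and> b < ?h c then X c else 0)"
        unfolding letters_mat_shift[OF assms(1), of "\<lambda>r. w (c, r)"] by (simp only: X_def)
    qed
    also have "\<dots> = (\<Sum>c<l 0. if a = b \<and> b < ?h c then \<Prod>c'<l 0. X c' else 0)"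
    proof (rule sum.cong[OF refl])
      fix c assume "c \<in> {..<l 0}"
      then have "(\<Prod>c'<l 0. X c') = X c * (\<Prod>c'\<in>{..<l 0} - {c}. X c')" by (intro prod.remove) auto
      then show "(\<Prod>c'\<in>{..<l 0} - {c}. X c') * (if a = b \<and> b < ?h c then X c else 0)
          = (if a = b \<and> b < ?h c then \<Prod>c'<l 0. X c' else 0)" by simp
    qed
    also have "\<dots> = (if a = b then of_nat (l a) * young_vec N l w else 0)"
    proof (cases "a = b")
      case True': True
      have "{c \<in> {..<l 0}. b < ?h c} = {..<l a}"
        using col_len_less[OF assms(2)] True' decreasing[of 0 b, OF _ assms(2)]
        by (auto intro: less_le_trans)
      then have "(\<Sum>c<l 0. if b < ?h c then \<Prod>c'<l 0. X c' else 0) = of_nat (l a) * (\<Prod>c'<l 0. X c')"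
        by (subst sum.inter_filter[symmetric]) simp_all
      then show ?thesis using True True' by (simp add: young_vec_def X_def)
    qed simp
    finally show ?thesis .
  qed
qed

lemma young_vec_nonzero: "\<exists>w. young_vec N l w \<noteq> 0"
proof -
  \<comment> \<open>Each box contains its row number, so every column determinant is that of an
    identity matrix.\<close>
  define w where "w = (\<lambda>(c, r). if (c, r) \<in> young N l then r else 0)"
  have w: "w \<in> words N (young N l)"
    by (auto simp: words_def w_def young_def split: if_splits)
  have "letters_mat (col_len N l c) (\<lambda>r. w (c, r)) = 1\<^sub>m (col_len N l c)" if "c < l 0" for c
    using that by (auto simp: letters_mat_def w_def young_Sigma intro!: eq_matI)
  then have "young_vec N l w = 1" using w by (simp add: young_vec_def)
  then show ?thesis by (intro exI[of _ w]) simp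
qed

end

section \<open>Irreducible modules as subquotients of tensor powers\<close>

text \<open>A functional on a subspace extends to the whole coordinate space. By induction it has
  coefficients on the vectors that vanish at \<open>v\<close>; a vector with value 1 at
  \<open>v\<close>, if there is one, fixes the missing coefficient.\<close>

lemma functional_on_finite_support:
  fixes \<phi> :: "('w \<Rightarrow> complex) \<Rightarrow> complex"
  assumes "finite \<Omega>" "lsub Y" "\<And>y w. y \<in> Y \<Longrightarrow> w \<notin> \<Omega> \<Longrightarrow> y w = 0"
    "\<And>x y. x \<in> Y \<Longrightarrow> y \<in> Y \<Longrightarrow> \<phi> (\<lambda>w. x w + y w) = \<phi> x + \<phi> y"
    "\<And>c y. y \<in> Y \<Longrightarrow> \<phi> (\<lambda>w. c * y w) = c * \<phi> y"
  shows "\<exists>P. \<forall>y\<in>Y. \<phi> y = (\<Sum>w\<in>\<Omega>. P w * y w)"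
  using assms
proof (induction \<Omega> arbitrary: Y rule: finite_induct)
  case empty
  have "\<phi> y = 0" if "y \<in> Y" for y
  proof -
    have y: "(\<lambda>w. 0 * y w) = y" using empty(2)[OF that] by auto
    have "\<phi> (\<lambda>w. 0 * y w) = 0 * \<phi> y" by (rule empty(4)[OF that])
    then show ?thesis unfolding y by simp
  qed
  then show ?case by simp
next
  case (insert v \<Omega>)
  define Y' where "Y' = {y \<in> Y. y v = 0}"
  have "\<exists>P. \<forall>y\<in>Y'. \<phi> y = (\<Sum>w\<in>\<Omega>. P w * y w)"
  proof (rule insert.IH)
    show "lsub Y'" using insert.prems(1) by (auto simp: lsub_def Y'_def)
    show "y w = 0" if "y \<in> Y'" "w \<notin> \<Omega>" for y w
      using insert.prems(2)[of y w] that by (cases "w = v") (auto simp: Y'_def)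
  qed (use insert.prems in \<open>auto simp: Y'_def\<close>)
  then obtain P where P: "\<And>y. y \<in> Y' \<Longrightarrow> \<phi> y = (\<Sum>w\<in>\<Omega>. P w * y w)" by blast
  show ?case
  proof (cases "\<exists>y\<in>Y. y v \<noteq> 0")
    case False
    then show ?thesis using P insert.hyps by (intro exI[of _ P]) (auto simp: Y'_def)
  next
    case True
    then obtain y0 where y0: "y0 \<in> Y" "y0 v \<noteq> 0" by blast
    define y1 where "y1 = (\<lambda>w. inverse (y0 v) * y0 w)"
    have y1: "y1 \<in> Y" "y1 v = 1" using y0 lsub_scale[OF insert.prems(1) y0(1)] by (auto simp: y1_def)
    define c where "c = \<phi> y1 - (\<Sum>w\<in>\<Omega>. P w * y1 w)"
    have "\<phi> y = (\<Sum>w\<in>insert v \<Omega>. (P(v := c)) w * y w)" if y: "y \<in> Y" for y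
    proof -
      define y' where "y' = (\<lambda>w. y w + (- y v) * y1 w)"
      have s: "(\<lambda>w. (- y v) * y1 w) \<in> Y" by (rule lsub_scale[OF insert.prems(1) y1(1)])
      have "y' \<in> Y'"
        using lsub_add[OF insert.prems(1) y s] y1 by (simp add: Y'_def y'_def)
      then have "\<phi> y' = (\<Sum>w\<in>\<Omega>. P w * y' w)" by (rule P)
      moreover have "\<phi> y' = \<phi> y - y v * \<phi> y1"
        unfolding y'_def insert.prems(3)[OF y s] insert.prems(4)[OF y1(1)] by simp
      moreover have "(\<Sum>w\<in>\<Omega>. P w * y' w) = (\<Sum>w\<in>\<Omega>. P w * y w) - y v * (\<Sum>w\<in>\<Omega>. P w * y1 w)"
        by (simp add: y'_def algebra_simps sum_distrib_left sum_subtractf)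
      ultimately have "\<phi> y = y v * c + (\<Sum>w\<in>\<Omega>. P w * y w)"
        by (simp add: c_def algebra_simps)
      also have "(\<Sum>w\<in>\<Omega>. P w * y w) = (\<Sum>w\<in>\<Omega>. (P(v := c)) w * y w)"
        using insert.hyps by (intro sum.cong) auto
      finally show ?thesis using insert.hyps by simp
    qed
    then show ?thesis by blast
  qed
qed

text \<open>The matrix action on functions that are cut to 0 from \<open>d\<close> on, the form to
  which \<open>lin\<close>, \<open>cl\<close> and \<open>lsub\<close> apply.\<close>

definition mact :: "nat \<Rightarrow> complex mat \<Rightarrow> (nat \<Rightarrow> complex) \<Rightarrow> nat \<Rightarrow> complex" where
  "mact d A x = (\<lambda>i. if i < d then \<Sum>k<d. A $$ (i, k) * x k else 0)"

lemma mact_vec: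
  assumes "A \<in> carrier_mat d d"
  shows "vec d (mact d A x) = A *\<^sub>v vec d x"
  using assms by (auto simp: mact_def scalar_prod_def lessThan_atLeast0 intro!: eq_vecI sum.cong)

lemma lin_mact: "lin (mact d A)"
  by (auto simp: lin_def mact_def fun_eq_iff sum_distrib_left sum.distrib algebra_simps)

lemma mact_mult:
  assumes "A \<in> carrier_mat d d" "B \<in> carrier_mat d d"
  shows "mact d A (mact d B x) = mact d (A * B) x"
proof
  fix i
  have "(\<Sum>k<d. A $$ (i, k) * (\<Sum>m<d. B $$ (k, m) * x m)) = (\<Sum>m<d. (A * B) $$ (i, m) * x m)" if "i < d"
  proof -
    have "(\<Sum>m<d. (A * B) $$ (i, m) * x m) = (\<Sum>m<d. \<Sum>k<d. A $$ (i, k) * (B $$ (k, m) * x m))"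
      using assms that by (intro sum.cong) (auto simp: scalar_prod_def lessThan_atLeast0 sum_distrib_right mult.assoc)
    also have "\<dots> = (\<Sum>k<d. A $$ (i, k) * (\<Sum>m<d. B $$ (k, m) * x m))"
      by (subst sum.swap) (simp add: sum_distrib_left)
    finally show ?thesis ..
  qed
  then show "mact d A (mact d B x) i = mact d (A * B) x i"
    by (simp add: mact_def)
qed

lemma gl_gen_carrier [simp]: "gl_gen N a b \<in> carrier_mat N N"
  by (simp add: gl_gen_def)

lemma gl_gen_mult: "b < N \<Longrightarrow> gl_gen N a b * gl_gen N c d = (if b = c then gl_gen N a d else 0\<^sub>m N N)"
  by (auto simp: gl_gen_def scalar_prod_def if_distrib[of "\<lambda>x. x * _"] cong: if_cong intro!: eq_matI)

lemma gl_module_mact_bracket: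
  assumes \<rho>: "gl_module N d \<rho>" and "a < N" "b < N" "c < N" "e < N"
  shows "mact d (\<rho> (gl_gen N a b)) (mact d (\<rho> (gl_gen N c e)) x) i
    = mact d (\<rho> (gl_gen N c e)) (mact d (\<rho> (gl_gen N a b)) x) i
      + (if b = c then mact d (\<rho> (gl_gen N a e)) x i else 0) - (if e = a then mact d (\<rho> (gl_gen N c b)) x i else 0)"
proof (cases "i < d")
  case True
  have carr: "\<rho> A \<in> carrier_mat d d" if "A \<in> carrier_mat N N" for A
    using \<rho> that by (auto simp: gl_module_def)
  have add: "\<rho> (A + B) = \<rho> A + \<rho> B" if "A \<in> carrier_mat N N" "B \<in> carrier_mat N N" for A B
    using \<rho> that by (auto simp: gl_module_def)
  have scale: "\<rho> (k \<cdot>\<^sub>m A) = k \<cdot>\<^sub>m \<rho> A" if "A \<in> carrier_mat N N" for A k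
    using \<rho> that by (auto simp: gl_module_def)
  define x1 :: complex where "x1 = (if b = c then 1 else 0)"
  define x2 :: complex where "x2 = (if e = a then - 1 else 0)"
  have br: "lie_bracket (gl_gen N a b) (gl_gen N c e) = x1 \<cdot>\<^sub>m gl_gen N a e + x2 \<cdot>\<^sub>m gl_gen N c b"
    unfolding lie_bracket_def gl_gen_mult[OF assms(3)] gl_gen_mult[OF assms(5)]
    by (auto simp: x1_def x2_def intro!: eq_matI) (auto simp: gl_gen_def)
  have "\<rho> (gl_gen N a b) * \<rho> (gl_gen N c e) - \<rho> (gl_gen N c e) * \<rho> (gl_gen N a b)
    = x1 \<cdot>\<^sub>m \<rho> (gl_gen N a e) + x2 \<cdot>\<^sub>m \<rho> (gl_gen N c b)"
  proof -
    have "\<rho> (gl_gen N a b) * \<rho> (gl_gen N c e) - \<rho> (gl_gen N c e) * \<rho> (gl_gen N a b)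
      = \<rho> (lie_bracket (gl_gen N a b) (gl_gen N c e))"
      using \<rho> unfolding gl_module_def lie_bracket_def by (metis gl_gen_carrier)
    also have "\<dots> = \<rho> (x1 \<cdot>\<^sub>m gl_gen N a e) + \<rho> (x2 \<cdot>\<^sub>m gl_gen N c b)"
      unfolding br by (rule add) auto
    finally show ?thesis by (simp add: scale)
  qed
  then have "(\<rho> (gl_gen N a b) * \<rho> (gl_gen N c e) - \<rho> (gl_gen N c e) * \<rho> (gl_gen N a b)) $$ (i, k)
    = (x1 \<cdot>\<^sub>m \<rho> (gl_gen N a e) + x2 \<cdot>\<^sub>m \<rho> (gl_gen N c b)) $$ (i, k)" for k by simp
  then have *: "(\<rho> (gl_gen N a b) * \<rho> (gl_gen N c e)) $$ (i, k) = (\<rho> (gl_gen N c e) * \<rho> (gl_gen N a b)) $$ (i, k)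
      + x1 * \<rho> (gl_gen N a e) $$ (i, k) + x2 * \<rho> (gl_gen N c b) $$ (i, k)" if "k < d" for k
    using that True carr[OF gl_gen_carrier, of a b] carr[OF gl_gen_carrier, of c e]
      carr[OF gl_gen_carrier, of a e] carr[OF gl_gen_carrier, of c b]
    by (auto simp: algebra_simps dest!: meta_spec[of _ k])
  have "(\<Sum>k<d. (\<rho> (gl_gen N a b) * \<rho> (gl_gen N c e)) $$ (i, k) * x k) =
     (\<Sum>k<d. (\<rho> (gl_gen N c e) * \<rho> (gl_gen N a b)) $$ (i, k) * x k)
      + x1 * (\<Sum>k<d. \<rho> (gl_gen N a e) $$ (i, k) * x k) + x2 * (\<Sum>k<d. \<rho> (gl_gen N c b) $$ (i, k) * x k)"
    unfolding sum_distrib_left sum.distrib[symmetric] by (rule sum.cong) (auto simp: * algebra_simps)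
  then show ?thesis
    unfolding mact_mult[OF carr[OF gl_gen_carrier] carr[OF gl_gen_carrier]]
    using True by (simp add: mact_def x1_def x2_def)
qed (simp add: mact_def)

text \<open>Irreducibility speaks of invariance under all matrices, whereas the constructions below
  control the generators.\<close>

lemma gl_span_induct:
  assumes gen: "\<And>a b. a < N \<Longrightarrow> b < N \<Longrightarrow> P (gl_gen N a b)"
    and add: "\<And>A B. A \<in> carrier_mat N N \<Longrightarrow> B \<in> carrier_mat N N \<Longrightarrow> P A \<Longrightarrow> P B \<Longrightarrow> P (A + B)"
    and scale: "\<And>c A. A \<in> carrier_mat N N \<Longrightarrow> P A \<Longrightarrow> P (c \<cdot>\<^sub>m A)"
    and A: "A \<in> carrier_mat N N" and N: "N > 0"
  shows "P A"
proof -
  define C where "C T = mat N N (\<lambda>ij. if ij \<in> T then A $$ ij else 0)" for T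
  have "P (C T)" if "finite T" "T \<subseteq> {..<N} \<times> {..<N}" for T
    using that
  proof (induction T rule: finite_induct)
    case empty
    have "C {} = 0 \<cdot>\<^sub>m gl_gen N 0 0" by (auto simp: C_def gl_gen_def)
    moreover have "P (0 \<cdot>\<^sub>m gl_gen N 0 0)" by (rule scale) (simp_all add: gen N)
    ultimately show ?case by simp
  next
    case (insert ab T)
    obtain a b where ab: "ab = (a, b)" by fastforce
    have "C (insert ab T) = C T + A $$ (a, b) \<cdot>\<^sub>m gl_gen N a b"
      using insert.hyps by (auto simp: C_def gl_gen_def ab)
    moreover have "P (A $$ (a, b) \<cdot>\<^sub>m gl_gen N a b)"
      by (rule scale) (use insert.prems ab gen in auto)
    moreover have "P (C T + A $$ (a, b) \<cdot>\<^sub>m gl_gen N a b)"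
      by (rule add) (use insert calculation(2) in \<open>auto simp: C_def\<close>)
    ultimately show ?case by simp
  qed
  from this[of "{..<N} \<times> {..<N}"] have "P (C ({..<N} \<times> {..<N}))" by simp
  moreover have "C ({..<N} \<times> {..<N}) = A" using A by (auto simp: C_def)
  ultimately show ?thesis by simp
qed

lemma dominant_weight_nat:
  assumes "N > 0" "integral_dominant N \<Lambda>" "\<Lambda> (N - 1) \<in> \<nat>"
  shows "\<exists>l. (\<forall>a<N. \<Lambda> a = of_nat (l a)) \<and> (\<forall>a b. a \<le> b \<longrightarrow> b < N \<longrightarrow> l b \<le> l a)"
proof -
  have nat: "\<Lambda> a \<in> \<nat>" if "a \<le> N - 1" for a
    using that
  proof (induction a rule: inc_induct)
    case (step a)
    then have "\<Lambda> a - \<Lambda> (Suc a) + \<Lambda> (Suc a) \<in> \<nat>"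
      using assms(2) by (intro Nats_add) (auto simp: integral_dominant_def)
    then show ?case by simp
  qed (use assms in auto)
  then have "\<forall>a. \<exists>k. a < N \<longrightarrow> \<Lambda> a = of_nat k"
    by (metis Nats_cases Suc_diff_1 Suc_leI assms(1) not_less_eq not_less Suc_le_mono)
  then obtain l where l: "\<And>a. a < N \<Longrightarrow> \<Lambda> a = of_nat (l a)" by metis
  have "l b \<le> l a" if "a \<le> b" "b < N" for a b
    using that
  proof (induction b rule: dec_induct)
    case (step b)
    obtain k where "\<Lambda> b - \<Lambda> (Suc b) = of_nat k"
      using assms(2) step.prems by (auto simp: integral_dominant_def elim: Nats_cases)
    then have "of_nat (l b) = (of_nat (l (Suc b) + k) :: complex)"
      using l[of b] l[of "Suc b"] step.prems by (simp add: algebra_simps)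
    then have "l b = l (Suc b) + k" by (simp only: of_nat_eq_iff)
    then show ?case using step by simp
  qed simp
  then show ?thesis using l by blast
qed

definition pair_act :: "nat \<Rightarrow> nat \<Rightarrow> (complex mat \<Rightarrow> complex mat) \<Rightarrow> 's set \<Rightarrow> nat \<Rightarrow> nat
    \<Rightarrow> (nat + ('s \<Rightarrow> nat) \<Rightarrow> complex) \<Rightarrow> nat + ('s \<Rightarrow> nat) \<Rightarrow> complex" where
  "pair_act N d \<rho> S a b p = case_sum (mact d (\<rho> (gl_gen N a b)) (p \<circ> Inl)) (vrep N S a b (p \<circ> Inr))"

lemma lin_pair_act: "lin (pair_act N d \<rho> S a b)"
proof -
  have 1: "(\<lambda>w. x w + y w) \<circ> f = (\<lambda>w. (x \<circ> f) w + (y \<circ> f) w)" "(\<lambda>w. c * x w) \<circ> f = (\<lambda>w. c * (x \<circ> f) w)"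
    for x y :: "'u \<Rightarrow> complex" and f :: "'v \<Rightarrow> 'u" and c by auto
  show ?thesis
    unfolding lin_def pair_act_def 1 lin_add[OF lin_mact] lin_scale[OF lin_mact]
      lin_add[OF lin_vrep] lin_scale[OF lin_vrep]
    by (auto simp: fun_eq_iff comp_def split: sum.split)
qed

lemma submodule_vecI:
  assumes "W \<subseteq> carrier_vec d" "0\<^sub>v d \<in> W" "\<And>x y. x \<in> W \<Longrightarrow> y \<in> W \<Longrightarrow> x + y \<in> W"
    "\<And>c x. x \<in> W \<Longrightarrow> c \<cdot>\<^sub>v x \<in> W"
  shows "LinearCombinations.submodule class_ring W (module_vec TYPE(complex) d)"
  using assms by (intro submodule.intro vec_module) (auto simp: module_vec_simps)

lemma irreducible_gl_module_subspace:
  assumes irr: "irreducible_gl_module N d \<rho>" and N: "N > 0" and X: "lsub X"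
    and supp: "\<And>x i. x \<in> X \<Longrightarrow> \<not> i < d \<Longrightarrow> x i = 0"
    and inv: "\<And>x a b. x \<in> X \<Longrightarrow> a < N \<Longrightarrow> b < N \<Longrightarrow> mact d (\<rho> (gl_gen N a b)) x \<in> X"
  shows "X = {\<lambda>_. 0} \<or> X = {x. \<forall>i. \<not> i < d \<longrightarrow> x i = 0}"
proof -
  have \<rho>: "gl_module N d \<rho>" using irr by (simp add: irreducible_gl_module_def)
  define W where "W = vec d ` X"
  have W1: "v \<in> W \<longleftrightarrow> v \<in> carrier_vec d \<and> (\<lambda>i. if i < d then v $ i else 0) \<in> X" for v
  proof
    assume "v \<in> W"
    then obtain x where x: "x \<in> X" "v = vec d x" by (auto simp: W_def)
    moreover have "(\<lambda>i. if i < d then v $ i else 0) = x" using supp[OF x(1)] x(2) by auto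
    ultimately show "v \<in> carrier_vec d \<and> (\<lambda>i. if i < d then v $ i else 0) \<in> X" by simp
  next
    assume v: "v \<in> carrier_vec d \<and> (\<lambda>i. if i < d then v $ i else 0) \<in> X"
    then have "v = vec d (\<lambda>i. if i < d then v $ i else 0)" by (intro eq_vecI) auto
    then show "v \<in> W" using v unfolding W_def by blast
  qed
  have add: "x + y \<in> W" if "x \<in> W" "y \<in> W" for x y
  proof -
    from that obtain x' y' where "x' \<in> X" "x = vec d x'" "y' \<in> X" "y = vec d y'" by (auto simp: W_def)
    moreover from this have "x + y = vec d (\<lambda>w. x' w + y' w)" by auto
    ultimately show ?thesis using lsub_add[OF X, of x' y'] unfolding W_def by blast
  qed
  have scale: "c \<cdot>\<^sub>v x \<in> W" if "x \<in> W" for c x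
  proof -
    from that obtain x' where "x' \<in> X" "x = vec d x'" by (auto simp: W_def)
    moreover from this have "c \<cdot>\<^sub>v x = vec d (\<lambda>w. c * x' w)" by auto
    ultimately show ?thesis using lsub_scale[OF X, of x' c] unfolding W_def by blast
  qed
  have "LinearCombinations.submodule class_ring W (module_vec TYPE(complex) d)"
  proof (rule submodule_vecI)
    have "0\<^sub>v d = vec d (\<lambda>_. 0)" by auto
    then show "0\<^sub>v d \<in> W" using lsub_0[OF X] unfolding W_def by blast
  qed (use add scale in \<open>auto simp: W_def\<close>)
  moreover have "\<forall>w\<in>W. \<rho> A *\<^sub>v w \<in> W" if A: "A \<in> carrier_mat N N" for A
  proof (rule gl_span_induct[OF _ _ _ A N])
    fix a b assume ab: "a < N" "b < N"
    show "\<forall>w\<in>W. \<rho> (gl_gen N a b) *\<^sub>v w \<in> W"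
    proof
      fix w assume "w \<in> W"
      then obtain x where x: "x \<in> X" "w = vec d x" by (auto simp: W_def)
      have "\<rho> (gl_gen N a b) *\<^sub>v w = vec d (mact d (\<rho> (gl_gen N a b)) x)"
        using \<rho> unfolding x(2) by (intro mact_vec[symmetric]) (auto simp: gl_module_def)
      then show "\<rho> (gl_gen N a b) *\<^sub>v w \<in> W" using inv[OF x(1) ab] unfolding W_def by blast
    qed
  next
    fix A B assume AB: "A \<in> carrier_mat N N" "B \<in> carrier_mat N N"
      "\<forall>w\<in>W. \<rho> A *\<^sub>v w \<in> W" "\<forall>w\<in>W. \<rho> B *\<^sub>v w \<in> W"
    have "\<rho> (A + B) *\<^sub>v w = \<rho> A *\<^sub>v w + \<rho> B *\<^sub>v w" if "w \<in> W" for w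
      using \<rho> AB W1 that by (simp add: gl_module_def add_mult_distrib_mat_vec[of _ d d])
    then show "\<forall>w\<in>W. \<rho> (A + B) *\<^sub>v w \<in> W" using AB add by simp
  next
    fix c A assume A: "A \<in> carrier_mat N N" "\<forall>w\<in>W. \<rho> A *\<^sub>v w \<in> W"
    have "\<rho> (c \<cdot>\<^sub>m A) *\<^sub>v w = c \<cdot>\<^sub>v (\<rho> A *\<^sub>v w)" if "w \<in> W" for w
    proof -
      have "\<rho> A \<in> carrier_mat d d" "w \<in> carrier_vec d" using \<rho> A W1 that by (auto simp: gl_module_def)
      then show ?thesis using \<rho> A by (auto simp: gl_module_def smult_scalar_prod_distrib intro!: eq_vecI)
    qed
    then show "\<forall>w\<in>W. \<rho> (c \<cdot>\<^sub>m A) *\<^sub>v w \<in> W" using A scale by simp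
  qed
  ultimately have "W = {0\<^sub>v d} \<or> W = carrier_vec d"
    using irr by (auto simp: irreducible_gl_module_def)
  then show ?thesis
  proof
    assume W: "W = {0\<^sub>v d}"
    have zero: "x = (\<lambda>_. 0)" if "x \<in> X" for x
    proof
      fix i
      have "vec d x = 0\<^sub>v d" using W that by (auto simp: W_def)
      then show "x i = 0" using supp[OF that, of i] by (cases "i < d") (auto dest: arg_cong[of _ _ "\<lambda>v. vec_index v i"])
    qed
    have "X = {\<lambda>_. 0}"
    proof (rule equalityI; rule subsetI)
      show "x \<in> {\<lambda>_. 0}" if "x \<in> X" for x unfolding singleton_iff by (rule zero[OF that])
      show "x \<in> X" if "x \<in> {\<lambda>_. 0}" for x
        using that lsub_0[OF X] unfolding singleton_iff by (simp only:)
    qed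
    then show ?thesis by (rule disjI1)
  next
    assume W: "W = carrier_vec d"
    have "x \<in> X" if "\<forall>i. \<not> i < d \<longrightarrow> x i = 0" for x
    proof -
      have "vec d x \<in> W" using W by simp
      then have "(\<lambda>i. if i < d then vec d x $ i else 0) \<in> X" using W1 by blast
      moreover have "(\<lambda>i. if i < d then vec d x $ i else 0) = x" using that by auto
      ultimately show ?thesis by simp
    qed
    then have "X = {x. \<forall>i. \<not> i < d \<longrightarrow> x i = 0}" using supp by (intro equalityI subsetI CollectI) simp_all
    then show ?thesis by (rule disjI2)
  qed
qed

text \<open>A tensor power of the vector representation has a subspace \<open>Y\<close> that \<open>P\<close> maps onto the module,
  as a homomorphism: both are projections of the submodule of the direct sum generated by the pair of
  highest weight vectors.\<close>

lemma tensor_power_model: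
  assumes N: "N > 0" and dom: "integral_dominant N \<Lambda>" "\<Lambda> (N - 1) \<in> \<nat>" and M: "is_M_Lambda N \<Lambda> d \<rho>"
  shows "\<exists>(S :: (nat \<times> nat) set) P Y. finite S \<and> lsub Y \<and>
    (\<forall>y\<in>Y. \<forall>a<N. \<forall>b<N. vrep N S a b y \<in> Y) \<and>
    (\<forall>y\<in>Y. \<forall>a<N. \<forall>b<N. \<forall>i<d. (\<Sum>w\<in>words N S. P i w * vrep N S a b y w)
       = (\<Sum>k<d. \<rho> (gl_gen N a b) $$ (i, k) * (\<Sum>w\<in>words N S. P k w * y w))) \<and>
    (\<forall>k<d. \<exists>y\<in>Y. \<forall>i<d. (\<Sum>w\<in>words N S. P i w * y w) = (if i = k then 1 else 0))"
proof -
  from dominant_weight_nat[OF N dom] obtain l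
    where "(\<forall>a<N. \<Lambda> a = of_nat (l a)) \<and> (\<forall>a b. a \<le> b \<longrightarrow> b < N \<longrightarrow> l b \<le> l a)" ..
  then have l: "\<And>a. a < N \<Longrightarrow> \<Lambda> a = of_nat (l a)" "\<And>a b. a \<le> b \<Longrightarrow> b < N \<Longrightarrow> l b \<le> l a"
    by simp_all
  define S where "S = young N l"
  have finS: "finite S" using finite_young[of N l] l(2) by (simp add: S_def)
  have irr: "irreducible_gl_module N d \<rho>" using M by (simp add: is_M_Lambda_def)
  have \<rho>: "gl_module N d \<rho>" using irr by (simp add: irreducible_gl_module_def)
  have carr: "\<rho> (gl_gen N a b) \<in> carrier_mat d d" for a b using \<rho> by (simp add: gl_module_def)
  obtain v where v: "highest_weight_vector N d \<rho> \<Lambda> v" using M by (auto simp: is_M_Lambda_def)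
  define x0 where "x0 = (\<lambda>i. if i < d then v $ i else 0)"
  have vx: "v = vec d x0" using v by (auto simp: highest_weight_vector_def x0_def)
  define p0 where "p0 = case_sum x0 (young_vec N l)"
  have p0: "p0 \<circ> Inl = x0" "p0 \<circ> Inr = young_vec N l" by (auto simp: p0_def)
  have mact_x0: "mact d (\<rho> (gl_gen N a b)) x0 i = (if i < d then (\<rho> (gl_gen N a b) *\<^sub>v v) $ i else 0)" for a b i
  proof -
    have "(\<rho> (gl_gen N a b) *\<^sub>v v) $ i = vec d (mact d (\<rho> (gl_gen N a b)) x0) $ i"
      unfolding vx mact_vec[OF carr] ..
    then show ?thesis by (simp add: mact_def)
  qed
  let ?E = "pair_act N d \<rho> S"
  interpret highest_weight_functions N ?E p0 \<Lambda>
  proof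
    fix a b c e p w assume *: "a < N" "b < N" "c < N" "e < N"
    show "?E a b (?E c e p) w = ?E c e (?E a b p) w + (if b = c then ?E a e p w else 0) - (if e = a then ?E c b p w else 0)"
    proof (cases w)
      case (Inl i)
      then show ?thesis using gl_module_mact_bracket[OF \<rho> *, of "p \<circ> Inl" i]
        by (simp add: pair_act_def comp_def)
    next
      case (Inr y)
      then show ?thesis using vrep_bracket[OF *, of S "p \<circ> Inr" y]
        by (simp add: pair_act_def comp_def)
    qed
  next
    fix a b assume "a < b" "b < N"
    then show "?E a b p0 = (\<lambda>_. 0)"
      using v young_vec_vrep[where N = N and l = l and a = a and b = b, OF l(2)]
      by (auto simp: pair_act_def p0 mact_x0 S_def highest_weight_vector_def fun_eq_iff split: sum.split)
  next
    fix a assume a: "a < N"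
    then have "mact d (\<rho> (gl_gen N a a)) x0 i = \<Lambda> a * x0 i" for i
      using v by (simp add: mact_x0 highest_weight_vector_def) (auto simp: x0_def)
    moreover have "vrep N S a a (young_vec N l) y = \<Lambda> a * young_vec N l y" for y
      using young_vec_vrep[where N = N and l = l and a = a and b = a, OF l(2)] l(1) a by (simp add: S_def)
    moreover have "p0 (Inl i) = x0 i" "p0 (Inr y) = young_vec N l y" for i y by (simp_all add: p0_def)
    ultimately show "?E a a p0 = (\<lambda>w. \<Lambda> a * p0 w)"
      by (auto simp: pair_act_def p0 fun_eq_iff split: sum.split)
  qed (rule lin_pair_act)
  have supp: "(\<forall>i. \<not> i < d \<longrightarrow> p (Inl i) = 0) \<and> (\<forall>w. w \<notin> words N S \<longrightarrow> p (Inr w) = 0)" if "p \<in> cyc" for p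
    using that
  proof (induction rule: cyc.induct)
    case base
    then show ?case by (auto simp: p0_def x0_def young_vec_def S_def)
  next
    case (lowering p b a)
    then show ?case by (auto simp: pair_act_def mact_def intro!: vrep_support)
  qed auto
  note lsubs = lsub_add[OF lsub_cyc] lsub_scale[OF lsub_cyc] lsub_0[OF lsub_cyc]
  \<comment> \<open>The intersection of the generated submodule with the first summand; being a
    submodule of an irreducible module, it is zero or everything.\<close>
  define U where "U = {x. case_sum x (\<lambda>_. 0) \<in> cyc}"
  have U01: "U = {\<lambda>_. 0} \<or> U = {x. \<forall>i. \<not> i < d \<longrightarrow> x i = 0}"
  proof (rule irreducible_gl_module_subspace[OF irr N])
    have *: "case_sum (\<lambda>w. x w + y w) (\<lambda>_. 0) = (\<lambda>w. case_sum x (\<lambda>_. 0) w + case_sum y (\<lambda>_. 0) w)"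
      "case_sum (\<lambda>w. c * x w) (\<lambda>_. 0) = (\<lambda>w. c * case_sum x (\<lambda>_. 0) w)"
      "case_sum (\<lambda>w. 0) (\<lambda>_. 0) = (\<lambda>w. 0)" for x y :: "nat \<Rightarrow> complex" and c
      by (auto simp: fun_eq_iff split: sum.split)
    show "lsub U" unfolding lsub_def U_def mem_Collect_eq * using lsubs by (auto simp: *)
    show "x i = 0" if "x \<in> U" "\<not> i < d" for x i
      using supp[OF that(1)[unfolded U_def mem_Collect_eq]] that(2) by simp
    show "mact d (\<rho> (gl_gen N a b)) x \<in> U" if "x \<in> U" "a < N" "b < N" for x a b
    proof -
      have "?E a b (case_sum x (\<lambda>_. 0)) \<in> cyc" by (rule cyc_invariant) (use that in \<open>auto simp: U_def\<close>)
      moreover have "?E a b (case_sum x (\<lambda>_. 0)) = case_sum (mact d (\<rho> (gl_gen N a b)) x) (\<lambda>_. 0)"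
        by (auto simp: pair_act_def comp_def fun_eq_iff lin_0[OF lin_vrep] split: sum.split)
      ultimately show ?thesis by (simp add: U_def)
    qed
  qed
  \<comment> \<open>The pair \<open>(x0, 0)\<close> is an \<open>h\<close>-eigenvector for
    \<open>h0\<close>, so inside \<open>cyc\<close> it would be a multiple of the pair
    \<open>p0\<close>. The second component forces that multiple to be 0, and then
    \<open>x0 = 0\<close>.\<close>
  have x0U: "x0 \<notin> U"
  proof
    assume "x0 \<in> U"
    define q where "q = case_sum x0 (\<lambda>_ :: nat \<times> nat \<Rightarrow> nat. 0 :: complex)"
    have q: "q \<in> cyc" using \<open>x0 \<in> U\<close> by (simp add: U_def q_def)
    have "h q = (\<lambda>w. h0 * q w)"
    proof
      fix w
      show "h q w = h0 * q w"
      proof (cases w)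
        case (Inl i)
        have "h q w = h p0 w" by (simp add: h_def Inl pair_act_def q_def p0_def comp_def)
        also have "\<dots> = h0 * p0 w" by (simp add: h_p0)
        finally show ?thesis by (simp add: Inl p0_def q_def)
      next
        case (Inr i)
        then show ?thesis by (simp add: h_def pair_act_def q_def comp_def lin_0[OF lin_vrep])
      qed
    qed
    from cyc_top_weight[OF q this] obtain c where c: "q = (\<lambda>w. c * p0 w)" by blast
    obtain y where y: "young_vec N l y \<noteq> 0" using young_vec_nonzero[where N = N and l = l, OF l(2)] by blast
    have "c = 0" using fun_cong[OF c, of "Inr y"] y by (simp add: q_def p0_def)
    then have "x0 i = 0" for i using fun_cong[OF c, of "Inl i"] by (simp add: q_def)
    then have "v = 0\<^sub>v d" using vx by auto
    then show False using v by (simp add: highest_weight_vector_def)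
  qed
  have U0: "U = {\<lambda>_. 0}"
    using U01
  proof
    assume "U = {x. \<forall>i. \<not> i < d \<longrightarrow> x i = 0}"
    then have "x0 \<in> U" by (simp add: x0_def)
    then show ?thesis using x0U by contradiction
  qed
  \<comment> \<open>The projection to the irreducible module; it contains \<open>x0\<close> and
    hence is everything.\<close>
  define X where "X = {x. \<exists>y. case_sum x y \<in> cyc}"
  have pairs: "case_sum (\<lambda>w. x w + x' w) (\<lambda>w. y w + y' w) = (\<lambda>w. case_sum x y w + case_sum x' y' w)"
      "case_sum (\<lambda>w. c * x w) (\<lambda>w. c * y w) = (\<lambda>w. c * case_sum x y w)"
      for x x' :: "nat \<Rightarrow> complex" and y y' :: "(nat \<times> nat \<Rightarrow> nat) \<Rightarrow> complex" and c
      by (auto simp: fun_eq_iff split: sum.split)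
  have pair_add: "case_sum (\<lambda>w. x w + x' w) (\<lambda>w. y w + y' w) \<in> cyc" if "case_sum x y \<in> cyc" "case_sum x' y' \<in> cyc" for x x' y y'
    unfolding pairs by (rule lsubs that)+
  have pair_scale: "case_sum (\<lambda>w. c * x w) (\<lambda>w. c * y w) \<in> cyc" if "case_sum x y \<in> cyc" for x y c
    unfolding pairs by (rule lsubs that)+
  have pair_0: "case_sum (\<lambda>w. 0) (\<lambda>w. 0) \<in> cyc"
    using pair_scale[of x0 "young_vec N l" 0] base by (simp add: p0_def[symmetric])
  have pair_inv: "case_sum (mact d (\<rho> (gl_gen N a b)) x) (vrep N S a b y) \<in> cyc"
    if "case_sum x y \<in> cyc" "a < N" "b < N" for x y a b
    using cyc_invariant[OF that] by (simp add: pair_act_def comp_def)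
  have X01: "X = {\<lambda>_. 0} \<or> X = {x. \<forall>i. \<not> i < d \<longrightarrow> x i = 0}"
  proof (rule irreducible_gl_module_subspace[OF irr N])
    show "lsub X" unfolding lsub_def X_def mem_Collect_eq
      by (safe, rule exI, rule pair_0, rule exI, rule pair_add, assumption, assumption, rule exI, rule pair_scale, assumption)
    show "x i = 0" if x: "x \<in> X" and i: "\<not> i < d" for x i
    proof -
      from x obtain y where "case_sum x y \<in> cyc" unfolding X_def by (elim CollectE exE)
      from supp[OF this] show ?thesis using i by simp
    qed
    show "mact d (\<rho> (gl_gen N a b)) x \<in> X" if "x \<in> X" "a < N" "b < N" for x a b
    proof -
      from that(1) obtain y where "case_sum x y \<in> cyc" unfolding X_def by (elim CollectE exE)
      from pair_inv[OF this that(2,3)] show ?thesis unfolding X_def by (intro CollectI exI)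
    qed
  qed
  have base0: "case_sum x0 (young_vec N l) \<in> cyc" unfolding p0_def[symmetric] by (rule base)
  have x0X: "x0 \<in> X" unfolding X_def by (rule CollectI, rule exI, rule base0)
  have "x0 \<noteq> (\<lambda>_. 0)"
  proof
    assume "x0 = (\<lambda>_. 0)"
    then have "v = 0\<^sub>v d" using vx by auto
    then show False using v by (simp add: highest_weight_vector_def)
  qed
  then have "X \<noteq> {\<lambda>_. 0}" using x0X by (auto simp only: singleton_iff)
  then have X: "X = {x. \<forall>i. \<not> i < d \<longrightarrow> x i = 0}" using X01 by simp
  define Y where "Y = {y. \<exists>x. case_sum x y \<in> cyc}"
  \<comment> \<open>As \<open>U\<close> is zero, \<open>cyc\<close> is the graph of a map on
    \<open>Y\<close>, and the choice is unique.\<close>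
  define \<pi> where "\<pi> y = (SOME x. case_sum x y \<in> cyc)" for y
  have \<pi>: "case_sum (\<pi> y) y \<in> cyc" if "y \<in> Y" for y
    using that unfolding \<pi>_def Y_def mem_Collect_eq by (rule someI_ex)
  have \<pi>_unique: "\<pi> y = x" if "case_sum x y \<in> cyc" for x y
  proof -
    have y: "y \<in> Y" unfolding Y_def by (rule CollectI, rule exI, rule that)
    have "case_sum (\<lambda>w. \<pi> y w + (- 1) * x w) (\<lambda>w. y w + (- 1) * y w) \<in> cyc"
      using pair_add[OF \<pi>[OF y] pair_scale[OF that, of "- 1"]] .
    then have "(\<lambda>w. \<pi> y w + (- 1) * x w) \<in> U" by (simp add: U_def)
    then have "(\<lambda>w. \<pi> y w + (- 1) * x w) = (\<lambda>_. 0)" unfolding U0 singleton_iff .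
    then show ?thesis by (auto simp: fun_eq_iff)
  qed
  have Ysub: "lsub Y" unfolding lsub_def Y_def mem_Collect_eq
      by (safe, rule exI, rule pair_0, rule exI, rule pair_add, assumption, assumption, rule exI, rule pair_scale, assumption)
  \<comment> \<open>The map is given on \<open>Y\<close> only. Its coordinates are written as
    coefficient sums over words, since in this form maps for several factors can be
    multiplied.\<close>
  have functional: "\<exists>P. \<forall>y\<in>Y. \<pi> y i = (\<Sum>w\<in>words N S. P w * y w)" for i
  proof (rule functional_on_finite_support)
    show "finite (words N S)" by (rule finite_words[OF finS])
    show "y w = 0" if "y \<in> Y" "w \<notin> words N S" for y w using supp[OF \<pi>[OF that(1)]] that(2) by simp
    show "\<pi> (\<lambda>w. x w + y w) i = \<pi> x i + \<pi> y i" if "x \<in> Y" "y \<in> Y" for x y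
      using \<pi>_unique[OF pair_add[OF \<pi>[OF that(1)] \<pi>[OF that(2)]]] by simp
    show "\<pi> (\<lambda>w. c * y w) i = c * \<pi> y i" if "y \<in> Y" for c y
      using \<pi>_unique[OF pair_scale[OF \<pi>[OF that], of c]] by simp
  qed (rule Ysub)
  from choice[OF allI, OF functional] obtain P
    where "\<forall>i. \<forall>y\<in>Y. \<pi> y i = (\<Sum>w\<in>words N S. P i w * y w)" ..
  then have P: "\<pi> y i = (\<Sum>w\<in>words N S. P i w * y w)" if "y \<in> Y" for i y using that by simp
  have inv: "vrep N S a b y \<in> Y" "\<pi> (vrep N S a b y) = mact d (\<rho> (gl_gen N a b)) (\<pi> y)"
    if "y \<in> Y" "a < N" "b < N" for a b y
    unfolding Y_def
    by (rule CollectI, rule exI, rule pair_inv[OF \<pi>[OF that(1)] that(2,3)])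
      (rule \<pi>_unique[OF pair_inv[OF \<pi>[OF that(1)] that(2,3)]])
  have "\<exists>y\<in>Y. \<forall>i<d. (\<Sum>w\<in>words N S. P i w * y w) = (if i = k then 1 else 0)" if "k < d" for k
  proof -
    have "(\<lambda>i. if i = k then 1 else 0) \<in> X" using that by (auto simp: X)
    then obtain y where y: "case_sum (\<lambda>i. if i = k then 1 else 0) y \<in> cyc" unfolding X_def by (elim CollectE exE)
    have Y: "y \<in> Y" unfolding Y_def by (rule CollectI, rule exI, rule y)
    show ?thesis by (rule bexI[OF _ Y]) (simp add: P[OF Y, symmetric] \<pi>_unique[OF y])
  qed
  moreover have "(\<Sum>w\<in>words N S. P i w * vrep N S a b y w)
       = (\<Sum>k<d. \<rho> (gl_gen N a b) $$ (i, k) * (\<Sum>w\<in>words N S. P k w * y w))"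
    if "y \<in> Y" "a < N" "b < N" "i < d" for y a b i
    using P[OF inv(1)[OF that(1-3)], of i] inv(2)[OF that(1-3)] P[OF that(1)] that(4) by (simp add: mact_def)
  ultimately show ?thesis using finS Ysub inv(1) by (intro exI[of _ S] exI[of _ P] exI[of _ Y] conjI ballI allI impI)
qed

section \<open>Kronecker products and the total tensor product\<close>

text \<open>The lexicographic index of a basis tensor is a mixed radix number.
  \<open>dim_after n d (Suc l)\<close> is the place value of factor \<open>l\<close>, and
  \<open>digit n d l\<close> its digit, the index in that factor.\<close>

definition dim_after :: "nat \<Rightarrow> (nat \<Rightarrow> nat) \<Rightarrow> nat \<Rightarrow> nat" where
  "dim_after n d m = (\<Prod>l\<in>{m..<n}. d l)"

definition digit :: "nat \<Rightarrow> (nat \<Rightarrow> nat) \<Rightarrow> nat \<Rightarrow> nat \<Rightarrow> nat" where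
  "digit n d l i = (i div dim_after n d (Suc l)) mod d l"

lemma dim_after_rec: "m < n \<Longrightarrow> dim_after n d m = d m * dim_after n d (Suc m)"
  by (simp add: dim_after_def prod.atLeast_Suc_lessThan)

lemma dim_after_end [simp]: "dim_after n d n = 1"
  by (simp add: dim_after_def)

lemma tensor_dim_eq: "tensor_dim n d = dim_after n d 0"
  by (simp add: tensor_dim_def dim_after_def lessThan_atLeast0)

lemma dim_after_dvd:
  assumes "m \<le> l" "l < n"
  shows "\<exists>c. dim_after n d m = c * (d l * dim_after n d (Suc l))"
  using assms
proof (induction m rule: inc_induct)
  case base
  then show ?case by (auto simp: dim_after_rec intro: exI[of _ 1])
next
  case (step m)
  then obtain c where "dim_after n d (Suc m) = c * (d l * dim_after n d (Suc l))" by auto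
  then show ?case using step by (intro exI[of _ "d m * c"]) (simp add: dim_after_rec)
qed

lemma digit_mod:
  assumes "m \<le> l" "l < n" "\<And>j. j < n \<Longrightarrow> d j > 0"
  shows "digit n d l (i mod dim_after n d m) = digit n d l i"
proof -
  define E where "E = dim_after n d (Suc l)"
  have E: "E > 0" using assms(3) by (auto simp: E_def dim_after_def)
  obtain c where c: "dim_after n d m = c * (d l * E)" using dim_after_dvd[OF assms(1,2)] by (auto simp: E_def)
  define q r where "q = i div dim_after n d m" and "r = i mod dim_after n d m"
  have "i = q * dim_after n d m + r" by (simp add: q_def r_def)
  then have "i = r + (q * c * d l) * E" by (simp add: c mult_ac)
  then have "i div E = (r + (q * c * d l) * E) div E" by (rule arg_cong)
  also have "\<dots> = q * c * d l + r div E" using E by (intro div_mult_self1) simp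
  finally have "i div E = r div E + q * c * d l" by simp
  then show ?thesis unfolding digit_def E_def[symmetric] r_def[symmetric] by simp
qed

lemma digit_first:
  assumes "m < n" "i < dim_after n d m"
  shows "digit n d m i = i div dim_after n d (Suc m)"
  using assms by (simp add: digit_def dim_after_rec less_mult_imp_div_less)

lemma digit_less: "d l > 0 \<Longrightarrow> digit n d l i < d l"
  by (simp add: digit_def)

lemma digits_eq:
  assumes "m \<le> n" "\<And>j. j < n \<Longrightarrow> d j > 0" "i < dim_after n d m" "k < dim_after n d m"
    "\<And>l. m \<le> l \<Longrightarrow> l < n \<Longrightarrow> digit n d l i = digit n d l k"
  shows "i = k"
  using assms
proof (induction m arbitrary: i k rule: inc_induct)
  case base
  then show ?case by simp
next
  case (step m)
  define E where "E = dim_after n d (Suc m)"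
  have E: "E > 0" using step.prems(1) by (auto simp: E_def dim_after_def)
  have "i div E = k div E" using step.prems(4)[of m] step.hyps step.prems(2,3)
    by (simp add: digit_first E_def)
  moreover have "i mod dim_after n d (Suc m) = k mod dim_after n d (Suc m)"
  proof (rule step.IH)
    show "digit n d l (i mod dim_after n d (Suc m)) = digit n d l (k mod dim_after n d (Suc m))"
      if "Suc m \<le> l" "l < n" for l
      using step.prems(4)[of l] that step.prems(1)
        digit_mod[where m = "Suc m" and n = n and l = l and d = d and i = i]
        digit_mod[where m = "Suc m" and n = n and l = l and d = d and i = k] by simp
  qed (use step.prems(1) E in \<open>simp_all add: E_def\<close>)
  ultimately show ?case unfolding E_def by (metis div_mult_mod_eq)
qed

lemma sum_mixed_radix:
  fixes g :: "nat \<Rightarrow> 'a::comm_monoid_add"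
  shows "(\<Sum>k<m * E. g k) = (\<Sum>a<m. \<Sum>r<E. g (a * E + r))"
proof -
  have "(\<Sum>r<E. g (a * E + r)) = sum g {a * E..<a * E + E}" for a
    using sum.shift_bounds_nat_ivl[of g 0 "a * E" E] by (simp add: lessThan_atLeast0 add.commute)
  then show ?thesis by (simp add: sum.nat_group)
qed

lemma kronecker_carrier:
  "A \<in> carrier_mat a a \<Longrightarrow> B \<in> carrier_mat b b \<Longrightarrow> kronecker A B \<in> carrier_mat (a * b) (a * b)"
  by (auto simp: kronecker_def)

text \<open>On pure tensors the factors act separately. The induction is over suffixes of the list
  of factors: an index splits into its first digit \<open>i div E\<close> and the index
  \<open>i mod E\<close> of the remaining factors.\<close>

lemma foldr_kronecker_pure:
  assumes "m \<le> n" and d: "\<And>j. j < n \<Longrightarrow> d j > 0" and B: "\<And>l. l < n \<Longrightarrow> B l \<in> carrier_mat (d l) (d l)"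
  defines "T \<equiv> \<lambda>m. foldr kronecker (map B [m..<n]) (1\<^sub>m 1)"
  shows "T m \<in> carrier_mat (dim_after n d m) (dim_after n d m) \<and>
    (\<forall>i<dim_after n d m. (\<Sum>k<dim_after n d m. T m $$ (i, k) * (\<Prod>l\<in>{m..<n}. x l (digit n d l k)))
      = (\<Prod>l\<in>{m..<n}. \<Sum>k<d l. B l $$ (digit n d l i, k) * x l k))"
  using assms(1)
proof (induction m rule: inc_induct)
  case base
  then show ?case by (simp add: T_def)
next
  case (step m)
  define E where "E = dim_after n d (Suc m)"
  have E: "E > 0" using d by (auto simp: E_def dim_after_def)
  have D: "dim_after n d m = d m * E" using step.hyps by (simp add: dim_after_rec E_def)
  have Tm: "T m = kronecker (B m) (T (Suc m))" using step.hyps by (simp add: T_def upt_conv_Cons)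
  have T1: "T (Suc m) \<in> carrier_mat E E" using step.IH by (simp add: E_def)
  have carr: "T m \<in> carrier_mat (d m * E) (d m * E)"
    unfolding Tm by (rule kronecker_carrier[OF B T1]) (use step.hyps in simp)
  have entry: "T m $$ (i, a * E + r) = B m $$ (i div E, a) * T (Suc m) $$ (i mod E, r)"
    if "i < d m * E" "a < d m" "r < E" for i a r
  proof -
    have "a * E + r < Suc a * E" using that by simp
    also have "\<dots> \<le> d m * E" using that(2) by (intro mult_le_mono1) simp
    finally have "a * E + r < d m * E" .
    moreover have "(a * E + r) div E = a" "(a * E + r) mod E = r" using that(3) E by simp_all
    ultimately show ?thesis
      using that(1) B[of m] T1 step.hyps unfolding Tm kronecker_def by auto
  qed
  have dig1: "digit n d m (a * E + r) = a" if "a < d m" "r < E" for a r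
    using that E by (simp add: digit_def E_def[symmetric])
  have dig2: "digit n d l (a * E + r) = digit n d l r" if "Suc m \<le> l" "l < n" "r < E" for l a r
  proof -
    have "(a * E + r) mod E = r" using that(3) by simp
    then show ?thesis
      using that d digit_mod[where m = "Suc m" and n = n and l = l and d = d and i = "a * E + r"] by (simp add: E_def)
  qed
  have split: "(\<Prod>l\<in>{m..<n}. f l) = f m * (\<Prod>l\<in>{Suc m..<n}. f l)" for f :: "nat \<Rightarrow> complex"
    using step.hyps(2) by (rule prod.atLeast_Suc_lessThan)
  show ?case
  proof (intro conjI allI impI)
    show "T m \<in> carrier_mat (dim_after n d m) (dim_after n d m)" using carr D by simp
    fix i assume "i < dim_after n d m"
    then have i: "i < d m * E" by (simp add: D)
    have iE: "i div E = digit n d m i" using \<open>i < dim_after n d m\<close> step.hyps by (simp add: digit_first E_def)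
    have "(\<Sum>k<dim_after n d m. T m $$ (i, k) * (\<Prod>l\<in>{m..<n}. x l (digit n d l k)))
      = (\<Sum>a<d m. \<Sum>r<E. (B m $$ (i div E, a) * x m a) *
          (T (Suc m) $$ (i mod E, r) * (\<Prod>l\<in>{Suc m..<n}. x l (digit n d l r))))"
      unfolding D sum_mixed_radix
    proof (intro sum.cong refl)
      fix a r assume ar: "a \<in> {..<d m}" "r \<in> {..<E}"
      have "(\<Prod>l\<in>{Suc m..<n}. x l (digit n d l (a * E + r))) = (\<Prod>l\<in>{Suc m..<n}. x l (digit n d l r))"
        using ar by (intro prod.cong) (auto simp: dig2)
      then show "T m $$ (i, a * E + r) * (\<Prod>l\<in>{m..<n}. x l (digit n d l (a * E + r)))
        = (B m $$ (i div E, a) * x m a) *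
          (T (Suc m) $$ (i mod E, r) * (\<Prod>l\<in>{Suc m..<n}. x l (digit n d l r)))"
        using ar i by (simp add: entry split dig1)
    qed
    also have "\<dots> = (\<Sum>a<d m. B m $$ (i div E, a) * x m a) *
        (\<Sum>r<E. T (Suc m) $$ (i mod E, r) * (\<Prod>l\<in>{Suc m..<n}. x l (digit n d l r)))"
      by (simp add: sum_product)
    also have "(\<Sum>r<E. T (Suc m) $$ (i mod E, r) * (\<Prod>l\<in>{Suc m..<n}. x l (digit n d l r)))
        = (\<Prod>l\<in>{Suc m..<n}. \<Sum>k<d l. B l $$ (digit n d l (i mod E), k) * x l k)"
      using step.IH E by (simp add: E_def)
    also have "\<dots> = (\<Prod>l\<in>{Suc m..<n}. \<Sum>k<d l. B l $$ (digit n d l i, k) * x l k)"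
      unfolding E_def by (intro prod.cong refl) (auto simp: digit_mod d)
    finally show "(\<Sum>k<dim_after n d m. T m $$ (i, k) * (\<Prod>l\<in>{m..<n}. x l (digit n d l k)))
      = (\<Prod>l\<in>{m..<n}. \<Sum>k<d l. B l $$ (digit n d l i, k) * x l k)"
      unfolding split iE .
  qed
qed

lemma slot_gen_pure:
  assumes d: "\<And>j. j < n \<Longrightarrow> d j > 0" and j: "j < n" and \<rho>: "\<rho> j (gl_gen N a b) \<in> carrier_mat (d j) (d j)"
    and i: "i < tensor_dim n d"
  shows "(\<Sum>k<tensor_dim n d. slot_gen N n d \<rho> j a b $$ (i, k) * (\<Prod>l<n. x l (digit n d l k)))
    = (\<Prod>l<n. if l = j then \<Sum>k<d j. \<rho> j (gl_gen N a b) $$ (digit n d j i, k) * x j k else x l (digit n d l i))"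
proof -
  define B where "B l = (if l = j then \<rho> j (gl_gen N a b) else 1\<^sub>m (d l))" for l
  have "(\<Sum>k<d l. B l $$ (digit n d l i, k) * x l k)
      = (if l = j then \<Sum>k<d j. \<rho> j (gl_gen N a b) $$ (digit n d j i, k) * x j k else x l (digit n d l i))"
    if "l < n" for l
  proof (cases "l = j")
    case False
    have less: "digit n d l i < d l" by (rule digit_less) (rule d[OF that])
    have "(\<Sum>k<d l. B l $$ (digit n d l i, k) * x l k) = (\<Sum>k<d l. if k = digit n d l i then x l k else 0)"
      using False less by (intro sum.cong) (auto simp: B_def)
    then show ?thesis using False less by simp
  qed (simp add: B_def)
  moreover have "(\<Sum>k<tensor_dim n d. slot_gen N n d \<rho> j a b $$ (i, k) * (\<Prod>l<n. x l (digit n d l k)))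
    = (\<Prod>l<n. \<Sum>k<d l. B l $$ (digit n d l i, k) * x l k)"
  proof -
    have "B l \<in> carrier_mat (d l) (d l)" for l using \<rho> by (simp add: B_def)
    from foldr_kronecker_pure[where m = 0 and B = B and x = x, OF _ d this] i show ?thesis
      by (simp add: tensor_dim_eq slot_gen_def B_def[abs_def] lessThan_atLeast0)
  qed
  ultimately show ?thesis by simp
qed

lemma slot_gen_carrier:
  assumes d: "\<And>j. j < n \<Longrightarrow> d j > 0" and \<rho>: "\<rho> j (gl_gen N a b) \<in> carrier_mat (d j) (d j)"
  shows "slot_gen N n d \<rho> j a b \<in> carrier_mat (tensor_dim n d) (tensor_dim n d)"
proof -
  define B where "B l = (if l = j then \<rho> j (gl_gen N a b) else 1\<^sub>m (d l))" for l
  have "B l \<in> carrier_mat (d l) (d l)" for l using \<rho> by (simp add: B_def)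
  from foldr_kronecker_pure[where m = 0 and B = B, OF _ d this] show ?thesis
    by (simp add: tensor_dim_eq slot_gen_def B_def[abs_def])
qed

section \<open>Reduction to tensor powers of the vector representation\<close>

lemma Xf_slice:
  assumes Q: "lsub Q" and e: "\<And>s x. s \<in> S \<Longrightarrow> x \<in> Q \<Longrightarrow> e s b a x \<in> Q" and f: "\<And>i. slice f i \<in> Q"
  shows "slice (Xf K S g e a b f) m \<in> Q"
proof -
  have 1: "(\<lambda>w. if a = b then of_nat (m + 1) * slice f (m + 1) w else 0) \<in> Q"
    using lsub_scale[OF Q f, of "of_nat (m + 1)" "m + 1"] lsub_0[OF Q] by (cases "a = b") simp_all
  have 2: "(\<lambda>w. - K a b * slice f m w) \<in> Q"
    by (rule lsub_scale[OF Q f])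
  have es: "e s b a (slice f i) \<in> Q" if "s \<in> S" for s i by (rule e[OF that f])
  have 3: "(\<lambda>w. \<Sum>s\<in>S. \<Sum>i=0..m. - fps_nth (g s) i * e s b a (slice f (m - i)) w) \<in> Q"
    by (intro lsub_sum[OF Q] lsub_scale[OF Q] es)
  have "slice (Xf K S g e a b f) m = (\<lambda>w. (if a = b then of_nat (m + 1) * slice f (m + 1) w else 0)
      + (- K a b * slice f m w + (\<Sum>s\<in>S. \<Sum>i=0..m. - fps_nth (g s) i * e s b a (slice f (m - i)) w)))"
    by (auto simp: slice_def Xf_def fps_sum_nth fps_mult_nth[of "g _"] cl_nth fun_eq_iff sum_negf)
  then show ?thesis using lsub_add[OF Q 1 lsub_add[OF Q 2 3]] by simp
qed

text \<open>The map from a tensor power is known to be a homomorphism only on a submodule. Hence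
  intertwining is assumed on \<open>Q\<close>, and every intermediate series has to be kept in
  \<open>Q\<close>.\<close>

lemma Df_natural_on:
  assumes \<phi>: "lin \<phi>" and Q: "lsub Q"
    and inv: "\<And>s a b x. s \<in> S \<Longrightarrow> a < N \<Longrightarrow> b < N \<Longrightarrow> x \<in> Q \<Longrightarrow> e s a b x \<in> Q"
    and e: "\<And>s a b x. s \<in> S \<Longrightarrow> a < N \<Longrightarrow> b < N \<Longrightarrow> x \<in> Q \<Longrightarrow> e' s a b (\<phi> x) = \<phi> (e s a b x)"
    and f: "\<And>i. slice f i \<in> Q"
  shows "Df N K S g e' (cl \<phi> f) = cl \<phi> (Df N K S g e f)"
proof -
  have X: "Xf K S g e' a b (cl \<phi> h) = cl \<phi> (Xf K S g e a b h)"
    if "a < N" "b < N" and h: "\<And>i. slice h i \<in> Q" for a b h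
  proof -
    have "e' s b a (\<phi> (slice h i)) = \<phi> (e s b a (slice h i))" if "s \<in> S" for s i
      by (rule e[OF that \<open>b < N\<close> \<open>a < N\<close> h])
    then have "cl (e' s b a) (cl \<phi> h) = cl \<phi> (cl (e s b a) h)" if "s \<in> S" for s
      using that unfolding cl_comp by (auto simp: slice_def fun_eq_iff cl_nth intro!: fps_ext)
    then have 1: "(\<Sum>s\<in>S. g s * cl (e' s b a) (cl \<phi> h) w) = cl \<phi> (\<lambda>w. \<Sum>s\<in>S. g s * cl (e s b a) h w) w" for w
      using \<phi> by (simp add: cl_sum cl_mult)
    show ?thesis unfolding Xf_def 1 using \<phi>
      by (cases "a = b") (simp_all add: cl_diff cl_mult cl_deriv cl_uminus)
  qed
  have "foldr (\<lambda>a h. Xf K S g e' a (\<sigma> a) h) as (cl \<phi> f) = cl \<phi> (foldr (\<lambda>a h. Xf K S g e a (\<sigma> a) h) as f)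
      \<and> (\<forall>i. slice (foldr (\<lambda>a h. Xf K S g e a (\<sigma> a) h) as f) i \<in> Q)"
    if "\<sigma> permutes {..<N}" "set as \<subseteq> {..<N}" for \<sigma> as
    using that(2)
  proof (induction as)
    case (Cons a as)
    define h where "h = foldr (\<lambda>a h. Xf K S g e a (\<sigma> a) h) as f"
    have h: "slice h i \<in> Q" "foldr (\<lambda>a h. Xf K S g e' a (\<sigma> a) h) as (cl \<phi> f) = cl \<phi> h" for i
      using Cons by (simp_all add: h_def)
    have a: "a < N" "\<sigma> a < N" using Cons.prems that(1) permutes_in_image[of \<sigma> "{..<N}" a] by auto
    have "slice (Xf K S g e a (\<sigma> a) h) i \<in> Q" for i
      by (rule Xf_slice[OF Q inv]) (use a h in auto)
    then show ?case using X[OF a h(1)] by (simp add: h(2) flip: h_def)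
  qed (simp add: f)
  then have 1: "of_int (sign \<sigma>) * foldr (\<lambda>a h. Xf K S g e' a (\<sigma> a) h) [0..<N] (cl \<phi> f) w
      = cl \<phi> (\<lambda>w. of_int (sign \<sigma>) * foldr (\<lambda>a h. Xf K S g e a (\<sigma> a) h) [0..<N] f w) w"
    if "\<sigma> permutes {..<N}" for \<sigma> w
    using that \<phi> by (simp add: cl_mult subset_iff)
  show ?thesis unfolding Df_def cl_sum[OF \<phi>] by (intro ext sum.cong refl) (simp add: 1)
qed

text \<open>A slot of the total tensor power is a pair of a factor \<open>j\<close> and a slot of
  the model of that factor.\<close>

definition loc :: "'j \<Rightarrow> ('j \<times> 's \<Rightarrow> nat) \<Rightarrow> 's \<Rightarrow> nat" where
  "loc j w = (\<lambda>s. w (j, s))"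

definition pure :: "nat \<Rightarrow> (nat \<Rightarrow> ('s \<Rightarrow> nat) \<Rightarrow> complex) \<Rightarrow> (nat \<times> 's \<Rightarrow> nat) \<Rightarrow> complex" where
  "pure n y = (\<lambda>w. \<Prod>j<n. y j (loc j w))"

definition vrep_at :: "nat \<Rightarrow> (nat \<Rightarrow> 's set) \<Rightarrow> nat \<Rightarrow> nat \<Rightarrow> nat
    \<Rightarrow> ((nat \<times> 's \<Rightarrow> nat) \<Rightarrow> complex) \<Rightarrow> (nat \<times> 's \<Rightarrow> nat) \<Rightarrow> complex" where
  "vrep_at N S j a b \<phi> = (\<lambda>w. \<Sum>s\<in>S j. epsV N (j, s) a b \<phi> w)"

text \<open>The tensor product of the subspaces \<open>Y j\<close>, realised as the span of pure
  tensors among the word functions.\<close>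

inductive_set tens :: "nat \<Rightarrow> (nat \<Rightarrow> (('s \<Rightarrow> nat) \<Rightarrow> complex) set) \<Rightarrow> ((nat \<times> 's \<Rightarrow> nat) \<Rightarrow> complex) set"
  for n Y where
  tens_0: "(\<lambda>_. 0) \<in> tens n Y"
| tens_add: "x \<in> tens n Y \<Longrightarrow> y \<in> tens n Y \<Longrightarrow> (\<lambda>w. x w + y w) \<in> tens n Y"
| tens_scale: "x \<in> tens n Y \<Longrightarrow> (\<lambda>w. c * x w) \<in> tens n Y"
| tens_pure: "(\<And>j. j < n \<Longrightarrow> y j \<in> Y j) \<Longrightarrow> pure n y \<in> tens n Y"

lemma lsub_tens: "lsub (tens n Y)"
  by (auto simp: lsub_def intro: tens_0 tens_add tens_scale)

lemma lin_vrep_at: "lin (vrep_at N S j a b)"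
  unfolding lin_def vrep_at_def lin_add[OF lin_epsV] lin_scale[OF lin_epsV] sum.distrib sum_distrib_left
  by simp

lemma vrep_at_pure:
  fixes y :: "nat \<Rightarrow> ('s \<Rightarrow> nat) \<Rightarrow> complex"
  assumes "j < n"
  shows "vrep_at N S j a b (pure n y) = pure n (y(j := vrep N (S j) a b (y j)))"
proof
  fix w :: "nat \<times> 's \<Rightarrow> nat"
  have split: "pure n y' w = y' j (loc j w) * (\<Prod>l\<in>{..<n} - {j}. y' l (loc l w))" for y' w
    unfolding pure_def using assms by (intro prod.remove) auto
  have put: "loc j (put N (j, s) b w) = put N s b (loc j w)"
    "l \<noteq> j \<Longrightarrow> loc l (put N (j, s) b w) = loc l w" for s l
    by (auto simp: loc_def put_def)
  have "epsV N (j, s) a b (pure n y) w = epsV N s a b (y j) (loc j w) * (\<Prod>l\<in>{..<n} - {j}. y l (loc l w))" for s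
  proof -
    have "(\<Prod>l\<in>{..<n} - {j}. y l (loc l (put N (j, s) b w))) = (\<Prod>l\<in>{..<n} - {j}. y l (loc l w))"
      by (intro prod.cong) (auto simp: put)
    then show ?thesis unfolding epsV_def split put by (simp add: letter_def loc_def)
  qed
  then have "vrep_at N S j a b (pure n y) w = vrep N (S j) a b (y j) (loc j w) * (\<Prod>l\<in>{..<n} - {j}. y l (loc l w))"
    by (simp add: vrep_at_def vrep_def sum_distrib_right)
  then show "vrep_at N S j a b (pure n y) w = pure n (y(j := vrep N (S j) a b (y j))) w"
    unfolding split by simp
qed

lemma tens_invariant:
  assumes "x \<in> tens n Y" "j < n" "\<And>y. y \<in> Y j \<Longrightarrow> vrep N (S j) a b y \<in> Y j"
  shows "vrep_at N S j a b x \<in> tens n Y"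
  using assms(1)
proof (induction rule: tens.induct)
  case tens_0
  then show ?case by (simp add: lin_0[OF lin_vrep_at] tens.tens_0)
next
  case (tens_add x y)
  then show ?case by (simp add: lin_add[OF lin_vrep_at, where x = x and y = y] tens.tens_add)
next
  case (tens_scale x c)
  then show ?case by (simp add: lin_scale[OF lin_vrep_at, where x = x and c = c] tens.tens_scale)
next
  case (tens_pure y)
  show ?case unfolding vrep_at_pure[OF assms(2)]
    by (rule tens.tens_pure) (use tens_pure assms(3) in auto)
qed

text \<open>The tensor product of the maps with coefficients \<open>P j\<close>. It is defined on
  all word functions; on \<open>tens n Y\<close> it is a homomorphism, by
  \<open>tmap_intertwines\<close>.\<close>

definition tmap :: "nat \<Rightarrow> nat \<Rightarrow> (nat \<Rightarrow> nat) \<Rightarrow> (nat \<Rightarrow> 's set) \<Rightarrow> (nat \<Rightarrow> nat \<Rightarrow> ('s \<Rightarrow> nat) \<Rightarrow> complex)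
    \<Rightarrow> ((nat \<times> 's \<Rightarrow> nat) \<Rightarrow> complex) \<Rightarrow> nat \<Rightarrow> complex" where
  "tmap N n d S P \<phi> = (\<lambda>i. if i < tensor_dim n d
     then \<Sum>w\<in>words N (Sigma {..<n} S). (\<Prod>j<n. P j (digit n d j i) (loc j w)) * \<phi> w else 0)"

lemma lin_tmap: "lin (tmap N n d S P)"
  by (auto simp: lin_def tmap_def fun_eq_iff sum_distrib_left sum.distrib distrib_left mult.left_commute)

lemma sum_words_Sigma:
  fixes F :: "nat \<Rightarrow> ('s \<Rightarrow> nat) \<Rightarrow> complex"
  assumes "\<And>j. j < n \<Longrightarrow> finite (S j)"
  shows "(\<Sum>w\<in>words N (Sigma {..<n} S). \<Prod>j<n. F j (loc j w)) = (\<Prod>j<n. \<Sum>x\<in>words N (S j). F j x)"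
proof -
  have "(\<Prod>j<n. \<Sum>x\<in>words N (S j). F j x) = (\<Sum>g\<in>PiE {..<n} (\<lambda>j. words N (S j)). \<Prod>j<n. F j (g j))"
    by (rule prod_sum_PiE) (auto simp: assms finite_words)
  also have "\<dots> = (\<Sum>w\<in>words N (Sigma {..<n} S). \<Prod>j<n. F j (loc j w))"
  proof (rule sum.reindex_bij_witness[where i = "\<lambda>w. restrict (\<lambda>j. loc j w) {..<n}"
        and j = "\<lambda>g (j, s). if j < n then g j s else 0"])
    fix g assume g: "g \<in> PiE {..<n} (\<lambda>j. words N (S j))"
    have gj: "g j \<in> words N (S j)" if "j < n" for j using g that by auto
    show "restrict (\<lambda>j. loc j (\<lambda>(j, s). if j < n then g j s else 0)) {..<n} = g"
    proof (rule ext)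
      fix j
      show "restrict (\<lambda>j. loc j (\<lambda>(j, s). if j < n then g j s else 0)) {..<n} j = g j"
        using PiE_arb[OF g, of j] by (cases "j < n") (simp_all add: loc_def)
    qed
    show "(\<lambda>(j, s). if j < n then g j s else 0) \<in> words N (Sigma {..<n} S)"
      using gj by (auto simp: words_def)
    show "(\<Prod>j<n. F j (loc j (\<lambda>(j, s). if j < n then g j s else 0))) = (\<Prod>j<n. F j (g j))"
      by (rule prod.cong[OF refl]) (simp add: loc_def)
  next
    fix w assume w: "w \<in> words N (Sigma {..<n} S)"
    then show "(\<lambda>(j, s). if j < n then restrict (\<lambda>j. loc j w) {..<n} j s else 0) = w"
      by (auto simp: words_def loc_def fun_eq_iff)
    show "restrict (\<lambda>j. loc j w) {..<n} \<in> PiE {..<n} (\<lambda>j. words N (S j))"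
      using w by (auto simp: words_def loc_def)
  qed
  finally show ?thesis ..
qed

lemma tmap_pure:
  assumes "\<And>j. j < n \<Longrightarrow> finite (S j)" "i < tensor_dim n d"
  shows "tmap N n d S P (pure n y) i = (\<Prod>j<n. \<Sum>x\<in>words N (S j). P j (digit n d j i) x * y j x)"
  using sum_words_Sigma[where S = S and n = n and N = N and F = "\<lambda>j x. P j (digit n d j i) x * y j x"] assms
  by (simp add: tmap_def pure_def prod.distrib)

lemma tmap_intertwines:
  assumes d: "\<And>j. j < n \<Longrightarrow> d j > 0" and S: "\<And>j. j < n \<Longrightarrow> finite (S j)" and j: "j < n"
    and \<rho>: "\<rho> j (gl_gen N a b) \<in> carrier_mat (d j) (d j)"
    and P: "\<And>y r. y \<in> Y j \<Longrightarrow> r < d j \<Longrightarrow> (\<Sum>x\<in>words N (S j). P j r x * vrep N (S j) a b y x)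
       = (\<Sum>k<d j. \<rho> j (gl_gen N a b) $$ (r, k) * (\<Sum>x\<in>words N (S j). P j k x * y x))"
    and \<phi>: "\<phi> \<in> tens n Y"
  shows "mact (tensor_dim n d) (slot_gen N n d \<rho> j a b) (tmap N n d S P \<phi>)
    = tmap N n d S P (vrep_at N S j a b \<phi>)"
  using \<phi>
proof (induction rule: tens.induct)
  case tens_0
  show ?case by (simp only: lin_0[OF lin_tmap] lin_0[OF lin_mact] lin_0[OF lin_vrep_at])
next
  case (tens_add x y)
  then show ?case by (simp only: lin_add[OF lin_tmap] lin_add[OF lin_mact] lin_add[OF lin_vrep_at])
next
  case (tens_scale x c)
  then show ?case by (simp only: lin_scale[OF lin_tmap] lin_scale[OF lin_mact] lin_scale[OF lin_vrep_at])
next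
  case (tens_pure y)
  define x where "x l r = (\<Sum>w\<in>words N (S l). P l r w * y l w)" for l r
  show ?case
  proof
    fix i
    show "mact (tensor_dim n d) (slot_gen N n d \<rho> j a b) (tmap N n d S P (pure n y)) i
      = tmap N n d S P (vrep_at N S j a b (pure n y)) i"
    proof (cases "i < tensor_dim n d")
      case True
      have "tmap N n d S P (pure n y) k = (\<Prod>l<n. x l (digit n d l k))" if "k < tensor_dim n d" for k
        using tmap_pure[where S = S and n = n and d = d and N = N and P = P and y = y, OF S that]
        by (simp add: x_def)
      then have "mact (tensor_dim n d) (slot_gen N n d \<rho> j a b) (tmap N n d S P (pure n y)) i
        = (\<Sum>k<tensor_dim n d. slot_gen N n d \<rho> j a b $$ (i, k) * (\<Prod>l<n. x l (digit n d l k)))"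
        using True by (simp add: mact_def)
      also have "\<dots> = (\<Prod>l<n. if l = j then \<Sum>k<d j. \<rho> j (gl_gen N a b) $$ (digit n d j i, k) * x j k else x l (digit n d l i))"
        by (rule slot_gen_pure[where \<rho> = \<rho>, OF d j \<rho> True])
      also have "\<dots> = (\<Prod>l<n. \<Sum>w\<in>words N (S l). P l (digit n d l i) w * (y(j := vrep N (S j) a b (y j))) l w)"
      proof (rule prod.cong[OF refl])
        fix l assume "l \<in> {..<n}"
        have "digit n d j i < d j" by (rule digit_less) (rule d[OF j])
        from P[OF tens_pure[OF j] this]
        show "(if l = j then \<Sum>k<d j. \<rho> j (gl_gen N a b) $$ (digit n d j i, k) * x j k else x l (digit n d l i))
          = (\<Sum>w\<in>words N (S l). P l (digit n d l i) w * (y(j := vrep N (S j) a b (y j))) l w)"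
          by (cases "l = j") (simp_all add: x_def)
      qed
      also have "\<dots> = tmap N n d S P (pure n (y(j := vrep N (S j) a b (y j)))) i"
        by (rule tmap_pure[where S = S and n = n, OF S True, symmetric])
      finally show ?thesis unfolding vrep_at_pure[OF j] .
    qed (simp add: mact_def tmap_def)
  qed
qed

text \<open>Preimages of the basis vectors of each factor, multiplied along the digits of
  \<open>k\<close>, form a preimage of the basis tensor \<open>k\<close>, because an index is
  determined by its digits.\<close>

lemma tmap_surjective:
  assumes d: "\<And>j. j < n \<Longrightarrow> d j > 0" and S: "\<And>j. j < n \<Longrightarrow> finite (S j)"
    and P: "\<And>j k. j < n \<Longrightarrow> k < d j \<Longrightarrow>
      \<exists>y\<in>Y j. \<forall>i<d j. (\<Sum>w\<in>words N (S j). P j i w * y w) = (if i = k then 1 else 0)"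
    and v: "\<And>i. \<not> i < tensor_dim n d \<Longrightarrow> v i = 0"
  shows "\<exists>\<phi>\<in>tens n Y. tmap N n d S P \<phi> = v"
proof -
  define y where "y j k = (SOME y. y \<in> Y j \<and>
    (\<forall>i<d j. (\<Sum>w\<in>words N (S j). P j i w * y w) = (if i = k then 1 else 0)))" for j k
  have y: "y j k \<in> Y j \<and> (\<forall>i<d j. (\<Sum>w\<in>words N (S j). P j i w * y j k w) = (if i = k then 1 else 0))"
    if "j < n" "k < d j" for j k
    unfolding y_def by (rule someI_ex[OF P[OF that, unfolded Bex_def]])
  have dig: "digit n d j i < d j" if "j < n" for i j by (rule digit_less) (rule d[OF that])
  define \<delta> where "\<delta> i = pure n (\<lambda>j. y j (digit n d j i))" for i
  have \<delta>: "\<delta> i \<in> tens n Y" for i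
    unfolding \<delta>_def by (rule tens_pure) (use y dig in blast)
  have t\<delta>: "tmap N n d S P (\<delta> k) i = (if i = k then 1 else 0)" if "i < tensor_dim n d" "k < tensor_dim n d" for i k
  proof -
    have "tmap N n d S P (\<delta> k) i
        = (\<Prod>j<n. \<Sum>x\<in>words N (S j). P j (digit n d j i) x * y j (digit n d j k) x)"
      unfolding \<delta>_def by (rule tmap_pure[where S = S and n = n, OF S that(1)])
    also have "\<dots> = (\<Prod>j<n. if digit n d j i = digit n d j k then 1 else 0)"
      by (intro prod.cong refl) (use y dig in auto)
    also have "\<dots> = (if \<forall>j<n. digit n d j i = digit n d j k then 1 else 0)"
      by (auto intro!: prod.neutral simp: prod_zero_iff)
    also have "(\<forall>j<n. digit n d j i = digit n d j k) \<longleftrightarrow> i = k"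
      using digits_eq[where m = 0 and n = n and d = d and i = i and k = k] d that by (auto simp: tensor_dim_eq)
    finally show ?thesis .
  qed
  define \<phi> where "\<phi> = (\<lambda>w. \<Sum>k<tensor_dim n d. v k * \<delta> k w)"
  have "\<phi> \<in> tens n Y" unfolding \<phi>_def by (intro lsub_sum[OF lsub_tens] lsub_scale[OF lsub_tens] \<delta>)
  moreover have "tmap N n d S P \<phi> i = v i" for i
  proof (cases "i < tensor_dim n d")
    case True
    have "tmap N n d S P \<phi> i = (\<Sum>k<tensor_dim n d. v k * tmap N n d S P (\<delta> k) i)"
      unfolding \<phi>_def lin_sum[OF lin_tmap] lin_scale[OF lin_tmap] ..
    also have "\<dots> = (\<Sum>k<tensor_dim n d. if k = i then v i else 0)"
      using True by (intro sum.cong) (auto simp: t\<delta>)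
    finally show ?thesis using True by simp
  qed (simp add: tmap_def v)
  ultimately show ?thesis by (intro bexI[of _ \<phi>] ext)
qed

text \<open>The action on factor \<open>j\<close> is the sum over its slots, all of which take over
  the pole \<open>g j\<close>. The result is an operator for single slots with repeated
  poles.\<close>

lemma Df_vrep_at:
  assumes "\<And>j. j < n \<Longrightarrow> finite (S j)"
  shows "Df N K {..<n} g (vrep_at N S) f = Df N K (Sigma {..<n} S) (\<lambda>s. g (fst s)) (\<lambda>s a b. epsV N s a b) f"
proof -
  have "Xf K {..<n} g (vrep_at N S) a b h w = Xf K (Sigma {..<n} S) (\<lambda>s. g (fst s)) (\<lambda>s a b. epsV N s a b) a b h w"
    for a b h w
  proof -
    have "(\<Sum>j<n. g j * cl (vrep_at N S j b a) h w) = (\<Sum>j<n. \<Sum>s\<in>S j. g j * cl (epsV N (j, s) b a) h w)"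
    proof (intro sum.cong refl)
      fix j
      have "cl (vrep_at N S j b a) h w = (\<Sum>s\<in>S j. cl (epsV N (j, s) b a) h w)"
        by (intro fps_ext) (simp add: cl_nth vrep_at_def fps_sum_nth)
      then show "g j * cl (vrep_at N S j b a) h w = (\<Sum>s\<in>S j. g j * cl (epsV N (j, s) b a) h w)"
        by (simp add: sum_distrib_left)
    qed
    also have "\<dots> = (\<Sum>s\<in>Sigma {..<n} S. g (fst s) * cl (epsV N s b a) h w)"
      using assms by (subst sum.Sigma) (auto intro!: sum.cong)
    finally show ?thesis by (simp add: Xf_def)
  qed
  then have "Xf K {..<n} g (vrep_at N S) = Xf K (Sigma {..<n} S) (\<lambda>s. g (fst s)) (\<lambda>s a b. epsV N s a b)"
    by (intro ext)
  then show ?thesis unfolding Df_def by simp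
qed

text \<open>Lift the first \<open>N\<close> coefficients of \<open>f\<close> through
  \<open>tmap\<close>, solve upstairs inside \<open>tens n Y\<close>, and map back. The image is a
  solution with the initial data of \<open>f\<close>, so by uniqueness it is \<open>f\<close>; the
  equation for the lifted solution descends with it.\<close>

lemma tensor_product_quasi_exponential:
  fixes f :: "nat \<Rightarrow> complex fps" and K :: "nat \<Rightarrow> nat \<Rightarrow> complex"
  assumes N: "N > 0" and dom: "\<And>j. j < n \<Longrightarrow> integral_dominant N (\<Lambda> j)" "\<And>j. j < n \<Longrightarrow> \<Lambda> j (N - 1) \<in> \<nat>"
    and M: "\<And>j. j < n \<Longrightarrow> is_M_Lambda N (\<Lambda> j) (d j) (\<rho> j)"
    and u0: "\<And>j. j < n \<Longrightarrow> u0 \<noteq> z j"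
    and f: "Df N K {..<n} (\<lambda>j. pole u0 (z j)) (\<lambda>j a b. mact (tensor_dim n d) (slot_gen N n d \<rho> j a b)) f = (\<lambda>_. 0)"
    and f0: "\<And>i. \<not> i < tensor_dim n d \<Longrightarrow> f i = 0"
  shows "\<exists>m. \<forall>i. pd (chiP N K ^ m) (f i) = 0"
proof -
  let ?e = "\<lambda>j a b. mact (tensor_dim n d) (slot_gen N n d \<rho> j a b)"
  let ?g = "\<lambda>j. pole u0 (z j)"
  have d: "d j > 0" if "j < n" for j
    using M[OF that] by (simp add: is_M_Lambda_def irreducible_gl_module_def)
  have \<rho>: "\<rho> j (gl_gen N a b) \<in> carrier_mat (d j) (d j)" if "j < n" for j a b
    using M[OF that] by (simp add: is_M_Lambda_def irreducible_gl_module_def gl_module_def)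
  define Model where "Model j S P Y \<longleftrightarrow> finite S \<and> lsub Y \<and>
    (\<forall>y\<in>Y. \<forall>a<N. \<forall>b<N. vrep N S a b y \<in> Y) \<and>
    (\<forall>y\<in>Y. \<forall>a<N. \<forall>b<N. \<forall>i<d j. (\<Sum>w\<in>words N S. P i w * vrep N S a b y w)
       = (\<Sum>k<d j. \<rho> j (gl_gen N a b) $$ (i, k) * (\<Sum>w\<in>words N S. P k w * y w))) \<and>
    (\<forall>k<d j. \<exists>y\<in>Y. \<forall>i<d j. (\<Sum>w\<in>words N S. P i w * y w) = (if i = k then 1 else 0))"
    for j and S :: "(nat \<times> nat) set" and P Y
  have "\<exists>SPY. Model j (fst SPY) (fst (snd SPY)) (snd (snd SPY))" if j: "j < n" for j
  proof -
    from tensor_power_model[OF N dom(1)[OF j] dom(2)[OF j] M[OF j]]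
    obtain S P Y where "Model j S P Y" unfolding Model_def[symmetric] by (elim exE)
    then show ?thesis by (intro exI[of _ "(S, P, Y)"]) simp
  qed
  then have "\<forall>j. \<exists>SPY. j < n \<longrightarrow> Model j (fst SPY) (fst (snd SPY)) (snd (snd SPY))" by simp
  from choice[OF this] obtain SPY where "\<forall>j. j < n \<longrightarrow> Model j (fst (SPY j)) (fst (snd (SPY j))) (snd (snd (SPY j)))" ..
  moreover define S P Y where "S = (\<lambda>j. fst (SPY j))" and "P = (\<lambda>j. fst (snd (SPY j)))" and "Y = (\<lambda>j. snd (snd (SPY j)))"
  ultimately have Model: "Model j (S j) (P j) (Y j)" if "j < n" for j using that by simp
  have S: "finite (S j)" if "j < n" for j using Model[OF that] by (simp add: Model_def)
  have inv: "vrep N (S j) a b y \<in> Y j" if "j < n" "a < N" "b < N" "y \<in> Y j" for j a b y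
    using Model[OF that(1)] that(2-) by (simp add: Model_def)
  have hom: "(\<Sum>w\<in>words N (S j). P j i w * vrep N (S j) a b y w)
       = (\<Sum>k<d j. \<rho> j (gl_gen N a b) $$ (i, k) * (\<Sum>w\<in>words N (S j). P j k w * y w))"
    if "j < n" "a < N" "b < N" "y \<in> Y j" "i < d j" for j a b y i
    using Model[OF that(1)] that(2-) by (simp add: Model_def)
  have onto: "\<exists>y\<in>Y j. \<forall>i<d j. (\<Sum>w\<in>words N (S j). P j i w * y w) = (if i = k then 1 else 0)"
    if "j < n" "k < d j" for j k
    using Model[OF that(1)] that(2) by (simp add: Model_def)
  let ?S = "Sigma {..<n} S"
  let ?\<Omega> = "words N ?S"
  have finS: "finite ?S" using S by auto
  have "\<exists>\<phi>. \<phi> \<in> tens n Y \<and> tmap N n d S P \<phi> = slice f k" for k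
    using tmap_surjective[where S = S and n = n and d = d and Y = Y and N = N and P = P and v = "slice f k", OF d S onto]
    by (auto simp: slice_def f0)
  from choice[OF allI, OF this] obtain v where v: "\<forall>k. v k \<in> tens n Y \<and> tmap N n d S P (v k) = slice f k" ..
  have pole': "fps_deriv (?g j) = - (?g j * ?g j)" if "j \<in> {..<n}" for j
    using pole_deriv[OF u0] that by simp
  have closed: "T x \<in> tens n Y" if "T \<in> gens N {..<n} (vrep_at N S)" and x: "x \<in> tens n Y" for T x
  proof -
    from that(1) obtain j a b where *: "T = vrep_at N S j a b" "j < n" "a < N" "b < N" by (auto simp: gens_def)
    show ?thesis unfolding *(1) by (rule tens_invariant[OF x *(2)]) (rule inv[OF *(2-)])
  qed
  have "\<exists>F. Df N K {..<n} ?g (vrep_at N S) F = (\<lambda>_. 0) \<and> (\<forall>k<N. slice F k = v k) \<and> (\<forall>i. slice F i \<in> tens n Y)"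
  proof (rule Df_solution_exists)
    show "lsub (tens n Y)" by (rule lsub_tens)
    show "T x \<in> tens n Y" if "T \<in> gens N {..<n} (vrep_at N S)" "x \<in> tens n Y" for T x
      by (rule closed[OF that])
    show "fps_deriv (?g j) = - (?g j * ?g j)" if "j \<in> {..<n}" for j by (rule pole'[OF that])
    show "lin T" if "T \<in> gens N {..<n} (vrep_at N S)" for T using that by (auto simp: gens_def lin_vrep_at)
  qed (use v in auto)
  then obtain F where F: "Df N K {..<n} ?g (vrep_at N S) F = (\<lambda>_. 0)" "\<And>k. k < N \<Longrightarrow> slice F k = v k"
    "\<And>i. slice F i \<in> tens n Y" by blast
  have chi: "pd (chiP N K ^ (N + card ?S * card ?\<Omega>)) (F w) = 0" if "w \<in> ?\<Omega>" for w
  proof (rule words_quasi_exponential[where zz = "\<lambda>s. z (fst s)", OF N finS])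
    show "Df N K ?S (\<lambda>s. pole u0 (z (fst s))) (\<lambda>s a b. epsV N s a b) F = (\<lambda>_. 0)"
      using F(1) Df_vrep_at[where n = n and S = S, OF S, where N = N and K = K and g = ?g and f = F] by simp
    show "u0 \<noteq> z (fst s)" if "s \<in> ?S" for s by (rule u0) (use that in auto)
    show "put N s b w' \<in> ?\<Omega>" if "w' \<in> ?\<Omega>" "s \<in> ?S" "b < N" for w' s b
      using put_words_iff[OF that(2,3)] that(1) by blast
  qed (rule finite_words[OF finS], rule that)
  define f' where "f' = cl (tmap N n d S P) F"
  have "Df N K {..<n} ?g ?e f' = cl (tmap N n d S P) (Df N K {..<n} ?g (vrep_at N S) F)"
    unfolding f'_def
  proof (rule Df_natural_on[OF lin_tmap lsub_tens])
    show "slice F i \<in> tens n Y" for i by (rule F(3))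
    fix j a b x assume *: "j \<in> {..<n}" "a < N" "b < N" "x \<in> tens n Y"
    show "vrep_at N S j a b x \<in> tens n Y"
      by (rule closed) (use * in \<open>auto simp: gens_def\<close>)
    show "mact (tensor_dim n d) (slot_gen N n d \<rho> j a b) (tmap N n d S P x) = tmap N n d S P (vrep_at N S j a b x)"
    proof (rule tmap_intertwines[where Y = Y])
      show "j < n" using *(1) by simp
      then show "\<rho> j (gl_gen N a b) \<in> carrier_mat (d j) (d j)" by (rule \<rho>)
    qed (use * d S hom in auto)
  qed
  also have "\<dots> = (\<lambda>_. 0)" unfolding F(1) by (rule cl_0[OF lin_tmap])
  finally have f'sol: "Df N K {..<n} ?g ?e f' = (\<lambda>_. 0)" .
  have "f = f'"
  proof (rule Df_solution_unique[OF _ _ pole' f f'sol])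
    show "lin T" if "T \<in> gens N {..<n} ?e" for T using that by (auto simp: gens_def lin_mact)
    fix k assume "k < N"
    have "slice f' k = tmap N n d S P (slice F k)"
      by (simp add: f'_def slice_def cl_nth)
    then show "slice f k = slice f' k" using F(2)[OF \<open>k < N\<close>] v by simp
  qed auto
  moreover have "pd (chiP N K ^ (N + card ?S * card ?\<Omega>)) (f' i) = 0" for i
  proof -
    let ?p = "chiP N K ^ (N + card ?S * card ?\<Omega>)"
    have "pd ?p (f' i) = cl (tmap N n d S P) (\<lambda>w. pd ?p (F w)) i"
      unfolding f'_def cl_pd[OF lin_tmap] ..
    also have "\<dots> = 0" by (intro fps_ext) (simp add: cl_nth tmap_def chi)
    finally show ?thesis .
  qed
  ultimately show ?thesis by blast
qed

section \<open>Formal and holomorphic solutions\<close>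

text \<open>Ties a function on the punctured plane to its Taylor coefficients at \<open>u0\<close>;
  the components from \<open>D\<close> on are 0, in accordance with \<open>mact\<close>.\<close>

definition expands :: "nat \<Rightarrow> complex set \<Rightarrow> complex \<Rightarrow> (complex \<Rightarrow> complex vec) \<Rightarrow> (nat \<Rightarrow> complex fps) \<Rightarrow> bool" where
  "expands D Z u0 f \<phi> \<longleftrightarrow> (\<forall>u. f u \<in> carrier_vec D) \<and>
     (\<forall>i<D. (\<lambda>u. vec_index (f u) i) holomorphic_on - Z \<and>
        (\<lambda>x. vec_index (f (u0 + x)) i) has_fps_expansion \<phi> i) \<and>
     (\<forall>i. \<not> i < D \<longrightarrow> \<phi> i = 0)"

lemma expandsD:
  assumes "expands D Z u0 f \<phi>"
  shows "f u \<in> carrier_vec D" "i < D \<Longrightarrow> (\<lambda>u. vec_index (f u) i) holomorphic_on - Z"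
    "i < D \<Longrightarrow> (\<lambda>x. vec_index (f (u0 + x)) i) has_fps_expansion \<phi> i" "\<not> i < D \<Longrightarrow> \<phi> i = 0"
  using assms by (auto simp: expands_def)

text \<open>The plane without finitely many points is connected, so by the identity theorem a zero
  Taylor series at \<open>u0\<close> forces the function to vanish off the poles.\<close>

lemma expands_zero_iff:
  assumes f: "expands D Z u0 f \<phi>" and Z: "finite Z" "u0 \<notin> Z"
  shows "(\<forall>u\<in>- Z. f u = 0\<^sub>v D) \<longleftrightarrow> \<phi> = (\<lambda>_. 0)"
proof
  assume zero: "\<forall>u\<in>- Z. f u = 0\<^sub>v D"
  have "\<phi> i = 0" if "i < D" for i
  proof -
    define A where "A = (\<lambda>x. u0 + x) -` (- Z)"
    have A: "open A" unfolding A_def using Z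
      by (intro open_vimage) (auto intro!: finite_imp_closed continuous_intros)
    have 0: "0 \<in> A" using Z by (simp add: A_def)
    have "eventually (\<lambda>x. x \<in> A) (nhds 0)" by (rule eventually_nhds_in_open[OF A 0])
    then have "eventually (\<lambda>x. eval_fps 0 x = vec_index (f (u0 + x)) i) (nhds 0)"
      by eventually_elim (use zero that in \<open>simp add: A_def\<close>)
    then have "(\<lambda>x. vec_index (f (u0 + x)) i) has_fps_expansion 0"
      by (simp add: has_fps_expansion_def)
    then show ?thesis using fps_expansion_unique_complex expandsD(3)[OF f that] by blast
  qed
  then show "\<phi> = (\<lambda>_. 0)" using expandsD(4)[OF f] by (intro ext) metis
next
  assume \<phi>: "\<phi> = (\<lambda>_. 0)"
  have openZ: "open (- Z)" using Z by (simp add: finite_imp_closed open_Compl)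
  have conn: "connected (- Z)"
    using connected_open_diff_countable[of "UNIV :: complex set" Z] Z connected_UNIV
    by (simp add: Compl_eq_Diff_UNIV countable_finite)
  have "vec_index (f u) i = 0" if i: "i < D" and u: "u \<in> - Z" for u i
  proof -
    have "eventually (\<lambda>x. vec_index (f (u0 + x)) i = 0) (nhds 0)"
      using expandsD(3)[OF f i] unfolding \<phi> has_fps_expansion_def by (elim conjE eventually_mono) simp
    then obtain A where A: "open A" "0 \<in> A" "\<And>x. x \<in> A \<Longrightarrow> vec_index (f (u0 + x)) i = 0"
      unfolding eventually_nhds by blast
    define B where "B = (+) u0 ` A \<inter> - Z"
    have "open B" unfolding B_def by (intro open_Int open_translation A(1) openZ)
    have "u0 \<in> B" using A(2) Z by (auto simp: B_def image_iff)
    show ?thesis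
    proof (rule analytic_continuation_open[where f = "\<lambda>u. vec_index (f u) i" and g = "\<lambda>_. 0"])
      show "B \<subseteq> - Z" by (simp add: B_def)
      show "(\<lambda>u. vec_index (f u) i) holomorphic_on - Z" by (rule expandsD(2)[OF f i])
      show "vec_index (f x) i = 0" if "x \<in> B" for x using that A(3) by (auto simp: B_def)
      show "B \<noteq> {}" using \<open>u0 \<in> B\<close> by blast
    qed (use \<open>open B\<close> openZ conn u in auto)
  qed
  then show "\<forall>u\<in>- Z. f u = 0\<^sub>v D"
    using expandsD(1)[OF f] by (intro ballI eq_vecI) auto
qed

lemma cl_mact:
  "cl (mact D A) \<phi> i = (if i < D then \<Sum>k<D. fps_const (A $$ (i, k)) * \<phi> k else 0)"
  by (intro fps_ext) (simp add: cl_nth mact_def fps_sum_nth)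

lemma pole_has_fps_expansion:
  assumes "u0 \<noteq> z"
  shows "(\<lambda>x. 1 / (u0 + x - z)) has_fps_expansion pole u0 z"
proof -
  have "(\<lambda>x. inverse (x + (u0 - z))) has_fps_expansion inverse (fps_X + fps_const (u0 - z))"
    by (intro has_fps_expansion_inverse has_fps_expansion_add has_fps_expansion_fps_X has_fps_expansion_const)
      (use assms in simp)
  then show ?thesis by (simp add: pole_def field_simps)
qed

lemma X_op_expands:
  assumes slot: "\<And>j a b. j < n \<Longrightarrow> slot_gen N n d \<rho> j a b \<in> carrier_mat (tensor_dim n d) (tensor_dim n d)"
    and u0: "u0 \<notin> z ` {..<n}" and f: "expands (tensor_dim n d) (z ` {..<n}) u0 f \<phi>"
  shows "expands (tensor_dim n d) (z ` {..<n}) u0 (X_op N n d \<rho> K z a b f)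
    (Xf (\<lambda>a b. K $$ (a, b)) {..<n} (\<lambda>j. pole u0 (z j))
      (\<lambda>j a b. mact (tensor_dim n d) (slot_gen N n d \<rho> j a b)) a b \<phi>)"
proof -
  let ?D = "tensor_dim n d"
  let ?Z = "z ` {..<n}"
  have openZ: "open (- ?Z)" by (simp add: finite_imp_closed open_Compl)
  have fD: "f u \<in> carrier_vec ?D" for u by (rule expandsD(1)[OF f])
  have dimf: "dim_vec (f u) = ?D" for u using fD[of u] by simp
  have carr: "(\<lambda>j. (1 / (u - z j)) \<cdot>\<^sub>v (slot_gen N n d \<rho> j b a *\<^sub>v f u)) \<in> {..<n} \<rightarrow> carrier_vec ?D" for u
  proof
    fix j assume "j \<in> {..<n}"
    then have "slot_gen N n d \<rho> j b a *\<^sub>v f u \<in> carrier_vec ?D"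
      using slot by (intro mult_mat_vec_carrier[OF _ fD]) simp
    then show "(1 / (u - z j)) \<cdot>\<^sub>v (slot_gen N n d \<rho> j b a *\<^sub>v f u) \<in> carrier_vec ?D" by simp
  qed
  have sumD: "finsum_vec TYPE(complex) ?D
         (\<lambda>j. (1 / (u - z j)) \<cdot>\<^sub>v (slot_gen N n d \<rho> j b a *\<^sub>v f u)) {..<n} \<in> carrier_vec ?D" for u
    by (rule finsum_vec_closed[OF carr])
  have idx: "vec_index (X_op N n d \<rho> K z a b f u) i = (if a = b then deriv (\<lambda>w. vec_index (f w) i) u else 0)
      - K $$ (a, b) * vec_index (f u) i
      - (\<Sum>j<n. (1 / (u - z j)) * (\<Sum>k<?D. slot_gen N n d \<rho> j b a $$ (i, k) * vec_index (f u) k))"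
    if i: "i < ?D" for u i
  proof -
    have "vec_index (finsum_vec TYPE(complex) ?D
         (\<lambda>j. (1 / (u - z j)) \<cdot>\<^sub>v (slot_gen N n d \<rho> j b a *\<^sub>v f u)) {..<n}) i
      = (\<Sum>j<n. vec_index ((1 / (u - z j)) \<cdot>\<^sub>v (slot_gen N n d \<rho> j b a *\<^sub>v f u)) i)"
      by (rule index_finsum_vec[OF _ i carr]) simp
    also have "\<dots> = (\<Sum>j<n. (1 / (u - z j)) * (\<Sum>k<?D. slot_gen N n d \<rho> j b a $$ (i, k) * vec_index (f u) k))"
    proof (rule sum.cong[OF refl])
      fix j assume "j \<in> {..<n}"
      then have "slot_gen N n d \<rho> j b a \<in> carrier_mat ?D ?D" using slot by simp
      then show "vec_index ((1 / (u - z j)) \<cdot>\<^sub>v (slot_gen N n d \<rho> j b a *\<^sub>v f u)) i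
        = (1 / (u - z j)) * (\<Sum>k<?D. slot_gen N n d \<rho> j b a $$ (i, k) * vec_index (f u) k)"
        using i by (simp add: scalar_prod_def dimf lessThan_atLeast0)
    qed
    finally show ?thesis
      using i sumD[of u] by (simp add: X_op_def dimf vec_deriv_def)
  qed
  show ?thesis
    unfolding expands_def
  proof (intro conjI allI impI)
    fix u show "X_op N n d \<rho> K z a b f u \<in> carrier_vec ?D"
      using sumD[of u] fD[of u] by (auto simp: X_op_def vec_deriv_def intro!: minus_carrier_vec)
  next
    fix i assume i: "i < ?D"
    have hol: "(\<lambda>u. vec_index (f u) i) holomorphic_on - ?Z" if "i < ?D" for i by (rule expandsD(2)[OF f that])
    have "(\<lambda>u. (if a = b then deriv (\<lambda>w. vec_index (f w) i) u else 0)) holomorphic_on - ?Z"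
      using holomorphic_deriv[OF hol[OF i] openZ] by (cases "a = b") simp_all
    moreover have "(\<lambda>u. \<Sum>j<n. (1 / (u - z j)) * (\<Sum>k<?D. slot_gen N n d \<rho> j b a $$ (i, k) * vec_index (f u) k))
        holomorphic_on - ?Z"
      by (intro holomorphic_intros hol) auto
    ultimately show "(\<lambda>u. vec_index (X_op N n d \<rho> K z a b f u) i) holomorphic_on - ?Z"
      unfolding idx[OF i] by (intro holomorphic_on_diff holomorphic_on_mult holomorphic_on_const hol i)
    have ex: "(\<lambda>x. vec_index (f (u0 + x)) i) has_fps_expansion \<phi> i" if "i < ?D" for i by (rule expandsD(3)[OF f that])
    have "deriv (\<lambda>x. vec_index (f (u0 + x)) i) = (\<lambda>x. deriv (\<lambda>w. vec_index (f w) i) (u0 + x))"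
      unfolding deriv_def by (subst add.commute, subst DERIV_shift[symmetric], simp add: add.commute)
    then have "(\<lambda>x. deriv (\<lambda>w. vec_index (f w) i) (u0 + x)) has_fps_expansion fps_deriv (\<phi> i)"
      using has_fps_expansion_deriv[OF ex[OF i]] by simp
    then have 1: "(\<lambda>x. if a = b then deriv (\<lambda>w. vec_index (f w) i) (u0 + x) else 0) has_fps_expansion
        (if a = b then fps_deriv (\<phi> i) else 0)"
      by (cases "a = b") simp_all
    have 2: "(\<lambda>x. \<Sum>j<n. (1 / (u0 + x - z j)) * (\<Sum>k<?D. slot_gen N n d \<rho> j b a $$ (i, k) * vec_index (f (u0 + x)) k))
      has_fps_expansion (\<Sum>j<n. pole u0 (z j) * (\<Sum>k<?D. fps_const (slot_gen N n d \<rho> j b a $$ (i, k)) * \<phi> k))"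
      by (intro has_fps_expansion_sum has_fps_expansion_mult has_fps_expansion_cmult_left pole_has_fps_expansion ex)
        (use u0 in auto)
    have 3: "(\<lambda>x. K $$ (a, b) * vec_index (f (u0 + x)) i) has_fps_expansion fps_const (K $$ (a, b)) * \<phi> i"
      by (rule has_fps_expansion_cmult_left[OF ex[OF i]])
    show "(\<lambda>x. vec_index (X_op N n d \<rho> K z a b f (u0 + x)) i) has_fps_expansion
      Xf (\<lambda>a b. K $$ (a, b)) {..<n} (\<lambda>j. pole u0 (z j)) (\<lambda>j a b. mact ?D (slot_gen N n d \<rho> j a b)) a b \<phi> i"
      unfolding idx[OF i] Xf_def cl_mact using has_fps_expansion_diff[OF has_fps_expansion_diff[OF 1 3] 2] i by simp
  next
    fix i assume "\<not> i < ?D"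
    then show "Xf (\<lambda>a b. K $$ (a, b)) {..<n} (\<lambda>j. pole u0 (z j)) (\<lambda>j a b. mact ?D (slot_gen N n d \<rho> j a b)) a b \<phi> i = 0"
      using expandsD(4)[OF f] by (simp add: Xf_def cl_mact)
  qed
qed

lemma universal_diff_op_expands:
  assumes slot: "\<And>j a b. j < n \<Longrightarrow> slot_gen N n d \<rho> j a b \<in> carrier_mat (tensor_dim n d) (tensor_dim n d)"
    and u0: "u0 \<notin> z ` {..<n}" and f: "expands (tensor_dim n d) (z ` {..<n}) u0 f \<phi>"
  shows "expands (tensor_dim n d) (z ` {..<n}) u0 (universal_diff_op N n d \<rho> K z f)
    (Df N (\<lambda>a b. K $$ (a, b)) {..<n} (\<lambda>j. pole u0 (z j))
      (\<lambda>j a b. mact (tensor_dim n d) (slot_gen N n d \<rho> j a b)) \<phi>)"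
proof -
  let ?D = "tensor_dim n d"
  let ?X = "Xf (\<lambda>a b. K $$ (a, b)) {..<n} (\<lambda>j. pole u0 (z j)) (\<lambda>j a b. mact (tensor_dim n d) (slot_gen N n d \<rho> j a b))"
  let ?P = "{\<sigma>. \<sigma> permutes {..<N}}"
  define G where "G \<sigma> = foldr (\<lambda>a g. X_op N n d \<rho> K z a (\<sigma> a) g) [0..<N] f" for \<sigma>
  define \<Gamma> where "\<Gamma> \<sigma> = foldr (\<lambda>a h. ?X a (\<sigma> a) h) [0..<N] \<phi>" for \<sigma>
  have fin: "finite ?P" by (simp add: finite_permutations)
  have "expands ?D (z ` {..<n}) u0 (foldr (\<lambda>a g. X_op N n d \<rho> K z a (\<sigma> a) g) as f)
     (foldr (\<lambda>a h. ?X a (\<sigma> a) h) as \<phi>)" for \<sigma> as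
  proof (induction as)
    case (Cons a as)
    show ?case unfolding foldr.simps comp_apply by (rule X_op_expands[OF slot u0 Cons.IH])
  qed (simp add: f)
  then have G: "expands ?D (z ` {..<n}) u0 (G \<sigma>) (\<Gamma> \<sigma>)" for \<sigma> by (simp add: G_def \<Gamma>_def)
  have carr: "(\<lambda>\<sigma>. of_int (sign \<sigma>) \<cdot>\<^sub>v G \<sigma> u) \<in> ?P \<rightarrow> carrier_vec ?D" for u
    using expandsD(1)[OF G] by auto
  have U: "universal_diff_op N n d \<rho> K z f u = finsum_vec TYPE(complex) ?D (\<lambda>\<sigma>. of_int (sign \<sigma>) \<cdot>\<^sub>v G \<sigma> u) ?P" for u
    by (simp add: universal_diff_op_def G_def)
  have idx: "vec_index (universal_diff_op N n d \<rho> K z f u) i = (\<Sum>\<sigma>\<in>?P. of_int (sign \<sigma>) * vec_index (G \<sigma> u) i)"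
    if "i < ?D" for u i
  proof -
    have "dim_vec (G \<sigma> u) = ?D" for \<sigma> using expandsD(1)[OF G, of \<sigma> u] by simp
    then show ?thesis unfolding U index_finsum_vec[OF fin that carr] using that by simp
  qed
  have D: "Df N (\<lambda>a b. K $$ (a, b)) {..<n} (\<lambda>j. pole u0 (z j))
      (\<lambda>j a b. mact (tensor_dim n d) (slot_gen N n d \<rho> j a b)) \<phi> i = (\<Sum>\<sigma>\<in>?P. fps_const (of_int (sign \<sigma>)) * \<Gamma> \<sigma> i)" for i
    by (simp add: Df_def \<Gamma>_def fps_of_int)
  show ?thesis
    unfolding expands_def D
  proof (intro conjI allI impI)
    show "universal_diff_op N n d \<rho> K z f u \<in> carrier_vec ?D" for u
      unfolding U by (rule finsum_vec_closed[OF carr])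
  next
    fix i assume i: "i < ?D"
    show "(\<lambda>u. vec_index (universal_diff_op N n d \<rho> K z f u) i) holomorphic_on - z ` {..<n}"
      unfolding idx[OF i] by (intro holomorphic_intros expandsD(2)[OF G i])
    show "(\<lambda>x. vec_index (universal_diff_op N n d \<rho> K z f (u0 + x)) i) has_fps_expansion
        (\<Sum>\<sigma>\<in>?P. fps_const (of_int (sign \<sigma>)) * \<Gamma> \<sigma> i)"
      unfolding idx[OF i] by (intro has_fps_expansion_sum has_fps_expansion_cmult_left expandsD(3)[OF G i])
  qed (simp add: expandsD(4)[OF G])
qed

lemma has_fps_expansion_poly: "(\<lambda>x. poly q x) has_fps_expansion fps_of_poly (q :: complex poly)"
proof (induction q)
  case (pCons a q)
  have "(\<lambda>x. a + x * poly q x) has_fps_expansion fps_const a + fps_X * fps_of_poly q"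
    by (rule has_fps_expansion_add[OF has_fps_expansion_const has_fps_expansion_mult[OF has_fps_expansion_fps_X pCons.IH]])
  then show ?case by (simp add: fps_of_poly_pCons mult.commute)
qed simp

lemma ep_has_fps_expansion: "(\<lambda>x. exp (\<mu> * x) * poly q x) has_fps_expansion ep \<mu> q"
  unfolding ep_def by (rule has_fps_expansion_mult[OF has_fps_expansion_exp has_fps_expansion_poly])

lemma quasi_exp_index:
  assumes "finite S" "\<And>\<mu>. \<mu> \<in> S \<Longrightarrow> p \<mu> \<in> carrier_vec D" "i < D"
  shows "vec_index (finsum_vec TYPE(complex) D (\<lambda>\<mu>. exp (\<mu> * u) \<cdot>\<^sub>v eval_vpoly (p \<mu>) u) S) i
    = (\<Sum>\<mu>\<in>S. exp (\<mu> * u) * poly (vec_index (p \<mu>) i) u)"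
proof -
  have carr: "(\<lambda>\<mu>. exp (\<mu> * u) \<cdot>\<^sub>v eval_vpoly (p \<mu>) u) \<in> S \<rightarrow> carrier_vec D"
    using assms(2) by (auto simp: eval_vpoly_def)
  show ?thesis unfolding index_finsum_vec[OF assms(1,3) carr]
  proof (rule sum.cong[OF refl])
    fix \<mu> assume "\<mu> \<in> S"
    then have "dim_vec (p \<mu>) = D" using carrier_vecD[OF assms(2)] by simp
    then show "vec_index (exp (\<mu> * u) \<cdot>\<^sub>v eval_vpoly (p \<mu>) u) i = exp (\<mu> * u) * poly (vec_index (p \<mu>) i) u"
      using assms(3) by (simp add: eval_vpoly_def)
  qed
qed

lemma quasi_exp_carrier:
  assumes "\<And>\<mu>. \<mu> \<in> S \<Longrightarrow> p \<mu> \<in> carrier_vec D"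
  shows "finsum_vec TYPE(complex) D (\<lambda>\<mu>. exp (\<mu> * u) \<cdot>\<^sub>v eval_vpoly (p \<mu>) u) S \<in> carrier_vec D"
  by (rule finsum_vec_closed) (use assms in \<open>auto simp: eval_vpoly_def\<close>)

text \<open>A quasi-exponential is re-expanded at the base point \<open>u0\<close>, which shifts the arguments of its polynomials.\<close>

lemma formal_quasi_exponential:
  assumes A: "finite A" and \<phi>: "\<And>i. i < D \<Longrightarrow> \<phi> i = (\<Sum>\<mu>\<in>A. ep \<mu> (q i \<mu>))" "\<And>i. \<not> i < D \<Longrightarrow> \<phi> i = 0"
  shows "\<exists>F S. S \<subseteq> A \<and> quasi_exp_with_exponents D S F \<and> expands D Z u0 F \<phi>"
proof -
  define p where "p \<mu> = vec D (\<lambda>i. Polynomial.smult (exp (- \<mu> * u0)) (q i \<mu> \<circ>\<^sub>p [:- u0, 1:]))" for \<mu>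
  define S where "S = {\<mu> \<in> A. p \<mu> \<noteq> 0\<^sub>v D}"
  define F where "F = (\<lambda>u. finsum_vec TYPE(complex) D (\<lambda>\<mu>. exp (\<mu> * u) \<cdot>\<^sub>v eval_vpoly (p \<mu>) u) S)"
  have p: "p \<mu> \<in> carrier_vec D" for \<mu> by (simp add: p_def)
  have S: "finite S" "S \<subseteq> A" using A by (auto simp: S_def)
  have idx: "vec_index (F u) i = (\<Sum>\<mu>\<in>A. exp (\<mu> * (u - u0)) * poly (q i \<mu>) (u - u0))" if i: "i < D" for u i
  proof -
    have "vec_index (F u) i = (\<Sum>\<mu>\<in>S. exp (\<mu> * u) * poly (vec_index (p \<mu>) i) u)"
      unfolding F_def by (rule quasi_exp_index[OF S(1) p i])
    also have "\<dots> = (\<Sum>\<mu>\<in>A. exp (\<mu> * u) * poly (vec_index (p \<mu>) i) u)"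
      using A i by (intro sum.mono_neutral_left) (auto simp: S_def)
    also have "\<dots> = (\<Sum>\<mu>\<in>A. exp (\<mu> * (u - u0)) * poly (q i \<mu>) (u - u0))"
    proof (intro sum.cong refl)
      fix \<mu>
      have "exp (\<mu> * (u - u0)) = exp (\<mu> * u) * exp (- \<mu> * u0)"
        by (simp add: algebra_simps flip: exp_add)
      then show "exp (\<mu> * u) * poly (vec_index (p \<mu>) i) u = exp (\<mu> * (u - u0)) * poly (q i \<mu>) (u - u0)"
        using i by (simp add: p_def poly_pcompose)
    qed
    finally show ?thesis .
  qed
  have "expands D Z u0 F \<phi>"
    unfolding expands_def
  proof (intro conjI allI impI)
    show "F u \<in> carrier_vec D" for u unfolding F_def by (rule quasi_exp_carrier[OF p])
  next
    fix i assume i: "i < D"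
    show "(\<lambda>u. vec_index (F u) i) holomorphic_on - Z"
      unfolding idx[OF i]
      by (intro holomorphic_intros holomorphic_on_compose_gen[of "\<lambda>u. u - u0" _ "\<lambda>x. poly _ x" UNIV, unfolded comp_def]) auto
    show "(\<lambda>x. vec_index (F (u0 + x)) i) has_fps_expansion \<phi> i"
      unfolding idx[OF i] \<phi>(1)[OF i] by (intro has_fps_expansion_sum) (simp add: ep_has_fps_expansion)
  qed (simp add: \<phi>(2))
  moreover have "quasi_exp_with_exponents D S F"
    unfolding quasi_exp_with_exponents_def using S(1) p
    by (intro conjI exI[of _ p]) (auto simp: S_def F_def)
  ultimately show ?thesis using S(2) by blast
qed

lemma quasi_exp_expands:
  assumes "quasi_exp_with_exponents D S f"
  shows "\<exists>q. expands D Z u0 f (\<lambda>i. \<Sum>\<mu>\<in>S. ep \<mu> (q i \<mu>)) \<and> (\<forall>i \<mu>. \<not> i < D \<longrightarrow> q i \<mu> = 0)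
    \<and> (\<forall>\<mu>\<in>S. \<exists>i<D. q i \<mu> \<noteq> 0)"
proof -
  obtain p where S: "finite S" and p: "\<And>\<mu>. \<mu> \<in> S \<Longrightarrow> p \<mu> \<in> carrier_vec D" "\<And>\<mu>. \<mu> \<in> S \<Longrightarrow> p \<mu> \<noteq> 0\<^sub>v D"
    and f: "f = (\<lambda>u. finsum_vec TYPE(complex) D (\<lambda>\<mu>. exp (\<mu> * u) \<cdot>\<^sub>v eval_vpoly (p \<mu>) u) S)"
    using assms by (auto simp: quasi_exp_with_exponents_def)
  define q where "q i \<mu> = (if i < D then Polynomial.smult (exp (\<mu> * u0)) (vec_index (p \<mu>) i \<circ>\<^sub>p [:u0, 1:]) else 0)" for i \<mu>
  have idx: "vec_index (f u) i = (\<Sum>\<mu>\<in>S. exp (\<mu> * u) * poly (vec_index (p \<mu>) i) u)" if "i < D" for u i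
    unfolding f by (rule quasi_exp_index[OF S p(1) that])
  have idx0: "vec_index (f (u0 + x)) i = (\<Sum>\<mu>\<in>S. exp (\<mu> * x) * poly (q i \<mu>) x)" if i: "i < D" for x i
    unfolding idx[OF i]
  proof (intro sum.cong refl)
    fix \<mu>
    have "exp (\<mu> * (u0 + x)) = exp (\<mu> * x) * exp (\<mu> * u0)"
      by (simp add: algebra_simps flip: exp_add)
    then show "exp (\<mu> * (u0 + x)) * poly (vec_index (p \<mu>) i) (u0 + x) = exp (\<mu> * x) * poly (q i \<mu>) x"
      using i by (simp add: q_def poly_pcompose)
  qed
  have "expands D Z u0 f (\<lambda>i. \<Sum>\<mu>\<in>S. ep \<mu> (q i \<mu>))"
    unfolding expands_def
  proof (intro conjI allI impI)
    show "f u \<in> carrier_vec D" for u unfolding f by (rule quasi_exp_carrier[OF p(1)])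
  next
    fix i assume i: "i < D"
    show "(\<lambda>u. vec_index (f u) i) holomorphic_on - Z"
      unfolding idx[OF i] by (intro holomorphic_intros)
    show "(\<lambda>x. vec_index (f (u0 + x)) i) has_fps_expansion (\<Sum>\<mu>\<in>S. ep \<mu> (q i \<mu>))"
      unfolding idx0[OF i] by (intro has_fps_expansion_sum ep_has_fps_expansion)
  qed (simp add: q_def ep_def)
  moreover have "\<exists>i<D. q i \<mu> \<noteq> 0" if \<mu>: "\<mu> \<in> S" for \<mu>
  proof (rule ccontr)
    assume *: "\<not> ?thesis"
    have "vec_index (p \<mu>) i = 0" if "i < D" for i
    proof -
      have "vec_index (p \<mu>) i \<circ>\<^sub>p [:u0, 1:] = 0" using * that by (auto simp: q_def)
      then show ?thesis by (simp add: pcompose_eq_0_iff)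
    qed
    then have "p \<mu> = 0\<^sub>v D" using p(1)[OF \<mu>] by (intro eq_vecI) auto
    then show False using p(2)[OF \<mu>] by contradiction
  qed
  ultimately show ?thesis by (intro exI[of _ q]) (simp add: q_def)
qed

lemma quasi_exp_exponent_zero:
  assumes "quasi_exp_with_exponents D S f" "S \<subseteq> {0}"
  shows "vec_polynomial D f"
proof -
  obtain p where S: "finite S" and p: "\<And>\<mu>. \<mu> \<in> S \<Longrightarrow> p \<mu> \<in> carrier_vec D"
    and f: "f = (\<lambda>u. finsum_vec TYPE(complex) D (\<lambda>\<mu>. exp (\<mu> * u) \<cdot>\<^sub>v eval_vpoly (p \<mu>) u) S)"
    using assms by (auto simp: quasi_exp_with_exponents_def)
  \<comment> \<open>\<open>S\<close> may be empty, in which case \<open>f\<close> is the zero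
    polynomial.\<close>
  define P where "P = (if 0 \<in> S then p 0 else 0\<^sub>v D)"
  have P: "P \<in> carrier_vec D" using p by (simp add: P_def)
  have "f u = eval_vpoly P u" for u
  proof (rule eq_vecI)
    show "dim_vec (f u) = dim_vec (eval_vpoly P u)"
      using quasi_exp_carrier[OF p, where u = u] P by (simp add: f eval_vpoly_def)
    fix i assume "i < dim_vec (eval_vpoly P u)"
    then have i: "i < D" using P by (simp add: eval_vpoly_def)
    have "vec_index (f u) i = (\<Sum>\<mu>\<in>S. exp (\<mu> * u) * poly (vec_index (p \<mu>) i) u)"
      unfolding f by (rule quasi_exp_index[OF S p i])
    also have "\<dots> = vec_index (eval_vpoly P u) i"
      using assms(2) i P by (cases "0 \<in> S") (auto simp: P_def eval_vpoly_def subset_singleton_iff)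
    finally show "vec_index (f u) i = vec_index (eval_vpoly P u) i" .
  qed
  then show ?thesis unfolding vec_polynomial_def using P by blast
qed

lemma chiP_eigenvalue:
  assumes "K \<in> carrier_mat N N"
  shows "poly (chiP N (\<lambda>a b. K $$ (a, b))) \<mu> = 0 \<longleftrightarrow> eigenvalue K \<mu>"
proof -
  have "mat N N (\<lambda>(i, j). K $$ (i, j)) = K" using assms by (intro eq_matI) auto
  then show ?thesis using eigenvalue_root_char_poly[OF assms] by (simp add: chiP_char_poly)
qed

section \<open>A basis of the kernel and its exponents\<close>

lemma univ_kernel_iff:
  assumes slot: "\<And>j a b. j < n \<Longrightarrow> slot_gen N n d \<rho> j a b \<in> carrier_mat (tensor_dim n d) (tensor_dim n d)"
    and u0: "u0 \<notin> z ` {..<n}" and f: "expands (tensor_dim n d) (z ` {..<n}) u0 f \<phi>"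
  shows "f \<in> univ_kernel N n d \<rho> K z \<longleftrightarrow> Df N (\<lambda>a b. K $$ (a, b)) {..<n} (\<lambda>j. pole u0 (z j))
      (\<lambda>j a b. mact (tensor_dim n d) (slot_gen N n d \<rho> j a b)) \<phi> = (\<lambda>_. 0)"
  using expands_zero_iff[OF universal_diff_op_expands[OF slot u0 f, where K = K] _ u0] expandsD(1,2)[OF f]
  by (simp add: univ_kernel_def)

text \<open>One solution for each unit vector of initial data: with \<open>D\<close> the dimension
  of the tensor product, \<open>k\<close> encodes the Taylor coefficient \<open>k div D\<close> of
  the component \<open>k mod D\<close>. A linear relation between the solutions, read at this
  coefficient, gives \<open>c k = 0\<close>.\<close>

lemma kernel_basis:
  assumes N: "N > 0" and dom: "\<And>j. j < n \<Longrightarrow> integral_dominant N (\<Lambda> j)" "\<And>j. j < n \<Longrightarrow> \<Lambda> j (N - 1) \<in> \<nat>"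
    and M: "\<And>j. j < n \<Longrightarrow> is_M_Lambda N (\<Lambda> j) (d j) (\<rho> j)" and K: "K \<in> carrier_mat N N"
    and slot: "\<And>j a b. j < n \<Longrightarrow> slot_gen N n d \<rho> j a b \<in> carrier_mat (tensor_dim n d) (tensor_dim n d)"
    and u0: "u0 \<notin> z ` {..<n}"
  shows "\<exists>F. (\<forall>k<N * tensor_dim n d. F k \<in> univ_kernel N n d \<rho> K z \<and>
      (\<exists>S. quasi_exp_with_exponents (tensor_dim n d) S (F k) \<and> (\<forall>\<mu>\<in>S. eigenvalue K \<mu>))) \<and>
    lin_indep_functions (tensor_dim n d) (N * tensor_dim n d) F"
proof -
  let ?D = "tensor_dim n d"
  let ?K = "\<lambda>a b. K $$ (a, b)"
  let ?e = "\<lambda>j a b. mact ?D (slot_gen N n d \<rho> j a b)"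
  let ?g = "\<lambda>j. pole u0 (z j)"
  let ?Z = "z ` {..<n}"
  define v where "v k l i = (if l = k div ?D \<and> i = k mod ?D then 1 else 0 :: complex)" for k l i
  define Good where "Good k F \<phi> \<longleftrightarrow> expands ?D ?Z u0 F \<phi> \<and> F \<in> univ_kernel N n d \<rho> K z \<and>
      (\<exists>S. quasi_exp_with_exponents ?D S F \<and> (\<forall>\<mu>\<in>S. eigenvalue K \<mu>)) \<and> (\<forall>l<N. slice \<phi> l = v k l)"
    for k F \<phi>
  have u0z: "u0 \<noteq> z j" if "j < n" for j using u0 that by auto
  have "\<exists>F\<phi>. Good k (fst F\<phi>) (snd F\<phi>)" if k: "k < N * ?D" for k
  proof -
    have D: "?D > 0" using k by (cases "?D = 0") auto
    let ?Q = "{x :: nat \<Rightarrow> complex. \<forall>i. \<not> i < ?D \<longrightarrow> x i = 0}"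
    have "\<exists>\<phi>. Df N ?K {..<n} ?g ?e \<phi> = (\<lambda>_. 0) \<and> (\<forall>l<N. slice \<phi> l = v k l) \<and> (\<forall>i. slice \<phi> i \<in> ?Q)"
    proof (rule Df_solution_exists)
      show "lsub ?Q" by (auto simp: lsub_def)
      show "T x \<in> ?Q" if "T \<in> gens N {..<n} ?e" for T x using that by (auto simp: gens_def mact_def)
      show "lin T" if "T \<in> gens N {..<n} ?e" for T using that by (auto simp: gens_def lin_mact)
      show "fps_deriv (?g j) = - (?g j * ?g j)" if "j \<in> {..<n}" for j
        by (rule pole_deriv) (use u0z that in auto)
      show "v k l \<in> ?Q" for l using D by (auto simp: v_def)
    qed simp
    then obtain \<phi> where \<phi>: "Df N ?K {..<n} ?g ?e \<phi> = (\<lambda>_. 0)" "\<And>l. l < N \<Longrightarrow> slice \<phi> l = v k l"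
      "\<And>i. slice \<phi> i \<in> ?Q" by blast
    have \<phi>0: "\<phi> i = 0" if "\<not> i < ?D" for i
      using \<phi>(3) that by (intro fps_ext) (simp add: slice_def)
    obtain m where m: "\<And>i. pd (chiP N ?K ^ m) (\<phi> i) = 0"
      using tensor_product_quasi_exponential[where z = z and f = \<phi> and K = ?K and ?u0.0 = u0, OF N dom M u0z \<phi>(1) \<phi>0]
      by blast
    let ?p = "chiP N ?K ^ m"
    let ?A = "{\<mu>. poly ?p \<mu> = 0}"
    have p: "?p \<noteq> 0" using chiP_monic(1)[of N ?K] by auto
    have A: "finite ?A" by (rule poly_roots_finite[OF p])
    have "\<forall>i. \<exists>q. \<phi> i = (\<Sum>\<mu>\<in>?A. ep \<mu> (q \<mu>))"
      using ode_quasi_exponential[OF p m] by blast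
    from choice[OF this] obtain q where q: "\<forall>i. \<phi> i = (\<Sum>\<mu>\<in>?A. ep \<mu> (q i \<mu>))" ..
    obtain F S where F: "S \<subseteq> ?A" "quasi_exp_with_exponents ?D S F" "expands ?D ?Z u0 F \<phi>"
      using formal_quasi_exponential[where D = ?D and \<phi> = \<phi> and A = ?A and q = q and Z = ?Z and ?u0.0 = u0, OF A] q \<phi>0 by blast
    have "eigenvalue K \<mu>" if "\<mu> \<in> S" for \<mu>
      using F(1) that chiP_eigenvalue[OF K] by (auto simp: poly_power)
    moreover have "F \<in> univ_kernel N n d \<rho> K z" using univ_kernel_iff[OF slot u0 F(3)] \<phi>(1) by simp
    ultimately show ?thesis using F \<phi>(2) by (intro exI[of _ "(F, \<phi>)"]) (auto simp: Good_def)
  qed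
  then have "\<forall>k. \<exists>F\<phi>. k < N * ?D \<longrightarrow> Good k (fst F\<phi>) (snd F\<phi>)" by blast
  from choice[OF this] obtain F\<phi> where "\<forall>k. k < N * ?D \<longrightarrow> Good k (fst (F\<phi> k)) (snd (F\<phi> k))" ..
  moreover define F \<phi> where "F k = fst (F\<phi> k)" and "\<phi> k = snd (F\<phi> k)" for k
  ultimately have good: "Good k (F k) (\<phi> k)" if "k < N * ?D" for k using that by simp
  have "lin_indep_functions ?D (N * ?D) F"
    unfolding lin_indep_functions_def
  proof (intro allI impI)
    fix c :: "nat \<Rightarrow> complex" and k
    assume zero: "\<forall>u. finsum_vec TYPE(complex) ?D (\<lambda>k. c k \<cdot>\<^sub>v F k u) {..<N * ?D} = 0\<^sub>v ?D"
      and k: "k < N * ?D"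
    have D: "?D > 0" using k by (cases "?D = 0") auto
    let ?i = "k mod ?D"
    let ?l = "k div ?D"
    have i: "?i < ?D" using D by simp
    have l: "?l < N" using k by (simp add: less_mult_imp_div_less)
    have ex: "expands ?D ?Z u0 (F k') (\<phi> k')" if "k' < N * ?D" for k'
      using good[OF that] by (simp add: Good_def)
    have "(\<Sum>k'<N * ?D. c k' * vec_index (F k' (u0 + x)) ?i) = 0" for x
    proof -
      have carr: "(\<lambda>k. c k \<cdot>\<^sub>v F k (u0 + x)) \<in> {..<N * ?D} \<rightarrow> carrier_vec ?D"
        using expandsD(1)[OF ex] by auto
      have "(\<Sum>k'<N * ?D. vec_index (c k' \<cdot>\<^sub>v F k' (u0 + x)) ?i) = vec_index (0\<^sub>v ?D) ?i"
        using index_finsum_vec[OF _ i carr] zero by simp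
      moreover have "vec_index (c k' \<cdot>\<^sub>v F k' (u0 + x)) ?i = c k' * vec_index (F k' (u0 + x)) ?i" if "k' < N * ?D" for k'
      proof -
        have "dim_vec (F k' (u0 + x)) = ?D" using expandsD(1)[OF ex[OF that], of "u0 + x"] by simp
        then show ?thesis using i by simp
      qed
      ultimately show ?thesis using i by simp
    qed
    moreover have "(\<lambda>x. \<Sum>k'<N * ?D. c k' * vec_index (F k' (u0 + x)) ?i) has_fps_expansion
        (\<Sum>k'<N * ?D. fps_const (c k') * \<phi> k' ?i)"
      by (rule has_fps_expansion_sum, rule has_fps_expansion_cmult_left, rule expandsD(3)[OF ex i]) simp
    ultimately have "(\<lambda>x. 0) has_fps_expansion (\<Sum>k'<N * ?D. fps_const (c k') * \<phi> k' ?i)" by simp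
    then have "(\<Sum>k'<N * ?D. fps_const (c k') * \<phi> k' ?i) = 0"
      by (rule fps_expansion_unique_complex) (rule has_fps_expansion_0)
    then have "fps_nth (\<Sum>k'<N * ?D. fps_const (c k') * \<phi> k' ?i) ?l = 0" by simp
    then have "0 = (\<Sum>k'<N * ?D. c k' * slice (\<phi> k') ?l ?i)" by (simp add: fps_sum_nth slice_def)
    also have "\<dots> = (\<Sum>k'<N * ?D. if k' = k then c k else 0)"
    proof (rule sum.cong[OF refl])
      fix k' assume "k' \<in> {..<N * ?D}"
      then have "slice (\<phi> k') ?l = v k' ?l" using good[of k'] l by (simp add: Good_def)
      moreover have "?l = k' div ?D \<and> ?i = k' mod ?D \<longleftrightarrow> k' = k" by (metis div_mult_mod_eq)
      ultimately show "c k' * slice (\<phi> k') ?l ?i = (if k' = k then c k else 0)" by (simp add: v_def)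
    qed
    also have "\<dots> = c k" using k by simp
    finally show "c k = 0" by simp
  qed
  then show ?thesis using good by (intro exI[of _ F]) (simp add: Good_def)
qed

lemma kernel_exponents_eigenvalues:
  assumes K: "K \<in> carrier_mat N N"
    and slot: "\<And>j a b. j < n \<Longrightarrow> slot_gen N n d \<rho> j a b \<in> carrier_mat (tensor_dim n d) (tensor_dim n d)"
    and u0: "u0 \<notin> z ` {..<n}" and \<mu>: "\<mu> \<in> kernel_exponents N n d \<rho> K z"
  shows "eigenvalue K \<mu>"
proof (rule ccontr)
  let ?D = "tensor_dim n d"
  let ?K = "\<lambda>a b. K $$ (a, b)"
  assume "\<not> eigenvalue K \<mu>"
  then have chi: "poly (chiP N ?K) \<mu> \<noteq> 0" using chiP_eigenvalue[OF K] by simp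
  obtain f S where f: "f \<in> univ_kernel N n d \<rho> K z" and S: "quasi_exp_with_exponents ?D S f" "\<mu> \<in> S"
    using \<mu> by (auto simp: kernel_exponents_def)
  have finS: "finite S" using S(1) by (simp add: quasi_exp_with_exponents_def)
  from quasi_exp_expands[OF S(1), of "z ` {..<n}" u0] obtain q where
    q: "expands ?D (z ` {..<n}) u0 f (\<lambda>i. \<Sum>\<mu>\<in>S. ep \<mu> (q i \<mu>))" "\<And>i \<mu>. \<not> i < ?D \<Longrightarrow> q i \<mu> = 0"
      "\<exists>i<?D. q i \<mu> \<noteq> 0" using S(2) by blast
  \<comment> \<open>Nothing is known about \<open>q\<close> off \<open>S\<close>; it is set to 0
    there so that one degree bound \<open>m\<close> holds for all exponents.\<close>
  define q' where "q' i \<nu> = (if \<nu> \<in> S then q i \<nu> else 0)" for i \<nu>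
  have qq': "(\<lambda>i. \<Sum>\<mu>\<in>S. ep \<mu> (q i \<mu>)) = (\<lambda>i. \<Sum>\<mu>\<in>S. ep \<mu> (q' i \<mu>))"
    by (intro ext sum.cong) (simp_all add: q'_def)
  define m where "m = Suc (\<Sum>i<?D. \<Sum>\<nu>\<in>S. degree (q i \<nu>))"
  have deg: "degree (q' i \<nu>) < m" for i \<nu>
  proof (cases "i < ?D \<and> \<nu> \<in> S")
    case True
    have "degree (q i \<nu>) \<le> (\<Sum>\<nu>\<in>S. degree (q i \<nu>))" using True finS by (intro member_le_sum) auto
    also have "\<dots> \<le> (\<Sum>i<?D. \<Sum>\<nu>\<in>S. degree (q i \<nu>))"
      using True by (intro member_le_sum[of i "{..<?D}" "\<lambda>i. \<Sum>\<nu>\<in>S. degree (q i \<nu>)"]) auto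
    finally show ?thesis using True by (simp add: m_def q'_def)
  next
    case False
    then show ?thesis using q(2)[of i \<nu>] by (auto simp: m_def q'_def)
  qed
  have "q' i \<mu> = 0" for i
  proof (rule Df_exponents[where N = N and K = ?K and S = "{..<n}" and z = z and ?u0.0 = u0 and A = S and m = m
        and e = "\<lambda>j a b. mact ?D (slot_gen N n d \<rho> j a b)"])
    show "lin T" if "T \<in> gens N {..<n} (\<lambda>j a b. mact ?D (slot_gen N n d \<rho> j a b))" for T
      using that by (auto simp: gens_def lin_mact)
    show "u0 \<noteq> z j" if "j \<in> {..<n}" for j using u0 that by auto
    show "bd m (q' w \<nu>)" for w \<nu>
      unfolding bd_def using deg[of w \<nu>] by (auto intro!: coeff_eq_0)
    show "Df N ?K {..<n} (\<lambda>j. pole u0 (z j)) (\<lambda>j a b. mact ?D (slot_gen N n d \<rho> j a b))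
        (\<lambda>w. \<Sum>\<mu>\<in>S. ep \<mu> (q' w \<mu>)) = (\<lambda>_. 0)"
      using univ_kernel_iff[OF slot u0 q(1)] f by (simp add: qq')
  qed (use finS S(2) chi in auto)
  then show False using q(3) S(2) by (auto simp: q'_def)
qed

theorem theorem1p1:
  fixes N n :: nat
    and \<Lambda> :: "nat \<Rightarrow> nat \<Rightarrow> complex"
    and d :: "nat \<Rightarrow> nat"
    and \<rho> :: "nat \<Rightarrow> complex mat \<Rightarrow> complex mat"
    and K :: "complex mat"
    and z :: "nat \<Rightarrow> complex"
  assumes "N \<ge> 1" and "n \<ge> 1"
    and "\<And>j. j < n \<Longrightarrow> integral_dominant N (\<Lambda> j)"
    and "\<And>j. j < n \<Longrightarrow> \<Lambda> j (N - 1) \<in> \<nat>"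
    and "\<And>j. j < n \<Longrightarrow> is_M_Lambda N (\<Lambda> j) (d j) (\<rho> j)"
    and "K \<in> carrier_mat N N"
    and "inj_on z {..<n}"
  shows "kernel_generated_by (quasi_exponential (tensor_dim n d)) N n d \<rho> K z
    \<and> (\<forall>\<mu> \<in> kernel_exponents N n d \<rho> K z. eigenvalue K \<mu>)
    \<and> (K = 0\<^sub>m N N \<longrightarrow> kernel_generated_by (vec_polynomial (tensor_dim n d)) N n d \<rho> K z)"
proof -
  let ?D = "tensor_dim n d"
  have N: "N > 0" using assms(1) by simp
  obtain u0 where u0: "u0 \<notin> z ` {..<n}"
    using ex_new_if_finite[OF infinite_UNIV_char_0, of "z ` {..<n}"] by auto
  have dpos: "d j > 0" if "j < n" for j
    using assms(5)[OF that] by (simp add: is_M_Lambda_def irreducible_gl_module_def)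
  have slot: "slot_gen N n d \<rho> j a b \<in> carrier_mat ?D ?D" if "j < n" for j a b
  proof (rule slot_gen_carrier[OF dpos])
    show "\<rho> j (gl_gen N a b) \<in> carrier_mat (d j) (d j)"
      using assms(5)[OF that] by (simp add: is_M_Lambda_def irreducible_gl_module_def gl_module_def)
  qed
  obtain F where F: "\<And>k. k < N * ?D \<Longrightarrow> F k \<in> univ_kernel N n d \<rho> K z"
      "\<And>k. k < N * ?D \<Longrightarrow> \<exists>S. quasi_exp_with_exponents ?D S (F k) \<and> (\<forall>\<mu>\<in>S. eigenvalue K \<mu>)"
      "lin_indep_functions ?D (N * ?D) F"
    using kernel_basis[OF N assms(3-6) slot u0] by blast
  have "kernel_generated_by (quasi_exponential ?D) N n d \<rho> K z"
    unfolding kernel_generated_by_def quasi_exponential_def using F by blast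
  moreover have "kernel_generated_by (vec_polynomial ?D) N n d \<rho> K z" if K0: "K = 0\<^sub>m N N"
  proof -
    have eig: "\<mu> = 0" if ev: "eigenvalue K \<mu>" for \<mu>
    proof -
      obtain v where v: "v \<in> carrier_vec N" "v \<noteq> 0\<^sub>v N" "K *\<^sub>v v = \<mu> \<cdot>\<^sub>v v"
        using ev assms(6) unfolding eigenvalue_def eigenvector_def by auto
      then obtain i where i: "i < N" "vec_index v i \<noteq> 0" by (metis carrier_vecD eq_vecI index_zero_vec)
      have "\<mu> * vec_index v i = vec_index (K *\<^sub>v v) i" using v i by simp
      also have "\<dots> = 0" using v(1) i(1) by (simp add: K0 scalar_prod_def)
      finally show ?thesis using i(2) by simp
    qed
    have "vec_polynomial ?D (F k)" if k: "k < N * ?D" for k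
    proof -
      obtain S where "quasi_exp_with_exponents ?D S (F k)" "\<forall>\<mu>\<in>S. eigenvalue K \<mu>" using F(2)[OF k] by blast
      then show ?thesis using eig by (intro quasi_exp_exponent_zero[of ?D S]) auto
    qed
    then show ?thesis unfolding kernel_generated_by_def using F by blast
  qed
  ultimately show ?thesis
    using kernel_exponents_eigenvalues[OF assms(6) slot u0] by blast
qed

end
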